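(* Let $u \in H^1(\Omega)$ be a nonnegative local minimum of the functional $\mathscr{F}(u)=\int_\Omega \left\{\tfrac12\langle a_{ij}(X)\nabla u,\nabla u\rangle+\chi_{\{u>0\}}\right\}dX$, where $a_{ij}$ is a $(\lambda,\Lambda)$-elliptic matrix field with no continuity assumption, and let $Z_0\in\partial\{u>0\}\cap\Omega$. Then there is a constant $C>0$, depending only on $n$, $\lambda$, $\Lambda$ and $\|u\|_{L^2(\Omega)}$, such that $$C^{-1}r\le \sup_{B_r(Z_0)}u\le Cr$$ for all sufficiently small $r>0$ (with $B_r(Z_0)\Subset\Omega$). Moreover there is a constant $\theta>0$, depending on the same quantities, such that $\mathcal{L}^n(\{u>0\}\cap B_r(Z_0))\ge \theta r^n$ for all $0<r\ll 1$. Furthermore there is a constant $0<\varsigma\le 1$, depending only on $n,\lambda,\Lambda$ (and the same data), such that $\dim_{\mathcal H}(\partial\{u>0\}\cap\Omega)\le n-\varsigma$.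
   Context: $\Omega\subset\mathbb{R}^n$ is a bounded Lipschitz domain. A measurable symmetric matrix field $a_{ij}:\Omega\to\mathbb{R}^{n\times n}$ is called $(\lambda,\Lambda)$-elliptic ($0<\lambda\le\Lambda$) if $\lambda\,\mathrm{Id}\le a_{ij}(X)\le\Lambda\,\mathrm{Id}$ for a.e. $X$. A local minimum of a functional $\mathscr{G}(u)=\int_\Omega G(X,u,\nabla u)\,dX$ is a function $u\in H^1(\Omega)$ such that for every ball $B\Subset\Omega$ and every $v\in H^1(\Omega)$ with $v-u\in H^1_0(B)$, $\int_B G(X,u,\nabla u)\le\int_B G(X,v,\nabla v)$. $\mathcal{L}^n$ is Lebesgue measure, $\dim_{\mathcal H}$ is Hausdorff dimension. *)

theory Defs
  imports "HOL-Analysis.Analysis"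
begin

definition pd :: "'n::finite \<Rightarrow> (real^'n \<Rightarrow> real) \<Rightarrow> real^'n \<Rightarrow> real" where
  "pd i f x = frechet_derivative f (at x) (axis i 1)"

definition grad :: "(real^'n::finite \<Rightarrow> real) \<Rightarrow> real^'n \<Rightarrow> real^'n" where
  "grad f x = (\<chi> i. pd i f x)"

fun Ck :: "nat \<Rightarrow> (real^'n::finite \<Rightarrow> real) \<Rightarrow> bool" where
  "Ck 0 f = continuous_on UNIV f"
| "Ck (Suc k) f = ((\<forall>x. f differentiable (at x)) \<and> (\<forall>i. Ck k (pd i f)))"

definition smooth_fun :: "(real^'n::finite \<Rightarrow> real) \<Rightarrow> bool" where
  "smooth_fun f \<longleftrightarrow> (\<forall>k. Ck k f)"

definition tsupport :: "(real^'n::finite \<Rightarrow> real) \<Rightarrow> (real^'n) set" where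
  "tsupport f = closure {x. f x \<noteq> 0}"

definition test_fun :: "(real^'n::finite) set \<Rightarrow> (real^'n \<Rightarrow> real) \<Rightarrow> bool" where
  "test_fun U \<phi> \<longleftrightarrow> smooth_fun \<phi> \<and> compact (tsupport \<phi>) \<and> tsupport \<phi> \<subseteq> U"

definition weak_grad :: "(real^'n::finite) set \<Rightarrow> (real^'n \<Rightarrow> real) \<Rightarrow> (real^'n \<Rightarrow> real^'n) \<Rightarrow> bool" where
  "weak_grad U u G \<longleftrightarrow>
     u \<in> borel_measurable (lebesgue_on U) \<and>
     set_integrable lebesgue U (\<lambda>x. (u x)^2) \<and>
     (\<forall>i. (\<lambda>x. G x $ i) \<in> borel_measurable (lebesgue_on U)) \<and>
     set_integrable lebesgue U (\<lambda>x. (norm (G x))^2) \<and>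
     (\<forall>\<phi>. test_fun U \<phi> \<longrightarrow>
        (\<forall>i. (LINT x:U|lebesgue. u x * pd i \<phi> x) = - (LINT x:U|lebesgue. G x $ i * \<phi> x)))"

definition H1 :: "(real^'n::finite) set \<Rightarrow> (real^'n \<Rightarrow> real) \<Rightarrow> bool" where
  "H1 U u \<longleftrightarrow> (\<exists>G. weak_grad U u G)"

text \<open>The weak gradient (unique up to null sets).\<close>
definition wgrad :: "(real^'n::finite) set \<Rightarrow> (real^'n \<Rightarrow> real) \<Rightarrow> real^'n \<Rightarrow> real^'n" where
  "wgrad U u = (SOME G. weak_grad U u G)"

definition H10 :: "(real^'n::finite) set \<Rightarrow> (real^'n \<Rightarrow> real) \<Rightarrow> bool" where
  "H10 U w \<longleftrightarrow> H1 U w \<and>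
     (\<exists>\<phi>. (\<forall>k. test_fun U (\<phi> k)) \<and>
        (\<lambda>k. LINT x:U|lebesgue. (\<phi> k x - w x)^2) \<longlonglongrightarrow> 0 \<and>
        (\<lambda>k. LINT x:U|lebesgue. (norm (grad (\<phi> k) x - wgrad U w x))^2) \<longlonglongrightarrow> 0)"

definition local_min :: "(real^'n::finite) set \<Rightarrow> (real^'n \<Rightarrow> real \<Rightarrow> real^'n \<Rightarrow> real) \<Rightarrow> (real^'n \<Rightarrow> real) \<Rightarrow> bool" where
  "local_min \<Omega> F u \<longleftrightarrow> H1 \<Omega> u \<and>
     (\<forall>c r v. 0 < r \<and> cball c r \<subseteq> \<Omega> \<and> H1 \<Omega> v \<and>
        (AE x in lebesgue. x \<in> \<Omega> - ball c r \<longrightarrow> v x = u x) \<and>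
        H10 (ball c r) (\<lambda>x. v x - u x) \<longrightarrow>
        (LINT x:ball c r|lebesgue. F x (u x) (wgrad \<Omega> u x))
          \<le> (LINT x:ball c r|lebesgue. F x (v x) (wgrad \<Omega> v x)))"

definition AC_integrand :: "(real^'n::finite \<Rightarrow> real^'n^'n) \<Rightarrow> real^'n \<Rightarrow> real \<Rightarrow> real^'n \<Rightarrow> real" where
  "AC_integrand a x s p = (1/2) * ((a x *v p) \<bullet> p) + (if s > 0 then 1 else 0)"

definition elliptic :: "(real^'n::finite) set \<Rightarrow> (real^'n \<Rightarrow> real^'n^'n) \<Rightarrow> real \<Rightarrow> real \<Rightarrow> bool" where
  "elliptic \<Omega> a lam Lam \<longleftrightarrow>
     (\<forall>i j. (\<lambda>x. a x $ i $ j) \<in> borel_measurable (lebesgue_on \<Omega>)) \<and>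
     (AE x in lebesgue. x \<in> \<Omega> \<longrightarrow> transpose (a x) = a x \<and>
        (\<forall>\<xi>. lam * (norm \<xi>)^2 \<le> \<xi> \<bullet> (a x *v \<xi>) \<and> \<xi> \<bullet> (a x *v \<xi>) \<le> Lam * (norm \<xi>)^2))"

definition lipschitz_domain :: "(real^'n::finite) set \<Rightarrow> bool" where
  "lipschitz_domain \<Omega> \<longleftrightarrow> open \<Omega> \<and> bounded \<Omega> \<and> connected \<Omega> \<and>
     (\<forall>p \<in> frontier \<Omega>. \<exists>r>0. \<exists>e g L. norm e = 1 \<and>
        L-lipschitz_on {y. y \<bullet> e = 0} g \<and>
        \<Omega> \<inter> ball p r = {x \<in> ball p r. g (x - (x \<bullet> e) *\<^sub>R e) < x \<bullet> e})"

definition hausdorff_pre :: "real \<Rightarrow> real \<Rightarrow> 'a::metric_space set \<Rightarrow> ennreal" where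
  "hausdorff_pre s \<delta> E = (INF C \<in> {C :: nat \<Rightarrow> 'a set. E \<subseteq> (\<Union>k. C k) \<and>
        (\<forall>k. bounded (C k) \<and> diameter (C k) \<le> \<delta>)}. (\<Sum>k. ennreal (diameter (C k) powr s)))"

definition hausdorff_measure :: "real \<Rightarrow> 'a::metric_space set \<Rightarrow> ennreal" where
  "hausdorff_measure s E = (SUP \<delta> \<in> {0<..}. hausdorff_pre s \<delta> E)"

definition hausdorff_dim :: "'a::metric_space set \<Rightarrow> real" where
  "hausdorff_dim E = Inf {s. 0 \<le> s \<and> hausdorff_measure s E = 0}"

end

theory Submission
  imports Defs
begin

text \<open>For coefficients that are merely measurable only De Giorgi's methods are available. Comparing $u$ with
  $u \mp \zeta^2 (u - k)^\pm$ gives Caccioppoli inequalities: without error for $u$, since lowering $u$ can only shrink the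
  positivity set, and for $-u$ with an error bounded by the measure of the superlevel set, which is absent where $u > 0$.

  Nondegeneracy: comparison with $(1 - \zeta^2) u$ bounds, on a smaller ball, the energy of $u$ plus the measure of
  $\{u > 0\}$ by the $L^2$ norm of $u$. Together with the Faber--Krahn inequality this starts De Giorgi's iteration, so $u = 0$
  on $B_{R/2}$ if $\int_{B_R} u^2$ is small compared to $R^{n+2}$.

  Linear growth: near a zero the scaled quantity $R^{-n-2} \int_{B_R} u^2$ cannot be both large and comparable at two
  scales. Otherwise $u$ exceeds a large multiple of $R$ on a fixed portion of a ball, the error term in the inequality for
  $-u$ is negligible at that height, and $u$ is bounded below near the centre. Hence the scaled quantity stays bounded
  by a universal constant at small scales. Continuity at points where $u$ is positive is De Giorgi's oscillation decay.

  Both bounds together give the density estimate, and they make the free boundary porous: every small ball of radius $r$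
  around a free boundary point contains a ball of radius $\kappa r$ on which $u$ is too large, compared with the linear
  growth, for it to meet the free boundary. Porous sets have dimension less than $n$.\<close>

section \<open>Smooth functions\<close>

text \<open>The minimizer is only an equivalence class, while its free boundary depends on pointwise
  values. All estimates are therefore proved for Borel versions \<open>f\<close>, \<open>G\<close>,
  and only then is a continuous representative built out of local almost-everywhere oscillation
  bounds.

  The geometry enters through a single fact: translating a function by h costs at most norm h times
  its gradient. Averaging the L2 form over h gives Faber--Krahn, averaging the L1 form over pairs of
  points gives De Giorgi's isoperimetric inequality. Faber--Krahn appears here with a free length d
  whose n-th power controls the measure of the support; choosing d at each step is what closes De
  Giorgi's iteration.

  The linear growth argument compares the radii R and R/8: the normalised L2 mass is below a
  universal constant or has halved. The initial mass is thus forgotten after finitely many scales,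
  but how many depends on the solution and on the point. Hence the free boundary is cut into
  countably many pieces with a uniform threshold radius, and each piece is porous with respect to
  itself; counting subcubes shows that it has zero Hausdorff content in a dimension below n.\<close>

lemma Ck_Suc_D: "Ck (Suc k) f \<Longrightarrow> Ck k f"
proof (induction k arbitrary: f)
  case 0
  then show ?case
    by (simp add: differentiable_imp_continuous_within continuous_at_imp_continuous_on)
next
  case (Suc k)
  then show ?case by auto
qed

lemma Ck_const: "Ck k (\<lambda>x::real^'n::finite. c)"
proof (induction k arbitrary: c)
  case (Suc k)
  have "pd i (\<lambda>x::real^'n::finite. c) = (\<lambda>x. 0)" for i
    by (auto simp: pd_def)
  with Suc show ?case by simp
qed simp

lemma pd_eqI: "(f has_derivative D) (at x) \<Longrightarrow> pd i f x = D (axis i 1)"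
  by (metis frechet_derivative_at pd_def)

lemma pd_add:
  assumes "f differentiable at x" "g differentiable at x"
  shows "pd i (\<lambda>x. f x + g x) x = pd i f x + pd i g x"
  using pd_eqI[OF has_derivative_add[OF assms[unfolded frechet_derivative_works]]]
  by (simp add: pd_def)

lemma pd_mult:
  assumes "f differentiable at x" "g differentiable at x"
  shows "pd i (\<lambda>x. f x * g x) x = f x * pd i g x + pd i f x * g x"
  using pd_eqI[OF has_derivative_mult[OF assms[unfolded frechet_derivative_works]]]
  by (simp add: pd_def)

lemma Ck_add: "Ck k f \<Longrightarrow> Ck k g \<Longrightarrow> Ck k (\<lambda>x. f x + g x)"
proof (induction k arbitrary: f g)
  case 0 then show ?case by (simp add: continuous_on_add)
next
  case (Suc k)
  then have "pd i (\<lambda>x. f x + g x) = (\<lambda>x. pd i f x + pd i g x)" for i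
    by (auto simp: pd_add)
  with Suc show ?case by simp
qed

lemma Ck_mult: "Ck k f \<Longrightarrow> Ck k g \<Longrightarrow> Ck k (\<lambda>x. f x * g x)"
proof (induction k arbitrary: f g)
  case 0 then show ?case by (simp add: continuous_on_mult)
next
  case (Suc k)
  then have "pd i (\<lambda>x. f x * g x) = (\<lambda>x. f x * pd i g x + pd i f x * g x)" for i
    by (auto simp: pd_mult)
  with Suc Ck_Suc_D[OF Suc.prems(1)] Ck_Suc_D[OF Suc.prems(2)] show ?case
    by (simp add: Ck_add)
qed

lemma Ck_prod: "finite S \<Longrightarrow> (\<And>j. j \<in> S \<Longrightarrow> Ck k (f j)) \<Longrightarrow> Ck k (\<lambda>x. \<Prod>j\<in>S. f j x)"
  by (induction S rule: finite_induct) (auto simp: Ck_const intro!: Ck_mult)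

text \<open>The functions $t^{-m} e^{-1/t}$ (zero for $t \le 0$) are closed under differentiation.\<close>

definition bump1 :: "nat \<Rightarrow> real \<Rightarrow> real" where
  "bump1 m t = (if t > 0 then (1/t)^m * exp (-(1/t)) else 0)"

text \<open>Substituting s = 1/t turns the limit from the right into the decay of s^m exp(-s) at
  infinity; from the left the function is constantly 0.\<close>

lemma bump1_lim0: "((\<lambda>t::real. bump1 m t) \<longlongrightarrow> 0) (at 0)"
proof -
  have "((\<lambda>s::real. s^m * exp (-s)) \<longlongrightarrow> 0) at_top"
    using tendsto_power_div_exp_0[of m] by (simp add: exp_minus divide_inverse)
  then have "((\<lambda>t::real. (inverse t)^m * exp (-(inverse t))) \<longlongrightarrow> 0) (at_right 0)"
    by (rule filterlim_compose[OF _ filterlim_inverse_at_top_right])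
  then have "(bump1 m \<longlongrightarrow> 0) (at_right 0)"
    by (rule Lim_transform_eventually)
      (auto simp: bump1_def eventually_at_filter inverse_eq_divide)
  moreover have "(bump1 m \<longlongrightarrow> 0) (at_left 0)"
    by (rule Lim_transform_eventually[where f="\<lambda>_. 0"]) (auto simp: bump1_def eventually_at_filter)
  ultimately show ?thesis by (simp add: filterlim_split_at)
qed

lemma bump1_deriv:
  "(bump1 m has_real_derivative (bump1 (m+2) t - real m * bump1 (m+1) t)) (at t)"
proof (cases t "0::real" rule: linorder_cases)
  case less
  have "((\<lambda>_. 0) has_real_derivative 0) (at t)" by simp
  then have "(bump1 m has_real_derivative 0) (at t)"
    by (rule DERIV_cong_ev[THEN iffD1, rotated 3])
      (use less in \<open>auto simp: bump1_def eventually_nhds intro!: exI[of _ "{..<0}"]\<close>)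
  then show ?thesis using less by (simp add: bump1_def)
next
  case equal
  \<comment> \<open>The difference quotient of \<open>bump1 m\<close> at 0 is
    \<open>bump1 (m+1)\<close>, so the limit at 0 for the next index gives derivative 0.\<close>
  have "((\<lambda>h. (bump1 m (0 + h) - bump1 m 0) / h) \<longlongrightarrow> 0) (at 0)"
    by (rule Lim_transform_eventually[OF bump1_lim0[of "m+1"]])
      (auto simp: bump1_def eventually_at_filter)
  then show ?thesis using equal by (simp add: DERIV_def bump1_def)
next
  case greater
  have "((\<lambda>t. (1/t)^m * exp (-(1/t))) has_real_derivative
     (bump1 (m+2) t - real m * bump1 (m+1) t)) (at t)"
    using greater
    apply (auto intro!: derivative_eq_intros simp: bump1_def)
    apply (cases m)
     apply (auto simp: field_simps power2_eq_square)
    done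
  then show ?thesis
    by (rule DERIV_cong_ev[THEN iffD1, rotated 3])
      (use greater in \<open>auto simp: bump1_def eventually_nhds intro!: exI[of _ "{0<..}"]\<close>)
qed

lemma Ck_bump1: "Ck k (\<lambda>x::real^'n::finite. bump1 m (a + b * x$j))"
proof (induction k arbitrary: m)
  case 0
  have "isCont (bump1 m) t" for t using DERIV_isCont[OF bump1_deriv] .
  then have "continuous_on UNIV (bump1 m)" by (simp add: continuous_at_imp_continuous_on)
  then show ?case
    by (auto intro!: continuous_on_compose2[of UNIV "bump1 m"] continuous_intros)
next
  case (Suc k)
  have D: "((\<lambda>x::real^'n. bump1 m (a + b * x$j)) has_derivative
     (\<lambda>h. (bump1 (m+2) (a + b * x$j) - real m * bump1 (m+1) (a + b * x$j)) * (b * h$j))) (at x)" for x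
  proof -
    have "((\<lambda>x::real^'n. a + b * x$j) has_derivative (\<lambda>h. b * h$j)) (at x)"
      by (auto intro!: derivative_eq_intros bounded_linear.has_derivative[OF bounded_linear_vec_nth])
    from has_derivative_compose[OF this bump1_deriv[unfolded has_field_derivative_def]]
    show ?thesis .
  qed
  have "pd i (\<lambda>x::real^'n. bump1 m (a + b * x$j)) =
    (\<lambda>x. (b * axis i 1 $ j) * (bump1 (m+2) (a + b * x$j) + (- real m) * bump1 (m+1) (a + b * x$j)))" for i
    by (rule ext) (simp add: pd_eqI[OF D] algebra_simps)
  moreover have "Ck k (\<lambda>x::real^'n. (b * axis i 1 $ j) * (bump1 (m+2) (a + b * x$j) + (- real m) * bump1 (m+1) (a + b * x$j)))" for i
    by (intro Ck_add Ck_mult Ck_const Suc.IH)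
  ultimately show ?case using D by (auto simp: differentiable_def simp del: add_2_eq_Suc' add_2_eq_Suc)
qed

text \<open>A product over coordinates only needs products of affine one-variable functions, for
  which \<open>Ck\<close> is already known. The price is a cubical support, contained in the ball of
  radius \<open>CARD('n)\<close>.\<close>

definition bump :: "real^'n::finite \<Rightarrow> real" where
  "bump x = (\<Prod>j\<in>UNIV. bump1 0 (1 + 1 * x$j) * bump1 0 (1 + (-1) * x$j))"

lemma smooth_bump: "smooth_fun bump"
  unfolding smooth_fun_def bump_def by (intro allI Ck_prod Ck_mult Ck_bump1) auto

section \<open>Gradients and test functions\<close>

lemma has_derivative_grad:
  assumes "f differentiable at x"
  shows "(f has_derivative (\<lambda>h. grad f x \<bullet> h)) (at x)"
proof -
  let ?D = "frechet_derivative f (at x)"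
  have D: "(f has_derivative ?D) (at x)" using assms frechet_derivative_works by blast
  interpret bounded_linear ?D using D by (rule has_derivative_bounded_linear)
  have "?D h = grad f x \<bullet> h" for h
  proof -
    have "?D h = ?D (\<Sum>i\<in>UNIV. h$i *\<^sub>R axis i 1)"
      by (simp add: basis_expansion scalar_mult_eq_scaleR[symmetric])
    also have "\<dots> = grad f x \<bullet> h"
      by (simp add: sum scaleR inner_vec_def grad_def pd_def mult.commute)
    finally show ?thesis .
  qed
  with D show ?thesis by (metis ext)
qed

lemma pd_has_derivative_grad: "(f has_derivative (\<lambda>h. g \<bullet> h)) (at x) \<Longrightarrow> pd i f x = g $ i"
  by (simp add: pd_eqI inner_axis)

lemma smooth_differentiable: "smooth_fun f \<Longrightarrow> f differentiable at x"
  unfolding smooth_fun_def by (metis Ck.simps(2))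

lemma smooth_pd: "smooth_fun f \<Longrightarrow> smooth_fun (pd i f)"
  unfolding smooth_fun_def by (metis Ck.simps(2))

lemma smooth_continuous: "smooth_fun f \<Longrightarrow> continuous_on S f"
  unfolding smooth_fun_def by (metis Ck.simps(1) continuous_on_subset subset_UNIV)

lemma smooth_borel [measurable_dest]: "smooth_fun f \<Longrightarrow> f \<in> borel_measurable borel"
  by (simp add: borel_measurable_continuous_onI smooth_continuous)

lemma smooth_mult: "smooth_fun f \<Longrightarrow> smooth_fun g \<Longrightarrow> smooth_fun (\<lambda>x. f x * g x)"
  by (simp add: smooth_fun_def Ck_mult)

lemma smooth_const: "smooth_fun (\<lambda>x. c)"
  by (simp add: smooth_fun_def Ck_const)

lemma pd_affine:
  assumes "smooth_fun f"
  shows "pd i (\<lambda>x. f (b + a *\<^sub>R x)) x = a * pd i f (b + a *\<^sub>R x)"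
    and "(\<lambda>x. f (b + a *\<^sub>R x)) differentiable at x"
proof -
  have "((\<lambda>x. b + a *\<^sub>R x) has_derivative (\<lambda>h. a *\<^sub>R h)) (at x)"
    by (auto intro!: derivative_eq_intros)
  from has_derivative_compose[OF this has_derivative_grad[OF smooth_differentiable[OF assms]]]
  have D: "((\<lambda>x. f (b + a *\<^sub>R x)) has_derivative (\<lambda>h. (a *\<^sub>R grad f (b + a *\<^sub>R x)) \<bullet> h)) (at x)"
    by simp
  from pd_has_derivative_grad[OF D] show "pd i (\<lambda>x. f (b + a *\<^sub>R x)) x = a * pd i f (b + a *\<^sub>R x)"
    by (simp add: grad_def)
  from D show "(\<lambda>x. f (b + a *\<^sub>R x)) differentiable at x"
    by (auto simp: differentiable_def)
qed

lemma smooth_affine: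
  assumes "smooth_fun f"
  shows "smooth_fun (\<lambda>x. f (b + a *\<^sub>R x))"
proof -
  have "Ck k (\<lambda>x. f (b + a *\<^sub>R x))" if "smooth_fun f" for k f
    using that
  proof (induction k arbitrary: f)
    case 0
    have "continuous_on UNIV (\<lambda>x. b + a *\<^sub>R x)" by (intro continuous_intros)
    with smooth_continuous[OF 0, of UNIV] show ?case
      unfolding Ck.simps by (rule continuous_on_compose2) simp
  next
    case (Suc k)
    have "pd i (\<lambda>x. f (b + a *\<^sub>R x)) = (\<lambda>x. a * pd i f (b + a *\<^sub>R x))" for i
      by (simp add: fun_eq_iff pd_affine[OF Suc.prems])
    moreover have "Ck k (\<lambda>x. pd i f (b + a *\<^sub>R x))" for i
      by (intro Suc.IH smooth_pd Suc.prems)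
    ultimately show ?case
      by (simp add: pd_affine(2)[OF Suc.prems] Ck_mult Ck_const)
  qed
  with assms show ?thesis by (simp add: smooth_fun_def)
qed

lemma pd_zero_outside:
  assumes "x \<notin> tsupport f"
  shows "pd i f x = 0"
proof -
  have "open (- tsupport f)" "x \<in> - tsupport f" using assms by (auto simp: tsupport_def)
  moreover have "f y = 0" if "y \<in> - tsupport f" for y
    using that closure_subset[of "{x. f x \<noteq> 0}"] by (auto simp: tsupport_def)
  ultimately have "(f has_derivative (\<lambda>h. 0)) (at x)"
    using has_derivative_transform_within_open[of "\<lambda>_. 0" "\<lambda>h. 0" x UNIV "- tsupport f" f]
    by auto
  from pd_eqI[OF this] show ?thesis .
qed

lemma tsupport_pd: "tsupport (pd i f) \<subseteq> tsupport f"
proof -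
  have "{x. pd i f x \<noteq> 0} \<subseteq> tsupport f" using pd_zero_outside by blast
  then show ?thesis by (simp add: closure_minimal tsupport_def)
qed

lemma tsupport_mult: "tsupport (\<lambda>x. f x * g x) \<subseteq> tsupport f" "tsupport (\<lambda>x. f x * g x) \<subseteq> tsupport g"
  unfolding tsupport_def by (intro closure_mono; auto)+

lemma zero_outside_tsupport: "x \<notin> tsupport f \<Longrightarrow> f x = 0"
  using closure_subset[of "{x. f x \<noteq> 0}"] by (auto simp: tsupport_def)

lemma closed_tsupport: "closed (tsupport f)" by (simp add: tsupport_def)

lemma tsupport_subsetI: "closed S \<Longrightarrow> (\<And>x. x \<notin> S \<Longrightarrow> f x = 0) \<Longrightarrow> tsupport f \<subseteq> S"
  unfolding tsupport_def by (rule closure_minimal) auto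

lemma compact_closed_subset: "compact K \<Longrightarrow> closed S \<Longrightarrow> S \<subseteq> K \<Longrightarrow> compact S"
  using compact_Int_closed[of K S] by (simp add: Int_absorb1)

lemma test_fun_pd: "test_fun U f \<Longrightarrow> test_fun U (pd i f)"
  using tsupport_pd[of i f] compact_closed_subset[OF _ closed_tsupport, of "tsupport f" "pd i f"]
  by (auto simp: test_fun_def smooth_pd)

lemma test_fun_mono: "test_fun U f \<Longrightarrow> U \<subseteq> V \<Longrightarrow> test_fun V f"
  by (auto simp: test_fun_def)

lemma test_fun_mult:
  assumes "test_fun U f" "smooth_fun g" shows "test_fun U (\<lambda>x. f x * g x)"
  using assms tsupport_mult(1)[of f g] compact_closed_subset[OF _ closed_tsupport, of "tsupport f" "\<lambda>x. f x * g x"]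
  by (auto simp: test_fun_def smooth_mult)

lemma test_fun_smooth: "test_fun U f \<Longrightarrow> smooth_fun f" by (simp add: test_fun_def)

lemma test_funI:
  assumes "smooth_fun f" "compact K" "K \<subseteq> U" "\<And>x. x \<notin> K \<Longrightarrow> f x = 0"
  shows "test_fun U f"
proof -
  have "tsupport f \<subseteq> K" by (rule tsupport_subsetI) (use assms compact_imp_closed in auto)
  then show ?thesis using assms compact_closed_subset[OF _ closed_tsupport, of K f]
    by (auto simp: test_fun_def)
qed

lemma test_fun_bounded:
  assumes "test_fun U f"
  obtains B where "0 < B" "\<And>x. \<bar>f x\<bar> \<le> B"
proof -
  have "compact (f ` tsupport f)"
    using assms by (auto simp: test_fun_def smooth_continuous intro!: compact_continuous_image)
  then obtain B where B: "\<And>y. y \<in> f ` tsupport f \<Longrightarrow> norm y \<le> B"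
    using compact_imp_bounded bounded_iff by metis
  have "\<bar>f x\<bar> \<le> max B 1" for x
    using B[of "f x"] zero_outside_tsupport[of x f] by (cases "x \<in> tsupport f") auto
  then show ?thesis using that[of "max B 1"] by auto
qed

lemma test_fun_grad_bounded:
  fixes f :: "real^'n::finite \<Rightarrow> real"
  assumes "test_fun U f"
  obtains B where "0 < B" "\<And>x. norm (grad f x) \<le> B"
proof -
  have "\<forall>i. \<exists>B. \<forall>x. \<bar>pd i f x\<bar> \<le> B"
  proof
    fix i show "\<exists>B. \<forall>x. \<bar>pd i f x\<bar> \<le> B"
      by (rule test_fun_bounded[OF test_fun_pd[OF assms, of i]]) blast
  qed
  then obtain B where B: "\<And>i x. \<bar>pd i f x\<bar> \<le> B i" by metis
  have "norm (grad f x) \<le> 1 + (\<Sum>i\<in>UNIV. \<bar>B i\<bar>)" for x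
  proof -
    have "norm (grad f x) \<le> (\<Sum>i\<in>UNIV. \<bar>grad f x $ i\<bar>)" by (rule norm_le_l1_cart)
    also have "\<dots> \<le> (\<Sum>i\<in>UNIV. \<bar>B i\<bar>)"
    proof (rule sum_mono)
      fix i show "\<bar>grad f x $ i\<bar> \<le> \<bar>B i\<bar>" using B[of i x] by (simp add: grad_def)
    qed
    finally show ?thesis by simp
  qed
  moreover have "0 < 1 + (\<Sum>i\<in>UNIV. \<bar>B i\<bar>)" by (simp add: add_pos_nonneg sum_nonneg)
  ultimately show ?thesis using that by blast
qed

lemma grad_bound_lipschitz:
  assumes "\<And>x. f differentiable at x" "\<And>x. norm (grad f x) \<le> B"
  shows "\<bar>f x - f y\<bar> \<le> B * norm (x - y)"
proof -
  have "norm (f x - f y) \<le> B * norm (x - y)"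
  proof (rule differentiable_bound[of UNIV f "\<lambda>x h. grad f x \<bullet> h"])
    fix x show "(f has_derivative (\<bullet>) (grad f x)) (at x within UNIV)"
      using has_derivative_grad[OF assms(1)] by simp
    have "onorm ((\<bullet>) (grad f x)) \<le> norm (grad f x)"
      by (rule onorm_le) (simp add: Cauchy_Schwarz_ineq2)
    then show "onorm ((\<bullet>) (grad f x)) \<le> B" using assms(2) by (rule order_trans)
  qed auto
  then show ?thesis by simp
qed

lemma test_fun_lipschitz:
  assumes "test_fun U f"
  obtains B where "0 < B" "\<And>x y. \<bar>f x - f y\<bar> \<le> B * norm (x - y)"
proof -
  obtain B where B: "0 < B" "\<And>x. norm (grad f x) \<le> B"
    using test_fun_grad_bounded[OF assms] by blast
  have "\<bar>f x - f y\<bar> \<le> B * norm (x - y)" for x y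
    using grad_bound_lipschitz[OF smooth_differentiable[OF test_fun_smooth[OF assms]] B(2)] .
  with B(1) show ?thesis by (rule that)
qed

section \<open>Translation, scaling and reflection of Lebesgue integrals\<close>

lemma lborel_integrable_translate:
  fixes f :: "'a::euclidean_space \<Rightarrow> 'b::{banach,second_countable_topology}"
  shows "integrable lborel (\<lambda>x. f (c + x)) \<longleftrightarrow> integrable lborel f"
proof -
  have *: "integrable lborel (\<lambda>x. f (c + x))" if "integrable lborel f" for f :: "'a \<Rightarrow> 'b" and c
  proof -
    have [measurable]: "f \<in> borel_measurable borel" using that by auto
    show ?thesis
      using that by (subst (asm) lborel_distr_plus[of c, symmetric], subst (asm) integrable_distr_eq) auto
  qed
  show ?thesis
  proof
    assume "integrable lborel (\<lambda>x. f (c + x))"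
    from *[OF this, of "-c"] show "integrable lborel f" by simp
  qed (rule *)
qed

lemma lborel_integral_translate:
  fixes f :: "'a::euclidean_space \<Rightarrow> 'b::{banach,second_countable_topology}"
  shows "(\<integral>x. f (c + x) \<partial>lborel) = (\<integral>x. f x \<partial>lborel)"
proof (cases "integrable lborel f")
  case True
  then have [measurable]: "f \<in> borel_measurable borel" by auto
  have "(\<integral>x. f x \<partial>lborel) = (\<integral>x. f x \<partial>distr lborel borel ((+) c))"
    by (subst lborel_distr_plus) simp
  also have "\<dots> = (\<integral>x. f (c + x) \<partial>lborel)" by (rule integral_distr) auto
  finally show ?thesis by simp
next
  case False
  then show ?thesis using lborel_integrable_translate[of f c] by (simp add: not_integrable_integral_eq)
qed

lemma lborel_integrable_scale:
  fixes f :: "'a::euclidean_space \<Rightarrow> real"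
  assumes "c \<noteq> 0" "integrable lborel f"
  shows "integrable lborel (\<lambda>x. f (t + c *\<^sub>R x))"
    and "(\<integral>x. f x \<partial>lborel) = \<bar>c\<bar>^DIM('a) * (\<integral>x. f (t + c *\<^sub>R x) \<partial>lborel)"
proof -
  have [measurable]: "f \<in> borel_measurable borel" using assms by auto
  have eq: "lborel = density (distr lborel borel (\<lambda>x. t + c *\<^sub>R x)) (\<lambda>_. ennreal (\<bar>c\<bar>^DIM('a)))"
    using lborel_affine[OF assms(1), of t] by (simp add: ennreal_power)
  have "integrable (density (distr lborel borel (\<lambda>x. t + c *\<^sub>R x)) (\<lambda>_. ennreal (\<bar>c\<bar>^DIM('a)))) f"
    using assms(2) eq by simp
  then show "integrable lborel (\<lambda>x. f (t + c *\<^sub>R x))"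
    using assms(1) by (subst (asm) integrable_density) (auto simp: integrable_distr_eq)
  have "(\<integral>x. f x \<partial>lborel) = (\<integral>x. f x \<partial>density (distr lborel borel (\<lambda>x. t + c *\<^sub>R x)) (\<lambda>_. ennreal (\<bar>c\<bar>^DIM('a))))"
    using eq by simp
  also have "\<dots> = \<bar>c\<bar>^DIM('a) * (\<integral>x. f (t + c *\<^sub>R x) \<partial>lborel)"
    by (subst integral_density) (auto simp: integral_distr)
  finally show "(\<integral>x. f x \<partial>lborel) = \<bar>c\<bar>^DIM('a) * (\<integral>x. f (t + c *\<^sub>R x) \<partial>lborel)" .
qed

lemma lborel_integrable_reflect:
  fixes f :: "'a::euclidean_space \<Rightarrow> real"
  shows "integrable lborel f \<Longrightarrow> integrable lborel (\<lambda>x. f (t - x))"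
  using lborel_integrable_scale(1)[of "-1" f t] by simp

lemma lborel_integral_reflect:
  fixes f :: "'a::euclidean_space \<Rightarrow> real"
  shows "(\<integral>x. f (t - x) \<partial>lborel) = (\<integral>x. f x \<partial>lborel)"
proof (cases "integrable lborel f")
  case True
  then show ?thesis using lborel_integrable_scale(2)[of "-1" f t] by simp
next
  case False
  moreover have "\<not> integrable lborel (\<lambda>x. f (t - x))"
    using False lborel_integrable_reflect[of "\<lambda>x. f (t - x)" t] by auto
  ultimately show ?thesis by (simp add: not_integrable_integral_eq)
qed

lemma integrable_bounded_support:
  fixes f :: "'a::euclidean_space \<Rightarrow> real"
  assumes [measurable]: "f \<in> borel_measurable borel" and "\<And>x. \<bar>f x\<bar> \<le> B" "\<And>x. x \<notin> K \<Longrightarrow> f x = 0" "bounded K"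
  shows "integrable lborel f"
proof -
  obtain r where r: "K \<subseteq> cball 0 r" using assms(4) bounded_subset_ballD[of K 0] ball_subset_cball by (metis order_trans)
  have "integrable lborel (\<lambda>x. indicator (cball (0::'a) r) x * B)"
    by (intro integrable_mult_left integrable_real_indicator) (auto simp: emeasure_lborel_cball_finite[unfolded infinity_ennreal_def])
  then show ?thesis
  proof (rule Bochner_Integration.integrable_bound, measurable, intro AE_I2)
    fix x
    have "x \<notin> cball 0 r \<Longrightarrow> f x = 0" using r assms(3) by blast
    then show "norm (f x) \<le> norm (indicator (cball 0 r) x * B)"
      using assms(2)[of x] by (auto simp: indicator_def)
  qed
qed

lemma test_fun_integrable: "test_fun U f \<Longrightarrow> integrable lborel f"
  by (rule test_fun_bounded, assumption, rule integrable_bounded_support[where K="tsupport f"])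
    (auto simp: test_fun_def zero_outside_tsupport compact_imp_bounded smooth_borel)

text \<open>The directional derivative along the steps h/(n+1), as a sequence, because dominated
  convergence is applied to these quotients both in the divergence theorem and in the translation
  estimates.\<close>

lemma directional_quotient:
  assumes "f differentiable at x"
  shows "(\<lambda>n. (f (h /\<^sub>R real (Suc n) + x) - f x) * real (Suc n)) \<longlonglongrightarrow> grad f x \<bullet> h"
proof -
  have "((\<lambda>t. f (x + t *\<^sub>R h)) has_derivative (\<lambda>s. grad f (x + 0 *\<^sub>R h) \<bullet> (s *\<^sub>R h))) (at 0)"
    by (rule has_derivative_compose[of "\<lambda>t. x + t *\<^sub>R h" "\<lambda>s. s *\<^sub>R h" 0 UNIV f])
      (use has_derivative_grad[OF assms] in \<open>auto intro!: derivative_eq_intros\<close>)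
  then have "((\<lambda>t. f (x + t *\<^sub>R h)) has_real_derivative (grad f x \<bullet> h)) (at 0)"
    unfolding has_field_derivative_def by (rule has_derivative_eq_rhs) (simp add: fun_eq_iff)
  then have "((\<lambda>t. (f (x + t *\<^sub>R h) - f x) / t) \<longlongrightarrow> grad f x \<bullet> h) (at 0)"
    by (simp add: DERIV_def)
  moreover have "filterlim (\<lambda>n. inverse (real (Suc n))) (at 0) sequentially"
    by (simp add: filterlim_at LIMSEQ_inverse_real_of_nat del: of_nat_Suc)
  ultimately have "(\<lambda>n. (f (x + inverse (real (Suc n)) *\<^sub>R h) - f x) / inverse (real (Suc n))) \<longlonglongrightarrow> grad f x \<bullet> h"
    by (rule filterlim_compose)
  then show ?thesis by (simp add: divide_inverse add.commute del: of_nat_Suc)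
qed

text \<open>Divergence theorem without Fubini: the integral of a difference quotient vanishes by
  translation invariance.\<close>

lemma integral_pd_eq_0:
  fixes f :: "real^'n::finite \<Rightarrow> real"
  assumes lip: "\<And>x y. \<bar>f x - f y\<bar> \<le> L * norm (x - y)"
    and diff: "\<And>x. f differentiable at x"
    and supp: "\<And>x. x \<notin> K \<Longrightarrow> f x = 0" and "bounded K"
  shows "(\<integral>x. pd i f x \<partial>lborel) = 0" "integrable lborel (pd i f)"
proof -
  obtain r where r: "K \<subseteq> cball 0 r" using \<open>bounded K\<close> bounded_subset_ballD[of K 0] ball_subset_cball by (metis order_trans)
  have [measurable]: "f \<in> borel_measurable borel"
    by (intro borel_measurable_continuous_onI)
      (use diff differentiable_imp_continuous_within continuous_at_imp_continuous_on in blast)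
  define e :: "real^'n" where "e = axis i 1"
  have ne: "norm e = 1" by (simp add: e_def)
  have L0: "0 \<le> L" using lip[of e 0] ne by (metis abs_ge_zero diff_zero mult.right_neutral order_trans)
  define q where "q n x = (f (e /\<^sub>R real (Suc n) + x) - f x) * real (Suc n)" for n x
  have qm [measurable]: "q n \<in> borel_measurable borel" for n unfolding q_def by measurable
  have lim: "(\<lambda>n. q n x) \<longlonglongrightarrow> pd i f x" for x
    using directional_quotient[OF diff, of e x] by (simp add: q_def e_def inner_axis grad_def)
  \<comment> \<open>The Lipschitz constant bounds every quotient, and since the steps have length at
    most 1 all quotients vanish outside the ball enlarged by 1. This gives one integrable
    majorant.\<close>
  have qb: "\<bar>q n x\<bar> \<le> indicator (cball 0 (r+1)) x * L" for n x
  proof (cases "x \<in> cball 0 (r+1)")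
    case True
    have "\<bar>q n x\<bar> = \<bar>f (e /\<^sub>R real (Suc n) + x) - f x\<bar> * real (Suc n)"
      by (simp add: q_def abs_mult)
    also have "\<dots> \<le> (L * norm (e /\<^sub>R real (Suc n))) * real (Suc n)"
      using lip[of "e /\<^sub>R real (Suc n) + x" x] by (intro mult_right_mono) auto
    also have "\<dots> = L" by (simp add: ne del: of_nat_Suc)
    finally show ?thesis using True by simp
  next
    case False
    have "norm (e /\<^sub>R real (Suc n)) \<le> 1" by (simp add: ne divide_simps)
    moreover have "norm x \<le> norm (e /\<^sub>R real (Suc n) + x) + norm (e /\<^sub>R real (Suc n))"
      using norm_triangle_ineq4[of "e /\<^sub>R real (Suc n) + x" "e /\<^sub>R real (Suc n)"] by simp
    ultimately have "norm (e /\<^sub>R real (Suc n) + x) > r" "norm x > r" using False by auto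
    then have "f (e /\<^sub>R real (Suc n) + x) = 0" "f x = 0"
      using r by (auto intro!: supp)
    then show ?thesis using False by (simp add: q_def)
  qed
  have bi: "integrable lborel (\<lambda>x. indicator (cball (0::real^'n) (r+1)) x * L)"
    by (intro integrable_mult_left integrable_real_indicator) (auto simp: emeasure_lborel_cball_finite[unfolded infinity_ennreal_def])
  have pm [measurable]: "pd i f \<in> borel_measurable borel"
    by (rule borel_measurable_LIMSEQ_real[OF lim qm])
  have fb: "integrable lborel f"
  proof (rule integrable_bounded_support[where K=K and B="L * (2 * \<bar>r\<bar> + 2)"])
    fix x
    show "\<bar>f x\<bar> \<le> L * (2 * \<bar>r\<bar> + 2)"
    proof (cases "x \<in> K")
      case True
      have "norm ((\<bar>r\<bar> + 1) *\<^sub>R e) > r" by (simp add: ne)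
      then have "f ((\<bar>r\<bar> + 1) *\<^sub>R e) = 0" using r by (auto intro!: supp)
      then have "\<bar>f x\<bar> \<le> L * norm (x - (\<bar>r\<bar> + 1) *\<^sub>R e)"
        using lip[of x "(\<bar>r\<bar> + 1) *\<^sub>R e"] by simp
      also have "\<dots> \<le> L * (2 * \<bar>r\<bar> + 2)"
      proof (rule mult_left_mono[OF _ L0])
        have "norm (x - (\<bar>r\<bar> + 1) *\<^sub>R e) \<le> norm x + norm ((\<bar>r\<bar> + 1) *\<^sub>R e)"
          by (rule norm_triangle_ineq4)
        then show "norm (x - (\<bar>r\<bar> + 1) *\<^sub>R e) \<le> 2 * \<bar>r\<bar> + 2"
          using True r ne by auto
      qed
      finally show ?thesis .
    qed (use L0 in \<open>auto simp: supp\<close>)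
  qed (use assms in auto)
  have q0: "(\<integral>x. q n x \<partial>lborel) = 0" for n
    using fb lborel_integral_translate[of f "e /\<^sub>R real (Suc n)"]
      lborel_integrable_translate[of f "e /\<^sub>R real (Suc n)"]
    by (simp add: q_def del: of_nat_Suc)
  have "(\<lambda>n. \<integral>x. q n x \<partial>lborel) \<longlonglongrightarrow> (\<integral>x. pd i f x \<partial>lborel)"
    by (rule integral_dominated_convergence[OF _ _ bi]) (use lim qb in auto)
  then show "(\<integral>x. pd i f x \<partial>lborel) = 0" using q0 by (simp add: LIMSEQ_const_iff)
  show "integrable lborel (pd i f)"
    by (rule integrable_dominated_convergence[OF _ _ bi, where s=q]) (use lim qb in auto)
qed

section \<open>Square integrable functions\<close>

text \<open>Borel rather than Lebesgue measurability is required, so that translations and integrals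
  over products raise no measurability questions. Versions of this kind of a Sobolev function are
  supplied by \<open>weak_grad_LW\<close>.\<close>

definition L2 :: "('a::euclidean_space \<Rightarrow> real) \<Rightarrow> bool" where
  "L2 f \<longleftrightarrow> f \<in> borel_measurable borel \<and> integrable lborel (\<lambda>x. (f x)^2)"

lemma L2_borel [measurable_dest]: "L2 f \<Longrightarrow> f \<in> borel_measurable borel"
  by (simp add: L2_def)

lemma L2_integrable: "L2 f \<Longrightarrow> integrable lborel (\<lambda>x. (f x)^2)"
  by (simp add: L2_def)

lemma L2_mono:
  assumes "L2 f" and [measurable]: "g \<in> borel_measurable borel" and "\<And>x. \<bar>g x\<bar> \<le> \<bar>f x\<bar>"
  shows "L2 g"
  unfolding L2_def
proof
  show "integrable lborel (\<lambda>x. (g x)^2)"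
    by (rule Bochner_Integration.integrable_bound[OF L2_integrable[OF assms(1)]])
      (use assms(3) in \<open>auto simp: abs_le_square_iff\<close>)
qed simp

lemma L2_cmult: "L2 f \<Longrightarrow> L2 (\<lambda>x. c * f x)"
  unfolding L2_def power_mult_distrib by (intro conjI borel_measurable_times integrable_mult_right) simp_all

lemma L2_prod_integrable:
  assumes "L2 f" "L2 g" shows "integrable lborel (\<lambda>x. f x * g x)"
proof (rule Bochner_Integration.integrable_bound)
  show "integrable lborel (\<lambda>x. (f x)^2 + (g x)^2)" using assms by (simp add: L2_def)
  show "(\<lambda>x. f x * g x) \<in> borel_measurable lborel" using assms by (intro borel_measurable_times) (auto simp: L2_def)
  have "\<bar>f x * g x\<bar> \<le> (f x)^2 + (g x)^2" for x
  proof -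
    have "2 * (\<bar>f x\<bar> * \<bar>g x\<bar>) \<le> (f x)^2 + (g x)^2"
      using sum_squares_bound[of "\<bar>f x\<bar>" "\<bar>g x\<bar>"] unfolding power2_abs mult.assoc .
    moreover have "0 \<le> \<bar>f x\<bar> * \<bar>g x\<bar>" by simp
    ultimately show ?thesis unfolding abs_mult by linarith
  qed
  then show "AE x in lborel. norm (f x * g x) \<le> norm ((f x)\<^sup>2 + (g x)\<^sup>2)" by simp
qed

lemma L2_add: assumes "L2 f" "L2 g" shows "L2 (\<lambda>x. f x + g x)"
proof -
  have "integrable lborel (\<lambda>x. (f x)^2 + (g x)^2 + 2 * (f x * g x))"
    using assms L2_prod_integrable[OF assms] by (intro Bochner_Integration.integrable_add integrable_mult_right) (auto simp: L2_def)
  then have "integrable lborel (\<lambda>x. (f x + g x)^2)" by (simp add: power2_sum algebra_simps)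
  then show ?thesis using assms by (simp add: L2_def borel_measurable_add)
qed

lemma L2_diff: "L2 f \<Longrightarrow> L2 g \<Longrightarrow> L2 (\<lambda>x. f x - g x)"
  using L2_add[of f "\<lambda>x. (-1) * g x"] L2_cmult[of g "-1"] by simp

lemma L2_minus: "L2 f \<Longrightarrow> L2 (\<lambda>x. - f x)"
  using L2_cmult[of f "-1"] by simp

lemma L2_zero: "L2 (\<lambda>x. 0)" by (simp add: L2_def)

lemma L2_sum: "finite I \<Longrightarrow> (\<And>i. i \<in> I \<Longrightarrow> L2 (f i)) \<Longrightarrow> L2 (\<lambda>x. \<Sum>i\<in>I. f i x)"
  by (induction I rule: finite_induct) (auto simp: L2_zero intro: L2_add)

lemma L2_bounded_mult:
  assumes "L2 f" and [measurable]: "g \<in> borel_measurable borel" and "\<And>x. \<bar>g x\<bar> \<le> B"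
  shows "L2 (\<lambda>x. g x * f x)"
proof (rule L2_mono[OF L2_cmult[OF assms(1), of B]])
  have [measurable]: "f \<in> borel_measurable borel" using assms by (simp add: L2_def)
  show "(\<lambda>x. g x * f x) \<in> borel_measurable borel" by measurable
  show "\<bar>g x * f x\<bar> \<le> \<bar>B * f x\<bar>" for x
    using mult_right_mono[OF assms(3)[of x], of "\<bar>f x\<bar>"] assms(3)[of x] by (simp add: abs_mult)
qed

lemma L2_bounded_support:
  assumes "f \<in> borel_measurable borel" and "\<And>x. \<bar>f x\<bar> \<le> B" "\<And>x. x \<notin> K \<Longrightarrow> f x = 0" "bounded K"
  shows "L2 f"
  unfolding L2_def
proof
  show "integrable lborel (\<lambda>x. (f x)^2)"
  proof (rule integrable_bounded_support[where K=K and B="B^2"])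
    show "\<bar>(f x)^2\<bar> \<le> B^2" for x using power_mono[OF assms(2)[of x], of 2] by simp
  qed (use assms in auto)
qed fact

lemma L2_indicator: "A \<in> sets borel \<Longrightarrow> bounded A \<Longrightarrow> L2 (indicator A)"
  by (rule L2_bounded_support[where B=1 and K=A]) (auto simp: indicator_def)

lemma L2_test_fun: "test_fun U f \<Longrightarrow> L2 f"
  by (rule test_fun_bounded, assumption, rule L2_bounded_support[where K="tsupport f"])
    (auto simp: test_fun_def zero_outside_tsupport compact_imp_bounded smooth_borel)

lemma L2_translate: "L2 f \<Longrightarrow> L2 (\<lambda>x. f (h + x))"
  using lborel_integrable_translate[of "\<lambda>x. (f x)^2" h] measurable_compose[of "\<lambda>x. h + x" borel borel f borel]
  by (simp add: L2_def)

lemma L2_local_integrable: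
  assumes "L2 f" "A \<in> sets borel" "bounded A"
  shows "integrable lborel (\<lambda>x. indicator A x * f x)"
  using L2_prod_integrable[OF L2_indicator[OF assms(2,3)] assms(1)] .

lemma L2_cauchy_schwarz:
  assumes "L2 f" "L2 g"
  shows "(\<integral>x. \<bar>f x * g x\<bar> \<partial>lborel)^2 \<le> (\<integral>x. (f x)^2 \<partial>lborel) * (\<integral>x. (g x)^2 \<partial>lborel)"
proof -
  have m [measurable]: "f \<in> borel_measurable borel" "g \<in> borel_measurable borel" using assms by (auto simp: L2_def)
  have 1: "(\<integral>\<^sup>+x. ennreal \<bar>f x\<bar> * ennreal \<bar>g x\<bar> \<partial>lborel) = ennreal (\<integral>x. \<bar>f x * g x\<bar> \<partial>lborel)"
    by (subst nn_integral_eq_integral[symmetric])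
      (use integrable_abs[OF L2_prod_integrable[OF assms]] in \<open>auto simp: ennreal_mult'[symmetric] abs_mult\<close>)
  have 2: "(\<integral>\<^sup>+x. (ennreal \<bar>h x\<bar>)^2 \<partial>lborel) = ennreal (\<integral>x. (h x)^2 \<partial>lborel)" if "L2 h" for h
    using that by (subst nn_integral_eq_integral[symmetric]) (auto simp: L2_def ennreal_power)
  have "(\<integral>\<^sup>+x. ennreal \<bar>f x\<bar> * ennreal \<bar>g x\<bar> \<partial>lborel)^2 \<le>
     (\<integral>\<^sup>+x. (ennreal \<bar>f x\<bar>)^2 \<partial>lborel) * (\<integral>\<^sup>+x. (ennreal \<bar>g x\<bar>)^2 \<partial>lborel)"
    by (rule Cauchy_Schwarz_nn_integral) auto
  then have "ennreal ((\<integral>x. \<bar>f x * g x\<bar> \<partial>lborel)^2) \<le>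
     ennreal ((\<integral>x. (f x)^2 \<partial>lborel) * (\<integral>x. (g x)^2 \<partial>lborel))"
    unfolding 1 2[OF assms(1)] 2[OF assms(2)] by (simp add: ennreal_power ennreal_mult')
  then show ?thesis by (subst (asm) ennreal_le_iff) auto
qed

lemma L2_cauchy_schwarz':
  assumes "L2 f" "L2 g"
  shows "(\<integral>x. f x * g x \<partial>lborel)^2 \<le> (\<integral>x. (f x)^2 \<partial>lborel) * (\<integral>x. (g x)^2 \<partial>lborel)"
proof -
  have "\<bar>\<integral>x. f x * g x \<partial>lborel\<bar> \<le> (\<integral>x. \<bar>f x * g x\<bar> \<partial>lborel)"
    using integral_norm_bound[of lborel "\<lambda>x. f x * g x"] by simp
  then have "(\<integral>x. f x * g x \<partial>lborel)^2 \<le> (\<integral>x. \<bar>f x * g x\<bar> \<partial>lborel)^2"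
    by (metis power_mono abs_ge_zero power2_abs)
  with L2_cauchy_schwarz[OF assms] show ?thesis by linarith
qed

lemma L2_add_bound:
  assumes "L2 f" "L2 g"
  shows "(\<integral>x. (f x + g x)^2 \<partial>lborel) \<le> 2 * (\<integral>x. (f x)^2 \<partial>lborel) + 2 * (\<integral>x. (g x)^2 \<partial>lborel)"
proof -
  have "(\<integral>x. (f x + g x)^2 \<partial>lborel) \<le> (\<integral>x. 2 * (f x)^2 + 2 * (g x)^2 \<partial>lborel)"
  proof (rule integral_mono)
    show "integrable lborel (\<lambda>x. (f x + g x)^2)" using L2_add[OF assms] by (simp add: L2_def)
    show "(f x + g x)^2 \<le> 2 * (f x)^2 + 2 * (g x)^2" for x
      using sum_squares_bound[of "f x" "g x"] by (simp add: power2_sum)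
  qed (use assms in \<open>simp add: L2_def\<close>)
  also have "\<dots> = 2 * (\<integral>x. (f x)^2 \<partial>lborel) + 2 * (\<integral>x. (g x)^2 \<partial>lborel)"
    using assms by (subst Bochner_Integration.integral_add) (auto simp: L2_def)
  finally show ?thesis .
qed

text \<open>Membership of all terms in \<open>L2\<close> is part of the notion: the integral of a
  non-integrable function is 0 by convention, so the limit alone would carry no information.\<close>

definition L2lim :: "(nat \<Rightarrow> 'a::euclidean_space \<Rightarrow> real) \<Rightarrow> ('a \<Rightarrow> real) \<Rightarrow> bool" where
  "L2lim F f \<longleftrightarrow> (\<forall>k. L2 (F k)) \<and> L2 f \<and> (\<lambda>k. \<integral>x. (F k x - f x)^2 \<partial>lborel) \<longlonglongrightarrow> 0"

lemma L2lim_prod: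
  assumes "L2lim F f" "L2 g"
  shows "(\<lambda>k. \<integral>x. F k x * g x \<partial>lborel) \<longlonglongrightarrow> (\<integral>x. f x * g x \<partial>lborel)"
proof -
  have L: "L2 (F k)" "L2 f" for k using assms by (auto simp: L2lim_def)
  have "(\<lambda>k. (\<integral>x. (F k x - f x)^2 \<partial>lborel) * (\<integral>x. (g x)^2 \<partial>lborel)) \<longlonglongrightarrow> 0"
    using assms(1) unfolding L2lim_def by (auto intro: tendsto_mult_left_zero)
  then have "(\<lambda>k. (\<integral>x. (F k x - f x) * g x \<partial>lborel)^2) \<longlonglongrightarrow> 0"
    by (rule tendsto_sandwich[OF _ _ tendsto_const, rotated -1])
      (auto intro!: always_eventually L2_cauchy_schwarz' L2_diff L assms)
  then have "(\<lambda>k. (\<integral>x. (F k x - f x) * g x \<partial>lborel)) \<longlonglongrightarrow> 0"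
    by (drule_tac tendsto_real_sqrt) (simp add: tendsto_rabs_zero_iff)
  moreover have "(\<integral>x. (F k x - f x) * g x \<partial>lborel) = (\<integral>x. F k x * g x \<partial>lborel) - (\<integral>x. f x * g x \<partial>lborel)" for k
    using L assms(2) by (subst Bochner_Integration.integral_diff[symmetric])
      (auto simp: L2_prod_integrable left_diff_distrib)
  ultimately show ?thesis by (simp add: LIM_zero_iff)
qed

text \<open>Expanding the square of F k - f reduces the convergence of the norms to the convergence
  of the products with f, which is \<open>L2lim_prod\<close>.\<close>

lemma L2lim_norm:
  assumes "L2lim F f"
  shows "(\<lambda>k. \<integral>x. (F k x)^2 \<partial>lborel) \<longlonglongrightarrow> (\<integral>x. (f x)^2 \<partial>lborel)"
proof -
  have L: "L2 (F k)" "L2 f" for k using assms by (auto simp: L2lim_def)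
  have "(\<integral>x. (F k x)^2 \<partial>lborel) = (\<integral>x. (F k x - f x)^2 \<partial>lborel) + 2 * (\<integral>x. F k x * f x \<partial>lborel)
     - (\<integral>x. f x * f x \<partial>lborel)" for k
  proof -
    have "(\<integral>x. (F k x)^2 \<partial>lborel) = (\<integral>x. (F k x - f x)^2 + 2 * (F k x * f x) - f x * f x \<partial>lborel)"
      by (rule Bochner_Integration.integral_cong) (auto simp: power2_eq_square algebra_simps)
    also have "\<dots> = (\<integral>x. (F k x - f x)^2 + 2 * (F k x * f x) \<partial>lborel) - (\<integral>x. f x * f x \<partial>lborel)"
      by (intro Bochner_Integration.integral_diff Bochner_Integration.integrable_add integrable_mult_right
          L2_prod_integrable L2_integrable L2_diff L)
    also have "(\<integral>x. (F k x - f x)^2 + 2 * (F k x * f x) \<partial>lborel) =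
      (\<integral>x. (F k x - f x)^2 \<partial>lborel) + (\<integral>x. 2 * (F k x * f x) \<partial>lborel)"
      by (intro Bochner_Integration.integral_add integrable_mult_right
          L2_prod_integrable L2_integrable L2_diff L)
    finally show ?thesis by simp
  qed
  moreover have "(\<lambda>k. (\<integral>x. (F k x - f x)^2 \<partial>lborel) + 2 * (\<integral>x. F k x * f x \<partial>lborel)
     - (\<integral>x. f x * f x \<partial>lborel)) \<longlonglongrightarrow> 0 + 2 * (\<integral>x. f x * f x \<partial>lborel) - (\<integral>x. f x * f x \<partial>lborel)"
    using assms by (intro tendsto_intros L2lim_prod) (auto simp: L2lim_def)
  ultimately show ?thesis by (simp add: power2_eq_square)
qed

section \<open>Continuity of translations in L1 and L2\<close>

lemma squeeze_0:
  fixes a b :: "nat \<Rightarrow> real"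
  assumes "b \<longlonglongrightarrow> 0" "\<And>k. 0 \<le> a k" "\<And>k. a k \<le> b k"
  shows "a \<longlonglongrightarrow> 0"
  by (rule tendsto_sandwich[OF _ _ tendsto_const assms(1)]) (simp_all add: assms)

lemma tendsto_0_less:
  fixes X :: "nat \<Rightarrow> real"
  assumes "X \<longlonglongrightarrow> 0" "0 < e"
  obtains N where "\<And>k. k \<ge> N \<Longrightarrow> X k < e"
proof -
  from order_tendstoD(2)[OF assms] obtain N where "\<forall>k\<ge>N. X k < e"
    by (auto simp: eventually_sequentially)
  then show ?thesis by (intro that) auto
qed

text \<open>A point of an open set stays in it under small translations, so only the mass that
  leaves \<open>U\<close> is controlled, with the indicator of \<open>U\<close> as majorant. The
  mass that enters is the same quantity for the opposite translation.\<close>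

lemma L1_translate_continuous_open:
  fixes U :: "'a::euclidean_space set"
  assumes "open U" "emeasure lborel U < \<infinity>" "h \<longlonglongrightarrow> 0"
  shows "(\<lambda>k. \<integral>x. max 0 (indicator U x - indicator U (h k + x)) \<partial>lborel) \<longlonglongrightarrow> (0::real)"
proof -
  have [measurable]: "U \<in> sets borel" using assms(1) by simp
  have "(\<lambda>k. \<integral>x. max 0 (indicator U x - indicator U (h k + x)) \<partial>lborel) \<longlonglongrightarrow> integral\<^sup>L lborel (\<lambda>x::'a. (0::real))"
  proof (rule integral_dominated_convergence[where w="indicator U"])
    show "integrable lborel (indicator U :: 'a \<Rightarrow> real)"
      using assms by (intro integrable_real_indicator) (auto simp: top.not_eq_extremum)
    have "(\<lambda>k. max 0 (indicator U x - indicator U (h k + x)) :: real) \<longlonglongrightarrow> 0" for x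
    proof (cases "x \<in> U")
      case True
      have "(\<lambda>k. h k + x) \<longlonglongrightarrow> x" using tendsto_add[OF assms(3) tendsto_const[of x]] by simp
      then have "eventually (\<lambda>k. h k + x \<in> U) sequentially"
        using assms(1) True by (rule topological_tendstoD)
      then show ?thesis
        by (intro tendsto_eventually) (auto elim!: eventually_mono simp: True)
    qed simp
    then show "AE x in lborel. (\<lambda>k. max 0 (indicator U x - indicator U (h k + x)) :: real) \<longlonglongrightarrow> 0" by simp
  qed (auto simp: indicator_def)
  then show ?thesis by simp
qed

text \<open>Induction over integrable functions; the only real case is an indicator, which outer
  regularity replaces by the indicator of an open set.\<close>

lemma L1_translate_continuous:
  fixes f :: "'a::euclidean_space \<Rightarrow> real"
  assumes "integrable lborel f" "h \<longlonglongrightarrow> 0"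
  shows "(\<lambda>k. \<integral>x. \<bar>f (h k + x) - f x\<bar> \<partial>lborel) \<longlonglongrightarrow> 0"
  using assms(1)
proof (induction rule: integrable_induct)
  case (base A c)
  note [measurable] = base(1)
  let ?I = "\<lambda>A x. indicator A x :: real"
  have tri: "(\<integral>x. \<bar>f (t + x) - f x\<bar> \<partial>lborel) \<le> 2 * (\<integral>x. \<bar>f x - g x\<bar> \<partial>lborel) + (\<integral>x. \<bar>g (t + x) - g x\<bar> \<partial>lborel)"
    if f: "integrable lborel f" and g: "integrable lborel g" for f g :: "'a \<Rightarrow> real" and t
  proof -
    have it: "integrable lborel (\<lambda>x. f (t + x))" "integrable lborel (\<lambda>x. g (t + x))"
      using f g by (auto simp: lborel_integrable_translate)
    have "(\<integral>x. \<bar>f (t + x) - f x\<bar> \<partial>lborel) \<le> (\<integral>x. \<bar>f (t + x) - g (t + x)\<bar> + \<bar>f x - g x\<bar> + \<bar>g (t + x) - g x\<bar> \<partial>lborel)"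
      by (rule integral_mono) (use f g it in auto)
    also have "\<dots> = (\<integral>x. \<bar>f (t + x) - g (t + x)\<bar> \<partial>lborel) + (\<integral>x. \<bar>f x - g x\<bar> \<partial>lborel) + (\<integral>x. \<bar>g (t + x) - g x\<bar> \<partial>lborel)"
      using f g it by (subst Bochner_Integration.integral_add, auto)+
    also have "(\<integral>x. \<bar>f (t + x) - g (t + x)\<bar> \<partial>lborel) = (\<integral>x. \<bar>f x - g x\<bar> \<partial>lborel)"
      by (rule lborel_integral_translate)
    finally show ?thesis by simp
  qed
  have key: "(\<lambda>k. \<integral>x. \<bar>?I A (h k + x) - ?I A x\<bar> \<partial>lborel) \<longlonglongrightarrow> 0"
  proof (rule LIMSEQ_I)
    fix e :: real assume "0 < e"
    obtain U where U: "open U" "A \<subseteq> U" "emeasure lborel (U - A) < ennreal (e/4)"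
      using outer_regular_lborel[of A "e/4"] base(1) \<open>0 < e\<close> by auto
    have [measurable]: "U \<in> sets borel" using U(1) by simp
    have fU: "emeasure lborel U < \<infinity>"
    proof -
      have "emeasure lborel U = emeasure lborel A + emeasure lborel (U - A)"
        using U(2) base(1) by (subst plus_emeasure) (auto simp: Un_absorb1)
      then show ?thesis using base(2) U(3) by (auto simp: ennreal_add_less_top less_trans top.extremum_strict)
    qed
    have iA: "integrable lborel (?I A)" and iU: "integrable lborel (?I U)"
      using base fU by (auto intro!: integrable_real_indicator)
    have d: "(\<integral>x. \<bar>?I A x - ?I U x\<bar> \<partial>lborel) < e/4"
    proof -
      have "(\<integral>x. \<bar>?I A x - ?I U x\<bar> \<partial>lborel) = (\<integral>x. ?I (U - A) x \<partial>lborel)"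
        by (rule Bochner_Integration.integral_cong) (use U(2) in \<open>auto simp: indicator_def\<close>)
      also have "\<dots> = measure lborel (U - A)" by simp
      also have "\<dots> < e/4"
      proof -
        have "emeasure lborel (U - A) = ennreal (measure lborel (U - A))"
          by (rule emeasure_eq_ennreal_measure) (use U(3) in auto)
        with U(3) show ?thesis by (simp add: ennreal_less_iff)
      qed
      finally show ?thesis .
    qed
    \<comment> \<open>The mass entering \<open>U\<close> under the translation by \<open>h k\<close>
      becomes, after a change of variables, the mass leaving it under the translation by
      \<open>- h k\<close>.\<close>
    have split: "(\<integral>x. \<bar>?I U (h k + x) - ?I U x\<bar> \<partial>lborel) =
      (\<integral>x. max 0 (?I U x - ?I U (h k + x)) \<partial>lborel) + (\<integral>x. max 0 (?I U x - ?I U (- h k + x)) \<partial>lborel)" for k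
    proof -
      have it: "integrable lborel (\<lambda>x. ?I U (h k + x))" "integrable lborel (\<lambda>x. ?I U (- h k + x))"
        by (rule lborel_integrable_translate[THEN iffD2, OF iU])+
      have "(\<integral>x. \<bar>?I U (h k + x) - ?I U x\<bar> \<partial>lborel) =
        (\<integral>x. max 0 (?I U x - ?I U (h k + x)) + max 0 (?I U (h k + x) - ?I U x) \<partial>lborel)"
        by (rule Bochner_Integration.integral_cong) auto
      also have "\<dots> = (\<integral>x. max 0 (?I U x - ?I U (h k + x)) \<partial>lborel) + (\<integral>x. max 0 (?I U (h k + x) - ?I U x) \<partial>lborel)"
        using iU it by (subst Bochner_Integration.integral_add) (auto intro!: integrable_max)
      also have "(\<integral>x. max 0 (?I U (h k + x) - ?I U x) \<partial>lborel) = (\<integral>x. max 0 (?I U x - ?I U (- h k + x)) \<partial>lborel)"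
        using lborel_integral_translate[of "\<lambda>x. max 0 (?I U x - ?I U (- h k + x))" "h k"]
        by simp
      finally show ?thesis .
    qed
    have U0: "(\<lambda>k. \<integral>x. \<bar>?I U (h k + x) - ?I U x\<bar> \<partial>lborel) \<longlonglongrightarrow> 0 + 0"
      unfolding split using assms(2) tendsto_minus[OF assms(2)]
      by (intro tendsto_add L1_translate_continuous_open[OF U(1) fU]) auto
    obtain N where N: "\<And>k. k \<ge> N \<Longrightarrow> (\<integral>x. \<bar>?I U (h k + x) - ?I U x\<bar> \<partial>lborel) < e/2"
      by (rule tendsto_0_less[OF U0[simplified], of "e/2"]) (use \<open>0 < e\<close> in auto)
    have "(\<integral>x. \<bar>?I A (h k + x) - ?I A x\<bar> \<partial>lborel) < e" if "k \<ge> N" for k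
      using tri[OF iA iU, of "h k"] N[OF that] d by linarith
    then show "\<exists>N. \<forall>k\<ge>N. norm ((\<integral>x. \<bar>?I A (h k + x) - ?I A x\<bar> \<partial>lborel) - 0) < e"
      by (intro exI[of _ N]) auto
  qed
  have "(\<integral>x. \<bar>?I A (h k + x) *\<^sub>R c - ?I A x *\<^sub>R c\<bar> \<partial>lborel) = (\<integral>x. \<bar>?I A (h k + x) - ?I A x\<bar> \<partial>lborel) * \<bar>c\<bar>" for k
    by (simp add: left_diff_distrib[symmetric] abs_mult)
  then show ?case using tendsto_mult_left_zero[OF key, of "\<bar>c\<bar>"] by simp
next
  case (add f g)
  have ineq: "(\<integral>x. \<bar>(f (h k + x) + g (h k + x)) - (f x + g x)\<bar> \<partial>lborel) \<le>
    (\<integral>x. \<bar>f (h k + x) - f x\<bar> \<partial>lborel) + (\<integral>x. \<bar>g (h k + x) - g x\<bar> \<partial>lborel)" for k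
  proof -
    have it: "integrable lborel (\<lambda>x. f (h k + x))" "integrable lborel (\<lambda>x. g (h k + x))"
      using add by (auto simp: lborel_integrable_translate)
    have "(\<integral>x. \<bar>(f (h k + x) + g (h k + x)) - (f x + g x)\<bar> \<partial>lborel) \<le> (\<integral>x. \<bar>f (h k + x) - f x\<bar> + \<bar>g (h k + x) - g x\<bar> \<partial>lborel)"
      by (rule integral_mono) (use add(1,2) it in auto)
    also have "\<dots> = (\<integral>x. \<bar>f (h k + x) - f x\<bar> \<partial>lborel) + (\<integral>x. \<bar>g (h k + x) - g x\<bar> \<partial>lborel)"
      by (rule Bochner_Integration.integral_add) (use add(1,2) it in auto)
    finally show ?thesis .
  qed
  have conv: "(\<lambda>k. (\<integral>x. \<bar>f (h k + x) - f x\<bar> \<partial>lborel) + (\<integral>x. \<bar>g (h k + x) - g x\<bar> \<partial>lborel)) \<longlonglongrightarrow> 0"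
    using tendsto_add[OF add(3,4)] by simp
  show ?case by (rule squeeze_0[OF conv Bochner_Integration.integral_nonneg ineq]) (rule abs_ge_zero)
next
  case (lim f s)
  have tri: "(\<integral>x. \<bar>f (t + x) - f x\<bar> \<partial>lborel) \<le> 2 * (\<integral>x. \<bar>g x - f x\<bar> \<partial>lborel) + (\<integral>x. \<bar>g (t + x) - g x\<bar> \<partial>lborel)"
    if g: "integrable lborel g" for g :: "'a \<Rightarrow> real" and t
  proof -
    have it: "integrable lborel (\<lambda>x. f (t + x))" "integrable lborel (\<lambda>x. g (t + x))"
      using lim(4) g by (auto simp: lborel_integrable_translate)
    have "(\<integral>x. \<bar>f (t + x) - f x\<bar> \<partial>lborel) \<le> (\<integral>x. \<bar>g (t + x) - f (t + x)\<bar> + \<bar>g x - f x\<bar> + \<bar>g (t + x) - g x\<bar> \<partial>lborel)"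
      by (rule integral_mono) (use lim(4) g it in auto)
    also have "\<dots> = (\<integral>x. \<bar>g (t + x) - f (t + x)\<bar> \<partial>lborel) + (\<integral>x. \<bar>g x - f x\<bar> \<partial>lborel) + (\<integral>x. \<bar>g (t + x) - g x\<bar> \<partial>lborel)"
      using lim(4) g it by (subst Bochner_Integration.integral_add, auto)+
    also have "(\<integral>x. \<bar>g (t + x) - f (t + x)\<bar> \<partial>lborel) = (\<integral>x. \<bar>g x - f x\<bar> \<partial>lborel)"
      by (rule lborel_integral_translate)
    finally show ?thesis by simp
  qed
  have "(\<lambda>i. \<integral>x. \<bar>s i x - f x\<bar> \<partial>lborel) \<longlonglongrightarrow> integral\<^sup>L lborel (\<lambda>x::'a. (0::real))"
  proof (rule integral_dominated_convergence[where w="\<lambda>x. 3 * \<bar>f x\<bar>"])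
    show "AE x in lborel. (\<lambda>i. \<bar>s i x - f x\<bar>) \<longlonglongrightarrow> 0"
      using lim(2) by (auto intro!: AE_I2 tendsto_rabs_zero LIM_zero)
    have "norm \<bar>s i x - f x\<bar> \<le> 3 * \<bar>f x\<bar>" for i x
      using lim(3)[of x i] by (auto simp: space_lborel)
    then show "AE x in lborel. norm \<bar>s i x - f x\<bar> \<le> 3 * \<bar>f x\<bar>" for i by simp
  qed (use lim(1,4) in auto)
  then have s0: "(\<lambda>i. \<integral>x. \<bar>s i x - f x\<bar> \<partial>lborel) \<longlonglongrightarrow> 0" by simp
  show ?case
  proof (rule LIMSEQ_I)
    fix e :: real assume "0 < e"
    obtain i where i: "(\<integral>x. \<bar>s i x - f x\<bar> \<partial>lborel) < e/4"
      by (rule tendsto_0_less[OF s0, of "e/4"]) (use \<open>0 < e\<close> in auto)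
    obtain N where N: "\<And>k. k \<ge> N \<Longrightarrow> (\<integral>x. \<bar>s i (h k + x) - s i x\<bar> \<partial>lborel) < e/2"
      by (rule tendsto_0_less[OF lim(5)[of i], of "e/2"]) (use \<open>0 < e\<close> in auto)
    have "(\<integral>x. \<bar>f (h k + x) - f x\<bar> \<partial>lborel) < e" if "k \<ge> N" for k
      using tri[OF lim(1)[of i], of "h k"] N[OF that] i by linarith
    then show "\<exists>N. \<forall>k\<ge>N. norm ((\<integral>x. \<bar>f (h k + x) - f x\<bar> \<partial>lborel) - 0) < e"
      by (intro exI[of _ N]) auto
  qed
qed

lemma abs_diff_square_le: "0 \<le> a \<Longrightarrow> 0 \<le> b \<Longrightarrow> (a - b)^2 \<le> \<bar>a^2 - b^2\<bar>" for a b :: real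
proof -
  assume "0 \<le> a" "0 \<le> b"
  then have "\<bar>a - b\<bar> * \<bar>a - b\<bar> \<le> \<bar>a - b\<bar> * (a + b)" by (intro mult_left_mono) auto
  also have "\<dots> = \<bar>(a - b) * (a + b)\<bar>" using \<open>0 \<le> a\<close> \<open>0 \<le> b\<close> by (simp add: abs_mult)
  finally show ?thesis by (simp add: power2_eq_square algebra_simps)
qed

text \<open>For nonnegative functions the square of a difference is at most the difference of the
  squares, so L1 continuity of the squared function suffices; the general case splits into positive
  and negative part.\<close>

lemma L2_translate_continuous:
  fixes f :: "'a::euclidean_space \<Rightarrow> real"
  assumes "L2 f" "h \<longlonglongrightarrow> 0"
  shows "(\<lambda>k. \<integral>x. (f (h k + x) - f x)^2 \<partial>lborel) \<longlonglongrightarrow> 0"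
proof -
  have nonneg: "(\<lambda>k. \<integral>x. (g (h k + x) - g x)^2 \<partial>lborel) \<longlonglongrightarrow> 0" if g: "L2 g" "\<And>x. 0 \<le> g x" for g :: "'a \<Rightarrow> real"
  proof (rule tendsto_sandwich[OF _ _ tendsto_const L1_translate_continuous[OF L2_integrable[OF g(1)] assms(2)]])
    have "integrable lborel (\<lambda>x. (g (t + x))^2)" for t using L2_translate[OF g(1)] by (simp add: L2_def)
    then show "\<forall>\<^sub>F k in sequentially. (\<integral>x. (g (h k + x) - g x)^2 \<partial>lborel) \<le> (\<integral>x. \<bar>(g (h k + x))^2 - (g x)^2\<bar> \<partial>lborel)"
      using g by (intro always_eventually allI integral_mono L2_integrable L2_diff L2_translate)
        (auto simp: abs_diff_square_le L2_integrable)
  qed (auto intro!: always_eventually)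
  let ?p = "\<lambda>x. max 0 (f x)" and ?n = "\<lambda>x. max 0 (- f x)"
  have fm [measurable]: "f \<in> borel_measurable borel" using assms(1) by (simp add: L2_def)
  have L: "L2 ?p" "L2 ?n" by (rule L2_mono[OF assms(1)]; auto)+
  have "(\<lambda>k. 2 * (\<integral>x. (?p (h k + x) - ?p x)^2 \<partial>lborel) + 2 * (\<integral>x. (?n (h k + x) - ?n x)^2 \<partial>lborel)) \<longlonglongrightarrow> 2 * 0 + 2 * 0"
    by (intro tendsto_intros nonneg L) auto
  then have lim: "(\<lambda>k. 2 * (\<integral>x. (?p (h k + x) - ?p x)^2 \<partial>lborel) + 2 * (\<integral>x. (?n (h k + x) - ?n x)^2 \<partial>lborel)) \<longlonglongrightarrow> 0"
    by simp
  have "(\<integral>x. (f (h k + x) - f x)^2 \<partial>lborel) \<le>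
    2 * (\<integral>x. (?p (h k + x) - ?p x)^2 \<partial>lborel) + 2 * (\<integral>x. (?n (h k + x) - ?n x)^2 \<partial>lborel)" for k
  proof -
    have "(\<integral>x. (f (h k + x) - f x)^2 \<partial>lborel) = (\<integral>x. ((?p (h k + x) - ?p x) + - (?n (h k + x) - ?n x))^2 \<partial>lborel)"
      by (rule Bochner_Integration.integral_cong) (auto simp: max_def)
    also have "\<dots> \<le> 2 * (\<integral>x. (?p (h k + x) - ?p x)^2 \<partial>lborel) + 2 * (\<integral>x. (- (?n (h k + x) - ?n x))^2 \<partial>lborel)"
      by (intro L2_add_bound L2_minus L2_diff L2_translate[OF L(1)] L2_translate[OF L(2)] L)
    finally show ?thesis by (simp add: power2_commute)
  qed
  then show ?thesis by (rule squeeze_0[OF lim Bochner_Integration.integral_nonneg, rotated]) (rule zero_le_power2)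
qed

section \<open>Mollification and cutoff functions\<close>

definition conv :: "(real^'n::finite \<Rightarrow> real) \<Rightarrow> (real^'n \<Rightarrow> real) \<Rightarrow> real^'n \<Rightarrow> real" where
  "conv f \<psi> x = (\<integral>y. f y * \<psi> (x - y) \<partial>lborel)"

lemma test_fun_reflect:
  assumes "test_fun UNIV \<psi>"
  shows "test_fun UNIV (\<lambda>y. \<psi> (x - y))" and "pd i (\<lambda>y. \<psi> (x - y)) y = - pd i \<psi> (x - y)"
proof -
  have s: "smooth_fun (\<lambda>y. \<psi> (x - y))"
    using smooth_affine[OF test_fun_smooth[OF assms], of x "-1"] by simp
  show "pd i (\<lambda>y. \<psi> (x - y)) y = - pd i \<psi> (x - y)"
    using pd_affine(1)[OF test_fun_smooth[OF assms], of i x "-1"] by simp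
  show "test_fun UNIV (\<lambda>y. \<psi> (x - y))"
  proof (rule test_funI[OF s])
    show "compact ((\<lambda>y. x - y) ` tsupport \<psi>)"
      using assms by (intro compact_continuous_image continuous_intros) (auto simp: test_fun_def)
    show "\<psi> (x - y) = 0" if "y \<notin> (\<lambda>y. x - y) ` tsupport \<psi>" for y
    proof (rule zero_outside_tsupport)
      show "x - y \<notin> tsupport \<psi>" using that image_eqI[of y "\<lambda>y. x - y" "x - y"] by auto
    qed
  qed simp
qed

lemma conv_integrable: "L2 f \<Longrightarrow> test_fun UNIV \<psi> \<Longrightarrow> integrable lborel (\<lambda>y. f y * \<psi> (x - y))"
  using L2_prod_integrable L2_test_fun test_fun_reflect(1) by blast

lemma test_fun_support_ball:
  assumes "test_fun U \<psi>" obtains R where "0 < R" "\<And>x. R < norm x \<Longrightarrow> \<psi> x = 0"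
proof -
  have "bounded (tsupport \<psi>)" using assms by (auto simp: test_fun_def compact_imp_bounded)
  then obtain R where "0 < R" "\<And>x. x \<in> tsupport \<psi> \<Longrightarrow> norm x \<le> R" by (auto simp: bounded_pos)
  then have "\<psi> x = 0" if "R < norm x" for x using that zero_outside_tsupport[of x \<psi>] by force
  with \<open>0 < R\<close> show ?thesis using that by blast
qed

text \<open>Dominated convergence along an arbitrary sequence tending to x: the quotient of the
  kernel minus its linear part tends to 0 pointwise and is at most 2 B, and everything happens on a
  fixed ball because the sequence is bounded.\<close>

lemma conv_has_derivative:
  fixes f :: "real^'n::finite \<Rightarrow> real"
  assumes f: "L2 f" and \<psi>: "test_fun UNIV \<psi>"
  shows "(conv f \<psi> has_derivative (\<lambda>h. (\<chi> i. conv f (pd i \<psi>) x) \<bullet> h)) (at x)"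
proof -
  have fm [measurable]: "f \<in> borel_measurable borel" using f by (simp add: L2_def)
  have sm: "smooth_fun \<psi>" using \<psi> by (simp add: test_fun_def)
  have pm [measurable]: "\<psi> \<in> borel_measurable borel" "pd i \<psi> \<in> borel_measurable borel" for i
    using smooth_borel[OF sm] smooth_borel[OF smooth_pd[OF sm]] by auto
  obtain B where B: "0 < B" "\<And>x. norm (grad \<psi> x) \<le> B" using test_fun_grad_bounded[OF \<psi>] by blast
  have lip: "\<bar>\<psi> x - \<psi> y\<bar> \<le> B * norm (x - y)" for x y
    by (rule grad_bound_lipschitz[OF smooth_differentiable[OF sm] B(2)])
  obtain R where R: "0 < R" "\<And>x. R < norm x \<Longrightarrow> \<psi> x = 0" using test_fun_support_ball[OF \<psi>] by blast
  have gradR: "grad \<psi> x = 0" if "R < norm x" for x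
  proof -
    have "tsupport \<psi> \<subseteq> cball 0 R" using R(2) by (intro tsupport_subsetI) auto
    then have "x \<notin> tsupport \<psi>" using that by auto
    then show ?thesis by (simp add: grad_def pd_zero_outside vec_eq_iff)
  qed
  have Dlin: "(\<chi> i. conv f (pd i \<psi>) x) \<bullet> h = (\<integral>y. f y * (grad \<psi> (x - y) \<bullet> h) \<partial>lborel)" for h
  proof -
    have "(\<integral>y. f y * (grad \<psi> (x - y) \<bullet> h) \<partial>lborel) = (\<integral>y. (\<Sum>i\<in>UNIV. (f y * pd i \<psi> (x - y)) * h$i) \<partial>lborel)"
      by (simp add: inner_vec_def grad_def sum_distrib_left mult.assoc)
    also have "\<dots> = (\<Sum>i\<in>UNIV. (\<integral>y. (f y * pd i \<psi> (x - y)) * h$i \<partial>lborel))"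
      by (intro Bochner_Integration.integral_sum integrable_mult_left conv_integrable f test_fun_pd \<psi>)
    also have "\<dots> = (\<chi> i. conv f (pd i \<psi>) x) \<bullet> h" by (simp add: inner_vec_def conv_def)
    finally show ?thesis by simp
  qed
  have Dint: "integrable lborel (\<lambda>y. f y * (grad \<psi> (x - y) \<bullet> h))" for h
  proof -
    have "integrable lborel (\<lambda>y. (\<Sum>i\<in>UNIV. (f y * pd i \<psi> (x - y)) * h$i))"
      by (intro Bochner_Integration.integrable_sum integrable_mult_left conv_integrable f test_fun_pd \<psi>)
    then show ?thesis by (simp add: inner_vec_def grad_def sum_distrib_left mult.assoc)
  qed
  have lim: "((\<lambda>z. norm ((conv f \<psi> z - conv f \<psi> x) - (\<chi> i. conv f (pd i \<psi>) x) \<bullet> (z - x)) / norm (z - x)) \<longlongrightarrow> 0) (at x)"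
    unfolding tendsto_at_iff_sequentially
  proof (intro allI impI)
    fix X assume "\<forall>i::nat. X i \<in> UNIV - {x}" "X \<longlonglongrightarrow> x"
    then have X: "X i \<noteq> x" "X \<longlonglongrightarrow> x" for i by auto
    obtain K where K: "\<And>n. norm (X n) \<le> K" using X(2) convergent_imp_bounded by (metis bounded_iff rangeI convergentI)
    \<comment> \<open>If y lies outside this radius, both \<open>X n - y\<close> and
      \<open>x - y\<close> lie outside the support of the kernel.\<close>
    define R' where "R' = R + K + norm x"
    define g where "g n y = f y * ((\<psi> (X n - y) - \<psi> (x - y) - grad \<psi> (x - y) \<bullet> (X n - x)) / norm (X n - x))" for n y
    have gm: "g n \<in> borel_measurable borel" for n
    proof -
      have "(\<lambda>y. grad \<psi> (x - y) \<bullet> (X n - x)) \<in> borel_measurable borel"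
        unfolding inner_vec_def grad_def by simp measurable
      then show ?thesis unfolding g_def by measurable
    qed
    have lim0: "(\<lambda>n. g n y) \<longlonglongrightarrow> 0" for y
    proof -
      have "((\<lambda>z. norm (\<psi> z - \<psi> (x - y) - grad \<psi> (x - y) \<bullet> (z - (x - y))) / norm (z - (x - y))) \<longlongrightarrow> 0) (at (x - y))"
        using has_derivative_grad[OF smooth_differentiable[OF sm], of "x - y"] by (simp add: has_derivative_iff_norm)
      moreover have "filterlim (\<lambda>n. X n - y) (at (x - y)) sequentially"
        using X by (auto simp: filterlim_at intro!: tendsto_intros)
      ultimately have "(\<lambda>n. norm (\<psi> (X n - y) - \<psi> (x - y) - grad \<psi> (x - y) \<bullet> ((X n - y) - (x - y))) / norm ((X n - y) - (x - y))) \<longlonglongrightarrow> 0"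
        by (rule filterlim_compose)
      then have "(\<lambda>n. (\<psi> (X n - y) - \<psi> (x - y) - grad \<psi> (x - y) \<bullet> (X n - x)) / norm (X n - x)) \<longlonglongrightarrow> 0"
        by (subst tendsto_norm_zero_iff[symmetric]) simp
      then show ?thesis unfolding g_def by (rule tendsto_mult_right_zero)
    qed
    have bound: "\<bar>g n y\<bar> \<le> \<bar>indicator (cball 0 R') y * f y\<bar> * (2 * B)" for n y
    proof (cases "y \<in> cball 0 R'")
      case True
      have n0: "norm (X n - x) > 0" using X by simp
      have "\<bar>\<psi> (X n - y) - \<psi> (x - y) - grad \<psi> (x - y) \<bullet> (X n - x)\<bar> \<le> 2 * B * norm (X n - x)"
      proof -
        have "\<bar>\<psi> (X n - y) - \<psi> (x - y)\<bar> \<le> B * norm (X n - x)" using lip[of "X n - y" "x - y"] by simp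
        moreover have "\<bar>grad \<psi> (x - y) \<bullet> (X n - x)\<bar> \<le> norm (grad \<psi> (x - y)) * norm (X n - x)"
          by (rule Cauchy_Schwarz_ineq2)
        moreover have "norm (grad \<psi> (x - y)) * norm (X n - x) \<le> B * norm (X n - x)"
          by (intro mult_right_mono B) auto
        ultimately show ?thesis by linarith
      qed
      then have "\<bar>(\<psi> (X n - y) - \<psi> (x - y) - grad \<psi> (x - y) \<bullet> (X n - x)) / norm (X n - x)\<bar> \<le> 2 * B"
        using n0 by (simp add: divide_le_eq)
      from mult_left_mono[OF this, of "\<bar>f y\<bar>"] show ?thesis
        using True unfolding g_def abs_mult by simp
    next
      case False
      then have y: "norm y > R'" by simp
      have "0 \<le> K" using K[of 0] norm_ge_zero order_trans by blast
      have "norm (X n - y) > R" "norm (x - y) > R"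
        using norm_triangle_ineq2[of y "X n"] norm_triangle_ineq2[of y x] y K[of n] \<open>0 \<le> K\<close> norm_ge_zero[of x]
        unfolding R'_def norm_minus_commute[of y] by linarith+
      then show ?thesis using False by (simp add: g_def R gradR)
    qed
    have "(\<lambda>n. \<integral>y. g n y \<partial>lborel) \<longlonglongrightarrow> integral\<^sup>L lborel (\<lambda>y::real^'n. 0::real)"
    proof (rule integral_dominated_convergence[where w="\<lambda>y. \<bar>indicator (cball 0 R') y * f y\<bar> * (2 * B)"])
      show "integrable lborel (\<lambda>y. \<bar>indicator (cball 0 R') y * f y\<bar> * (2 * B))"
        by (intro integrable_mult_left integrable_abs L2_local_integrable f) auto
    qed (use gm lim0 bound in auto)
    then have "(\<lambda>n. \<bar>\<integral>y. g n y \<partial>lborel\<bar>) \<longlonglongrightarrow> 0" by (auto intro: tendsto_rabs_zero)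
    moreover have "\<bar>\<integral>y. g n y \<partial>lborel\<bar> = norm ((conv f \<psi> (X n) - conv f \<psi> x) - (\<chi> i. conv f (pd i \<psi>) x) \<bullet> (X n - x)) / norm (X n - x)" for n
    proof -
      have "(\<integral>y. g n y \<partial>lborel) = (\<integral>y. (f y * \<psi> (X n - y) - f y * \<psi> (x - y) - f y * (grad \<psi> (x - y) \<bullet> (X n - x))) / norm (X n - x) \<partial>lborel)"
        by (simp add: g_def algebra_simps)
      also have "\<dots> = ((\<integral>y. f y * \<psi> (X n - y) \<partial>lborel) - (\<integral>y. f y * \<psi> (x - y) \<partial>lborel) - (\<integral>y. f y * (grad \<psi> (x - y) \<bullet> (X n - x)) \<partial>lborel)) / norm (X n - x)"
        using Dint conv_integrable[OF f \<psi>] by simp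
      finally show ?thesis unfolding Dlin by (simp add: conv_def)
    qed
    ultimately show "((\<lambda>z. norm ((conv f \<psi> z - conv f \<psi> x) - (\<chi> i. conv f (pd i \<psi>) x) \<bullet> (z - x)) / norm (z - x)) \<circ> X) \<longlonglongrightarrow> 0"
      by (simp add: comp_def)
  qed
  show ?thesis unfolding has_derivative_iff_norm
    using lim by (auto intro: bounded_linear_inner_right)
qed

lemma conv_pd: "L2 f \<Longrightarrow> test_fun UNIV \<psi> \<Longrightarrow> pd i (conv f \<psi>) = conv f (pd i \<psi>)"
  using pd_has_derivative_grad[OF conv_has_derivative, of f \<psi>] by (simp add: fun_eq_iff)

lemma conv_smooth:
  assumes "L2 f" "test_fun UNIV \<psi>"
  shows "smooth_fun (conv f \<psi>)"
proof -
  have d: "conv f \<psi> differentiable (at x)" if "test_fun UNIV \<psi>" for \<psi> x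
    using conv_has_derivative[OF assms(1) that] by (auto simp: differentiable_def)
  have "Ck k (conv f \<psi>)" if "test_fun UNIV \<psi>" for k \<psi>
    using that
  proof (induction k arbitrary: \<psi>)
    case 0
    then show ?case using d[OF 0]
      by (simp add: differentiable_imp_continuous_within continuous_at_imp_continuous_on)
  next
    case (Suc k)
    then show ?case using d[OF Suc.prems] by (simp add: conv_pd assms(1) test_fun_pd)
  qed
  then show ?thesis using assms(2) by (simp add: smooth_fun_def)
qed

lemma bump_nonneg: "0 \<le> bump x"
  unfolding bump_def by (intro prod_nonneg) (auto simp: bump1_def)

lemma bump_0_pos: "0 < bump (0::real^'n::finite)"
  unfolding bump_def by (intro prod_pos) (auto simp: bump1_def)

lemma bump_support:
  fixes x :: "real^'n::finite"
  assumes "real CARD('n) < norm x" shows "bump x = 0"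
proof -
  have "\<exists>j. 1 < \<bar>x$j\<bar>"
  proof (rule ccontr)
    assume "\<not> ?thesis"
    then have "\<bar>x$j\<bar> \<le> 1" for j by (meson not_le)
    then have "(\<Sum>j\<in>UNIV. \<bar>x$j\<bar>) \<le> (\<Sum>j\<in>(UNIV::'n set). 1)" by (intro sum_mono)
    with norm_le_l1_cart[of x] assms show False by simp
  qed
  then obtain j where "1 < \<bar>x$j\<bar>" by blast
  then have "bump1 0 (1 + 1 * x$j) * bump1 0 (1 + (-1) * x$j) = 0" by (auto simp: bump1_def)
  then show ?thesis unfolding bump_def by (intro prod_zero) auto
qed

lemma test_fun_bump: "test_fun UNIV (bump :: real^'n::finite \<Rightarrow> real)"
  by (rule test_funI[OF smooth_bump compact_cball[of 0 "real CARD('n)"]]) (auto intro: bump_support)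

lemma bump_integral_pos: "0 < (\<integral>x. (bump (x::real^'n::finite)) \<partial>lborel)"
proof -
  have i: "integrable lborel (bump :: real^'n \<Rightarrow> real)" by (rule test_fun_integrable[OF test_fun_bump])
  have "(\<integral>x. (bump (x::real^'n)) \<partial>lborel) \<noteq> 0"
  proof
    assume "(\<integral>x. (bump (x::real^'n)) \<partial>lborel) = 0"
    then have ae: "AE x::real^'n in lborel. bump x = 0"
      using integral_nonneg_eq_0_iff_AE[OF i] bump_nonneg by auto
    have "open {x::real^'n. bump x \<noteq> 0}"
      by (intro open_Collect_neq smooth_continuous smooth_bump continuous_on_const)
    then obtain r where r: "0 < r" "ball 0 r \<subseteq> {x::real^'n. bump x \<noteq> 0}"
      using bump_0_pos[where 'n='n] by (metis (mono_tags, lifting) mem_Collect_eq open_contains_ball less_irrefl)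
    have "AE x::real^'n in lborel. x \<notin> ball 0 r" using ae r(2) by (auto elim!: eventually_mono)
    then have "emeasure lborel (ball (0::real^'n) r) = 0"
      using AE_iff_null_sets[of "ball (0::real^'n) r" lborel] by (auto simp: null_sets_def)
    with content_ball_pos[OF r(1), of "0::real^'n"] show False by (simp add: measure_def)
  qed
  moreover have "0 \<le> (\<integral>x. (bump (x::real^'n)) \<partial>lborel)" by (simp add: bump_nonneg)
  ultimately show ?thesis by linarith
qed

text \<open>\<open>bump\<close> is supported in the ball of radius \<open>CARD('n)\<close>, so this
  scaling puts the support into the ball of radius e; the denominator normalises the integral to
  1.\<close>

definition moll :: "real \<Rightarrow> real^'n::finite \<Rightarrow> real" where
  "moll e x = bump ((real CARD('n) / e) *\<^sub>R x) / (\<integral>y. bump ((real CARD('n) / e) *\<^sub>R (y::real^'n)) \<partial>lborel)"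

lemma moll_props:
  assumes "0 < e"
  shows moll_nonneg: "0 \<le> moll e (x::real^'n::finite)"
    and moll_support: "e < norm (x::real^'n) \<Longrightarrow> moll e x = 0"
    and moll_test_fun: "test_fun UNIV (moll e :: real^'n \<Rightarrow> real)"
    and moll_integral: "(\<integral>x. moll e (x::real^'n) \<partial>lborel) = 1"
    and moll_pd_integral: "(\<integral>x. \<bar>pd i (moll e) (x::real^'n)\<bar> \<partial>lborel) =
      (real CARD('n) * (\<integral>x. \<bar>pd i bump (x::real^'n)\<bar> \<partial>lborel) / (\<integral>x. bump (x::real^'n) \<partial>lborel)) / e"
proof -
  define s where "s = real CARD('n) / e"
  define J where "J = (\<integral>y. bump (s *\<^sub>R (y::real^'n)) \<partial>lborel)"
  have s: "0 < s" using assms by (simp add: s_def)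
  have m: "moll e = (\<lambda>x::real^'n. (1/J) * bump (0 + s *\<^sub>R x))" by (simp add: fun_eq_iff moll_def s_def J_def)
  have Jeq: "(\<integral>x. (bump (x::real^'n)) \<partial>lborel) = s ^ CARD('n) * J"
    using lborel_integrable_scale(2)[OF _ test_fun_integrable[OF test_fun_bump], of s 0] s by (simp add: J_def)
  then have J: "0 < J" using bump_integral_pos[where 'n='n] s by (simp add: zero_less_mult_iff)
  show "0 \<le> moll e x" using J by (simp add: m bump_nonneg)
  show sup: "moll e x = 0" if "e < norm x" for x :: "real^'n"
  proof -
    have "real CARD('n) < norm (s *\<^sub>R x)" using that assms by (simp add: s_def field_simps)
    then show ?thesis by (simp add: m bump_support)
  qed
  have sm: "smooth_fun (moll e :: real^'n \<Rightarrow> real)"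
    unfolding m by (intro smooth_mult smooth_const smooth_affine smooth_bump)
  show "test_fun UNIV (moll e :: real^'n \<Rightarrow> real)"
    by (rule test_funI[OF sm compact_cball[of 0 e]]) (auto intro: sup)
  show "(\<integral>x. moll e (x::real^'n) \<partial>lborel) = 1"
    using J unfolding m J_def by simp
  have pdm: "pd i (moll e) x = (1/J) * (s * pd i bump (0 + s *\<^sub>R x))" for x :: "real^'n"
  proof -
    have "pd i (moll e) x = (1/J) * pd i (\<lambda>x. bump (0 + s *\<^sub>R x)) x + pd i (\<lambda>x. 1/J) x * bump (0 + s *\<^sub>R x)"
      unfolding m by (rule pd_mult) (auto intro: pd_affine(2)[OF smooth_bump, of 0, simplified])
    also have "pd i (\<lambda>x::real^'n. 1/J) x = 0" by (rule pd_eqI[OF has_derivative_const])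
    finally show ?thesis by (simp only: pd_affine(1)[OF smooth_bump])
  qed
  have "(\<integral>x. \<bar>pd i (moll e) (x::real^'n)\<bar> \<partial>lborel) = (s / J) * (\<integral>x. \<bar>pd i bump (0 + s *\<^sub>R (x::real^'n))\<bar> \<partial>lborel)"
    unfolding pdm abs_mult using s J by simp
  also have "(\<integral>x. \<bar>pd i bump (x::real^'n)\<bar> \<partial>lborel) = s ^ CARD('n) * (\<integral>x. \<bar>pd i bump (0 + s *\<^sub>R (x::real^'n))\<bar> \<partial>lborel)"
    using lborel_integrable_scale(2)[of s "\<lambda>x. \<bar>pd i bump (x::real^'n)\<bar>" 0] s
      integrable_abs[OF test_fun_integrable[OF test_fun_pd[OF test_fun_bump, of i]]] by simp
  then have "(\<integral>x. \<bar>pd i bump (0 + s *\<^sub>R (x::real^'n))\<bar> \<partial>lborel) = (\<integral>x. \<bar>pd i bump (x::real^'n)\<bar> \<partial>lborel) / s ^ CARD('n)"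
    using s by simp
  finally show "(\<integral>x. \<bar>pd i (moll e) (x::real^'n)\<bar> \<partial>lborel) =
      (real CARD('n) * (\<integral>x. \<bar>pd i bump (x::real^'n)\<bar> \<partial>lborel) / (\<integral>x. bump (x::real^'n) \<partial>lborel)) / e"
    using s J assms unfolding Jeq by (simp add: s_def field_simps)
qed

lemma L2_reflect: "L2 f \<Longrightarrow> L2 (\<lambda>y. f (x - y))"
  using lborel_integrable_reflect[of "\<lambda>x. (f x)^2" x] measurable_compose[of "\<lambda>y. x - y" borel borel f borel]
  by (simp add: L2_def)

text \<open>The mollifier is a probability density, so by Jensen the squared error at x is at most
  the average of the squared differences f(x - h) - f(x); Tonelli then averages the L2 modulus over
  norm h at most e.\<close>

lemma conv_moll_L2_bound:
  fixes f :: "real^'n::finite \<Rightarrow> real"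
  assumes f: "L2 f" and e: "0 < e" and "0 \<le> \<eta>"
    and mod: "\<And>h. norm h \<le> e \<Longrightarrow> (\<integral>x. (f (h + x) - f x)^2 \<partial>lborel) \<le> \<eta>"
  shows "L2 (conv f (moll e))" "(\<integral>x. (conv f (moll e) x - f x)^2 \<partial>lborel) \<le> \<eta>"
proof -
  let ?\<rho> = "moll e :: real^'n \<Rightarrow> real"
  have tf: "test_fun UNIV ?\<rho>" by (rule moll_test_fun[OF e])
  have fm [measurable]: "f \<in> borel_measurable borel" using f by (simp add: L2_def)
  have rm [measurable]: "?\<rho> \<in> borel_measurable borel" using smooth_borel test_fun_smooth tf by blast
  have cm [measurable]: "conv f ?\<rho> \<in> borel_measurable borel" by (rule smooth_borel[OF conv_smooth[OF f tf]])
  have ri: "integrable lborel ?\<rho>" by (rule test_fun_integrable[OF tf])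
  obtain B where B: "\<And>x. \<bar>?\<rho> x\<bar> \<le> B" using test_fun_bounded[OF tf] by blast
  have pt: "(conv f ?\<rho> x - f x)^2 \<le> (\<integral>h. (f (x - h) - f x)^2 * ?\<rho> h \<partial>lborel)"
    and ptint: "integrable lborel (\<lambda>h. (f (x - h) - f x)^2 * ?\<rho> h)" for x
  proof -
    have F: "L2 (\<lambda>h. f (x - h))" by (rule L2_reflect[OF f])
    have i1: "integrable lborel (\<lambda>h. f (x - h) * ?\<rho> h)"
      by (rule L2_prod_integrable[OF F L2_test_fun[OF tf]])
    have i2: "integrable lborel (\<lambda>h. f (x - h) * (?\<rho> h * f (x - h)))"
      by (rule L2_prod_integrable[OF F L2_bounded_mult[OF F rm B]])
    have c: "conv f ?\<rho> x = (\<integral>h. f (x - h) * ?\<rho> h \<partial>lborel)"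
      unfolding conv_def using lborel_integral_reflect[of "\<lambda>y. f y * ?\<rho> (x - y)" x] by simp
    \<comment> \<open>The second moment about an arbitrary level \<open>a\<close>. With
      \<open>a\<close> the mean it is nonnegative, which is Jensen's inequality; with
      \<open>a = f x\<close> it is the right-hand side wanted.\<close>
    have sq: "integrable lborel (\<lambda>h. (f (x - h) - a)^2 * ?\<rho> h)"
       and sqv: "(\<integral>h. (f (x - h) - a)^2 * ?\<rho> h \<partial>lborel) =
         (\<integral>h. f (x - h) * (?\<rho> h * f (x - h)) \<partial>lborel) - 2 * a * conv f ?\<rho> x + a^2" for a
    proof -
      have eq: "(\<lambda>h. (f (x - h) - a)^2 * ?\<rho> h) =
        (\<lambda>h. f (x - h) * (?\<rho> h * f (x - h)) - 2 * a * (f (x - h) * ?\<rho> h) + a^2 * ?\<rho> h)"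
        by (simp add: fun_eq_iff power2_eq_square algebra_simps)
      show "integrable lborel (\<lambda>h. (f (x - h) - a)^2 * ?\<rho> h)" unfolding eq
        by (intro Bochner_Integration.integrable_add Bochner_Integration.integrable_diff integrable_mult_right i1 i2 ri)
      show "(\<integral>h. (f (x - h) - a)^2 * ?\<rho> h \<partial>lborel) =
         (\<integral>h. f (x - h) * (?\<rho> h * f (x - h)) \<partial>lborel) - 2 * a * conv f ?\<rho> x + a^2"
        unfolding eq c using i1 i2 ri moll_integral[OF e, where 'n='n] by simp
    qed
    show "integrable lborel (\<lambda>h. (f (x - h) - f x)^2 * ?\<rho> h)" by (rule sq)
    have "0 \<le> (\<integral>h. (f (x - h) - conv f ?\<rho> x)^2 * ?\<rho> h \<partial>lborel)"
      by (intro Bochner_Integration.integral_nonneg mult_nonneg_nonneg moll_nonneg[OF e]) simp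
    then have "(conv f ?\<rho> x)^2 \<le> (\<integral>h. f (x - h) * (?\<rho> h * f (x - h)) \<partial>lborel)"
      unfolding sqv by (simp add: power2_eq_square)
    then show "(conv f ?\<rho> x - f x)^2 \<le> (\<integral>h. (f (x - h) - f x)^2 * ?\<rho> h \<partial>lborel)"
      unfolding sqv by (simp add: power2_eq_square algebra_simps)
  qed
  have nn: "(\<integral>\<^sup>+x. ennreal ((conv f ?\<rho> x - f x)^2) \<partial>lborel) \<le> ennreal \<eta>"
  proof -
    have "(\<integral>\<^sup>+x. ennreal ((conv f ?\<rho> x - f x)^2) \<partial>lborel) \<le>
      (\<integral>\<^sup>+x. (\<integral>\<^sup>+h. ennreal ((f (x - h) - f x)^2 * ?\<rho> h) \<partial>lborel) \<partial>lborel)"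
    proof (rule nn_integral_mono)
      fix x
      have "ennreal ((conv f ?\<rho> x - f x)^2) \<le> ennreal (\<integral>h. (f (x - h) - f x)^2 * ?\<rho> h \<partial>lborel)"
        by (rule ennreal_leI[OF pt])
      also have "\<dots> = (\<integral>\<^sup>+h. ennreal ((f (x - h) - f x)^2 * ?\<rho> h) \<partial>lborel)"
        by (rule nn_integral_eq_integral[symmetric, OF ptint]) (simp add: moll_nonneg[OF e])
      finally show "ennreal ((conv f ?\<rho> x - f x)^2) \<le> (\<integral>\<^sup>+h. ennreal ((f (x - h) - f x)^2 * ?\<rho> h) \<partial>lborel)" .
    qed
    also have "\<dots> = (\<integral>\<^sup>+h. (\<integral>\<^sup>+x. ennreal ((f (x - h) - f x)^2 * ?\<rho> h) \<partial>lborel) \<partial>lborel)"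
      by (rule lborel_pair.Fubini'[symmetric]) measurable
    also have "\<dots> \<le> (\<integral>\<^sup>+h. ennreal \<eta> * ennreal (?\<rho> h) \<partial>lborel)"
    proof (rule nn_integral_mono)
      fix h :: "real^'n"
      have "L2 (\<lambda>x. f (- h + x) - f x)" by (intro L2_diff L2_translate f)
      then have i: "integrable lborel (\<lambda>x. (f (- h + x) - f x)^2)" by (rule L2_integrable)
      have "(\<integral>\<^sup>+x. ennreal ((f (x - h) - f x)^2 * ?\<rho> h) \<partial>lborel) = (\<integral>\<^sup>+x. ennreal ((f (- h + x) - f x)^2) * ennreal (?\<rho> h) \<partial>lborel)"
        by (intro nn_integral_cong) (simp add: ennreal_mult moll_nonneg[OF e])
      also have "\<dots> = (\<integral>\<^sup>+x. ennreal ((f (- h + x) - f x)^2) \<partial>lborel) * ennreal (?\<rho> h)"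
        by (rule nn_integral_multc) simp
      also have "\<dots> = ennreal (\<integral>x. (f (- h + x) - f x)^2 \<partial>lborel) * ennreal (?\<rho> h)"
        by (subst nn_integral_eq_integral[OF i]) auto
      also have "\<dots> \<le> ennreal \<eta> * ennreal (?\<rho> h)"
      proof (cases "norm h \<le> e")
        case True
        then show ?thesis using mod[of "-h"] by (intro mult_right_mono ennreal_leI) auto
      next
        case False
        then show ?thesis using moll_support[OF e, of h] by simp
      qed
      finally show "(\<integral>\<^sup>+x. ennreal ((f (x - h) - f x)^2 * ?\<rho> h) \<partial>lborel) \<le> ennreal \<eta> * ennreal (?\<rho> h)" .
    qed
    also have "\<dots> = ennreal \<eta> * (\<integral>\<^sup>+h. ennreal (?\<rho> h) \<partial>lborel)" by (rule nn_integral_cmult) simp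
    also have "(\<integral>\<^sup>+h. ennreal (?\<rho> h) \<partial>lborel) = 1"
      using nn_integral_eq_integral[OF ri] moll_integral[OF e, where 'n='n] by (simp add: moll_nonneg[OF e])
    finally show ?thesis by simp
  qed
  have int: "integrable lborel (\<lambda>x. (conv f ?\<rho> x - f x)^2)"
    by (rule integrableI_bounded) (use nn in \<open>auto intro: le_less_trans\<close>)
  then have "L2 (\<lambda>x. conv f ?\<rho> x - f x)" by (simp add: L2_def)
  from L2_add[OF this f] show "L2 (conv f (moll e))" by simp
  show "(\<integral>x. (conv f (moll e) x - f x)^2 \<partial>lborel) \<le> \<eta>"
    using nn nn_integral_eq_integral[OF int] \<open>0 \<le> \<eta>\<close> by (simp add: ennreal_le_iff)
qed

abbreviation "seps k \<equiv> 1 / real (Suc k)"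

lemma L2lim_conv_moll:
  fixes f :: "real^'n::finite \<Rightarrow> real"
  assumes f: "L2 f"
  shows "L2lim (\<lambda>k. conv f (moll (seps k))) f"
proof -
  let ?\<phi> = "\<lambda>h. \<integral>x. (f (h + x) - f x)^2 \<partial>lborel"
  have "(?\<phi> \<longlongrightarrow> 0) (at 0)"
    unfolding tendsto_at_iff_sequentially
    using L2_translate_continuous[OF f] by (auto simp: comp_def)
  have mod: "\<exists>N. \<forall>k\<ge>N. \<forall>h. norm h \<le> seps k \<longrightarrow> ?\<phi> h \<le> \<eta>" if "0 < \<eta>" for \<eta>
  proof -
    from order_tendstoD(2)[OF \<open>(?\<phi> \<longlongrightarrow> 0) (at 0)\<close> that]
    obtain d where d: "0 < d" "\<And>h. h \<noteq> 0 \<Longrightarrow> norm h < d \<Longrightarrow> ?\<phi> h < \<eta>"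
      by (auto simp: eventually_at)
    obtain N where N: "seps N < d" using \<open>0 < d\<close> nat_approx_posE by blast
    have "?\<phi> h \<le> \<eta>" if "k \<ge> N" "norm h \<le> seps k" for k h
    proof (cases "h = 0")
      case False
      have "seps k \<le> seps N" using that(1) by (simp add: frac_le)
      then have "norm h < d" using that(2) N by linarith
      then show ?thesis using d(2) False by force
    qed (use \<open>0 < \<eta>\<close> in simp)
    then show ?thesis by blast
  qed
  \<comment> \<open>A crude modulus valid for every translation, which is enough to put each
    mollification into \<open>L2\<close>.\<close>
  have bound: "?\<phi> h \<le> 4 * (\<integral>x. (f x)^2 \<partial>lborel)" for h
  proof -
    have "?\<phi> h = (\<integral>x. (f (h + x) + - f x)^2 \<partial>lborel)" by simp
    also have "\<dots> \<le> 2 * (\<integral>x. (f (h + x))^2 \<partial>lborel) + 2 * (\<integral>x. (- f x)^2 \<partial>lborel)"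
      by (intro L2_add_bound L2_translate L2_minus f)
    also have "(\<integral>x. (f (h + x))^2 \<partial>lborel) = (\<integral>x. (f x)^2 \<partial>lborel)" by (rule lborel_integral_translate)
    finally show ?thesis by simp
  qed
  have L: "L2 (conv f (moll (seps k)))" for k
    by (rule conv_moll_L2_bound(1)[OF f _ _ bound]) auto
  have "(\<lambda>k. \<integral>x. (conv f (moll (seps k)) x - f x)^2 \<partial>lborel) \<longlonglongrightarrow> 0"
  proof (rule LIMSEQ_I)
    fix r :: real assume "0 < r"
    obtain N where N: "\<And>k h. k \<ge> N \<Longrightarrow> norm h \<le> seps k \<Longrightarrow> ?\<phi> h \<le> r/2"
      using mod[of "r/2"] \<open>0 < r\<close> by auto
    have "(\<integral>x. (conv f (moll (seps k)) x - f x)^2 \<partial>lborel) \<le> r/2" if "k \<ge> N" for k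
      by (rule conv_moll_L2_bound(2)[OF f]) (use N[OF that] \<open>0 < r\<close> in auto)
    then show "\<exists>N. \<forall>k\<ge>N. norm ((\<integral>x. (conv f (moll (seps k)) x - f x)^2 \<partial>lborel) - 0) < r"
      using \<open>0 < r\<close> by (intro exI[of _ N]) force
  qed
  with f L show ?thesis by (simp add: L2lim_def)
qed

lemma conv_moll_support:
  assumes "0 < e" "\<And>y. norm (x - y) \<le> e \<Longrightarrow> f y = 0"
  shows "conv f (moll e) x = 0"
proof -
  have "f y * moll e (x - y) = 0" for y
    using assms moll_support[OF assms(1), of "x - y"] by (cases "norm (x - y) \<le> e") auto
  then have "(\<lambda>y. f y * moll e (x - y)) = (\<lambda>y. 0)" by (rule ext)
  then show ?thesis by (simp only: conv_def) simp
qed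

text \<open>The factor 4 arises from mollifying at scale (r - \<rho>)/4, the sum bounds the gradient
  by its l1 norm, and the summand 1 keeps the constant positive.\<close>

definition cutoff_const :: "'n::finite itself \<Rightarrow> real" where
  "cutoff_const _ = 1 + 4 * (\<Sum>i\<in>(UNIV::'n set). real CARD('n) *
     (\<integral>x. \<bar>pd i bump (x::real^'n)\<bar> \<partial>lborel) / (\<integral>x. bump (x::real^'n) \<partial>lborel))"

lemma cutoff_const_pos: "0 < cutoff_const TYPE('n::finite)"
  unfolding cutoff_const_def using bump_integral_pos[where 'n='n]
  by (intro add_pos_nonneg mult_nonneg_nonneg sum_nonneg divide_nonneg_nonneg) auto

text \<open>The indicator of the ball of middle radius is mollified at a quarter of the gap, which
  leaves room on both sides. The gradient falls on the kernel, whose derivative has L1 norm of order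
  one over the scale.\<close>

lemma cutoff_exists:
  fixes c :: "real^'n::finite"
  assumes "0 < \<rho>" "\<rho> < r"
  obtains \<zeta> where "test_fun (ball c r) \<zeta>" "\<And>x. 0 \<le> \<zeta> x" "\<And>x. \<zeta> x \<le> 1"
    "\<And>x. x \<in> ball c \<rho> \<Longrightarrow> \<zeta> x = 1" "\<And>x. norm (grad \<zeta> x) \<le> cutoff_const TYPE('n) / (r - \<rho>)"
proof -
  define m where "m = (\<rho> + r) / 2"
  define e where "e = (r - \<rho>) / 4"
  have e: "0 < e" using assms by (simp add: e_def)
  let ?\<rho> = "moll e :: real^'n \<Rightarrow> real" and ?I = "indicator (cball c m) :: real^'n \<Rightarrow> real"
  define \<zeta> where "\<zeta> = conv ?I ?\<rho>"
  have I: "L2 ?I" by (rule L2_indicator) auto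
  have tf: "test_fun UNIV ?\<rho>" by (rule moll_test_fun[OF e])
  have ri: "integrable lborel ?\<rho>" by (rule test_fun_integrable[OF tf])
  have rx: "integrable lborel (\<lambda>y. ?\<rho> (x - y))" for x by (rule lborel_integrable_reflect[OF ri])
  have r1: "(\<integral>y. ?\<rho> (x - y) \<partial>lborel) = 1" for x
    using lborel_integral_reflect[of ?\<rho> x] moll_integral[OF e, where 'n='n] by simp
  have ci: "integrable lborel (\<lambda>y. ?I y * ?\<rho> (x - y))" for x by (rule conv_integrable[OF I tf])
  have n: "0 \<le> \<zeta> x" for x
    unfolding \<zeta>_def conv_def by (intro Bochner_Integration.integral_nonneg mult_nonneg_nonneg moll_nonneg[OF e]) simp
  have l: "\<zeta> x \<le> 1" for x
  proof -
    have "\<zeta> x \<le> (\<integral>y. ?\<rho> (x - y) \<partial>lborel)" unfolding \<zeta>_def conv_def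
      by (rule integral_mono[OF ci rx]) (auto simp: indicator_def moll_nonneg[OF e])
    then show ?thesis using r1 by simp
  qed
  have one: "\<zeta> x = 1" if "x \<in> ball c \<rho>" for x
  proof -
    have "?I y * ?\<rho> (x - y) = ?\<rho> (x - y)" for y
    proof (cases "norm (x - y) \<le> e")
      case True
      have "dist c y \<le> dist c x + dist x y" by (rule dist_triangle)
      also have "\<dots> \<le> m" using True that e by (auto simp: dist_norm m_def e_def field_simps)
      finally show ?thesis by (simp add: indicator_def)
    next
      case False
      then show ?thesis by (simp add: moll_support[OF e])
    qed
    then have "(\<lambda>y. ?I y * ?\<rho> (x - y)) = (\<lambda>y. ?\<rho> (x - y))" by (rule ext)
    then show ?thesis using r1[of x] by (simp only: \<zeta>_def conv_def)
  qed
  have sm: "smooth_fun \<zeta>" unfolding \<zeta>_def by (rule conv_smooth[OF I tf])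
  have t: "test_fun (ball c r) \<zeta>"
  proof (rule test_funI[OF sm compact_cball[of c "m + e"]])
    show "cball c (m + e) \<subseteq> ball c r" using assms by (auto simp: m_def e_def field_simps)
    show "\<zeta> x = 0" if "x \<notin> cball c (m + e)" for x
      unfolding \<zeta>_def
    proof (rule conv_moll_support[OF e])
      fix y assume "norm (x - y) \<le> e"
      moreover have "dist c x \<le> dist c y + dist x y" by (metis dist_triangle2)
      ultimately have "y \<notin> cball c m" using that by (auto simp: dist_norm)
      then show "?I y = 0" by simp
    qed
  qed
  have g: "norm (grad \<zeta> x) \<le> cutoff_const TYPE('n) / (r - \<rho>)" for x
  proof -
    have pdb: "\<bar>pd i \<zeta> x\<bar> \<le> (real CARD('n) * (\<integral>x. \<bar>pd i bump (x::real^'n)\<bar> \<partial>lborel) / (\<integral>x. bump (x::real^'n) \<partial>lborel)) / e" for i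
    proof -
      have pt: "test_fun UNIV (pd i ?\<rho>)" by (rule test_fun_pd[OF tf])
      have "\<bar>pd i \<zeta> x\<bar> = \<bar>\<integral>y. ?I y * pd i ?\<rho> (x - y) \<partial>lborel\<bar>"
        unfolding \<zeta>_def by (simp add: conv_pd[OF I tf] conv_def)
      also have "\<dots> \<le> (\<integral>y. \<bar>?I y * pd i ?\<rho> (x - y)\<bar> \<partial>lborel)"
        using integral_norm_bound[of lborel "\<lambda>y. ?I y * pd i ?\<rho> (x - y)"] by simp
      also have "\<dots> \<le> (\<integral>y. \<bar>pd i ?\<rho> (x - y)\<bar> \<partial>lborel)"
      proof (rule integral_mono)
        show "integrable lborel (\<lambda>y. \<bar>pd i ?\<rho> (x - y)\<bar>)"
          by (rule integrable_abs[OF lborel_integrable_reflect[OF test_fun_integrable[OF pt]]])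
        show "integrable lborel (\<lambda>y. \<bar>?I y * pd i ?\<rho> (x - y)\<bar>)"
          by (rule integrable_abs[OF conv_integrable[OF I pt]])
      qed (auto simp: indicator_def)
      also have "\<dots> = (\<integral>y. \<bar>pd i ?\<rho> y\<bar> \<partial>lborel)"
        by (rule lborel_integral_reflect[of "\<lambda>y. \<bar>pd i ?\<rho> y\<bar>"])
      also note moll_pd_integral[OF e]
      finally show ?thesis .
    qed
    have "norm (grad \<zeta> x) \<le> (\<Sum>i\<in>UNIV. \<bar>grad \<zeta> x $ i\<bar>)" by (rule norm_le_l1_cart)
    also have "\<dots> \<le> (\<Sum>i\<in>UNIV. (real CARD('n) * (\<integral>x. \<bar>pd i bump (x::real^'n)\<bar> \<partial>lborel) / (\<integral>x. bump (x::real^'n) \<partial>lborel)) / e)"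
      by (rule sum_mono) (use pdb in \<open>simp add: grad_def\<close>)
    also have "\<dots> = (\<Sum>i\<in>UNIV. real CARD('n) * (\<integral>x. \<bar>pd i bump (x::real^'n)\<bar> \<partial>lborel) / (\<integral>x. bump (x::real^'n) \<partial>lborel)) / e"
      by (rule sum_divide_distrib[symmetric])
    also have "\<dots> = (cutoff_const TYPE('n) - 1) / (r - \<rho>)"
      unfolding cutoff_const_def e_def by (simp only: add_diff_cancel_left' divide_divide_eq_right mult.commute)
    also have "\<dots> \<le> cutoff_const TYPE('n) / (r - \<rho>)" using assms by (simp add: divide_right_mono)
    finally show ?thesis .
  qed
  show ?thesis using that[OF t n l one g] by blast
qed

section \<open>Weak derivatives on the whole space and on open sets\<close>

text \<open>Functions and gradients live on the whole space and only the test functions are confined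
  to \<open>U\<close>. Shrinking \<open>U\<close> is then free, and no restricted measure
  appears.\<close>

definition LW :: "(real^'n::finite) set \<Rightarrow> (real^'n \<Rightarrow> real) \<Rightarrow> (real^'n \<Rightarrow> real^'n) \<Rightarrow> bool" where
  "LW U f G \<longleftrightarrow> L2 f \<and> (\<forall>i. L2 (\<lambda>x. G x $ i)) \<and>
     (\<forall>\<phi>. test_fun U \<phi> \<longrightarrow> (\<forall>i. (\<integral>x. f x * pd i \<phi> x \<partial>lborel) = - (\<integral>x. G x $ i * \<phi> x \<partial>lborel)))"

lemma LW_D:
  assumes "LW U f G"
  shows "L2 f" "L2 (\<lambda>x. G x $ i)"
    "test_fun U \<phi> \<Longrightarrow> (\<integral>x. f x * pd i \<phi> x \<partial>lborel) = - (\<integral>x. G x $ i * \<phi> x \<partial>lborel)"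
  using assms by (auto simp: LW_def)

lemma LW_mono: "LW U f G \<Longrightarrow> V \<subseteq> U \<Longrightarrow> LW V f G"
  unfolding LW_def using test_fun_mono by blast

lemma LW_minus:
  assumes "LW U f G" shows "LW U (\<lambda>x. - f x) (\<lambda>x. - G x)"
  using assms by (auto simp: LW_def intro!: L2_minus)

lemma LW_add:
  assumes f: "LW U f G" and h: "LW U h H"
  shows "LW U (\<lambda>x. f x + h x) (\<lambda>x. G x + H x)"
  unfolding LW_def
proof (intro conjI allI impI)
  note Lf = LW_D[OF f] and Lh = LW_D[OF h]
  show "L2 (\<lambda>x. f x + h x)" by (intro L2_add Lf Lh)
  show "L2 (\<lambda>x. (G x + H x) $ i)" for i using L2_add[OF Lf(2) Lh(2)] by simp
  fix \<phi> i assume t: "test_fun U \<phi>"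
  note L = L2_test_fun[OF t] L2_test_fun[OF test_fun_pd[OF t, of i]]
  have "(\<integral>x. (f x + h x) * pd i \<phi> x \<partial>lborel) = (\<integral>x. f x * pd i \<phi> x \<partial>lborel) + (\<integral>x. h x * pd i \<phi> x \<partial>lborel)"
    unfolding distrib_right by (intro Bochner_Integration.integral_add L2_prod_integrable Lf Lh L)
  also have "\<dots> = - ((\<integral>x. G x $ i * \<phi> x \<partial>lborel) + (\<integral>x. H x $ i * \<phi> x \<partial>lborel))"
    using Lf(3)[OF t] Lh(3)[OF t] by simp
  also have "(\<integral>x. G x $ i * \<phi> x \<partial>lborel) + (\<integral>x. H x $ i * \<phi> x \<partial>lborel) = (\<integral>x. (G x + H x) $ i * \<phi> x \<partial>lborel)"
    unfolding vector_add_component distrib_right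
    by (intro Bochner_Integration.integral_add[symmetric] L2_prod_integrable Lf Lh L)
  finally show "(\<integral>x. (f x + h x) * pd i \<phi> x \<partial>lborel) = - (\<integral>x. (G x + H x) $ i * \<phi> x \<partial>lborel)" .
qed

lemma smooth_pd_mult:
  "smooth_fun f \<Longrightarrow> smooth_fun g \<Longrightarrow> pd i (\<lambda>x. f x * g x) x = f x * pd i g x + pd i f x * g x"
  by (intro pd_mult smooth_differentiable)

text \<open>The product of a test function with a cutoff supported in \<open>U\<close> is a test
  function on \<open>U\<close>; hence cutting off turns a local weak gradient into a global one, to
  which mollification applies.\<close>

lemma LW_mult:
  fixes f :: "real^'n::finite \<Rightarrow> real"
  assumes f: "LW U f G" and c: "test_fun U \<eta>"
  shows "LW UNIV (\<lambda>x. \<eta> x * f x) (\<lambda>x. \<eta> x *\<^sub>R G x + f x *\<^sub>R grad \<eta> x)"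
  unfolding LW_def
proof (intro conjI allI impI)
  note Lf = LW_D[OF f]
  obtain B where B: "\<And>x. \<bar>\<eta> x\<bar> \<le> B" using test_fun_bounded[OF c] by blast
  have sc: "smooth_fun \<eta>" by (rule test_fun_smooth[OF c])
  have Lc: "L2 h \<Longrightarrow> L2 (\<lambda>x. \<eta> x * h x)" for h
    by (rule L2_bounded_mult[OF _ smooth_borel[OF sc] B])
  have Lp: "L2 h \<Longrightarrow> L2 (\<lambda>x. pd i \<eta> x * h x)" for h i
  proof -
    assume "L2 h"
    obtain B' where "\<And>x. \<bar>pd i \<eta> x\<bar> \<le> B'" using test_fun_bounded[OF test_fun_pd[OF c]] by blast
    with \<open>L2 h\<close> show ?thesis by (intro L2_bounded_mult smooth_borel smooth_pd sc)
  qed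
  show "L2 (\<lambda>x. \<eta> x * f x)" by (rule Lc[OF Lf(1)])
  show "L2 (\<lambda>x. (\<eta> x *\<^sub>R G x + f x *\<^sub>R grad \<eta> x) $ i)" for i
    using L2_add[OF Lc[OF Lf(2)] Lp[OF Lf(1)]] by (simp add: grad_def mult.commute)
  fix \<phi> :: "real^'n \<Rightarrow> real" and i assume t: "test_fun UNIV \<phi>"
  have s: "smooth_fun \<phi>" by (rule test_fun_smooth[OF t])
  have tc: "test_fun U (\<lambda>x. \<eta> x * \<phi> x)" by (rule test_fun_mult[OF c s])
  note L = L2_test_fun[OF t] L2_test_fun[OF test_fun_pd[OF t, of i]]
  have "(\<integral>x. f x * (\<eta> x * pd i \<phi> x + pd i \<eta> x * \<phi> x) \<partial>lborel) = - (\<integral>x. G x $ i * (\<eta> x * \<phi> x) \<partial>lborel)"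
    using Lf(3)[OF tc, of i] by (simp add: smooth_pd_mult[OF sc s])
  moreover have "(\<integral>x. f x * (\<eta> x * pd i \<phi> x + pd i \<eta> x * \<phi> x) \<partial>lborel) =
    (\<integral>x. (\<eta> x * f x) * pd i \<phi> x \<partial>lborel) + (\<integral>x. (pd i \<eta> x * f x) * \<phi> x \<partial>lborel)"
  proof -
    have "(\<integral>x. f x * (\<eta> x * pd i \<phi> x + pd i \<eta> x * \<phi> x) \<partial>lborel) =
      (\<integral>x. (\<eta> x * f x) * pd i \<phi> x + (pd i \<eta> x * f x) * \<phi> x \<partial>lborel)"
      by (rule Bochner_Integration.integral_cong) (simp_all add: algebra_simps)
    also have "\<dots> = (\<integral>x. (\<eta> x * f x) * pd i \<phi> x \<partial>lborel) + (\<integral>x. (pd i \<eta> x * f x) * \<phi> x \<partial>lborel)"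
      by (intro Bochner_Integration.integral_add L2_prod_integrable Lc Lp Lf L)
    finally show ?thesis .
  qed
  moreover have "(\<integral>x. (\<eta> x *\<^sub>R G x + f x *\<^sub>R grad \<eta> x) $ i * \<phi> x \<partial>lborel) =
    (\<integral>x. G x $ i * (\<eta> x * \<phi> x) \<partial>lborel) + (\<integral>x. (pd i \<eta> x * f x) * \<phi> x \<partial>lborel)"
  proof -
    have "(\<integral>x. (\<eta> x *\<^sub>R G x + f x *\<^sub>R grad \<eta> x) $ i * \<phi> x \<partial>lborel) =
      (\<integral>x. G x $ i * (\<eta> x * \<phi> x) + (pd i \<eta> x * f x) * \<phi> x \<partial>lborel)"
      by (rule Bochner_Integration.integral_cong) (simp_all add: grad_def algebra_simps)
    also have "\<dots> = (\<integral>x. G x $ i * (\<eta> x * \<phi> x) \<partial>lborel) + (\<integral>x. (pd i \<eta> x * f x) * \<phi> x \<partial>lborel)"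
      by (intro Bochner_Integration.integral_add L2_prod_integrable Lp Lf L L2_test_fun[OF tc])
    finally show ?thesis .
  qed
  ultimately show "(\<integral>x. (\<eta> x * f x) * pd i \<phi> x \<partial>lborel) = - (\<integral>x. (\<eta> x *\<^sub>R G x + f x *\<^sub>R grad \<eta> x) $ i * \<phi> x \<partial>lborel)"
    by simp
qed

lemma LW_conv:
  fixes f :: "real^'n::finite \<Rightarrow> real"
  assumes f: "LW UNIV f G" and t: "test_fun UNIV \<psi>"
  shows "pd i (conv f \<psi>) = conv (\<lambda>y. G y $ i) \<psi>"
proof
  fix x
  have "pd i (conv f \<psi>) x = (\<integral>y. f y * pd i \<psi> (x - y) \<partial>lborel)"
    by (simp add: conv_pd[OF LW_D(1)[OF f] t] conv_def)
  also have "\<dots> = - (\<integral>y. f y * pd i (\<lambda>y. \<psi> (x - y)) y \<partial>lborel)"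
    by (simp add: test_fun_reflect(2)[OF t])
  also have "\<dots> = conv (\<lambda>y. G y $ i) \<psi> x"
    using LW_D(3)[OF f test_fun_reflect(1)[OF t, of x], of i] by (simp add: conv_def)
  finally show "pd i (conv f \<psi>) x = conv (\<lambda>y. G y $ i) \<psi> x" .
qed

section \<open>Uniqueness of weak gradients\<close>

lemma AE_local:
  fixes U :: "'a::euclidean_space set"
  assumes "\<And>x. x \<in> U \<Longrightarrow> \<exists>r>0. AE y in M. y \<in> ball x r \<longrightarrow> P y"
  shows "AE y in M. y \<in> U \<longrightarrow> P y"
proof -
  obtain r where r: "\<And>x. x \<in> U \<Longrightarrow> 0 < r x" "\<And>x. x \<in> U \<Longrightarrow> AE y in M. y \<in> ball x (r x) \<longrightarrow> P y"
    using assms by metis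
  obtain F where F: "F \<subseteq> (\<lambda>x. ball x (r x)) ` U" "countable F" "\<Union>F = \<Union>((\<lambda>x. ball x (r x)) ` U)"
    using Lindelof[of "(\<lambda>x. ball x (r x)) ` U"] by (metis (no_types, lifting) image_iff open_ball)
  have "AE y in M. y \<in> B \<longrightarrow> P y" if "B \<in> F" for B using that F(1) r(2) by auto
  then have "AE y in M. \<forall>B\<in>F. y \<in> B \<longrightarrow> P y" by (subst AE_ball_countable[OF F(2)]) blast
  moreover have "U \<subseteq> \<Union>F" using F(3) r(1) by (force intro: centre_in_ball[THEN iffD2])
  ultimately show ?thesis by (auto elim!: eventually_mono)
qed

lemma L2_zero_AE:
  assumes "L2 g" "(\<integral>x. (g x)^2 \<partial>lborel) \<le> 0"
  shows "AE x in lborel. g x = 0"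
proof -
  have "(\<integral>x. (g x)^2 \<partial>lborel) = 0" using assms(2) by (intro antisym) auto
  then show ?thesis using integral_nonneg_eq_0_iff_AE[OF L2_integrable[OF assms(1)]] by simp
qed

text \<open>For x near c and small scales the shifted mollifiers are test functions on
  \<open>U\<close>, so the mollifications of \<open>D\<close> vanish near c, while they converge to
  \<open>D\<close> in L2.\<close>

lemma fundamental_lemma:
  fixes D :: "real^'n::finite \<Rightarrow> real"
  assumes D: "L2 D" and U: "open U" and z: "\<And>\<phi>. test_fun U \<phi> \<Longrightarrow> (\<integral>x. D x * \<phi> x \<partial>lborel) = 0"
  shows "AE x in lborel. x \<in> U \<longrightarrow> D x = 0"
proof (rule AE_local)
  fix c assume "c \<in> U"
  then obtain r where r: "0 < r" "ball c r \<subseteq> U" using U open_contains_ball by blast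
  let ?B = "ball c (r/2)"
  have [measurable]: "D \<in> borel_measurable borel" using D by (simp add: L2_def)
  obtain N where N: "seps N < r/2" using nat_approx_posE[of "r/2"] r(1) by auto
  have cz: "conv D (moll (seps k)) x = 0" if "k \<ge> N" "x \<in> ?B" for k x
  proof -
    have "seps k \<le> seps N" using that(1) by (simp add: frac_le)
    then have k: "seps k < r/2" using N by linarith
    have e: "0 < seps k" by simp
    have t: "test_fun UNIV (\<lambda>y. moll (seps k) (x - y))"
      by (rule test_fun_reflect(1)[OF moll_test_fun[OF e]])
    have "test_fun U (\<lambda>y. moll (seps k) (x - y))"
    proof (rule test_funI[OF test_fun_smooth[OF t] compact_cball[of x "seps k"]])
      show "cball x (seps k) \<subseteq> U"
      proof
        fix y assume "y \<in> cball x (seps k)"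
        then have "dist c y < r" using that(2) k dist_triangle[of c y x] by auto
        then show "y \<in> U" using r(2) by auto
      qed
      show "moll (seps k) (x - y) = 0" if "y \<notin> cball x (seps k)" for y
        by (rule moll_support[OF e]) (use that in \<open>auto simp: dist_norm\<close>)
    qed
    from z[OF this] show ?thesis by (simp add: conv_def)
  qed
  have lim: "L2lim (\<lambda>k. conv D (moll (seps k))) D" by (rule L2lim_conv_moll[OF D])
  have DB: "L2 (\<lambda>x. indicator ?B x * D x)"
    by (rule L2_bounded_mult[OF D, where B=1]) (auto simp: indicator_def)
  have "(\<integral>x. (indicator ?B x * D x)^2 \<partial>lborel) \<le> 0"
  proof (rule LIMSEQ_le_const)
    show "(\<lambda>k. \<integral>x. (conv D (moll (seps k)) x - D x)^2 \<partial>lborel) \<longlonglongrightarrow> 0" using lim by (simp add: L2lim_def)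
    have "(\<integral>x. (indicator ?B x * D x)^2 \<partial>lborel) \<le> (\<integral>x. (conv D (moll (seps k)) x - D x)^2 \<partial>lborel)" if "k \<ge> N" for k
    proof (rule integral_mono)
      show "integrable lborel (\<lambda>x. (conv D (moll (seps k)) x - D x)^2)"
        using lim by (intro L2_integrable L2_diff) (auto simp: L2lim_def)
      show "(indicator ?B x * D x)^2 \<le> (conv D (moll (seps k)) x - D x)^2" for x
        using cz[OF that, of x] by (cases "x \<in> ?B") auto
    qed (rule L2_integrable[OF DB])
    then show "\<exists>N. \<forall>k\<ge>N. (\<integral>x. (indicator ?B x * D x)^2 \<partial>lborel) \<le> (\<integral>x. (conv D (moll (seps k)) x - D x)^2 \<partial>lborel)"
      by blast
  qed
  from L2_zero_AE[OF DB this] have "AE x in lborel. x \<in> ?B \<longrightarrow> D x = 0"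
    by (auto elim!: eventually_mono)
  then show "\<exists>r>0. AE x in lborel. x \<in> ball c r \<longrightarrow> D x = 0" using r(1) by (intro exI[of _ "r/2"]) auto
qed

lemma LW_unique:
  assumes G: "LW U f G" and G': "LW U f G'" and U: "open U"
  shows "AE x in lborel. x \<in> U \<longrightarrow> G x = G' x"
proof -
  have "AE x in lborel. x \<in> U \<longrightarrow> G x $ i - G' x $ i = 0" for i
  proof (rule fundamental_lemma[OF _ U])
    show "L2 (\<lambda>x. G x $ i - G' x $ i)" by (intro L2_diff LW_D(2)[OF G] LW_D(2)[OF G'])
    fix \<phi> assume t: "test_fun U \<phi>"
    have "(\<integral>x. (G x $ i - G' x $ i) * \<phi> x \<partial>lborel) = (\<integral>x. G x $ i * \<phi> x \<partial>lborel) - (\<integral>x. G' x $ i * \<phi> x \<partial>lborel)"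
      unfolding left_diff_distrib
      by (intro Bochner_Integration.integral_diff L2_prod_integrable LW_D(2)[OF G] LW_D(2)[OF G'] L2_test_fun[OF t])
    then show "(\<integral>x. (G x $ i - G' x $ i) * \<phi> x \<partial>lborel) = 0"
      using LW_D(3)[OF G t, of i] LW_D(3)[OF G' t, of i] by simp
  qed
  then have "AE x in lborel. \<forall>i\<in>UNIV. x \<in> U \<longrightarrow> G x $ i - G' x $ i = 0"
    by (intro AE_finite_allI) auto
  then show ?thesis by (auto elim!: eventually_mono simp: vec_eq_iff)
qed

section \<open>Integration by parts, chain rule and truncation\<close>

lemma integral_pd_eq_0':
  fixes f :: "real^'n::finite \<Rightarrow> real"
  assumes diff: "\<And>x. f differentiable at x" and cont: "\<And>i. continuous_on UNIV (pd i f)"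
    and supp: "\<And>x. x \<notin> K \<Longrightarrow> f x = 0" and "compact K"
  shows "(\<integral>x. pd i f x \<partial>lborel) = 0" "integrable lborel (pd i f)"
proof -
  have tK: "tsupport f \<subseteq> K" by (rule tsupport_subsetI) (use assms compact_imp_closed in auto)
  have "\<forall>i. \<exists>B. \<forall>x. \<bar>pd i f x\<bar> \<le> B"
  proof
    fix i
    have "compact (pd i f ` K)" by (rule compact_continuous_image[OF continuous_on_subset[OF cont] \<open>compact K\<close>]) simp
    then obtain B where B: "\<And>y. y \<in> pd i f ` K \<Longrightarrow> norm y \<le> B"
      using compact_imp_bounded bounded_iff by metis
    have "\<bar>pd i f x\<bar> \<le> max B 0" for x
    proof (cases "x \<in> K")
      case True then show ?thesis using B[of "pd i f x"] by auto
    next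
      case False
      then have "x \<notin> tsupport f" using tK by blast
      then show ?thesis by (simp add: pd_zero_outside)
    qed
    then show "\<exists>B. \<forall>x. \<bar>pd i f x\<bar> \<le> B" by blast
  qed
  then obtain B where B: "\<And>i x. \<bar>pd i f x\<bar> \<le> B i" by metis
  have "norm (grad f x) \<le> (\<Sum>i\<in>UNIV. B i)" for x
  proof -
    have "norm (grad f x) \<le> (\<Sum>i\<in>UNIV. \<bar>grad f x $ i\<bar>)" by (rule norm_le_l1_cart)
    also have "\<dots> \<le> (\<Sum>i\<in>UNIV. B i)" by (rule sum_mono) (simp add: grad_def B)
    finally show ?thesis .
  qed
  then have "\<bar>f x - f y\<bar> \<le> (\<Sum>i\<in>UNIV. B i) * norm (x - y)" for x y
    by (rule grad_bound_lipschitz[OF diff])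
  from integral_pd_eq_0[OF this diff supp compact_imp_bounded[OF \<open>compact K\<close>]]
  show "(\<integral>x. pd i f x \<partial>lborel) = 0" "integrable lborel (pd i f)" by auto
qed

text \<open>Only C1 regularity is asked of g, because the chain rule applies it to the composition
  of a smooth function with an outer function whose derivative is merely Lipschitz.\<close>

lemma integration_by_parts:
  fixes g \<phi> :: "real^'n::finite \<Rightarrow> real"
  assumes diff: "\<And>x. g differentiable at x" and cont: "\<And>i. continuous_on UNIV (pd i g)"
    and t: "test_fun U \<phi>"
  shows "(\<integral>x. g x * pd i \<phi> x \<partial>lborel) = - (\<integral>x. pd i g x * \<phi> x \<partial>lborel)"
proof -
  have s: "smooth_fun \<phi>" and K: "compact (tsupport \<phi>)" using t by (auto simp: test_fun_def)
  have cg: "continuous_on UNIV g"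
    using diff differentiable_imp_continuous_within continuous_at_imp_continuous_on by blast
  have bm [measurable]: "g \<in> borel_measurable borel" "pd i g \<in> borel_measurable borel"
    "\<phi> \<in> borel_measurable borel" "pd i \<phi> \<in> borel_measurable borel"
    using cg cont smooth_borel[OF s] smooth_borel[OF smooth_pd[OF s]] by (auto intro: borel_measurable_continuous_onI)
  have p: "pd j (\<lambda>x. g x * \<phi> x) x = g x * pd j \<phi> x + pd j g x * \<phi> x" for j x
    by (rule pd_mult[OF diff smooth_differentiable[OF s]])
  have c: "continuous_on UNIV (pd j (\<lambda>x. g x * \<phi> x))" for j
    unfolding p[abs_def] by (intro continuous_intros cg cont smooth_continuous s smooth_pd)
  have z: "x \<notin> tsupport \<phi> \<Longrightarrow> g x * \<phi> x = 0" for x by (simp add: zero_outside_tsupport)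
  have d: "(\<lambda>x. g x * \<phi> x) differentiable at x" for x
    by (intro differentiable_mult diff smooth_differentiable s)
  have int: "integrable lborel (\<lambda>x. h x * \<psi> x)" if h: "continuous_on UNIV h" and \<psi>: "test_fun U \<psi>" for h \<psi> :: "real^'n \<Rightarrow> real"
  proof -
    have cs: "continuous_on UNIV (\<lambda>x. h x * \<psi> x)"
      by (intro continuous_intros h smooth_continuous test_fun_smooth[OF \<psi>])
    have K: "compact (tsupport \<psi>)" using \<psi> by (simp add: test_fun_def)
    have "compact ((\<lambda>x. h x * \<psi> x) ` tsupport \<psi>)"
      by (rule compact_continuous_image[OF continuous_on_subset[OF cs] K]) simp
    then obtain B where B: "\<And>y. y \<in> (\<lambda>x. h x * \<psi> x) ` tsupport \<psi> \<Longrightarrow> norm y \<le> B"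
      using compact_imp_bounded bounded_iff by metis
    show ?thesis
    proof (rule integrable_bounded_support[where K="tsupport \<psi>" and B="max B 0"])
      show "\<bar>h x * \<psi> x\<bar> \<le> max B 0" for x
        using B[of "h x * \<psi> x"] by (cases "x \<in> tsupport \<psi>") (auto simp: zero_outside_tsupport)
    qed (auto simp: borel_measurable_continuous_onI[OF cs] zero_outside_tsupport compact_imp_bounded[OF K])
  qed
  have "0 = (\<integral>x. g x * pd i \<phi> x + pd i g x * \<phi> x \<partial>lborel)"
    using integral_pd_eq_0'(1)[OF d c z K, of i] by (simp add: p)
  also have "\<dots> = (\<integral>x. g x * pd i \<phi> x \<partial>lborel) + (\<integral>x. pd i g x * \<phi> x \<partial>lborel)"
    by (intro Bochner_Integration.integral_add int cg cont t test_fun_pd)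
  finally show ?thesis by simp
qed

lemma LW_test_fun:
  fixes \<psi> :: "real^'n::finite \<Rightarrow> real"
  assumes "test_fun U \<psi>" shows "LW UNIV \<psi> (grad \<psi>)"
  unfolding LW_def
proof (intro conjI allI impI)
  show "L2 \<psi>" "L2 (\<lambda>x. grad \<psi> x $ i)" for i
    using L2_test_fun[OF assms] L2_test_fun[OF test_fun_pd[OF assms]] by (auto simp: grad_def)
  fix \<phi> :: "real^'n \<Rightarrow> real" and i assume "test_fun UNIV \<phi>"
  from integration_by_parts[OF _ _ this, of \<psi> i]
  show "(\<integral>x. \<psi> x * pd i \<phi> x \<partial>lborel) = - (\<integral>x. grad \<psi> x $ i * \<phi> x \<partial>lborel)"
    using test_fun_smooth[OF assms] by (simp add: smooth_differentiable smooth_continuous smooth_pd grad_def)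
qed

lemma LW_limit:
  assumes L: "\<And>k. LW U (F k) (H k)" and f: "L2lim F f" and g: "\<And>i. L2lim (\<lambda>k x. H k x $ i) (\<lambda>x. G x $ i)"
  shows "LW U f G"
  unfolding LW_def
proof (intro conjI allI impI)
  show "L2 f" "L2 (\<lambda>x. G x $ i)" for i using f g[of i] by (auto simp: L2lim_def)
  fix \<phi> i assume t: "test_fun U \<phi>"
  have "(\<lambda>k. \<integral>x. F k x * pd i \<phi> x \<partial>lborel) \<longlonglongrightarrow> (\<integral>x. f x * pd i \<phi> x \<partial>lborel)"
    by (rule L2lim_prod[OF f L2_test_fun[OF test_fun_pd[OF t]]])
  moreover have "(\<lambda>k. - (\<integral>x. H k x $ i * \<phi> x \<partial>lborel)) \<longlonglongrightarrow> - (\<integral>x. G x $ i * \<phi> x \<partial>lborel)"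
    by (intro tendsto_minus L2lim_prod[OF g L2_test_fun[OF t]])
  ultimately show "(\<integral>x. f x * pd i \<phi> x \<partial>lborel) = - (\<integral>x. G x $ i * \<phi> x \<partial>lborel)"
    using LW_D(3)[OF L t, of _ i] by (simp add: LIMSEQ_unique)
qed

lemma L2lim_dominated:
  assumes m: "\<And>k. F k \<in> borel_measurable borel" and g: "L2 g"
    and b: "\<And>k x. \<bar>F k x\<bar> \<le> \<bar>g x\<bar>" and l: "\<And>x. (\<lambda>k. F k x) \<longlonglongrightarrow> f x"
  shows "L2lim F f"
proof -
  have fm [measurable]: "f \<in> borel_measurable borel" by (rule borel_measurable_LIMSEQ_real[OF l m])
  note m[measurable]
  have fb: "\<bar>f x\<bar> \<le> \<bar>g x\<bar>" for x
    by (rule LIMSEQ_le_const2[OF tendsto_rabs[OF l]]) (use b in auto)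
  have L: "L2 (F k)" "L2 f" for k by (rule L2_mono[OF g]; simp add: m fm b fb)+
  have "(\<lambda>k. \<integral>x. (F k x - f x)^2 \<partial>lborel) \<longlonglongrightarrow> integral\<^sup>L lborel (\<lambda>x::'a. 0::real)"
  proof (rule integral_dominated_convergence[where w="\<lambda>x. 4 * (g x)^2"])
    show "integrable lborel (\<lambda>x. 4 * (g x)^2)" using L2_integrable[OF g] by simp
    have "(\<lambda>k. (F k x - f x)^2) \<longlonglongrightarrow> (f x - f x)^2" for x by (intro tendsto_intros l)
    then show "AE x in lborel. (\<lambda>k. (F k x - f x)^2) \<longlonglongrightarrow> 0" by simp
    have "(F k x - f x)^2 \<le> 4 * (g x)^2" for k x
    proof -
      have "\<bar>F k x - f x\<bar> \<le> \<bar>2 * g x\<bar>" using b[of k x] fb[of x] by (simp add: abs_mult)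
      then have "(F k x - f x)^2 \<le> (2 * g x)^2" by (simp add: abs_le_square_iff)
      then show ?thesis by (simp add: power_mult_distrib)
    qed
    then show "AE x in lborel. norm ((F k x - f x)^2) \<le> 4 * (g x)^2" for k by simp
  qed auto
  with L show ?thesis by (simp add: L2lim_def)
qed

lemma LW_moll:
  assumes f: "LW UNIV f G"
  defines "F \<equiv> \<lambda>k. conv f (moll (seps k))"
  shows "smooth_fun (F k)" "L2lim F f" "L2lim (\<lambda>k. pd i (F k)) (\<lambda>x. G x $ i)"
proof -
  have t: "test_fun UNIV (moll (seps k) :: real^'a \<Rightarrow> real)" for k by (rule moll_test_fun) simp
  show "smooth_fun (F k)" unfolding F_def by (rule conv_smooth[OF LW_D(1)[OF f] t])
  show "L2lim F f" unfolding F_def by (rule L2lim_conv_moll[OF LW_D(1)[OF f]])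
  show "L2lim (\<lambda>k. pd i (F k)) (\<lambda>x. G x $ i)"
    unfolding F_def LW_conv[OF f t] by (rule L2lim_conv_moll[OF LW_D(2)[OF f]])
qed

lemma real_lipschitz_from_deriv:
  fixes F :: "real \<Rightarrow> real"
  assumes "\<And>t. (F has_real_derivative F' t) (at t)" "\<And>t. \<bar>F' t\<bar> \<le> B"
  shows "\<bar>F s - F t\<bar> \<le> B * \<bar>s - t\<bar>"
  using field_differentiable_bound[of UNIV F F' B s t] assms by auto

lemma L2lim_prod_L1:
  assumes F: "L2lim F f" and g: "L2 g"
  shows "(\<lambda>k. \<integral>x. \<bar>(F k x - f x) * g x\<bar> \<partial>lborel) \<longlonglongrightarrow> 0"
proof -
  have L: "L2 (F k)" "L2 f" for k using F by (auto simp: L2lim_def)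
  have "(\<lambda>k. (\<integral>x. (F k x - f x)^2 \<partial>lborel) * (\<integral>x. (g x)^2 \<partial>lborel)) \<longlonglongrightarrow> 0"
    using F unfolding L2lim_def by (intro tendsto_mult_left_zero) blast
  then have "(\<lambda>k. (\<integral>x. \<bar>(F k x - f x) * g x\<bar> \<partial>lborel)^2) \<longlonglongrightarrow> 0"
    by (rule squeeze_0) (intro zero_le_power2 L2_cauchy_schwarz L2_diff L g)+
  from tendsto_real_sqrt[OF this] show ?thesis by simp
qed

text \<open>The classical chain rule for the mollifications passes to the limit. Since F' is
  Lipschitz, the error F'(h k) - F'(f) is at most L times the L2-small function h k - f, so no
  almost everywhere convergent subsequence is needed. F 0 = 0 keeps F(f) in L2 over the whole
  space.\<close>

lemma LW_chain:
  fixes f :: "real^'n::finite \<Rightarrow> real"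
  assumes f: "LW UNIV f G" and F0: "F 0 = 0" and F': "\<And>t. (F has_real_derivative F' t) (at t)"
    and B: "\<And>t. \<bar>F' t\<bar> \<le> B" and L: "\<And>s t. \<bar>F' s - F' t\<bar> \<le> L * \<bar>s - t\<bar>"
  shows "LW UNIV (\<lambda>x. F (f x)) (\<lambda>x. F' (f x) *\<^sub>R G x)"
proof -
  define h where "h k = conv f (moll (seps k))" for k
  have hs: "smooth_fun (h k)" and hl: "L2lim h f" and hg: "L2lim (\<lambda>k. pd i (h k)) (\<lambda>x. G x $ i)" for k i
    using LW_moll[OF f] unfolding h_def by auto
  have Lf: "L2 f" "L2 (\<lambda>x. G x $ i)" for i using LW_D[OF f] by auto
  have Lh: "L2 (h k)" "L2 (pd i (h k))" for k i using hl hg[of i] by (auto simp: L2lim_def)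
  have B0: "0 \<le> B" using B[of 0] by linarith
  have L0: "0 \<le> L" using L[of 0 1] by simp
  have lip: "\<bar>F s - F t\<bar> \<le> B * \<bar>s - t\<bar>" for s t by (rule real_lipschitz_from_deriv[OF F' B])
  have cF: "continuous_on UNIV F" using F' DERIV_isCont by (metis continuous_at_imp_continuous_on)
  have cF': "continuous_on UNIV F'"
    by (rule lipschitz_on_continuous_on[of L]) (use L L0 in \<open>auto simp: lipschitz_on_def dist_real_def\<close>)
  have [measurable]: "F \<in> borel_measurable borel" "F' \<in> borel_measurable borel"
    using cF cF' by (auto intro: borel_measurable_continuous_onI)
  have [measurable]: "f \<in> borel_measurable borel" "h k \<in> borel_measurable borel" "pd i (h k) \<in> borel_measurable borel"
    "(\<lambda>x. G x $ i) \<in> borel_measurable borel" for k i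
    using Lf Lh by (auto simp: L2_def)
  have LF: "L2 (\<lambda>x. F (g x))" if "L2 g" for g :: "real^'n \<Rightarrow> real"
  proof (rule L2_mono[OF L2_cmult[OF that, of B]])
    have [measurable]: "g \<in> borel_measurable borel" using that by (simp add: L2_def)
    show "(\<lambda>x. F (g x)) \<in> borel_measurable borel" by measurable
    show "\<bar>F (g x)\<bar> \<le> \<bar>B * g x\<bar>" for x using lip[of "g x" 0] F0 B0 by (simp add: abs_mult)
  qed
  have LF': "L2 (\<lambda>x. F' (g x) * k x)" if "L2 g" "L2 k" for g k :: "real^'n \<Rightarrow> real"
  proof (rule L2_bounded_mult[OF that(2)])
    have [measurable]: "g \<in> borel_measurable borel" using that by (simp add: L2_def)
    show "(\<lambda>x. F' (g x)) \<in> borel_measurable borel" by measurable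
  qed (rule B)
  show ?thesis unfolding LW_def
  proof (intro conjI allI impI)
    show "L2 (\<lambda>x. F (f x))" by (rule LF[OF Lf(1)])
    show "L2 (\<lambda>x. (F' (f x) *\<^sub>R G x) $ i)" for i using LF'[OF Lf] by simp
    fix \<phi> :: "real^'n \<Rightarrow> real" and i assume t: "test_fun UNIV \<phi>"
    have L\<phi>: "L2 \<phi>" "L2 (pd i \<phi>)" using L2_test_fun[OF t] L2_test_fun[OF test_fun_pd[OF t]] by auto
    have [measurable]: "\<phi> \<in> borel_measurable borel" using L\<phi> by (simp add: L2_def)
    obtain C where C: "\<And>x. \<bar>\<phi> x\<bar> \<le> C" using test_fun_bounded[OF t] by blast
    have LG\<phi>: "L2 (\<lambda>x. \<phi> x * G x $ i)" by (rule L2_bounded_mult[OF Lf(2) _ C]) simp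
    have D: "((\<lambda>x. F (h k x)) has_derivative (\<lambda>v. (F' (h k x) *\<^sub>R grad (h k) x) \<bullet> v)) (at x)" for k x
      using has_derivative_compose[OF has_derivative_grad[OF smooth_differentiable[OF hs]]
          F'[unfolded has_field_derivative_def], of k x] by simp
    have pF: "pd j (\<lambda>x. F (h k x)) x = F' (h k x) * pd j (h k) x" for j k x
      using pd_has_derivative_grad[OF D] by (simp add: grad_def)
    have "continuous_on UNIV (\<lambda>x. F' (h k x) * pd j (h k) x)" for j k
      by (intro continuous_on_mult smooth_continuous smooth_pd hs continuous_on_compose2[OF cF']) auto
    then have cont: "continuous_on UNIV (pd j (\<lambda>x. F (h k x)))" for j k
      by (simp add: pF[abs_def])
    have id: "(\<integral>x. F (h k x) * pd i \<phi> x \<partial>lborel) = - (\<integral>x. (F' (h k x) * pd i (h k) x) * \<phi> x \<partial>lborel)" for k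
      using integration_by_parts[OF _ cont t, of k i] D[of k] by (auto simp: pF differentiable_def)
    have Fl: "L2lim (\<lambda>k x. F (h k x)) (\<lambda>x. F (f x))"
      unfolding L2lim_def
    proof (intro conjI allI LF Lf Lh)
      have "(\<lambda>k. B^2 * (\<integral>x. (h k x - f x)^2 \<partial>lborel)) \<longlonglongrightarrow> 0"
        using hl by (intro tendsto_mult_right_zero) (simp add: L2lim_def)
      then show "(\<lambda>k. \<integral>x. (F (h k x) - F (f x))^2 \<partial>lborel) \<longlonglongrightarrow> 0"
      proof (rule squeeze_0)
        fix k
        have "(\<integral>x. (F (h k x) - F (f x))^2 \<partial>lborel) \<le> (\<integral>x. B^2 * (h k x - f x)^2 \<partial>lborel)"
        proof (rule integral_mono)
          show "integrable lborel (\<lambda>x. (F (h k x) - F (f x))^2)"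
            by (intro L2_integrable L2_diff LF Lf Lh)
          show "integrable lborel (\<lambda>x. B^2 * (h k x - f x)^2)"
            by (intro integrable_mult_right L2_integrable L2_diff Lf Lh)
          show "(F (h k x) - F (f x))^2 \<le> B^2 * (h k x - f x)^2" for x
            using power_mono[OF lip[of "h k x" "f x"], of 2] by (simp add: power_mult_distrib)
        qed
        then show "(\<integral>x. (F (h k x) - F (f x))^2 \<partial>lborel) \<le> B^2 * (\<integral>x. (h k x - f x)^2 \<partial>lborel)" by simp
      qed simp
    qed
    have l1: "(\<lambda>k. \<integral>x. F (h k x) * pd i \<phi> x \<partial>lborel) \<longlonglongrightarrow> (\<integral>x. F (f x) * pd i \<phi> x \<partial>lborel)"
      by (rule L2lim_prod[OF Fl L\<phi>(2)])
    have l2: "(\<lambda>k. (\<integral>x. (F' (h k x) * pd i (h k) x) * \<phi> x \<partial>lborel) - (\<integral>x. (F' (f x) * G x $ i) * \<phi> x \<partial>lborel)) \<longlonglongrightarrow> 0"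
    proof -
      have "(\<lambda>k. B * (\<integral>x. \<bar>(pd i (h k) x - G x $ i) * \<phi> x\<bar> \<partial>lborel) + L * (\<integral>x. \<bar>(h k x - f x) * (\<phi> x * G x $ i)\<bar> \<partial>lborel)) \<longlonglongrightarrow> B * 0 + L * 0"
        by (intro tendsto_add tendsto_mult tendsto_const L2lim_prod_L1[OF hg L\<phi>(1)] L2lim_prod_L1[OF hl LG\<phi>])
      then have lim: "(\<lambda>k. B * (\<integral>x. \<bar>(pd i (h k) x - G x $ i) * \<phi> x\<bar> \<partial>lborel) + L * (\<integral>x. \<bar>(h k x - f x) * (\<phi> x * G x $ i)\<bar> \<partial>lborel)) \<longlonglongrightarrow> 0"
        by simp
      have "(\<lambda>k. \<bar>(\<integral>x. (F' (h k x) * pd i (h k) x) * \<phi> x \<partial>lborel) - (\<integral>x. (F' (f x) * G x $ i) * \<phi> x \<partial>lborel)\<bar>) \<longlonglongrightarrow> 0"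
      proof (rule squeeze_0[OF lim])
        fix k
        have i1: "integrable lborel (\<lambda>x. (F' (h k x) * pd i (h k) x) * \<phi> x)"
          "integrable lborel (\<lambda>x. (F' (f x) * G x $ i) * \<phi> x)"
          by (intro L2_prod_integrable LF' Lf Lh L\<phi>)+
        have i2: "integrable lborel (\<lambda>x. \<bar>(pd i (h k) x - G x $ i) * \<phi> x\<bar>)"
          "integrable lborel (\<lambda>x. \<bar>(h k x - f x) * (\<phi> x * G x $ i)\<bar>)"
          by (intro integrable_abs L2_prod_integrable L2_diff Lf Lh L\<phi> LG\<phi>)+
        have "\<bar>(\<integral>x. (F' (h k x) * pd i (h k) x) * \<phi> x \<partial>lborel) - (\<integral>x. (F' (f x) * G x $ i) * \<phi> x \<partial>lborel)\<bar>
          = \<bar>\<integral>x. (F' (h k x) * pd i (h k) x) * \<phi> x - (F' (f x) * G x $ i) * \<phi> x \<partial>lborel\<bar>"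
          using i1 by simp
        also have "\<dots> \<le> (\<integral>x. \<bar>(F' (h k x) * pd i (h k) x) * \<phi> x - (F' (f x) * G x $ i) * \<phi> x\<bar> \<partial>lborel)"
          using integral_norm_bound[of lborel "\<lambda>x. (F' (h k x) * pd i (h k) x) * \<phi> x - (F' (f x) * G x $ i) * \<phi> x"]
          by simp
        also have "\<dots> \<le> (\<integral>x. B * \<bar>(pd i (h k) x - G x $ i) * \<phi> x\<bar> + L * \<bar>(h k x - f x) * (\<phi> x * G x $ i)\<bar> \<partial>lborel)"
        proof (rule integral_mono)
          fix x
          have "(F' (h k x) * pd i (h k) x) * \<phi> x - (F' (f x) * G x $ i) * \<phi> x =
             F' (h k x) * ((pd i (h k) x - G x $ i) * \<phi> x) + (F' (h k x) - F' (f x)) * (\<phi> x * G x $ i)"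
            by (simp add: algebra_simps)
          also have "\<bar>\<dots>\<bar> \<le> \<bar>F' (h k x)\<bar> * \<bar>(pd i (h k) x - G x $ i) * \<phi> x\<bar> + \<bar>F' (h k x) - F' (f x)\<bar> * \<bar>\<phi> x * G x $ i\<bar>"
            by (metis abs_mult abs_triangle_ineq)
          also have "\<dots> \<le> B * \<bar>(pd i (h k) x - G x $ i) * \<phi> x\<bar> + (L * \<bar>h k x - f x\<bar>) * \<bar>\<phi> x * G x $ i\<bar>"
            by (intro add_mono mult_right_mono B L) auto
          finally show "\<bar>(F' (h k x) * pd i (h k) x) * \<phi> x - (F' (f x) * G x $ i) * \<phi> x\<bar> \<le>
            B * \<bar>(pd i (h k) x - G x $ i) * \<phi> x\<bar> + L * \<bar>(h k x - f x) * (\<phi> x * G x $ i)\<bar>"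
            by (simp add: abs_mult mult.assoc)
        qed (intro integrable_abs Bochner_Integration.integrable_add Bochner_Integration.integrable_diff integrable_mult_right i1 i2)+
        also have "\<dots> = B * (\<integral>x. \<bar>(pd i (h k) x - G x $ i) * \<phi> x\<bar> \<partial>lborel) + L * (\<integral>x. \<bar>(h k x - f x) * (\<phi> x * G x $ i)\<bar> \<partial>lborel)"
          using i2 by simp
        finally show "\<bar>(\<integral>x. (F' (h k x) * pd i (h k) x) * \<phi> x \<partial>lborel) - (\<integral>x. (F' (f x) * G x $ i) * \<phi> x \<partial>lborel)\<bar> \<le>
          B * (\<integral>x. \<bar>(pd i (h k) x - G x $ i) * \<phi> x\<bar> \<partial>lborel) + L * (\<integral>x. \<bar>(h k x - f x) * (\<phi> x * G x $ i)\<bar> \<partial>lborel)" .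
      qed simp
      then show ?thesis by (simp add: tendsto_rabs_zero_iff)
    qed
    have "(\<lambda>k. - (\<integral>x. F (h k x) * pd i \<phi> x \<partial>lborel) - (\<integral>x. (F' (f x) * G x $ i) * \<phi> x \<partial>lborel)) \<longlonglongrightarrow> 0"
      using l2 by (simp add: id)
    moreover have "(\<lambda>k. - (\<integral>x. F (h k x) * pd i \<phi> x \<partial>lborel) - (\<integral>x. (F' (f x) * G x $ i) * \<phi> x \<partial>lborel)) \<longlonglongrightarrow>
      - (\<integral>x. F (f x) * pd i \<phi> x \<partial>lborel) - (\<integral>x. (F' (f x) * G x $ i) * \<phi> x \<partial>lborel)"
      by (intro tendsto_diff tendsto_minus l1 tendsto_const)
    ultimately have "- (\<integral>x. F (f x) * pd i \<phi> x \<partial>lborel) - (\<integral>x. (F' (f x) * G x $ i) * \<phi> x \<partial>lborel) = 0"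
      by (rule LIMSEQ_unique[symmetric])
    then show "(\<integral>x. F (f x) * pd i \<phi> x \<partial>lborel) = - (\<integral>x. (F' (f x) *\<^sub>R G x) $ i * \<phi> x \<partial>lborel)" by simp
  qed
qed

lemma max0_square_deriv: "((\<lambda>t::real. (max 0 t)^2) has_real_derivative 2 * max 0 t) (at t)"
proof (cases t "0::real" rule: linorder_cases)
  case less
  have "((\<lambda>t::real. 0) has_real_derivative 0) (at t)" by simp
  then have "((\<lambda>t::real. (max 0 t)^2) has_real_derivative 0) (at t)"
    by (rule DERIV_cong_ev[THEN iffD1, rotated 3])
      (use less in \<open>auto simp: eventually_nhds intro!: exI[of _ "{..<0}"]\<close>)
  then show ?thesis using less by simp
next
  case equal
  have "((\<lambda>h::real. (max 0 h)^2 / h) \<longlongrightarrow> 0) (at 0)"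
  proof (rule Lim_null_comparison[OF always_eventually])
    show "\<forall>h::real. norm ((max 0 h)^2 / h) \<le> \<bar>h\<bar>" by (auto simp: max_def power2_eq_square)
    show "((\<lambda>h::real. \<bar>h\<bar>) \<longlongrightarrow> 0) (at 0)" using tendsto_rabs[OF tendsto_ident_at[of "0::real" UNIV]] by simp
  qed
  then show ?thesis using equal by (simp add: DERIV_def)
next
  case greater
  have "((\<lambda>t::real. t^2) has_real_derivative 2 * t) (at t)" by (auto intro!: derivative_eq_intros)
  then have "((\<lambda>t::real. (max 0 t)^2) has_real_derivative 2 * t) (at t)"
    by (rule DERIV_cong_ev[THEN iffD1, rotated 3])
      (use greater in \<open>auto simp: eventually_nhds intro!: exI[of _ "{0<..}"]\<close>)
  then show ?thesis using greater by simp
qed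

text \<open>Approximation of the kink by functions whose derivative is a ramp from 0 to 1 over the
  interval from k to k + \<delta> m. The ramps vanish at k, which produces the strict inequality in
  the gradient. For negative k the subtracted constant is what keeps the function square integrable
  at infinity.\<close>

lemma LW_truncate:
  fixes f :: "real^'n::finite \<Rightarrow> real"
  assumes f: "LW UNIV f G"
  shows "LW UNIV (\<lambda>x. max 0 (f x - k) - max 0 (- k)) (\<lambda>x. of_bool (k < f x) *\<^sub>R G x)"
proof -
  define \<delta> where "\<delta> m = seps m" for m
  \<comment> \<open>A difference of two squared positive parts, so that the derivative is a
    difference of two positive parts and hence Lipschitz.\<close>
  define E where "E m t = ((max 0 (t - k))^2 - (max 0 (t - k - \<delta> m))^2) / (2 * \<delta> m)" for m t
  define E' where "E' m t = (max 0 (t - k) - max 0 (t - k - \<delta> m)) / \<delta> m" for m t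
  have s: "0 < \<delta> m" for m by (simp add: \<delta>_def)
  have D: "(E m has_real_derivative E' m t) (at t)" for m t
  proof -
    have 1: "((\<lambda>t. (max 0 (t - a))^2) has_real_derivative 2 * max 0 (t - a)) (at t)" for a
    proof -
      have "((\<lambda>t. t - a) has_real_derivative 1) (at t)" by (auto intro!: derivative_eq_intros)
      from DERIV_chain2[OF max0_square_deriv this] show ?thesis by simp
    qed
    have "((\<lambda>t. ((max 0 (t - k))^2 - (max 0 (t - (k + \<delta> m)))^2) / (2 * \<delta> m)) has_real_derivative
      (2 * max 0 (t - k) - 2 * max 0 (t - (k + \<delta> m))) / (2 * \<delta> m)) (at t)"
      by (intro DERIV_cdivide DERIV_diff 1)
    then show ?thesis
      unfolding E_def[abs_def] E'_def diff_diff_add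
      by (simp only: right_diff_distrib[symmetric] mult_divide_mult_cancel_left_if) (simp del: of_nat_Suc)
  qed
  have E'b: "0 \<le> E' m t" "E' m t \<le> 1" for m t
  proof -
    have "0 \<le> (max 0 t' - max 0 (t' - d)) / d \<and> (max 0 t' - max 0 (t' - d)) / d \<le> 1" if "0 < d" for t' d :: real
      using that by (auto simp: max_def)
    from this[OF s[of m], of "t - k"] show "0 \<le> E' m t" "E' m t \<le> 1" unfolding E'_def by blast+
  qed
  have lip: "\<bar>E m s - E m t\<bar> \<le> 1 * \<bar>s - t\<bar>" for m s t
    by (rule real_lipschitz_from_deriv[OF D]) (use E'b in auto)
  have E'lip: "\<bar>E' m s - E' m t\<bar> \<le> (2 / \<delta> m) * \<bar>s - t\<bar>" for m s t
  proof -
    have "E' m s - E' m t = ((max 0 (s - k) - max 0 (s - k - \<delta> m)) - (max 0 (t - k) - max 0 (t - k - \<delta> m))) / \<delta> m"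
      unfolding E'_def by (rule diff_divide_distrib[symmetric])
    then have "\<bar>E' m s - E' m t\<bar> = \<bar>(max 0 (s - k) - max 0 (s - k - \<delta> m)) - (max 0 (t - k) - max 0 (t - k - \<delta> m))\<bar> / \<delta> m"
      using s[of m] by (simp only: abs_divide abs_of_pos)
    also have "\<dots> \<le> (2 * \<bar>s - t\<bar>) / \<delta> m"
    proof (rule divide_right_mono)
      have "\<bar>max 0 x - max 0 y\<bar> \<le> \<bar>x - y\<bar>" for x y :: real by (simp add: max_def)
      then have m: "\<bar>max 0 (s - a) - max 0 (t - a)\<bar> \<le> \<bar>s - t\<bar>" for a
        using diff_diff_eq2[of "s - a" t a] by (metis add_diff_cancel_right' diff_add_cancel diff_diff_eq2)
      have tri: "\<bar>a - b - (c - d)\<bar> \<le> \<bar>a - c\<bar> + \<bar>b - d\<bar>" for a b c d :: real by linarith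
      show "\<bar>(max 0 (s - k) - max 0 (s - k - \<delta> m)) - (max 0 (t - k) - max 0 (t - k - \<delta> m))\<bar> \<le> 2 * \<bar>s - t\<bar>"
        using order_trans[OF tri add_mono[OF m[of k] m[of "k + \<delta> m"]]] by (simp only: diff_diff_add mult_2)
    qed (use s[of m] in simp)
    finally show ?thesis by (simp only: times_divide_eq_left)
  qed
  have Ez: "E m t = 0" "E' m t = 0" if "t \<le> k" for m t using that s[of m] by (auto simp: E_def E'_def max_def)
  have E1: "E m t = (t - k) - \<delta> m / 2" "E' m t = 1" if "k + \<delta> m \<le> t" for m t
  proof -
    define d where "d = \<delta> m"
    have d: "0 < d" "k + d \<le> t" using that s[of m] by (auto simp: d_def)
    have "(max 0 (t - k))^2 - (max 0 (t - k - d))^2 = (t - k)^2 - (t - k - d)^2" using d by (simp add: max_def)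
    also have "\<dots> = 2 * d * ((t - k) - d / 2)" by (simp add: power2_eq_square algebra_simps)
    finally show "E m t = (t - k) - \<delta> m / 2" unfolding E_def d_def[symmetric] using d by simp
    show "E' m t = 1" unfolding E'_def d_def[symmetric] using d by (simp add: max_def)
  qed
  have ev: "eventually (\<lambda>m. k + \<delta> m \<le> t) sequentially" if "k < t" for t
  proof -
    have "0 < t - k" using that by simp
    from order_tendstoD(2)[OF LIMSEQ_inverse_real_of_nat this]
    show ?thesis by eventually_elim (simp add: \<delta>_def inverse_eq_divide del: of_nat_Suc)
  qed
  have sl: "(\<lambda>m. \<delta> m) \<longlonglongrightarrow> 0" using LIMSEQ_inverse_real_of_nat by (simp add: \<delta>_def inverse_eq_divide)
  have El: "(\<lambda>m. E m t) \<longlonglongrightarrow> max 0 (t - k)" for t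
  proof (cases "t \<le> k")
    case False
    have "(\<lambda>m. (t - k) - \<delta> m / 2) \<longlonglongrightarrow> (t - k) - 0 / 2" by (intro tendsto_intros sl) simp
    then have "(\<lambda>m. E m t) \<longlonglongrightarrow> (t - k) - 0 / 2"
      by (rule Lim_transform_eventually) (use ev[of t] False E1(1) in \<open>auto elim!: eventually_mono\<close>)
    then show ?thesis using False by simp
  qed (simp add: Ez)
  have E'l: "(\<lambda>m. E' m t) \<longlonglongrightarrow> of_bool (k < t)" for t
  proof (cases "t \<le> k")
    case False
    have "eventually (\<lambda>m. E' m t = 1) sequentially" using ev[of t] False E1(2) by (auto elim!: eventually_mono)
    then show ?thesis using False by (simp add: tendsto_eventually)
  qed (simp add: Ez)
  note Lf = LW_D[OF f]
  have [measurable]: "f \<in> borel_measurable borel" "(\<lambda>x. G x $ i) \<in> borel_measurable borel" for i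
    using Lf by (auto simp: L2_def)
  have LWm: "LW UNIV (\<lambda>x. E m (f x) - E m 0) (\<lambda>x. E' m (f x) *\<^sub>R G x)" for m
    by (rule LW_chain[OF f _ _ _ E'lip, where F="\<lambda>t. E m t - E m 0" and B=1])
      (use E'b in \<open>auto intro!: DERIV_diff[OF D DERIV_const, simplified]\<close>)
  have m1 [measurable]: "(\<lambda>x. E m (f x) - E m 0) \<in> borel_measurable borel" "(\<lambda>x. E' m (f x) * G x $ i) \<in> borel_measurable borel" for m i
    unfolding E_def E'_def by measurable
  have e0: "(\<lambda>m. E m (f x) - E m 0) \<longlonglongrightarrow> max 0 (f x - k) - max 0 (- k)" for x
    using tendsto_diff[OF El[of "f x"] El[of 0]] by simp
  show ?thesis
  proof (rule LW_limit[OF LWm])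
    show "L2lim (\<lambda>m x. E m (f x) - E m 0) (\<lambda>x. max 0 (f x - k) - max 0 (- k))"
      by (rule L2lim_dominated[OF m1(1) Lf(1) _ e0]) (use lip[of _ _ 0] in auto)
    show "L2lim (\<lambda>m x. (E' m (f x) *\<^sub>R G x) $ i) (\<lambda>x. (of_bool (k < f x) *\<^sub>R G x) $ i)" for i
      unfolding vector_scaleR_component real_scaleR_def
    proof (rule L2lim_dominated[OF m1(2) Lf(2)])
      show "(\<lambda>m. E' m (f x) * G x $ i) \<longlonglongrightarrow> of_bool (k < f x) * G x $ i" for x
        by (intro tendsto_mult E'l tendsto_const)
      show "\<bar>E' m (f x) * G x $ i\<bar> \<le> \<bar>G x $ i\<bar>" for m x
        using E'b[of m "f x"] by (simp add: abs_mult mult_left_le_one_le)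
    qed
  qed
qed

section \<open>Translation, Faber--Krahn and isoperimetric estimates\<close>

lemma grad_locally_const:
  assumes "open S" "x \<in> S" "\<And>y. y \<in> S \<Longrightarrow> f y = a"
  shows "grad f x = 0"
proof -
  have "(f has_derivative (\<lambda>h. 0)) (at x)"
    by (rule has_derivative_transform_within_open[OF has_derivative_const[of a] assms(1,2)]) (simp add: assms(3))
  from pd_eqI[OF this] show ?thesis by (simp add: grad_def vec_eq_iff)
qed

lemma compact_in_smaller_ball:
  fixes c :: "'a::euclidean_space"
  assumes "compact K" "K \<subseteq> ball c R" "0 < R"
  obtains r where "0 < r" "r < R" "K \<subseteq> ball c r"
proof (cases "K = {}")
  case True
  then show ?thesis using that[of "R/2"] assms by auto
next
  case False
  obtain y where y: "y \<in> K" "\<And>z. z \<in> K \<Longrightarrow> dist c z \<le> dist c y"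
  proof -
    have "continuous_on K (dist c)" by (intro continuous_intros)
    from continuous_attains_sup[OF assms(1) False this] show ?thesis using that by blast
  qed
  have "dist c y < R" using y assms by auto
  define r where "r = (dist c y + R) / 2"
  have d: "dist c y < R" "0 < R" "0 \<le> dist c y" using \<open>dist c y < R\<close> assms(3) by auto
  have "0 < r" unfolding r_def using add_nonneg_pos[OF d(3,2)] by simp
  moreover have "r < R" "dist c y < r" unfolding r_def using d(1) by auto
  moreover have "K \<subseteq> ball c r"
  proof
    fix z assume "z \<in> K"
    from y(2)[OF this] \<open>dist c y < r\<close> show "z \<in> ball c r" by simp
  qed
  ultimately show ?thesis using that by blast
qed

lemma LW_zero: "LW U (\<lambda>x. 0) (\<lambda>x. 0)" by (simp add: LW_def L2_zero)

text \<open>The truncation rule is global while f has a gradient only in a ball. So f is first cut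
  off by a function equal to 1 on a ball containing the support of \<zeta>, then truncated, then
  multiplied by \<zeta>.\<close>

lemma LW_truncate_cutoff:
  fixes f :: "real^'n::finite \<Rightarrow> real"
  assumes f: "LW (ball c R) f G" and z: "test_fun (ball c R) \<zeta>"
  shows "LW UNIV (\<lambda>x. \<zeta> x * max 0 (f x - k))
    (\<lambda>x. (\<zeta> x * of_bool (k < f x)) *\<^sub>R G x + max 0 (f x - k) *\<^sub>R grad \<zeta> x)"
proof (cases "0 < R")
  case False
  then have "ball c R = {}" by simp
  with z have "tsupport \<zeta> = {}" unfolding test_fun_def by blast
  then have "\<zeta> x = 0" "grad \<zeta> x = 0" for x
    using zero_outside_tsupport[of x \<zeta>] pd_zero_outside[of x \<zeta>] by (auto simp: grad_def vec_eq_iff)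
  then show ?thesis using LW_zero[of UNIV] by simp
next
  case True
  obtain r where r: "0 < r" "r < R" "tsupport \<zeta> \<subseteq> ball c r"
    using compact_in_smaller_ball[of "tsupport \<zeta>" c R] z True by (auto simp: test_fun_def)
  obtain \<eta> where e: "test_fun (ball c R) \<eta>" "\<And>x. x \<in> ball c r \<Longrightarrow> \<eta> x = 1"
    using cutoff_exists[OF r(1,2)] by metis
  have ge: "grad \<eta> x = 0" if "x \<in> ball c r" for x
    by (rule grad_locally_const[OF open_ball that e(2)])
  have zU: "test_fun UNIV \<zeta>" using test_fun_mono[OF z] by simp
  \<comment> \<open>The constant that \<open>LW_truncate\<close> subtracts; it is given back in the
    form of the test function \<zeta> times a.\<close>
  define a where "a = max 0 (- k)"
  have tc: "test_fun UNIV (\<lambda>x. \<zeta> x * a)" by (rule test_fun_mult[OF zU smooth_const])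
  have gc: "grad (\<lambda>x. \<zeta> x * a) x = a *\<^sub>R grad \<zeta> x" for x
  proof -
    have "pd i (\<lambda>x::real^'n. a) x = 0" for i by (rule pd_eqI[OF has_derivative_const])
    then show ?thesis
      by (simp add: grad_def vec_eq_iff smooth_pd_mult[OF test_fun_smooth[OF z] smooth_const])
  qed
  let ?W = "\<lambda>x. \<eta> x * f x" and ?H = "\<lambda>x. \<eta> x *\<^sub>R G x + f x *\<^sub>R grad \<eta> x"
  note 1 = LW_mult[OF f e(1)]
  note 2 = LW_mult[OF LW_truncate[OF 1, of k] zU]
  note 3 = LW_add[OF 2 LW_test_fun[OF tc]]
  have A: "\<zeta> x * (max 0 (?W x - k) - max 0 (- k)) + \<zeta> x * a = \<zeta> x * max 0 (f x - k)" for x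
  proof (cases "x \<in> tsupport \<zeta>")
    case True
    then show ?thesis using r(3) e(2)[of x] by (auto simp: a_def algebra_simps)
  qed (simp add: zero_outside_tsupport)
  have B: "\<zeta> x *\<^sub>R (of_bool (k < ?W x) *\<^sub>R ?H x) + (max 0 (?W x - k) - max 0 (- k)) *\<^sub>R grad \<zeta> x + grad (\<lambda>x. \<zeta> x * a) x
    = (\<zeta> x * of_bool (k < f x)) *\<^sub>R G x + max 0 (f x - k) *\<^sub>R grad \<zeta> x" for x
  proof (cases "x \<in> tsupport \<zeta>")
    case True
    then have "x \<in> ball c r" using r(3) by auto
    then show ?thesis using e(2)[of x] ge[of x]
      unfolding gc by (simp add: a_def scaleR_diff_left)
  next
    case False
    then have "\<zeta> x = 0" "grad \<zeta> x = 0"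
      using zero_outside_tsupport[of x \<zeta>] pd_zero_outside[of x \<zeta>] by (auto simp: grad_def vec_eq_iff)
    then show ?thesis by (simp add: gc)
  qed
  show ?thesis using 3 unfolding A B .
qed

section \<open>Translation estimates in terms of the gradient\<close>

lemma test_fun_quotient_limit:
  fixes g :: "real^'n::finite \<Rightarrow> real" and h :: "real^'n"
  assumes g: "test_fun UNIV g"
  defines "q \<equiv> \<lambda>m x. (g (h /\<^sub>R real (Suc m) + x) - g x) * real (Suc m)"
  shows "L2lim q (\<lambda>x. grad g x \<bullet> h)" 
proof -
  obtain B where B: "0 < B" "\<And>x y. \<bar>g x - g y\<bar> \<le> B * norm (x - y)" using test_fun_lipschitz[OF g] by blast
  obtain R where R: "0 < R" "\<And>x. R < norm x \<Longrightarrow> g x = 0" using test_fun_support_ball[OF g] by blast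
  have [measurable]: "g \<in> borel_measurable borel" by (rule smooth_borel[OF test_fun_smooth[OF g]])
  let ?K = "cball 0 (R + norm h) :: (real^'n) set"
  show ?thesis
  proof (rule L2lim_dominated[where g="\<lambda>x. (B * norm h) * indicator ?K x"])
    show "q m \<in> borel_measurable borel" for m unfolding q_def by measurable
    show "L2 (\<lambda>x. (B * norm h) * indicator ?K x)" by (intro L2_cmult L2_indicator) auto
    show "(\<lambda>m. q m x) \<longlonglongrightarrow> grad g x \<bullet> h" for x unfolding q_def
      by (rule directional_quotient[OF smooth_differentiable[OF test_fun_smooth[OF g]]])
    show "\<bar>q m x\<bar> \<le> \<bar>(B * norm h) * indicator ?K x\<bar>" for m x
    proof (cases "x \<in> ?K")
      case True
      have "\<bar>q m x\<bar> = \<bar>g (h /\<^sub>R real (Suc m) + x) - g x\<bar> * real (Suc m)" by (simp add: q_def abs_mult)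
      also have "\<dots> \<le> (B * norm (h /\<^sub>R real (Suc m))) * real (Suc m)"
        using B(2)[of "h /\<^sub>R real (Suc m) + x" x] by (intro mult_right_mono) auto
      also have "\<dots> = B * norm h" by (simp del: of_nat_Suc)
      finally show ?thesis using True B(1) by (simp add: abs_mult)
    next
      case False
      have "norm (h /\<^sub>R real (Suc m)) \<le> norm h"
        by (simp add: mult_left_le_one_le inverse_le_1_iff)
      moreover have "norm x \<le> norm (h /\<^sub>R real (Suc m) + x) + norm (h /\<^sub>R real (Suc m))"
        using norm_triangle_ineq4[of "h /\<^sub>R real (Suc m) + x" "h /\<^sub>R real (Suc m)"] by simp
      ultimately have "norm (h /\<^sub>R real (Suc m) + x) > R" using False by simp
      moreover have "norm x > R" using False norm_ge_zero[of h] by (simp del: norm_ge_zero)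
      ultimately show ?thesis using False by (simp add: q_def R)
    qed
  qed
qed

lemma telescope_translate:
  fixes g :: "real^'n::finite \<Rightarrow> real"
  shows "g (h + x) - g x = (\<Sum>i<Suc m. g (h /\<^sub>R real (Suc m) + ((real i / real (Suc m)) *\<^sub>R h + x)) - g ((real i / real (Suc m)) *\<^sub>R h + x))"
proof -
  define N where "N = real (Suc m)"
  have N: "N \<noteq> 0" by (simp add: N_def)
  have e: "h /\<^sub>R N + ((real i / N) *\<^sub>R h + x) = (real (Suc i) / N) *\<^sub>R h + x" for i
  proof -
    have "h /\<^sub>R N + (real i / N) *\<^sub>R h = (1 / N + real i / N) *\<^sub>R h"
      by (simp add: scaleR_add_left inverse_eq_divide)
    also have "1 / N + real i / N = real (Suc i) / N" by (simp add: add_divide_distrib)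
    finally show ?thesis by (simp add: add.assoc[symmetric])
  qed
  show ?thesis
    unfolding N_def[symmetric] e
    unfolding sum_lessThan_telescope[of "\<lambda>i. g ((real i / N) *\<^sub>R h + x)" "Suc m"]
    by (simp add: N_def del: of_nat_Suc)
qed

lemma sum_square_le: "(\<Sum>i<n. a i)^2 \<le> real n * (\<Sum>i<n. (a i)^2)" for a :: "nat \<Rightarrow> real"
  using Cauchy_Schwarz_ineq_sum[of "\<lambda>_. 1" a "{..<n}"] by simp

text \<open>The segment from $x$ to $x+h$ is cut into equal steps; translation invariance makes all steps
  contribute equally, and a step is a difference quotient.\<close>

lemma translate_L2_test_fun:
  fixes g :: "real^'n::finite \<Rightarrow> real"
  assumes g: "test_fun UNIV g"
  shows "(\<integral>x. (g (h + x) - g x)^2 \<partial>lborel) \<le> (\<integral>x. (grad g x \<bullet> h)^2 \<partial>lborel)"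
proof -
  define q where "q m x = (g (h /\<^sub>R real (Suc m) + x) - g x) * real (Suc m)" for m x
  have ql: "L2lim q (\<lambda>x. grad g x \<bullet> h)" using test_fun_quotient_limit[OF g, of h] by (simp add: q_def[abs_def])
  have Lg: "L2 g" by (rule L2_test_fun[OF g])
  have "(\<integral>x. (g (h + x) - g x)^2 \<partial>lborel) \<le> (\<integral>x. (q m x)^2 \<partial>lborel)" for m
  proof -
    define N where "N = real (Suc m)"
    let ?d = "\<lambda>x. g (h /\<^sub>R N + x) - g x" and ?t = "\<lambda>i. (real i / N) *\<^sub>R h"
    have Ld: "L2 ?d" by (intro L2_diff L2_translate Lg)
    have Ldt: "L2 (\<lambda>x. ?d (?t i + x))" for i by (rule L2_translate[OF Ld])
    have "(\<integral>x. (g (h + x) - g x)^2 \<partial>lborel) \<le> (\<integral>x. N * (\<Sum>i<Suc m. (?d (?t i + x))^2) \<partial>lborel)"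
    proof (rule integral_mono)
      show "integrable lborel (\<lambda>x. (g (h + x) - g x)^2)" by (intro L2_integrable L2_diff L2_translate Lg)
      show "integrable lborel (\<lambda>x. N * (\<Sum>i<Suc m. (?d (?t i + x))^2))"
        by (intro integrable_mult_right Bochner_Integration.integrable_sum L2_integrable Ldt)
      show "(g (h + x) - g x)^2 \<le> N * (\<Sum>i<Suc m. (?d (?t i + x))^2)" for x
        unfolding telescope_translate[of g h x m] N_def by (rule sum_square_le)
    qed
    also have "\<dots> = N * (\<Sum>i<Suc m. (\<integral>x. (?d (?t i + x))^2 \<partial>lborel))"
      using Ldt by (subst Bochner_Integration.integral_mult_right_zero, subst Bochner_Integration.integral_sum) (auto intro: L2_integrable)
    also have "(\<lambda>i. \<integral>x. (?d (?t i + x))^2 \<partial>lborel) = (\<lambda>i. \<integral>x. (?d x)^2 \<partial>lborel)"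
      by (rule ext) (rule lborel_integral_translate)
    also have "N * (\<Sum>i<Suc m. (\<integral>x. (?d x)^2 \<partial>lborel)) = (\<integral>x. (q m x)^2 \<partial>lborel)"
      by (simp add: q_def N_def power_mult_distrib power2_eq_square[of "real (Suc m)"] mult_ac del: of_nat_Suc)
    finally show ?thesis .
  qed
  then show ?thesis by (intro LIMSEQ_le_const[OF L2lim_norm[OF ql]]) auto
qed

lemma L2lim_L1_on:
  assumes F: "L2lim F f" and A: "A \<in> sets borel" "bounded A"
  shows "(\<lambda>k. \<integral>x. indicator A x * \<bar>F k x\<bar> \<partial>lborel) \<longlonglongrightarrow> (\<integral>x. indicator A x * \<bar>f x\<bar> \<partial>lborel)"
proof -
  have L: "L2 (F k)" "L2 f" for k using F by (auto simp: L2lim_def)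
  have La: "L2 (\<lambda>x. \<bar>F k x\<bar>)" "L2 (\<lambda>x. \<bar>f x\<bar>)" for k
    using L2_mono[OF L(1)[of k] borel_measurable_abs[OF L2_borel[OF L(1)[of k]]]]
      L2_mono[OF L(2) borel_measurable_abs[OF L2_borel[OF L(2)]]] by simp_all
  note LA = L2_indicator[OF A]
  have "(\<lambda>k. \<bar>(\<integral>x. indicator A x * \<bar>F k x\<bar> \<partial>lborel) - (\<integral>x. indicator A x * \<bar>f x\<bar> \<partial>lborel)\<bar>) \<longlonglongrightarrow> 0"
  proof (rule squeeze_0[OF L2lim_prod_L1[OF F LA]])
    fix k
    have "\<bar>(\<integral>x. indicator A x * \<bar>F k x\<bar> \<partial>lborel) - (\<integral>x. indicator A x * \<bar>f x\<bar> \<partial>lborel)\<bar> =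
      \<bar>\<integral>x. indicator A x * \<bar>F k x\<bar> - indicator A x * \<bar>f x\<bar> \<partial>lborel\<bar>"
      by (subst Bochner_Integration.integral_diff[OF L2_prod_integrable[OF LA La(1)] L2_prod_integrable[OF LA La(2)]]) simp
    also have "\<dots> \<le> (\<integral>x. \<bar>indicator A x * \<bar>F k x\<bar> - indicator A x * \<bar>f x\<bar>\<bar> \<partial>lborel)"
      using integral_norm_bound[of lborel "\<lambda>x. indicator A x * \<bar>F k x\<bar> - indicator A x * \<bar>f x\<bar>"] by simp
    also have "\<dots> \<le> (\<integral>x. \<bar>(F k x - f x) * indicator A x\<bar> \<partial>lborel)"
    proof (rule integral_mono)
      show "integrable lborel (\<lambda>x. \<bar>indicator A x * \<bar>F k x\<bar> - indicator A x * \<bar>f x\<bar>\<bar>)"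
        by (intro integrable_abs Bochner_Integration.integrable_diff L2_prod_integrable LA La)
      show "integrable lborel (\<lambda>x. \<bar>(F k x - f x) * indicator A x\<bar>)"
        by (intro integrable_abs L2_prod_integrable LA L2_diff L)
    qed (auto simp: indicator_def)
    finally show "\<bar>(\<integral>x. indicator A x * \<bar>F k x\<bar> \<partial>lborel) - (\<integral>x. indicator A x * \<bar>f x\<bar> \<partial>lborel)\<bar> \<le>
      (\<integral>x. \<bar>(F k x - f x) * indicator A x\<bar> \<partial>lborel)" .
  qed simp
  then show ?thesis by (simp add: tendsto_rabs_zero_iff LIM_zero_iff)
qed

text \<open>The subdivision of the segment is the same as in the L2 estimate. Only x with both ends
  in \<open>B\<close> are counted, so by convexity all intermediate points lie in \<open>B\<close>
  and only the gradient inside \<open>B\<close> is charged.\<close>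

lemma translate_L1_test_fun:
  fixes g :: "real^'n::finite \<Rightarrow> real"
  assumes g: "test_fun UNIV g" and B: "convex B" "B \<in> sets borel" "bounded B"
  shows "(\<integral>x. indicator {x\<in>B. h + x \<in> B} x * \<bar>g (h + x) - g x\<bar> \<partial>lborel) \<le> (\<integral>x. indicator B x * \<bar>grad g x \<bullet> h\<bar> \<partial>lborel)"
proof -
  define q where "q m x = (g (h /\<^sub>R real (Suc m) + x) - g x) * real (Suc m)" for m x
  have ql: "L2lim q (\<lambda>x. grad g x \<bullet> h)" using test_fun_quotient_limit[OF g, of h] by (simp add: q_def[abs_def])
  have Lg: "L2 g" by (rule L2_test_fun[OF g])
  note [measurable] = B(2)
  let ?S = "{x\<in>B. h + x \<in> B}"
  have Sm [measurable]: "?S \<in> sets borel"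
  proof -
    have "?S = B \<inter> (\<lambda>x. h + x) -` B" by auto
    also have "\<dots> \<in> sets borel" using B(2) measurable_sets[of "\<lambda>x. h + x" borel borel B] by auto
    finally show ?thesis .
  qed
  have Sb: "bounded ?S" by (rule bounded_subset[OF B(3)]) auto
  have "(\<integral>x. indicator ?S x * \<bar>g (h + x) - g x\<bar> \<partial>lborel) \<le> (\<integral>x. indicator B x * \<bar>q m x\<bar> \<partial>lborel)" for m
  proof -
    define N where "N = real (Suc m)"
    have N: "0 < N" by (simp add: N_def)
    let ?d = "\<lambda>x. g (h /\<^sub>R N + x) - g x" and ?t = "\<lambda>i. (real i / N) *\<^sub>R h"
    have Ld: "L2 ?d" by (intro L2_diff L2_translate Lg)
    have iB: "integrable lborel (\<lambda>x. indicator B x * \<bar>?d x\<bar>)"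
      using integrable_abs[OF L2_local_integrable[OF Ld B(2,3)]] by (simp add: abs_mult)
    have iBt: "integrable lborel (\<lambda>x. indicator B (?t i + x) * \<bar>?d (?t i + x)\<bar>)" for i
      using lborel_integrable_translate[of "\<lambda>x. indicator B x * \<bar>?d x\<bar>" "?t i"] iB by simp
    have "(\<integral>x. indicator ?S x * \<bar>g (h + x) - g x\<bar> \<partial>lborel) \<le> (\<integral>x. (\<Sum>i<Suc m. indicator B (?t i + x) * \<bar>?d (?t i + x)\<bar>) \<partial>lborel)"
    proof (rule integral_mono)
      have "integrable lborel (\<lambda>x. \<bar>indicator ?S x * (g (h + x) - g x)\<bar>)"
        by (intro integrable_abs L2_local_integrable L2_diff L2_translate Lg Sm Sb)
      then show "integrable lborel (\<lambda>x. indicator ?S x * \<bar>g (h + x) - g x\<bar>)" by (simp add: abs_mult)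
      show "integrable lborel (\<lambda>x. (\<Sum>i<Suc m. indicator B (?t i + x) * \<bar>?d (?t i + x)\<bar>))"
        by (intro Bochner_Integration.integrable_sum iBt)
      fix x
      show "indicator ?S x * \<bar>g (h + x) - g x\<bar> \<le> (\<Sum>i<Suc m. indicator B (?t i + x) * \<bar>?d (?t i + x)\<bar>)"
      proof (cases "x \<in> ?S")
        case True
        have inB: "?t i + x \<in> B" if "i < Suc m" for i
        proof -
          have "real i / N \<le> 1" "0 \<le> real i / N" using that N by (auto simp: N_def divide_le_eq)
          then have "(1 - real i / N) *\<^sub>R x + (real i / N) *\<^sub>R (h + x) \<in> B"
            using True by (intro convexD[OF B(1)]) auto
          then show ?thesis by (simp add: algebra_simps)
        qed
        have "\<bar>g (h + x) - g x\<bar> \<le> (\<Sum>i<Suc m. \<bar>?d (?t i + x)\<bar>)"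
          unfolding telescope_translate[of g h x m] N_def by (rule sum_abs)
        also have "\<dots> = (\<Sum>i<Suc m. indicator B (?t i + x) * \<bar>?d (?t i + x)\<bar>)"
          by (intro sum.cong refl) (use inB in simp)
        finally show ?thesis using True by simp
      qed (auto intro!: sum_nonneg)
    qed
    also have "\<dots> = (\<Sum>i<Suc m. (\<integral>x. indicator B (?t i + x) * \<bar>?d (?t i + x)\<bar> \<partial>lborel))"
      by (rule Bochner_Integration.integral_sum[OF iBt])
    also have "(\<lambda>i. \<integral>x. indicator B (?t i + x) * \<bar>?d (?t i + x)\<bar> \<partial>lborel) = (\<lambda>i. \<integral>x. indicator B x * \<bar>?d x\<bar> \<partial>lborel)"
      by (rule ext) (rule lborel_integral_translate[of "\<lambda>x. indicator B x * \<bar>?d x\<bar>"])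
    also have "(\<Sum>i<Suc m. (\<integral>x. indicator B x * \<bar>?d x\<bar> \<partial>lborel)) = (\<integral>x. indicator B x * \<bar>q m x\<bar> \<partial>lborel)"
    proof -
      have "(\<Sum>i<Suc m. (\<integral>x. indicator B x * \<bar>?d x\<bar> \<partial>lborel)) = (\<integral>x. indicator B x * \<bar>?d x\<bar> \<partial>lborel) * N"
        by (simp add: N_def)
      also have "\<dots> = (\<integral>x. indicator B x * \<bar>?d x\<bar> * N \<partial>lborel)" by simp
      also have "(\<lambda>x. indicator B x * \<bar>?d x\<bar> * N) = (\<lambda>x. indicator B x * \<bar>q m x\<bar>)"
        by (simp add: q_def N_def abs_mult mult.assoc del: of_nat_Suc)
      finally show ?thesis .
    qed
    finally show ?thesis .
  qed
  then show ?thesis by (intro LIMSEQ_le_const[OF L2lim_L1_on[OF ql B(2,3)]]) auto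
qed

lemma LW_moll_test_fun:
  fixes f :: "real^'n::finite \<Rightarrow> real"
  assumes f: "LW UNIV f G" and K: "\<And>x. x \<notin> K \<Longrightarrow> f x = 0" "bounded K"
  shows "test_fun UNIV (conv f (moll (seps k)))"
proof -
  obtain R where R: "K \<subseteq> cball 0 R" using K(2) bounded_subset_ballD[of K 0] ball_subset_cball by (metis order_trans)
  show ?thesis
  proof (rule test_funI[OF LW_moll(1)[OF f] compact_cball[of 0 "R + 1"]])
    fix x :: "real^'n" assume x: "x \<notin> cball 0 (R + 1)"
    show "conv f (moll (seps k)) x = 0"
    proof (rule conv_moll_support)
      fix y assume y: "norm (x - y) \<le> seps k"
      have "seps k \<le> 1" by simp
      moreover have "norm x > R + 1" using x by simp
      ultimately have "norm y > R" using y norm_triangle_sub[of x y] by linarith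
      then show "f y = 0" using R by (intro K(1)) auto
    qed simp
  qed simp
qed

lemma L2lim_translate_diff:
  assumes "L2lim F f"
  shows "L2lim (\<lambda>k x. F k (h + x) - F k x) (\<lambda>x. f (h + x) - f x)"
proof -
  have L: "L2 (F k)" "L2 f" for k using assms by (auto simp: L2lim_def)
  show ?thesis
      unfolding L2lim_def
    proof (intro conjI allI L2_diff L2_translate L)
      have lim: "(\<lambda>k. 4 * (\<integral>x. (F k x - f x)^2 \<partial>lborel)) \<longlonglongrightarrow> 0"
        using assms by (intro tendsto_mult_right_zero) (simp add: L2lim_def)
      show "(\<lambda>k. \<integral>x. (F k (h + x) - F k x - (f (h + x) - f x))^2 \<partial>lborel) \<longlonglongrightarrow> 0"
      proof (rule squeeze_0[OF lim])
        fix k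
        let ?e = "\<lambda>x. F k x - f x"
        have Le: "L2 ?e" by (intro L2_diff L)
        have "(\<integral>x. (F k (h + x) - F k x - (f (h + x) - f x))^2 \<partial>lborel) = (\<integral>x. (?e (h + x) + - ?e x)^2 \<partial>lborel)"
          by (rule Bochner_Integration.integral_cong) (simp_all add: algebra_simps)
        also have "\<dots> \<le> 2 * (\<integral>x. (?e (h + x))^2 \<partial>lborel) + 2 * (\<integral>x. (- ?e x)^2 \<partial>lborel)"
          by (rule L2_add_bound[OF L2_translate[OF Le] L2_minus[OF Le]])
        also have "(\<integral>x. (?e (h + x))^2 \<partial>lborel) = (\<integral>x. (?e x)^2 \<partial>lborel)" by (rule lborel_integral_translate)
        finally show "(\<integral>x. (F k (h + x) - F k x - (f (h + x) - f x))^2 \<partial>lborel) \<le> 4 * (\<integral>x. (F k x - f x)^2 \<partial>lborel)"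
          by (simp add: power2_commute)
      qed simp
    qed
qed

lemma translate_L2:
  fixes f :: "real^'n::finite \<Rightarrow> real"
  assumes f: "LW UNIV f G" and K: "\<And>x. x \<notin> K \<Longrightarrow> f x = 0" "bounded K"
  shows "(\<integral>x. (f (h + x) - f x)^2 \<partial>lborel) \<le> (norm h)^2 * (\<Sum>i\<in>UNIV. \<integral>x. (G x $ i)^2 \<partial>lborel)"
proof -
  define g where "g k = conv f (moll (seps k))" for k
  have t: "test_fun UNIV (g k)" for k unfolding g_def by (rule LW_moll_test_fun[OF f K])
  have gl: "L2lim g f" and gp: "L2lim (\<lambda>k. pd i (g k)) (\<lambda>x. G x $ i)" for i
    using LW_moll[OF f] unfolding g_def by auto
  have Lg: "L2 (g k)" "L2 f" for k using gl by (auto simp: L2lim_def)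
  have Lp: "L2 (pd i (g k))" for i k using gp[of i] by (auto simp: L2lim_def)
  have "(\<integral>x. (g k (h + x) - g k x)^2 \<partial>lborel) \<le> (norm h)^2 * (\<Sum>i\<in>UNIV. \<integral>x. (pd i (g k) x)^2 \<partial>lborel)" for k
  proof -
    have "(\<integral>x. (g k (h + x) - g k x)^2 \<partial>lborel) \<le> (\<integral>x. (grad (g k) x \<bullet> h)^2 \<partial>lborel)"
      by (rule translate_L2_test_fun[OF t])
    also have "\<dots> \<le> (\<integral>x. (norm h)^2 * (\<Sum>i\<in>UNIV. (pd i (g k) x)^2) \<partial>lborel)"
    proof (rule integral_mono)
      have "L2 (\<lambda>x. grad (g k) x \<bullet> h)"
        unfolding inner_vec_def grad_def using L2_cmult[OF Lp] by (intro L2_sum) (auto simp: mult.commute)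
      then show "integrable lborel (\<lambda>x. (grad (g k) x \<bullet> h)^2)" by (rule L2_integrable)
      show "integrable lborel (\<lambda>x. (norm h)^2 * (\<Sum>i\<in>UNIV. (pd i (g k) x)^2))"
        by (intro integrable_mult_right Bochner_Integration.integrable_sum L2_integrable Lp)
      fix x
      have "(grad (g k) x \<bullet> h)^2 \<le> (grad (g k) x \<bullet> grad (g k) x) * (h \<bullet> h)" by (rule Cauchy_Schwarz_ineq)
      also have "grad (g k) x \<bullet> grad (g k) x = (\<Sum>i\<in>UNIV. (pd i (g k) x)^2)"
        by (simp add: inner_vec_def grad_def power2_eq_square)
      finally show "(grad (g k) x \<bullet> h)^2 \<le> (norm h)^2 * (\<Sum>i\<in>UNIV. (pd i (g k) x)^2)"
        by (simp add: power2_norm_eq_inner mult.commute)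
    qed
    also have "\<dots> = (norm h)^2 * (\<Sum>i\<in>UNIV. \<integral>x. (pd i (g k) x)^2 \<partial>lborel)"
      using Lp by (subst Bochner_Integration.integral_mult_right_zero, subst Bochner_Integration.integral_sum) (auto intro: L2_integrable)
    finally show ?thesis .
  qed
  moreover have "(\<lambda>k. (norm h)^2 * (\<Sum>i\<in>UNIV. \<integral>x. (pd i (g k) x)^2 \<partial>lborel)) \<longlonglongrightarrow> (norm h)^2 * (\<Sum>i\<in>UNIV. \<integral>x. (G x $ i)^2 \<partial>lborel)"
    by (intro tendsto_mult tendsto_const tendsto_sum L2lim_norm gp)
  moreover have "(\<lambda>k. \<integral>x. (g k (h + x) - g k x)^2 \<partial>lborel) \<longlonglongrightarrow> (\<integral>x. (f (h + x) - f x)^2 \<partial>lborel)"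
  proof (rule L2lim_norm)
    show "L2lim (\<lambda>k x. g k (h + x) - g k x) (\<lambda>x. f (h + x) - f x)"
      by (rule L2lim_translate_diff[OF gl])
  qed
  ultimately show ?thesis using LIMSEQ_le by blast
qed

lemma translate_L1:
  fixes f :: "real^'n::finite \<Rightarrow> real"
  assumes f: "LW UNIV f G" and K: "\<And>x. x \<notin> K \<Longrightarrow> f x = 0" "bounded K"
    and B: "convex B" "B \<in> sets borel" "bounded B"
  shows "(\<integral>x. indicator {x\<in>B. h + x \<in> B} x * \<bar>f (h + x) - f x\<bar> \<partial>lborel) \<le> norm h * (\<Sum>i\<in>UNIV. \<integral>x. indicator B x * \<bar>G x $ i\<bar> \<partial>lborel)"
proof -
  define g where "g k = conv f (moll (seps k))" for k
  have t: "test_fun UNIV (g k)" for k unfolding g_def by (rule LW_moll_test_fun[OF f K])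
  have gl: "L2lim g f" and gp: "L2lim (\<lambda>k. pd i (g k)) (\<lambda>x. G x $ i)" for i
    using LW_moll[OF f] unfolding g_def by auto
  have Lg: "L2 (g k)" "L2 f" for k using gl by (auto simp: L2lim_def)
  have Lp: "L2 (pd i (g k))" for i k using gp[of i] by (auto simp: L2lim_def)
  let ?S = "{x\<in>B. h + x \<in> B}"
  have Sm: "?S \<in> sets borel"
  proof -
    have "?S = B \<inter> (\<lambda>x. h + x) -` B" by auto
    also have "\<dots> \<in> sets borel" using B(2) measurable_sets[of "\<lambda>x. h + x" borel borel B] by auto
    finally show ?thesis .
  qed
  have Sb: "bounded ?S" by (rule bounded_subset[OF B(3)]) auto
  have "(\<integral>x. indicator ?S x * \<bar>g k (h + x) - g k x\<bar> \<partial>lborel) \<le> norm h * (\<Sum>i\<in>UNIV. \<integral>x. indicator B x * \<bar>pd i (g k) x\<bar> \<partial>lborel)" for k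
  proof -
    have ip: "integrable lborel (\<lambda>x. indicator B x * \<bar>pd i (g k) x\<bar>)" for i
      using integrable_abs[OF L2_local_integrable[OF Lp B(2,3)]] by (simp add: abs_mult)
    have "(\<integral>x. indicator ?S x * \<bar>g k (h + x) - g k x\<bar> \<partial>lborel) \<le> (\<integral>x. indicator B x * \<bar>grad (g k) x \<bullet> h\<bar> \<partial>lborel)"
      by (rule translate_L1_test_fun[OF t B])
    also have "\<dots> \<le> (\<integral>x. norm h * (\<Sum>i\<in>UNIV. indicator B x * \<bar>pd i (g k) x\<bar>) \<partial>lborel)"
    proof (rule integral_mono)
      have "L2 (\<lambda>x. grad (g k) x \<bullet> h)"
        unfolding inner_vec_def grad_def using L2_cmult[OF Lp] by (intro L2_sum) (auto simp: mult.commute)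
      then show "integrable lborel (\<lambda>x. indicator B x * \<bar>grad (g k) x \<bullet> h\<bar>)"
        using integrable_abs[OF L2_local_integrable[OF _ B(2,3)], of "\<lambda>x. grad (g k) x \<bullet> h"] by (simp add: abs_mult)
      show "integrable lborel (\<lambda>x. norm h * (\<Sum>i\<in>UNIV. indicator B x * \<bar>pd i (g k) x\<bar>))"
        by (intro integrable_mult_right Bochner_Integration.integrable_sum ip)
      fix x
      have "\<bar>grad (g k) x \<bullet> h\<bar> \<le> norm (grad (g k) x) * norm h" by (rule Cauchy_Schwarz_ineq2)
      also have "norm (grad (g k) x) \<le> (\<Sum>i\<in>UNIV. \<bar>grad (g k) x $ i\<bar>)" by (rule norm_le_l1_cart)
      finally have "\<bar>grad (g k) x \<bullet> h\<bar> \<le> norm h * (\<Sum>i\<in>UNIV. \<bar>pd i (g k) x\<bar>)"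
        by (simp add: grad_def mult_right_mono mult.commute)
      then show "indicator B x * \<bar>grad (g k) x \<bullet> h\<bar> \<le> norm h * (\<Sum>i\<in>UNIV. indicator B x * \<bar>pd i (g k) x\<bar>)"
        by (cases "x \<in> B") auto
    qed
    also have "\<dots> = norm h * (\<Sum>i\<in>UNIV. \<integral>x. indicator B x * \<bar>pd i (g k) x\<bar> \<partial>lborel)"
      using ip by (subst Bochner_Integration.integral_mult_right_zero, subst Bochner_Integration.integral_sum) auto
    finally show ?thesis .
  qed
  moreover have "(\<lambda>k. norm h * (\<Sum>i\<in>UNIV. \<integral>x. indicator B x * \<bar>pd i (g k) x\<bar> \<partial>lborel)) \<longlonglongrightarrow> norm h * (\<Sum>i\<in>UNIV. \<integral>x. indicator B x * \<bar>G x $ i\<bar> \<partial>lborel)"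
    by (intro tendsto_mult tendsto_const tendsto_sum L2lim_L1_on gp B)
  moreover have "(\<lambda>k. \<integral>x. indicator ?S x * \<bar>g k (h + x) - g k x\<bar> \<partial>lborel) \<longlonglongrightarrow> (\<integral>x. indicator ?S x * \<bar>f (h + x) - f x\<bar> \<partial>lborel)"
  proof (rule L2lim_L1_on[OF _ Sm Sb])
    show "L2lim (\<lambda>k x. g k (h + x) - g k x) (\<lambda>x. f (h + x) - f x)"
      by (rule L2lim_translate_diff[OF gl])
  qed
  ultimately show ?thesis using LIMSEQ_le by blast
qed

section \<open>Averaging over translations: Faber--Krahn and isoperimetry\<close>

lemma emeasure_lborel_translate:
  fixes A :: "'a::euclidean_space set"
  assumes [measurable]: "A \<in> sets borel"
  shows "emeasure lborel ((\<lambda>h. h + x) -` A) = emeasure lborel A" "(\<lambda>h. h + x) -` A \<in> sets borel"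
proof -
  show m: "(\<lambda>h. h + x) -` A \<in> sets borel"
    using measurable_sets[of "\<lambda>h. h + x" borel borel A] assms by simp
  have "emeasure lborel A = emeasure (distr lborel borel ((+) x)) A" by (simp add: lborel_distr_plus)
  also have "\<dots> = emeasure lborel ((+) x -` A)" by (subst emeasure_distr) auto
  also have "(+) x -` A = (\<lambda>h. h + x) -` A" by (auto simp: add.commute)
  finally show "emeasure lborel ((\<lambda>h. h + x) -` A) = emeasure lborel A" by simp
qed

lemma L2_norm_square:
  fixes G :: "real^'n::finite \<Rightarrow> real^'n"
  assumes "\<And>i. L2 (\<lambda>x. G x $ i)"
  shows "integrable lborel (\<lambda>x. (norm (G x))^2)"
    "(\<integral>x. (norm (G x))^2 \<partial>lborel) = (\<Sum>i\<in>UNIV. \<integral>x. (G x $ i)^2 \<partial>lborel)"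
proof -
  have eq: "(\<lambda>x. (norm (G x))^2) = (\<lambda>x. \<Sum>i\<in>UNIV. (G x $ i)^2)"
    unfolding power2_norm_eq_inner inner_vec_def by (simp add: power2_eq_square)
  show "integrable lborel (\<lambda>x. (norm (G x))^2)" unfolding eq
    by (intro Bochner_Integration.integrable_sum L2_integrable assms)
  show "(\<integral>x. (norm (G x))^2 \<partial>lborel) = (\<Sum>i\<in>UNIV. \<integral>x. (G x $ i)^2 \<partial>lborel)" unfolding eq
    by (intro Bochner_Integration.integral_sum L2_integrable assms)
qed

text \<open>Averaging the translation estimate over a cube $Q$ of side $d$: for every $x$, at least half of the
  translates $x + h$, $h \<in> Q$, lie outside the support.\<close>

lemma faber_krahn:
  fixes w :: "real^'n::finite \<Rightarrow> real"
  assumes w: "LW UNIV w W" and K: "\<And>x. x \<notin> K \<Longrightarrow> w x = 0" "bounded K"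
    and A: "A \<in> sets borel" "\<And>x. x \<notin> A \<Longrightarrow> w x = 0" "emeasure lborel A < \<infinity>"
    and d: "0 < d" "2 * measure lborel A \<le> d ^ CARD('n)"
  shows "(\<integral>x. (w x)^2 \<partial>lborel) \<le> 2 * real CARD('n) * d^2 * (\<integral>x. (norm (W x))^2 \<partial>lborel)"
proof -
  define S where "S = (\<integral>x. (norm (W x))^2 \<partial>lborel)"
  have S: "0 \<le> S" by (simp add: S_def)
  define Q where "Q = cbox (0::real^'n) (\<chi> i. d)"
  have Q [measurable]: "Q \<in> sets borel" by (simp add: Q_def)
  have "cbox (0::real^'n) (\<chi> i. d) \<noteq> {}" using d(1) using mem_box_cart(2)[of 0 0 "\<chi> i. d"] by (auto simp del: mem_box)
  then have mQ: "measure lborel Q = d ^ CARD('n)"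
    unfolding Q_def by (simp add: content_cbox_cart)
  have eQ: "emeasure lborel Q = ennreal (d ^ CARD('n))"
    using emeasure_eq_ennreal_measure[of lborel Q] emeasure_lborel_cbox_finite[of "0::real^'n" "\<chi> i. d"]
    by (simp add: Q_def[symmetric] mQ less_top)
  have Lw: "L2 w" and LW': "L2 (\<lambda>x. W x $ i)" for i using LW_D[OF w] by auto
  have wm [measurable]: "w \<in> borel_measurable borel" by (rule L2_borel[OF Lw])
  define n where "n = real CARD('n)"
  \<comment> \<open>This is the origin of the factor \<open>CARD('n)\<close> times d^2; the factor 2
    of the result pays for the half of \<open>Q\<close> on which x + h may lie in
    \<open>A\<close>.\<close>
  have hQ: "(norm h)^2 \<le> n * d^2" if "h \<in> Q" for h
  proof -
    have "(norm h)^2 = (\<Sum>i\<in>UNIV. (h $ i)^2)"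
      unfolding power2_norm_eq_inner inner_vec_def by (simp add: power2_eq_square)
    also have "\<dots> \<le> (\<Sum>i\<in>(UNIV::'n set). d^2)"
    proof (rule sum_mono)
      fix i
      have "0 \<le> h $ i" "h $ i \<le> d" using that by (auto simp: Q_def mem_box_cart)
      then show "(h $ i)^2 \<le> d^2" by (simp add: power_mono)
    qed
    finally show ?thesis by (simp add: n_def)
  qed
  have up: "(\<integral>\<^sup>+h. (\<integral>\<^sup>+x. ennreal (indicator Q h * (w (h + x) - w x)^2) \<partial>lborel) \<partial>lborel) \<le> ennreal (d ^ CARD('n) * (n * d^2 * S))"
  proof -
    have "(\<integral>\<^sup>+x. ennreal (indicator Q h * (w (h + x) - w x)^2) \<partial>lborel) \<le> ennreal (n * d^2 * S) * indicator Q h" for h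
    proof (cases "h \<in> Q")
      case True
      have i: "integrable lborel (\<lambda>x. (w (h + x) - w x)^2)" by (intro L2_integrable L2_diff L2_translate Lw)
      have "(\<integral>\<^sup>+x. ennreal (indicator Q h * (w (h + x) - w x)^2) \<partial>lborel) = ennreal (\<integral>x. (w (h + x) - w x)^2 \<partial>lborel)"
        using nn_integral_eq_integral[OF i] True by simp
      also have "\<dots> \<le> ennreal ((norm h)^2 * S)"
        using translate_L2[OF w K, of h] unfolding S_def L2_norm_square(2)[OF LW'] by (rule ennreal_leI)
      also have "\<dots> \<le> ennreal (n * d^2 * S)" using hQ[OF True] S by (intro ennreal_leI mult_right_mono)
      finally show ?thesis using True by simp
    qed simp
    then have "(\<integral>\<^sup>+h. (\<integral>\<^sup>+x. ennreal (indicator Q h * (w (h + x) - w x)^2) \<partial>lborel) \<partial>lborel) \<le> (\<integral>\<^sup>+h. ennreal (n * d^2 * S) * indicator Q h \<partial>lborel)"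
      by (rule nn_integral_mono)
    also have "\<dots> = ennreal (n * d^2 * S) * emeasure lborel Q" by (subst nn_integral_cmult_indicator) auto
    also have "\<dots> = ennreal (d ^ CARD('n) * (n * d^2 * S))"
      unfolding eQ using S d(1) by (subst ennreal_mult'[symmetric]) (auto simp: n_def mult_ac)
    finally show ?thesis .
  qed
  have low: "ennreal (d ^ CARD('n) / 2) * (\<integral>\<^sup>+x. ennreal ((w x)^2) \<partial>lborel) \<le> (\<integral>\<^sup>+x. (\<integral>\<^sup>+h. ennreal (indicator Q h * (w (h + x) - w x)^2) \<partial>lborel) \<partial>lborel)"
  proof -
    have "ennreal (d ^ CARD('n) / 2) * ennreal ((w x)^2) \<le> (\<integral>\<^sup>+h. ennreal (indicator Q h * (w (h + x) - w x)^2) \<partial>lborel)" for x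
    proof -
      define A' where "A' = (\<lambda>h. h + x) -` A"
      have A' [measurable]: "A' \<in> sets borel" and eA': "emeasure lborel A' = emeasure lborel A"
        unfolding A'_def using emeasure_lborel_translate[OF A(1)] by auto
      have "ennreal (d ^ CARD('n) / 2) \<le> ennreal (d ^ CARD('n) - measure lborel A)"
        using d(2) by (intro ennreal_leI) simp
      also have "\<dots> = emeasure lborel Q - emeasure lborel A'"
        unfolding eQ eA' using A(3) by (subst emeasure_eq_ennreal_measure[of lborel A]) (auto simp: ennreal_minus)
      also have "\<dots> \<le> emeasure lborel (Q - A')"
      proof -
        have "emeasure lborel Q \<le> emeasure lborel ((Q - A') \<union> A')" by (intro emeasure_mono) auto
        also have "\<dots> \<le> emeasure lborel (Q - A') + emeasure lborel A'" by (rule emeasure_subadditive) auto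
        finally have "emeasure lborel Q \<le> emeasure lborel A' + emeasure lborel (Q - A')" by (simp add: add.commute)
        then show ?thesis using eA' A(3) by (subst ennreal_minus_le_iff) auto
      qed
      finally have "ennreal (d ^ CARD('n) / 2) \<le> emeasure lborel (Q - A')" .
      then have "ennreal (d ^ CARD('n) / 2) * ennreal ((w x)^2) \<le> ennreal ((w x)^2) * emeasure lborel (Q - A')"
        by (subst mult.commute) (rule mult_left_mono, auto)
      also have "\<dots> = (\<integral>\<^sup>+h. ennreal ((w x)^2) * indicator (Q - A') h \<partial>lborel)"
        by (subst nn_integral_cmult_indicator) auto
      also have "\<dots> \<le> (\<integral>\<^sup>+h. ennreal (indicator Q h * (w (h + x) - w x)^2) \<partial>lborel)"
      proof (rule nn_integral_mono)
        fix h
        show "ennreal ((w x)^2) * indicator (Q - A') h \<le> ennreal (indicator Q h * (w (h + x) - w x)^2)"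
          using A(2)[of "h + x"] by (cases "h \<in> Q - A'") (auto simp: A'_def)
      qed
      finally show ?thesis .
    qed
    then have "(\<integral>\<^sup>+x. ennreal (d ^ CARD('n) / 2) * ennreal ((w x)^2) \<partial>lborel) \<le> (\<integral>\<^sup>+x. (\<integral>\<^sup>+h. ennreal (indicator Q h * (w (h + x) - w x)^2) \<partial>lborel) \<partial>lborel)"
      by (rule nn_integral_mono)
    then show ?thesis by (subst (asm) nn_integral_cmult) auto
  qed
  have "(\<integral>\<^sup>+x. (\<integral>\<^sup>+h. ennreal (indicator Q h * (w (h + x) - w x)^2) \<partial>lborel) \<partial>lborel) =
    (\<integral>\<^sup>+h. (\<integral>\<^sup>+x. ennreal (indicator Q h * (w (h + x) - w x)^2) \<partial>lborel) \<partial>lborel)"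
    by (rule lborel_pair.Fubini') measurable
  with up low have "ennreal (d ^ CARD('n) / 2) * (\<integral>\<^sup>+x. ennreal ((w x)^2) \<partial>lborel) \<le> ennreal (d ^ CARD('n) * (n * d^2 * S))"
    by simp
  also have "(\<integral>\<^sup>+x. ennreal ((w x)^2) \<partial>lborel) = ennreal (\<integral>x. (w x)^2 \<partial>lborel)"
    by (rule nn_integral_eq_integral[OF L2_integrable[OF Lw]]) simp
  finally have "d ^ CARD('n) / 2 * (\<integral>x. (w x)^2 \<partial>lborel) \<le> d ^ CARD('n) * (n * d^2 * S)"
    using d(1) S by (simp add: ennreal_mult'[symmetric] ennreal_le_iff n_def)
  then have "d ^ CARD('n) * (\<integral>x. (w x)^2 \<partial>lborel) \<le> d ^ CARD('n) * (2 * n * d^2 * S)" by simp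
  then show ?thesis using d(1) by (simp add: n_def S_def)
qed

text \<open>Clamp f between k and l. Any pair consisting of a point below k and a point above l
  contributes exactly l - k to the increment of the clamped function, so integrating over pairs
  yields the product of the two measures. The L1 translation estimate with norm h below 2 R bounds
  the same double integral, and the gradient of the clamped function lives only on the layer between
  the levels.\<close>

lemma isoperimetric:
  fixes f :: "real^'n::finite \<Rightarrow> real"
  assumes f: "LW (ball c R') f G" and R: "0 < R" "R < R'" and kl: "k < l"
  shows "(l - k) * measure lborel ({x. f x \<le> k} \<inter> ball c R) * measure lborel ({x. l < f x} \<inter> ball c R)
    \<le> 2 * R * measure lborel (ball (0::real^'n) (2 * R)) *
       (\<Sum>i\<in>UNIV. \<integral>x. indicator ({x. k < f x \<and> f x \<le> l} \<inter> ball c R) x * \<bar>G x $ i\<bar> \<partial>lborel)"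
proof -
  obtain \<zeta> where z: "test_fun (ball c R') \<zeta>" "\<And>x. x \<in> ball c R \<Longrightarrow> \<zeta> x = 1"
    using cutoff_exists[OF R] by metis
  have gz: "grad \<zeta> x = 0" if "x \<in> ball c R" for x by (rule grad_locally_const[OF open_ball that z(2)])
  let ?B = "ball c R"
  \<comment> \<open>On \<open>ball c R\<close>, where \<zeta> is 1, this difference of truncations
    is f - k clamped to the interval from 0 to l - k.\<close>
  define w where "w x = \<zeta> x * max 0 (f x - k) + - (\<zeta> x * max 0 (f x - l))" for x
  define W where "W x = ((\<zeta> x * of_bool (k < f x)) *\<^sub>R G x + max 0 (f x - k) *\<^sub>R grad \<zeta> x) + - ((\<zeta> x * of_bool (l < f x)) *\<^sub>R G x + max 0 (f x - l) *\<^sub>R grad \<zeta> x)" for x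
  have w: "LW UNIV w W" unfolding w_def[abs_def] W_def[abs_def]
    by (rule LW_add[OF LW_truncate_cutoff[OF f z(1)] LW_minus[OF LW_truncate_cutoff[OF f z(1)]]])
  have wK: "w x = 0" if "x \<notin> ball c R'" for x
  proof -
    have "x \<notin> tsupport \<zeta>" using z(1) that by (auto simp: test_fun_def)
    then show ?thesis by (simp add: w_def zero_outside_tsupport)
  qed
  have [measurable]: "f \<in> borel_measurable borel" "w \<in> borel_measurable borel"
    using L2_borel[OF LW_D(1)[OF f]] L2_borel[OF LW_D(1)[OF w]] by auto
  have w1: "w x = max 0 (f x - k) - max 0 (f x - l)" if "x \<in> ?B" for x using z(2)[OF that] by (simp add: w_def)
  have W1: "indicator ?B x * \<bar>W x $ i\<bar> = indicator ({x. k < f x \<and> f x \<le> l} \<inter> ?B) x * \<bar>G x $ i\<bar>" for x i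
    using z(2)[of x] gz[of x] kl by (cases "x \<in> ?B") (auto simp: W_def indicator_def)
  define T where "T = (\<Sum>i\<in>UNIV. \<integral>x. indicator ({x. k < f x \<and> f x \<le> l} \<inter> ?B) x * \<bar>G x $ i\<bar> \<partial>lborel)"
  have T0: "0 \<le> T" unfolding T_def by (intro sum_nonneg Bochner_Integration.integral_nonneg) simp
  have tr: "(\<integral>x. indicator {x\<in>?B. h + x \<in> ?B} x * \<bar>w (h + x) - w x\<bar> \<partial>lborel) \<le> norm h * T" for h
    using translate_L1[OF w, of "ball c R'" ?B h] wK by (simp add: W1 T_def del: mem_ball)
  define D where "D = {x. f x \<le> k} \<inter> ?B"
  define E where "E = {x. l < f x} \<inter> ?B"
  have DE [measurable]: "D \<in> sets borel" "E \<in> sets borel" unfolding D_def E_def by measurable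
  have fin: "emeasure lborel X = ennreal (measure lborel X)" if "X \<subseteq> ?B" "X \<in> sets borel" for X
  proof (rule emeasure_eq_ennreal_measure)
    have "emeasure lborel X \<le> emeasure lborel ?B" using that by (intro emeasure_mono) auto
    also have "\<dots> < \<infinity>" by (rule emeasure_lborel_ball_finite)
    finally show "emeasure lborel X \<noteq> top" by simp
  qed
  \<comment> \<open>Pairs are parametrised by the point x and the increment h; two points of
    \<open>ball c R\<close> differ by less than 2 R, so the first indicator loses nothing and makes
    the range of h finite in measure.\<close>
  define \<Phi> where "\<Phi> h x = ennreal (indicator (ball (0::real^'n) (2 * R)) h * (indicator ?B x * (indicator ?B (h + x) * \<bar>w (h + x) - w x\<bar>)))" for h x
  have up: "(\<integral>\<^sup>+h. (\<integral>\<^sup>+x. \<Phi> h x \<partial>lborel) \<partial>lborel) \<le> ennreal (2 * R * measure lborel (ball (0::real^'n) (2 * R)) * T)"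
  proof -
    have le: "(\<integral>\<^sup>+x. \<Phi> h x \<partial>lborel) \<le> ennreal (2 * R * T) * indicator (ball (0::real^'n) (2 * R)) h" for h
    proof (cases "h \<in> ball 0 (2 * R)")
      case True
      have "{x\<in>?B. h + x \<in> ?B} = ?B \<inter> (\<lambda>x. x + h) -` ?B" by (auto simp: add.commute)
      also have "\<dots> \<in> sets borel" using emeasure_lborel_translate(2)[of ?B h] by (intro sets.Int) auto
      finally have S: "{x\<in>?B. h + x \<in> ?B} \<in> sets borel" .
      have "integrable lborel (\<lambda>x. \<bar>indicator {x\<in>?B. h + x \<in> ?B} x * (w (h + x) - w x)\<bar>)"
        by (intro integrable_abs L2_local_integrable L2_diff L2_translate LW_D(1)[OF w] S bounded_subset[OF bounded_ball[of c R]]) auto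
      then have i: "integrable lborel (\<lambda>x. indicator {x\<in>?B. h + x \<in> ?B} x * \<bar>w (h + x) - w x\<bar>)"
        by (simp add: abs_mult)
      have "(\<integral>\<^sup>+x. \<Phi> h x \<partial>lborel) = (\<integral>\<^sup>+x. ennreal (indicator {x\<in>?B. h + x \<in> ?B} x * \<bar>w (h + x) - w x\<bar>) \<partial>lborel)"
        unfolding \<Phi>_def using True by (intro nn_integral_cong) (auto simp: indicator_def)
      also have "\<dots> = ennreal (\<integral>x. indicator {x\<in>?B. h + x \<in> ?B} x * \<bar>w (h + x) - w x\<bar> \<partial>lborel)"
        by (rule nn_integral_eq_integral[OF i]) simp
      also have "\<dots> \<le> ennreal (2 * R * T)"
      proof (rule ennreal_leI[OF order_trans[OF tr]])
        show "norm h * T \<le> 2 * R * T" using True T0 by (intro mult_right_mono) auto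
      qed
      finally show ?thesis using True by simp
    qed (simp add: \<Phi>_def)
    have "(\<integral>\<^sup>+h. (\<integral>\<^sup>+x. \<Phi> h x \<partial>lborel) \<partial>lborel) \<le> (\<integral>\<^sup>+h. ennreal (2 * R * T) * indicator (ball (0::real^'n) (2 * R)) h \<partial>lborel)"
      by (rule nn_integral_mono) (rule le)
    also have "\<dots> = ennreal (2 * R * T) * emeasure lborel (ball (0::real^'n) (2 * R))"
      by (subst nn_integral_cmult_indicator) auto
    also have "emeasure lborel (ball (0::real^'n) (2 * R)) = ennreal (measure lborel (ball (0::real^'n) (2 * R)))"
      using emeasure_lborel_ball_finite[of "0::real^'n" "2 * R"] by (intro emeasure_eq_ennreal_measure) auto
    finally show ?thesis using T0 R(1) by (subst (asm) ennreal_mult'[symmetric]) (auto simp: mult_ac)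
  qed
  have low: "ennreal ((l - k) * measure lborel D * measure lborel E) \<le> (\<integral>\<^sup>+x. (\<integral>\<^sup>+h. \<Phi> h x \<partial>lborel) \<partial>lborel)"
  proof -
    have le: "ennreal ((l - k) * measure lborel E) * indicator D x \<le> (\<integral>\<^sup>+h. \<Phi> h x \<partial>lborel)" for x
    proof (cases "x \<in> D")
      case True
      define E' where "E' = (\<lambda>h. h + x) -` E"
      have E' [measurable]: "E' \<in> sets borel" and eE': "emeasure lborel E' = emeasure lborel E"
        unfolding E'_def using emeasure_lborel_translate[OF DE(2)] by auto
      have "ennreal ((l - k) * measure lborel E) = ennreal (l - k) * emeasure lborel E'"
        unfolding eE' using fin[of E] kl by (simp add: E_def[symmetric] ennreal_mult) (simp add: E_def ennreal_mult)
      also have "\<dots> = (\<integral>\<^sup>+h. ennreal (l - k) * indicator E' h \<partial>lborel)"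
        by (subst nn_integral_cmult_indicator) auto
      also have "\<dots> \<le> (\<integral>\<^sup>+h. \<Phi> h x \<partial>lborel)"
      proof (rule nn_integral_mono)
        fix h
        show "ennreal (l - k) * indicator E' h \<le> \<Phi> h x"
        proof (cases "h \<in> E'")
          case h: True
          have 1: "x \<in> ?B" "h + x \<in> ?B" "f x \<le> k" "l < f (h + x)" using True h by (auto simp: D_def E_def E'_def)
          have "norm h \<le> dist c x + dist c (h + x)"
            using dist_triangle3[of x "h + x" c] by (simp add: dist_norm norm_minus_commute)
          then have "h \<in> ball 0 (2 * R)" using 1 by auto
          moreover have "\<bar>w (h + x) - w x\<bar> = l - k" using w1[OF 1(1)] w1[OF 1(2)] 1(3,4) kl by simp
          ultimately show ?thesis using 1(1,2) h by (simp add: \<Phi>_def)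
        qed simp
      qed
      finally show ?thesis using True by simp
    qed simp
    have "(\<integral>\<^sup>+x. ennreal ((l - k) * measure lborel E) * indicator D x \<partial>lborel) \<le> (\<integral>\<^sup>+x. (\<integral>\<^sup>+h. \<Phi> h x \<partial>lborel) \<partial>lborel)"
      by (rule nn_integral_mono) (rule le)
    moreover have "(\<integral>\<^sup>+x. ennreal ((l - k) * measure lborel E) * indicator D x \<partial>lborel) = ennreal ((l - k) * measure lborel D * measure lborel E)"
      using fin[of D] kl by (subst nn_integral_cmult_indicator) (auto simp: D_def ennreal_mult mult_ac)
    ultimately show ?thesis by simp
  qed
  have "(\<integral>\<^sup>+x. (\<integral>\<^sup>+h. \<Phi> h x \<partial>lborel) \<partial>lborel) = (\<integral>\<^sup>+h. (\<integral>\<^sup>+x. \<Phi> h x \<partial>lborel) \<partial>lborel)"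
  proof (rule lborel_pair.Fubini')
    have M: "(\<lambda>(h, x). ennreal (indicator X h * (indicator Y x * (indicator Y (h + x) * \<bar>w (h + x) - w x\<bar>)))) \<in> borel_measurable (lborel \<Otimes>\<^sub>M lborel)"
      if [measurable]: "X \<in> sets borel" "Y \<in> sets borel" for X Y :: "(real^'n) set"
      by measurable
    show "case_prod \<Phi> \<in> borel_measurable (lborel \<Otimes>\<^sub>M lborel)" unfolding \<Phi>_def by (rule M) auto
  qed
  with up low have "ennreal ((l - k) * measure lborel D * measure lborel E) \<le> ennreal (2 * R * measure lborel (ball (0::real^'n) (2 * R)) * T)"
    by simp
  then show ?thesis using T0 R(1) by (subst (asm) ennreal_le_iff) (auto simp: D_def E_def T_def)
qed

section \<open>Sobolev spaces and local minimality\<close>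

text \<open>The bridge between the completed measure, in which Sobolev functions and minimality are
  formulated, and Borel versions.\<close>

lemma lebesgue_lborel_AE:
  fixes F f :: "'a::euclidean_space \<Rightarrow> real"
  assumes F: "F \<in> borel_measurable borel" and ae: "AE x in lborel. F x = f x"
  shows "f \<in> borel_measurable lebesgue" "integral\<^sup>L lebesgue f = integral\<^sup>L lborel F"
    "integrable lebesgue f \<longleftrightarrow> integrable lborel F"
proof -
  have Fl: "F \<in> borel_measurable lebesgue" using F by (simp add: measurable_completion)
  have ae': "AE x in lebesgue. F x = f x" by (rule AE_completion[OF ae])
  show fm: "f \<in> borel_measurable lebesgue" by (rule borel_measurable_AE[OF Fl ae'])
  show "integral\<^sup>L lebesgue f = integral\<^sup>L lborel F"
    using integral_cong_AE[OF Fl fm ae'] integral_completion[of F lborel] F by simp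
  show "integrable lebesgue f \<longleftrightarrow> integrable lborel F"
    using integrable_cong_AE[OF Fl fm ae'] integrable_completion[of F lborel] F by simp
qed

lemma LW_weak_grad:
  fixes f :: "real^'n::finite \<Rightarrow> real"
  assumes f: "LW U f G" and U: "open U"
  shows "weak_grad U f G"
proof -
  note L = LW_D[OF f]
  have Ub: "U \<in> sets borel" using U by simp
  have [measurable]: "f \<in> borel_measurable borel" "(\<lambda>x. G x $ i) \<in> borel_measurable borel" for i
    using L(1) L(2)[of i] by (auto simp: L2_def)
  have leb: "g \<in> borel_measurable (lebesgue_on U)" if "g \<in> borel_measurable borel" for g :: "real^'n \<Rightarrow> real"
    using that by (intro measurable_restrict_space1) (simp add: measurable_completion)
  have si: "set_integrable lebesgue U g" if "integrable lborel g" for g :: "real^'n \<Rightarrow> real"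
  proof -
    have [measurable]: "g \<in> borel_measurable borel" using that by auto
    have "integrable lborel (\<lambda>x. indicator U x *\<^sub>R g x)"
      using integrable_mult_indicator[OF _ that, of U] Ub by simp
    then show ?thesis unfolding set_integrable_def using Ub
      by (subst lebesgue_lborel_AE(3)[of "\<lambda>x. indicator U x *\<^sub>R g x"]) auto
  qed
  have sl: "(LINT x:U|lebesgue. g x) = (\<integral>x. g x \<partial>lborel)"
    if "g \<in> borel_measurable borel" "\<And>x. x \<notin> U \<Longrightarrow> g x = 0" for g :: "real^'n \<Rightarrow> real"
  proof -
    have "(\<lambda>x. indicator U x *\<^sub>R g x) = g" using that(2) by (auto simp: indicator_def fun_eq_iff)
    then show ?thesis unfolding set_lebesgue_integral_def using lebesgue_lborel_AE(2)[OF that(1), of g] by simp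
  qed
  show ?thesis unfolding weak_grad_def
  proof (intro conjI allI impI)
    fix \<phi> i assume t: "test_fun U \<phi>"
    have [measurable]: "\<phi> \<in> borel_measurable borel" "pd i \<phi> \<in> borel_measurable borel"
      using smooth_borel[OF test_fun_smooth[OF t]] smooth_borel[OF smooth_pd[OF test_fun_smooth[OF t]]] by auto
    have z: "\<phi> x = 0" "pd i \<phi> x = 0" if "x \<notin> U" for x
    proof -
      have "x \<notin> tsupport \<phi>" using t that by (auto simp: test_fun_def)
      then show "\<phi> x = 0" "pd i \<phi> x = 0" by (auto simp: zero_outside_tsupport pd_zero_outside)
    qed
    show "(LINT x:U|lebesgue. f x * pd i \<phi> x) = - (LINT x:U|lebesgue. G x $ i * \<phi> x)"
      using L(3)[OF t, of i] by (subst (1 2) sl) (auto simp: z)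
  next
    show "f \<in> borel_measurable (lebesgue_on U)" by (rule leb) simp
    show "(\<lambda>x. G x $ i) \<in> borel_measurable (lebesgue_on U)" for i by (rule leb) simp
    show "set_integrable lebesgue U (\<lambda>x. (f x)^2)" by (rule si[OF L2_integrable[OF L(1)]])
    show "set_integrable lebesgue U (\<lambda>x. (norm (G x))^2)" by (rule si[OF L2_norm_square(1)[OF L(2)]])
  qed
qed

text \<open>Borel versions exist by completion, and they are set to 0 outside \<open>U\<close>; this
  makes the square integrability over \<open>U\<close> a global one, as \<open>LW\<close>
  demands.\<close>

lemma weak_grad_LW:
  fixes u :: "real^'n::finite \<Rightarrow> real"
  assumes u: "weak_grad U u g" and U: "open U"
  obtains f G where "LW U f G" "AE x in lborel. x \<in> U \<longrightarrow> f x = u x \<and> G x = g x"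
proof -
  have Ub [measurable]: "U \<in> sets borel" using U by simp
  have ex: "\<exists>h. h \<in> borel_measurable borel \<and> (\<forall>x. x \<notin> U \<longrightarrow> h x = 0) \<and> (AE x in lborel. h x = indicator U x * v x)"
    if "v \<in> borel_measurable (lebesgue_on U)" for v :: "real^'n \<Rightarrow> real"
  proof -
    have "U \<inter> space lebesgue \<in> sets lebesgue" using Ub by simp
    from that have "(\<lambda>x. indicator U x *\<^sub>R v x) \<in> borel_measurable lebesgue"
      by (subst (asm) borel_measurable_restrict_space_iff[OF \<open>U \<inter> space lebesgue \<in> sets lebesgue\<close>])
    then obtain h where h: "h \<in> borel_measurable lborel" "AE x in lborel. indicator U x *\<^sub>R v x = h x"
      using completion_ex_borel_measurable_real by blast
    then have [measurable]: "h \<in> borel_measurable borel" by simp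
    have "(\<lambda>x. indicator U x * h x) \<in> borel_measurable borel" by measurable
    moreover have "AE x in lborel. indicator U x * h x = indicator U x * v x"
      using h(2) by eventually_elim (auto simp: indicator_def split: if_splits)
    ultimately show ?thesis by (intro exI[of _ "\<lambda>x. indicator U x * h x"]) auto
  qed
  obtain f where f: "f \<in> borel_measurable borel" "\<And>x. x \<notin> U \<Longrightarrow> f x = 0" "AE x in lborel. f x = indicator U x * u x"
    using ex[of u] u by (auto simp: weak_grad_def)
  have "\<forall>i. \<exists>h. h \<in> borel_measurable borel \<and> (\<forall>x. x \<notin> U \<longrightarrow> h x = 0) \<and> (AE x in lborel. h x = indicator U x * g x $ i)"
    using ex u by (auto simp: weak_grad_def)
  then obtain H where H: "\<And>i. H i \<in> borel_measurable borel" "\<And>i x. x \<notin> U \<Longrightarrow> H i x = 0"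
    "\<And>i. AE x in lborel. H i x = indicator U x * g x $ i" by metis
  define G where "G x = (\<chi> i. H i x)" for x
  have Gi: "G x $ i = H i x" for x i by (simp add: G_def)
  note [measurable] = f(1) H(1)
  have Hall: "AE x in lborel. \<forall>i\<in>UNIV. H i x = indicator U x * g x $ i" by (intro AE_finite_allI) (auto simp: H)
  have L2f: "L2 f"
  proof -
    have ae: "AE x in lborel. (f x)^2 = indicator U x *\<^sub>R (u x)^2"
      using f(3) by eventually_elim (auto simp: indicator_def)
    have "integrable lebesgue (\<lambda>x. indicator U x *\<^sub>R (u x)^2)"
      using u unfolding weak_grad_def set_integrable_def by blast
    with lebesgue_lborel_AE(3)[OF _ ae] have "integrable lborel (\<lambda>x. (f x)^2)" by simp
    then show ?thesis by (simp add: L2_def)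
  qed
  have L2H: "L2 (H i)" for i
  proof -
    have ae: "AE x in lborel. (\<Sum>i\<in>UNIV. (H i x)^2) = indicator U x *\<^sub>R (norm (g x))^2"
      using Hall unfolding power2_norm_eq_inner inner_vec_def
      by eventually_elim (auto simp: indicator_def power2_eq_square)
    have "integrable lebesgue (\<lambda>x. indicator U x *\<^sub>R (norm (g x))^2)"
      using u unfolding weak_grad_def set_integrable_def by blast
    with lebesgue_lborel_AE(3)[OF _ ae] have I: "integrable lborel (\<lambda>x. \<Sum>i\<in>UNIV. (H i x)^2)" by simp
    have "integrable lborel (\<lambda>x. (H i x)^2)"
    proof (rule Bochner_Integration.integrable_bound[OF I])
      show "AE x in lborel. norm ((H i x)^2) \<le> norm (\<Sum>i\<in>UNIV. (H i x)^2)"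
        using member_le_sum[of i UNIV "\<lambda>i. (H i x)^2" for x] by (auto simp: sum_nonneg)
    qed simp
    then show ?thesis by (simp add: L2_def H)
  qed
  have lw: "LW U f G" unfolding LW_def Gi
  proof (intro conjI allI impI L2f L2H)
    fix \<phi> i assume t: "test_fun U \<phi>"
    have [measurable]: "\<phi> \<in> borel_measurable borel" "pd i \<phi> \<in> borel_measurable borel"
      using smooth_borel[OF test_fun_smooth[OF t]] smooth_borel[OF smooth_pd[OF test_fun_smooth[OF t]]] by auto
    have 1: "AE x in lborel. f x * pd i \<phi> x = indicator U x *\<^sub>R (u x * pd i \<phi> x)"
      using f(3) by eventually_elim simp
    have 2: "AE x in lborel. H i x * \<phi> x = indicator U x *\<^sub>R (g x $ i * \<phi> x)"
      using H(3)[of i] by eventually_elim simp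
    have "(LINT x:U|lebesgue. u x * pd i \<phi> x) = - (LINT x:U|lebesgue. g x $ i * \<phi> x)"
      using u t unfolding weak_grad_def by blast
    then show "(\<integral>x. f x * pd i \<phi> x \<partial>lborel) = - (\<integral>x. H i x * \<phi> x \<partial>lborel)"
      unfolding set_lebesgue_integral_def
      using lebesgue_lborel_AE(2)[OF _ 1] lebesgue_lborel_AE(2)[OF _ 2] by simp
  qed
  have "AE x in lborel. x \<in> U \<longrightarrow> f x = u x \<and> G x = g x"
    using f(3) Hall by eventually_elim (auto simp: vec_eq_iff Gi)
  with lw show ?thesis by (rule that)
qed

text \<open>\<open>wgrad\<close> is a choice among all weak gradients; this is how any concretely
  computed gradient is identified with the chosen one.\<close>

lemma LW_weak_grad_unique:
  fixes f :: "real^'n::finite \<Rightarrow> real"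
  assumes f: "LW U f F" and u: "weak_grad U u g" and U: "open U"
    and eq: "AE x in lborel. x \<in> U \<longrightarrow> f x = u x"
  shows "AE x in lborel. x \<in> U \<longrightarrow> F x = g x"
proof -
  obtain f' G where G: "LW U f' G" "AE x in lborel. x \<in> U \<longrightarrow> f' x = u x \<and> G x = g x"
    using weak_grad_LW[OF u U] .
  have ff: "AE x in lborel. x \<in> U \<longrightarrow> f x = f' x" using eq G(2) by eventually_elim auto
  have [measurable]: "f \<in> borel_measurable borel" "f' \<in> borel_measurable borel"
    using LW_D(1)[OF f] LW_D(1)[OF G(1)] by (auto simp: L2_def)
  have "LW U f G" unfolding LW_def
  proof (intro conjI allI impI LW_D(1)[OF f] LW_D(2)[OF G(1)])
    fix \<phi> i assume t: "test_fun U \<phi>"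
    have [measurable]: "pd i \<phi> \<in> borel_measurable borel" by (rule smooth_borel[OF smooth_pd[OF test_fun_smooth[OF t]]])
    have z: "pd i \<phi> x = 0" if "x \<notin> U" for x using t that pd_zero_outside[of x \<phi>] by (auto simp: test_fun_def)
    have "(\<integral>x. f x * pd i \<phi> x \<partial>lborel) = (\<integral>x. f' x * pd i \<phi> x \<partial>lborel)"
      by (rule integral_cong_AE) (use ff in \<open>auto elim!: eventually_mono simp: z\<close>)
    then show "(\<integral>x. f x * pd i \<phi> x \<partial>lborel) = - (\<integral>x. G x $ i * \<phi> x \<partial>lborel)"
      using LW_D(3)[OF G(1) t] by simp
  qed
  from LW_unique[OF f this U] G(2) show ?thesis by eventually_elim auto
qed

section \<open>Competitors and the minimality inequality\<close>

lemma borel_indicator_mult: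
  fixes h :: "'a::euclidean_space \<Rightarrow> real"
  assumes [measurable]: "A \<in> sets borel" "h \<in> borel_measurable borel"
  shows "(\<lambda>x. indicator A x * h x) \<in> borel_measurable borel"
  by measurable

lemma H1_wgrad: "H1 U u \<Longrightarrow> weak_grad U u (wgrad U u)"
  unfolding H1_def wgrad_def using someI_ex[of "weak_grad U u"] by blast

text \<open>A function supported in a strictly smaller closed ball is approximated by its own
  mollifications, which are test functions of the ball once the scale is below r - r'.\<close>

lemma LW_H10:
  fixes w :: "real^'n::finite \<Rightarrow> real"
  assumes w: "LW UNIV w W" and r: "r' < r" and s: "\<And>x. x \<notin> cball c r' \<Longrightarrow> w x = 0"
  shows "H10 (ball c r) w"
proof -
  let ?B = "ball c r"
  have wB: "LW ?B w W" by (rule LW_mono[OF w]) simp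
  have H: "H1 ?B w" unfolding H1_def using LW_weak_grad[OF wB] by auto
  have wg: "AE x in lborel. x \<in> ?B \<longrightarrow> W x = wgrad ?B w x"
    by (rule LW_weak_grad_unique[OF wB H1_wgrad[OF H]]) auto
  \<comment> \<open>Shifting the index by \<open>k0\<close> makes every mollification radius smaller
    than the gap, so that all terms of the sequence have support in the ball.\<close>
  obtain k0 where k0: "seps k0 < r - r'" using nat_approx_posE[of "r - r'"] r by auto
  define \<phi> where "\<phi> k = conv w (moll (seps (k + k0)))" for k
  have sm: "smooth_fun (\<phi> k)" for k unfolding \<phi>_def by (rule LW_moll(1)[OF w])
  have t: "test_fun ?B (\<phi> k)" for k
  proof (rule test_funI[OF sm compact_cball[of c "r' + seps (k + k0)"]])
    have "seps (k + k0) \<le> seps k0" by (simp add: frac_le)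
    then have e: "r' + seps (k + k0) < r" using k0 by linarith
    then show "cball c (r' + seps (k + k0)) \<subseteq> ?B" by auto
    fix x assume x: "x \<notin> cball c (r' + seps (k + k0))"
    show "\<phi> k x = 0" unfolding \<phi>_def
    proof (rule conv_moll_support)
      fix y assume y: "norm (x - y) \<le> seps (k + k0)"
      have "dist c x \<le> dist c y + norm (x - y)" using dist_triangle2[of c x y] by (simp add: dist_norm)
      then have "y \<notin> cball c r'" using x y by (simp del: of_nat_Suc)
      then show "w y = 0" by (rule s)
    qed simp
  qed
  have l: "(\<lambda>k. \<integral>x. (\<phi> k x - w x)^2 \<partial>lborel) \<longlonglongrightarrow> 0"
    using LW_moll(2)[OF w] unfolding \<phi>_def L2lim_def
    by (intro LIMSEQ_ignore_initial_segment[of "\<lambda>k. \<integral>x. (conv w (moll (seps k)) x - w x)^2 \<partial>lborel"]) auto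
  have lp: "(\<lambda>k. \<integral>x. (pd i (\<phi> k) x - W x $ i)^2 \<partial>lborel) \<longlonglongrightarrow> 0" for i
    using LW_moll(3)[OF w, of i] unfolding \<phi>_def L2lim_def
    by (intro LIMSEQ_ignore_initial_segment[of "\<lambda>k. \<integral>x. (pd i (conv w (moll (seps k))) x - W x $ i)^2 \<partial>lborel"]) auto
  have L: "L2 (\<phi> k)" "L2 (pd i (\<phi> k))" for k i
    by (rule L2_test_fun[OF t]) (rule L2_test_fun[OF test_fun_pd[OF t]])
  have Lw: "L2 w" "L2 (\<lambda>x. W x $ i)" for i using LW_D[OF w] by auto
  have "(\<lambda>k. LINT x:?B|lebesgue. (\<phi> k x - w x)^2) \<longlonglongrightarrow> 0"
  proof (rule squeeze_0[OF l])
    fix k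
    have Ld: "L2 (\<lambda>x. \<phi> k x - w x)" by (intro L2_diff L Lw)
    have [measurable]: "\<phi> k \<in> borel_measurable borel" "w \<in> borel_measurable borel" using L Lw by (auto simp: L2_def)
    have eq: "(LINT x:?B|lebesgue. (\<phi> k x - w x)^2) = (\<integral>x. indicator ?B x * (\<phi> k x - w x)^2 \<partial>lborel)"
      unfolding set_lebesgue_integral_def real_scaleR_def
      by (rule lebesgue_lborel_AE(2)[OF borel_indicator_mult]) simp_all
    show "0 \<le> (LINT x:?B|lebesgue. (\<phi> k x - w x)^2)" unfolding eq by (rule Bochner_Integration.integral_nonneg) simp
    show "(LINT x:?B|lebesgue. (\<phi> k x - w x)^2) \<le> (\<integral>x. (\<phi> k x - w x)^2 \<partial>lborel)"
      unfolding eq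
      by (rule integral_mono[OF integrable_mult_indicator[OF _ L2_integrable[OF Ld], of ?B, unfolded real_scaleR_def] L2_integrable[OF Ld]])
        (auto simp: indicator_def)
  qed
  moreover have "(\<lambda>k. LINT x:?B|lebesgue. (norm (grad (\<phi> k) x - wgrad ?B w x))^2) \<longlonglongrightarrow> 0"
  proof (rule squeeze_0)
    show "(\<lambda>k. \<Sum>i\<in>UNIV. \<integral>x. (pd i (\<phi> k) x - W x $ i)^2 \<partial>lborel) \<longlonglongrightarrow> 0"
    proof -
      have "(\<lambda>k. \<Sum>i\<in>UNIV. \<integral>x. (pd i (\<phi> k) x - W x $ i)^2 \<partial>lborel) \<longlonglongrightarrow> (\<Sum>i\<in>(UNIV::'n set). 0)"
        by (rule tendsto_sum[OF lp])
      then show ?thesis by simp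
    qed
    fix k
    have Lc: "L2 (\<lambda>x. (grad (\<phi> k) x - W x) $ i)" for i
      using L2_diff[OF L(2)[of i k] Lw(2)[of i]] by (simp add: grad_def)
    note I = L2_norm_square[where G="\<lambda>x. grad (\<phi> k) x - W x", OF Lc]
    have [measurable]: "(\<lambda>x. (norm (grad (\<phi> k) x - W x))^2) \<in> borel_measurable borel"
      using borel_measurable_integrable[OF I(1)] by simp
    have eq: "(LINT x:?B|lebesgue. (norm (grad (\<phi> k) x - wgrad ?B w x))^2) = (\<integral>x. indicator ?B x * (norm (grad (\<phi> k) x - W x))^2 \<partial>lborel)"
      unfolding set_lebesgue_integral_def real_scaleR_def
    proof (rule lebesgue_lborel_AE(2)[OF borel_indicator_mult])
      show "AE x in lborel. indicator ?B x * (norm (grad (\<phi> k) x - W x))^2 = indicator ?B x * (norm (grad (\<phi> k) x - wgrad ?B w x))^2"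
        using wg by eventually_elim (auto simp: indicator_def)
    qed simp_all
    show "0 \<le> (LINT x:?B|lebesgue. (norm (grad (\<phi> k) x - wgrad ?B w x))^2)"
      unfolding eq by (rule Bochner_Integration.integral_nonneg) simp
    have "(\<integral>x. indicator ?B x * (norm (grad (\<phi> k) x - W x))^2 \<partial>lborel) \<le> (\<integral>x. (norm (grad (\<phi> k) x - W x))^2 \<partial>lborel)"
      by (rule integral_mono[OF integrable_mult_indicator[OF _ I(1), of ?B, unfolded real_scaleR_def] I(1)])
        (auto simp: indicator_def)
    then show "(LINT x:?B|lebesgue. (norm (grad (\<phi> k) x - wgrad ?B w x))^2) \<le> (\<Sum>i\<in>UNIV. \<integral>x. (pd i (\<phi> k) x - W x $ i)^2 \<partial>lborel)"
      unfolding eq I(2) by (simp add: grad_def)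
  qed
  ultimately show ?thesis unfolding H10_def using H t by blast
qed

text \<open>Convexity of the quadratic form at (1 - z^2) p + z^2 (r / z), with the division cleared
  so that z = 0 is covered.\<close>

lemma quadratic_convexity:
  fixes A :: "real^'n::finite^'n" and p r :: "real^'n"
  assumes psd: "\<And>\<xi>. 0 \<le> \<xi> \<bullet> (A *v \<xi>)" and z: "0 \<le> z" "z \<le> 1"
  shows "(A *v ((1 - z^2) *\<^sub>R p + z *\<^sub>R r)) \<bullet> ((1 - z^2) *\<^sub>R p + z *\<^sub>R r)
    \<le> (1 - z^2) * ((A *v p) \<bullet> p) + (A *v r) \<bullet> r"
proof -
  define pp where "pp = (A *v p) \<bullet> p"
  define pr where "pr = (A *v p) \<bullet> r + (A *v r) \<bullet> p"
  define rr where "rr = (A *v r) \<bullet> r"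
  have q: "(A *v (a *\<^sub>R p + b *\<^sub>R r)) \<bullet> (a *\<^sub>R p + b *\<^sub>R r) = a^2 * pp + a * b * pr + b^2 * rr" for a b
    by (simp add: pp_def pr_def rr_def matrix_vector_right_distrib matrix_vector_mult_scaleR
        inner_add_left inner_add_right power2_eq_square algebra_simps)
  \<comment> \<open>The gap between the two sides is 1 - z^2 times the form at z p - r.\<close>
  have "0 \<le> (A *v (z *\<^sub>R p + (-1) *\<^sub>R r)) \<bullet> (z *\<^sub>R p + (-1) *\<^sub>R r)"
    using psd[of "z *\<^sub>R p + (-1) *\<^sub>R r"] by (simp add: inner_commute)
  then have "0 \<le> z^2 * pp - z * pr + rr" unfolding q by simp
  moreover have "0 \<le> 1 - z^2" using z by (simp add: power_le_one)
  ultimately have "0 \<le> (1 - z^2) * (z^2 * pp - z * pr + rr)" by simp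
  also have "\<dots> = ((1 - z^2) * pp + rr) - ((1 - z^2)^2 * pp + (1 - z^2) * z * pr + z^2 * rr)"
    by (simp add: power2_eq_square algebra_simps)
  finally show ?thesis unfolding q by (simp add: pp_def rr_def)
qed

text \<open>Comparing integrals needs this: a non-integrable integrand would have integral 0 by
  convention, and pointwise inequalities would not pass to integrals.\<close>

lemma AC_integrable:
  fixes f :: "real^'n::finite \<Rightarrow> real"
  assumes el: "elliptic \<Omega> a lam Lam" and lam: "0 < lam" and B: "ball c r \<subseteq> \<Omega>" and O: "open \<Omega>"
    and f: "f \<in> borel_measurable borel" and G: "\<And>i. L2 (\<lambda>x. G x $ i)"
  shows "integrable lebesgue (\<lambda>x. indicator (ball c r) x * AC_integrand a x (f x) (G x))"
proof -
  let ?I = "indicator (ball c r) :: real^'n \<Rightarrow> real"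
  have am: "(\<lambda>x. ?I x * a x $ i $ j) \<in> borel_measurable lebesgue" for i j
  proof -
    have "\<Omega> \<inter> space lebesgue \<in> sets lebesgue" using O by simp
    moreover have "(\<lambda>x. a x $ i $ j) \<in> borel_measurable (lebesgue_on \<Omega>)" using el by (simp add: elliptic_def)
    ultimately have "(\<lambda>x. indicator \<Omega> x *\<^sub>R a x $ i $ j) \<in> borel_measurable lebesgue"
      by (subst (asm) borel_measurable_restrict_space_iff)
    moreover have "?I \<in> borel_measurable lebesgue" by (simp add: borel_measurable_indicator)
    ultimately have "(\<lambda>x. ?I x * (indicator \<Omega> x *\<^sub>R a x $ i $ j)) \<in> borel_measurable lebesgue"
      by (intro borel_measurable_times)
    moreover have "(\<lambda>x. ?I x * (indicator \<Omega> x *\<^sub>R a x $ i $ j)) = (\<lambda>x. ?I x * a x $ i $ j)"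
      using B by (auto simp: indicator_def fun_eq_iff)
    ultimately show ?thesis by simp
  qed
  have Gm: "(\<lambda>x. G x $ i) \<in> borel_measurable lebesgue" for i
    using L2_borel[OF G[of i]] by (simp add: measurable_completion)
  have fm: "(\<lambda>x. if 0 < f x then 1 else 0 :: real) \<in> borel_measurable lebesgue"
  proof -
    note [measurable] = f
    have "(\<lambda>x. if 0 < f x then 1 else 0 :: real) \<in> borel_measurable borel" by measurable
    then show ?thesis by (simp add: measurable_completion)
  qed
  have Im: "?I \<in> borel_measurable lebesgue" by (simp add: borel_measurable_indicator)
  have eq: "?I x * AC_integrand a x (f x) (G x) =
    (1/2) * (\<Sum>i\<in>UNIV. (\<Sum>j\<in>UNIV. (?I x * a x $ i $ j) * G x $ j) * G x $ i) + ?I x * (if 0 < f x then 1 else 0)" for x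
    by (simp add: AC_integrand_def inner_vec_def matrix_vector_mult_def distrib_left sum_distrib_left mult.assoc mult.left_commute)
  have m: "(\<lambda>x. ?I x * AC_integrand a x (f x) (G x)) \<in> borel_measurable lebesgue"
    unfolding eq by (intro borel_measurable_add borel_measurable_times borel_measurable_sum borel_measurable_const am Gm fm Im)
  have iG: "integrable lebesgue (\<lambda>x. (norm (G x))^2)" using L2_norm_square(1)[OF G]
    by (subst integrable_completion) auto
  have iI: "integrable lebesgue ?I"
    using emeasure_lborel_ball_finite[of c r] by (intro integrable_real_indicator) auto
  have "integrable lebesgue (\<lambda>x. (\<bar>Lam\<bar> / 2) * (norm (G x))^2 + ?I x)"
    by (intro Bochner_Integration.integrable_add integrable_mult_right iG iI)
  then show ?thesis
  proof (rule Bochner_Integration.integrable_bound[OF _ m])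
    have "AE x in lebesgue. x \<in> \<Omega> \<longrightarrow> (\<forall>\<xi>. lam * (norm \<xi>)^2 \<le> \<xi> \<bullet> (a x *v \<xi>) \<and> \<xi> \<bullet> (a x *v \<xi>) \<le> Lam * (norm \<xi>)^2)"
      using el unfolding elliptic_def by (auto elim!: eventually_mono)
    then show "AE x in lebesgue. norm (?I x * AC_integrand a x (f x) (G x)) \<le> norm ((\<bar>Lam\<bar> / 2) * (norm (G x))^2 + ?I x)"
    proof eventually_elim
      case (elim x)
      show ?case
      proof (cases "x \<in> ball c r")
        case True
        then have 1: "lam * (norm (G x))^2 \<le> (a x *v G x) \<bullet> G x" "(a x *v G x) \<bullet> G x \<le> Lam * (norm (G x))^2"
          using elim B by (auto simp: inner_commute)
        have "0 \<le> lam * (norm (G x))^2" using lam by simp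
        moreover have "Lam * (norm (G x))^2 \<le> \<bar>Lam\<bar> * (norm (G x))^2" by (intro mult_right_mono) auto
        ultimately have 2: "0 \<le> (a x *v G x) \<bullet> G x" "(a x *v G x) \<bullet> G x \<le> \<bar>Lam\<bar> * (norm (G x))^2" using 1 by linarith+
        then have "0 \<le> AC_integrand a x (f x) (G x)" "AC_integrand a x (f x) (G x) \<le> (\<bar>Lam\<bar> / 2) * (norm (G x))^2 + 1"
          by (auto simp: AC_integrand_def)
        then show ?thesis using True by simp
      qed simp
    qed
  qed
qed

text \<open>The functions $f$ and $G$ are Borel versions of the minimizer $u$ and of its weak gradient.\<close>

definition AC_minimizer :: "real \<Rightarrow> real \<Rightarrow> (real^'n::finite) set \<Rightarrow> (real^'n \<Rightarrow> real^'n^'n) \<Rightarrow> (real^'n \<Rightarrow> real)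
    \<Rightarrow> (real^'n \<Rightarrow> real) \<Rightarrow> (real^'n \<Rightarrow> real^'n) \<Rightarrow> bool" where
  "AC_minimizer lam Lam \<Omega> a u f G \<longleftrightarrow> 0 < lam \<and> lam \<le> Lam \<and> open \<Omega> \<and> elliptic \<Omega> a lam Lam \<and> local_min \<Omega> (AC_integrand a) u
    \<and> LW \<Omega> f G \<and> (AE x in lborel. x \<in> \<Omega> \<longrightarrow> f x = u x \<and> G x = wgrad \<Omega> u x) \<and> (AE x in lborel. x \<in> \<Omega> \<longrightarrow> 0 \<le> u x)"

text \<open>\<open>R\<close> bounds the pointwise increase of the integrand caused by the
  perturbation \<open>p\<close>. Both energies are finite and cancel, so later arguments never see
  the energy itself, only the integral of \<open>R\<close>.\<close>

lemma minimality:
  fixes f :: "real^'n::finite \<Rightarrow> real"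
  assumes M: "AC_minimizer lam Lam \<Omega> a u f G"
    and B: "0 < r" "cball c r \<subseteq> \<Omega>" and p: "LW UNIV p P" and p0: "r' < r" "\<And>x. x \<notin> cball c r' \<Longrightarrow> p x = 0"
    and R: "integrable lborel R"
    and le: "AE x in lborel. x \<in> ball c r \<longrightarrow> AC_integrand a x (f x + p x) (G x + P x) \<le> AC_integrand a x (f x) (G x) + R x"
  shows "0 \<le> (\<integral>x. indicator (ball c r) x * R x \<partial>lborel)"
proof -
  have lam: "0 < lam" and O: "open \<Omega>" and el: "elliptic \<Omega> a lam Lam" and lm: "local_min \<Omega> (AC_integrand a) u"
    and f: "LW \<Omega> f G" and fu: "AE x in lborel. x \<in> \<Omega> \<longrightarrow> f x = u x \<and> G x = wgrad \<Omega> u x"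
    using M by (auto simp: AC_minimizer_def)
  let ?B = "ball c r" and ?I = "indicator (ball c r) :: real^'n \<Rightarrow> real"
  have BO: "?B \<subseteq> \<Omega>" using B(2) ball_subset_cball by blast
  \<comment> \<open>The competitor is built from \<open>u\<close>, about which
    \<open>local_min\<close> speaks, and not from its Borel version; it must lie in
    \<open>H1\<close> of all of \<Omega>, with weak gradient \<open>wgrad \<Omega> u\<close> plus
    \<open>P\<close>.\<close>
  define v where "v x = u x + p x" for x
  have pO: "LW \<Omega> p P" by (rule LW_mono[OF p]) simp
  have fp: "LW \<Omega> (\<lambda>x. f x + p x) (\<lambda>x. G x + P x)" by (rule LW_add[OF f pO])
  have wu: "weak_grad \<Omega> u (wgrad \<Omega> u)" using lm H1_wgrad by (auto simp: local_min_def)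
  have wv: "weak_grad \<Omega> v (\<lambda>x. wgrad \<Omega> u x + P x)"
  proof -
    have wp: "weak_grad \<Omega> p P" by (rule LW_weak_grad[OF pO O])
    have ws: "weak_grad \<Omega> (\<lambda>x. f x + p x) (\<lambda>x. G x + P x)" by (rule LW_weak_grad[OF fp O])
    have fO: "\<Omega> \<inter> space lebesgue \<in> sets lebesgue" using O by simp
    have ae1: "AE x in lborel. x \<in> \<Omega> \<longrightarrow> f x + p x = v x" using fu by eventually_elim (auto simp: v_def)
    have ae2: "AE x in lborel. x \<in> \<Omega> \<longrightarrow> G x + P x = wgrad \<Omega> u x + P x" using fu by eventually_elim auto
    show ?thesis unfolding weak_grad_def
    proof (intro conjI allI impI)
      have bm: "g \<in> borel_measurable (lebesgue_on \<Omega>)"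
        if "h \<in> borel_measurable borel" "AE x in lborel. x \<in> \<Omega> \<longrightarrow> h x = g x" for g h :: "real^'n \<Rightarrow> real"
        unfolding borel_measurable_restrict_space_iff[OF fO]
      proof (rule lebesgue_lborel_AE(1)[OF borel_indicator_mult[OF _ that(1)]])
        show "AE x in lborel. indicator \<Omega> x * h x = indicator \<Omega> x *\<^sub>R g x" using that(2) by eventually_elim auto
      qed (use O in simp)
      have si: "set_integrable lebesgue \<Omega> g"
        if h: "integrable lborel h" "AE x in lborel. x \<in> \<Omega> \<longrightarrow> h x = g x" for g h :: "real^'n \<Rightarrow> real"
        unfolding set_integrable_def
      proof (subst lebesgue_lborel_AE(3)[symmetric, symmetric])
        show "(\<lambda>x. indicator \<Omega> x * h x) \<in> borel_measurable borel"
          by (rule borel_indicator_mult) (use O borel_measurable_integrable[OF h(1)] in auto)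
        show "AE x in lborel. indicator \<Omega> x * h x = indicator \<Omega> x *\<^sub>R g x" using h(2) by eventually_elim auto
        show "integrable lborel (\<lambda>x. indicator \<Omega> x * h x)"
          using integrable_mult_indicator[OF _ h(1), of \<Omega>] O by simp
      qed
      note L = LW_D[OF fp]
      show "v \<in> borel_measurable (lebesgue_on \<Omega>)" by (rule bm[OF L2_borel[OF L(1)] ae1])
      show "set_integrable lebesgue \<Omega> (\<lambda>x. (v x)^2)"
        by (rule si[OF L2_integrable[OF L(1)]]) (use ae1 in eventually_elim, auto)
      show "(\<lambda>x. (wgrad \<Omega> u x + P x) $ i) \<in> borel_measurable (lebesgue_on \<Omega>)" for i
        by (rule bm[OF L2_borel[OF L(2)[of i]]]) (use ae2 in eventually_elim, auto)
      show "set_integrable lebesgue \<Omega> (\<lambda>x. (norm (wgrad \<Omega> u x + P x))^2)"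
        by (rule si[OF L2_norm_square(1)[OF L(2)]]) (use ae2 in eventually_elim, auto)
      fix \<phi> i assume t: "test_fun \<Omega> \<phi>"
      have ml: "\<phi> \<in> borel_measurable borel" "pd i \<phi> \<in> borel_measurable borel"
        using smooth_borel[OF test_fun_smooth[OF t]] smooth_borel[OF smooth_pd[OF test_fun_smooth[OF t]]] by auto
      have sl: "(LINT x:\<Omega>|lebesgue. g x * k x) = (\<integral>x. indicator \<Omega> x * (h x * k x) \<partial>lborel)"
        if h: "h \<in> borel_measurable borel" "k \<in> borel_measurable borel" "AE x in lborel. x \<in> \<Omega> \<longrightarrow> h x = g x" for g h k :: "real^'n \<Rightarrow> real"
        unfolding set_lebesgue_integral_def
      proof (rule lebesgue_lborel_AE(2)[OF borel_indicator_mult])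
        show "AE x in lborel. indicator \<Omega> x * (h x * k x) = indicator \<Omega> x *\<^sub>R (g x * k x)" using h(3) by eventually_elim auto
      qed (use O h in auto)
      have ae2i: "AE x in lborel. x \<in> \<Omega> \<longrightarrow> (G x + P x) $ i = (wgrad \<Omega> u x + P x) $ i"
        using ae2 by eventually_elim auto
      have "(LINT x:\<Omega>|lebesgue. (f x + p x) * pd i \<phi> x) = - (LINT x:\<Omega>|lebesgue. (G x + P x) $ i * \<phi> x)"
        using ws t unfolding weak_grad_def by blast
      moreover have "(LINT x:\<Omega>|lebesgue. (f x + p x) * pd i \<phi> x) = (LINT x:\<Omega>|lebesgue. v x * pd i \<phi> x)"
        unfolding sl[OF L2_borel[OF L(1)] ml(2) ae1] by (rule sl[OF L2_borel[OF L(1)] ml(2)]) simp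
      moreover have "(LINT x:\<Omega>|lebesgue. (G x + P x) $ i * \<phi> x) = (LINT x:\<Omega>|lebesgue. (wgrad \<Omega> u x + P x) $ i * \<phi> x)"
        unfolding sl[OF L2_borel[OF L(2)[of i]] ml(1) ae2i] by (rule sl[OF L2_borel[OF L(2)[of i]] ml(1)]) simp
      ultimately show "(LINT x:\<Omega>|lebesgue. v x * pd i \<phi> x) = - (LINT x:\<Omega>|lebesgue. (wgrad \<Omega> u x + P x) $ i * \<phi> x)"
        by simp
    qed
  qed
  have Hv: "H1 \<Omega> v" unfolding H1_def using wv by blast
  have wgv: "AE x in lborel. x \<in> \<Omega> \<longrightarrow> G x + P x = wgrad \<Omega> v x"
    by (rule LW_weak_grad_unique[OF fp H1_wgrad[OF Hv] O]) (use fu in eventually_elim, auto simp: v_def)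
  have "H10 ?B (\<lambda>x. v x - u x)" using LW_H10[OF p p0] by (simp add: v_def)
  moreover have "v x = u x" if "x \<in> \<Omega> - ?B" for x using that p0 by (auto simp: v_def)
  ultimately have min: "(LINT x:?B|lebesgue. AC_integrand a x (u x) (wgrad \<Omega> u x)) \<le> (LINT x:?B|lebesgue. AC_integrand a x (v x) (wgrad \<Omega> v x))"
    using lm B Hv unfolding local_min_def by (auto simp del: AE_completion_iff)
  have IF: "integrable lebesgue (\<lambda>x. ?I x * AC_integrand a x (f x) (G x))"
    by (rule AC_integrable[OF el lam BO O L2_borel[OF LW_D(1)[OF f]] LW_D(2)[OF f]])
  have IV: "integrable lebesgue (\<lambda>x. ?I x * AC_integrand a x (f x + p x) (G x + P x))"
    by (rule AC_integrable[OF el lam BO O L2_borel[OF LW_D(1)[OF fp]] LW_D(2)[OF fp]])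
  have lebeq: "integral\<^sup>L lebesgue g = integral\<^sup>L lebesgue h"
    if "integrable lebesgue h" "AE x in lborel. h x = g x" for g h :: "real^'n \<Rightarrow> real"
  proof -
    have ae: "AE x in lebesgue. h x = g x" by (rule AE_completion[OF that(2)])
    have "g \<in> borel_measurable lebesgue" by (rule borel_measurable_AE[OF borel_measurable_integrable[OF that(1)] ae])
    from integral_cong_AE[OF borel_measurable_integrable[OF that(1)] this ae] show ?thesis by simp
  qed
  have eu: "(LINT x:?B|lebesgue. AC_integrand a x (u x) (wgrad \<Omega> u x)) = (\<integral>x. ?I x * AC_integrand a x (f x) (G x) \<partial>lebesgue)"
    unfolding set_lebesgue_integral_def
    by (rule lebeq[OF IF]) (use fu in eventually_elim, use BO in \<open>auto simp: indicator_def\<close>)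
  have ev: "(LINT x:?B|lebesgue. AC_integrand a x (v x) (wgrad \<Omega> v x)) = (\<integral>x. ?I x * AC_integrand a x (f x + p x) (G x + P x) \<partial>lebesgue)"
    unfolding set_lebesgue_integral_def
  proof (rule lebeq[OF IV])
    show "AE x in lborel. ?I x * AC_integrand a x (f x + p x) (G x + P x) = ?I x *\<^sub>R AC_integrand a x (v x) (wgrad \<Omega> v x)"
      using fu wgv
    proof eventually_elim
      case (elim x)
      then show ?case using BO by (cases "x \<in> ?B") (auto simp: v_def)
    qed
  qed
  have Rm: "R \<in> borel_measurable borel" using borel_measurable_integrable[OF R] by simp
  have IR': "integrable lborel (\<lambda>x. ?I x * R x)"
    using integrable_mult_indicator[OF _ R, of ?B] by simp
  have IRm: "(\<lambda>x. ?I x * R x) \<in> borel_measurable borel" by (rule borel_indicator_mult[OF _ Rm]) simp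
  have IR: "integrable lebesgue (\<lambda>x. ?I x * R x)" and eR: "(\<integral>x. ?I x * R x \<partial>lebesgue) = (\<integral>x. ?I x * R x \<partial>lborel)"
    using lebesgue_lborel_AE(2,3)[OF IRm, of "\<lambda>x. ?I x * R x"] IR' by auto
  have "(\<integral>x. ?I x * AC_integrand a x (f x + p x) (G x + P x) \<partial>lebesgue) \<le> (\<integral>x. ?I x * AC_integrand a x (f x) (G x) + ?I x * R x \<partial>lebesgue)"
  proof (rule integral_mono_AE[OF IV Bochner_Integration.integrable_add[OF IF IR]])
    show "AE x in lebesgue. ?I x * AC_integrand a x (f x + p x) (G x + P x) \<le> ?I x * AC_integrand a x (f x) (G x) + ?I x * R x"
      using AE_completion[OF le]
    proof eventually_elim
      case (elim x)
      then show ?case by (cases "x \<in> ?B") auto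
    qed
  qed
  also have "\<dots> = (\<integral>x. ?I x * AC_integrand a x (f x) (G x) \<partial>lebesgue) + (\<integral>x. ?I x * R x \<partial>lborel)"
    unfolding eR[symmetric] by (rule Bochner_Integration.integral_add[OF IF IR])
  finally show ?thesis using min unfolding eu ev by simp
qed

section \<open>Caccioppoli inequalities\<close>

lemma integral_nonpos_AE:
  fixes f :: "'a \<Rightarrow> real"
  assumes "AE x in M. f x \<le> 0" shows "integral\<^sup>L M f \<le> 0"
proof -
  have "0 \<le> integral\<^sup>L M (\<lambda>x. - f x)" by (rule integral_nonneg_AE) (use assms in auto)
  then show ?thesis by simp
qed

lemma LW_cmult:
  assumes "LW U f G" shows "LW U (\<lambda>x. c * f x) (\<lambda>x. c *\<^sub>R G x)"
  using assms by (auto simp: LW_def mult.assoc intro!: L2_cmult)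

text \<open>The sign s, which is 1 or -1, treats u and -u at once. The square of the cutoff is
  essential: where k < s f the perturbed gradient is (1 - \<zeta>^2) G plus \<zeta> times a multiple
  of the gradient of \<zeta>, the exact form of \<open>quadratic_convexity\<close>. The change of
  the positivity set is kept as an integral, since its sign and size depend on s, k and f.\<close>

lemma caccioppoli:
  fixes f :: "real^'n::finite \<Rightarrow> real" and k :: real
  assumes M: "AC_minimizer lam Lam \<Omega> a u f G" and B: "0 < r" "cball c r \<subseteq> \<Omega>"
    and z: "test_fun (ball c r) \<zeta>" "\<And>x. 0 \<le> \<zeta> x" "\<And>x. \<zeta> x \<le> 1" and s: "s * s = (1::real)"
  defines "p \<equiv> \<lambda>x. - s * ((\<zeta> x)^2 * max 0 (s * f x - k))"
  shows "lam / 2 * (\<integral>x. of_bool (k < s * f x) * (\<zeta> x)^2 * (norm (G x))^2 \<partial>lborel) \<le>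
    2 * Lam * (\<integral>x. (max 0 (s * f x - k))^2 * (norm (grad \<zeta> x))^2 \<partial>lborel) +
    (\<integral>x. indicator (ball c r) x * (of_bool (0 < f x + p x) - of_bool (0 < f x)) \<partial>lborel)"
    "integrable lborel (\<lambda>x. (max 0 (s * f x - k))^2 * (norm (grad \<zeta> x))^2)"
    "integrable lborel (\<lambda>x. of_bool (k < s * f x) * (\<zeta> x)^2 * (norm (G x))^2)"
    "p \<in> borel_measurable borel"
proof -
  have lam: "0 < lam" and el: "elliptic \<Omega> a lam Lam" and f: "LW \<Omega> f G"
    using M by (auto simp: AC_minimizer_def)
  let ?B = "ball c r"
  have BO: "?B \<subseteq> \<Omega>" using B(2) ball_subset_cball by blast
  define m where "m x = max 0 (s * f x - k)" for x
  define A where "A x = (of_bool (k < s * f x) :: real)" for x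
  have zs: "smooth_fun \<zeta>" by (rule test_fun_smooth[OF z(1)])
  have z2: "test_fun ?B (\<lambda>x. \<zeta> x * \<zeta> x)" by (rule test_fun_mult[OF z(1) zs])
  have gz2: "grad (\<lambda>x. \<zeta> x * \<zeta> x) x = (2 * \<zeta> x) *\<^sub>R grad \<zeta> x" for x
    by (simp add: grad_def vec_eq_iff smooth_pd_mult[OF zs zs])
  define P where "P x = (- s) *\<^sub>R (((\<zeta> x * \<zeta> x) * A x) *\<^sub>R (s *\<^sub>R G x) + m x *\<^sub>R grad (\<lambda>x. \<zeta> x * \<zeta> x) x)" for x
  have p: "LW UNIV p P"
    using LW_cmult[OF LW_truncate_cutoff[OF LW_cmult[OF LW_mono[OF f BO], of s] z2, of k], of "- s"]
    unfolding p_def P_def m_def A_def power2_eq_square by simp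
  have pb: "p \<in> borel_measurable borel" by (rule L2_borel[OF LW_D(1)[OF p]])
  then show "p \<in> borel_measurable borel" .
  obtain r' where r': "0 < r'" "r' < r" "tsupport \<zeta> \<subseteq> ball c r'"
    by (rule compact_in_smaller_ball[of "tsupport \<zeta>" c r]) (use z(1) B(1) in \<open>auto simp: test_fun_def\<close>)
  have p0: "p x = 0" if "x \<notin> cball c r'" for x
  proof -
    have "x \<notin> tsupport \<zeta>" using that r'(3) by auto
    then show ?thesis by (simp add: p_def zero_outside_tsupport)
  qed
  have fb [measurable]: "f \<in> borel_measurable borel" by (rule L2_borel[OF LW_D(1)[OF f]])
  have zb [measurable]: "\<zeta> \<in> borel_measurable borel" by (rule smooth_borel[OF zs])
  note pb[measurable]
  have mA: "m x = 0" "A x = 0" if "\<not> k < s * f x" for x using that by (auto simp: m_def A_def)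
  have I1: "integrable lborel (\<lambda>x. (m x)^2 * (norm (grad \<zeta> x))^2)"
  proof -
    have "L2 (\<lambda>x. m x * pd i \<zeta> x)" for i
    proof -
      have t: "test_fun ?B (pd i \<zeta>)" by (rule test_fun_pd[OF z(1)])
      have [measurable]: "pd i \<zeta> \<in> borel_measurable borel" by (rule smooth_borel[OF test_fun_smooth[OF t]])
      obtain C where C: "\<And>x. \<bar>pd i \<zeta> x\<bar> \<le> C" using test_fun_bounded[OF t] by blast
      have L: "L2 (\<lambda>x. \<bar>pd i \<zeta> x * f x\<bar> + \<bar>k\<bar> * \<bar>pd i \<zeta> x\<bar>)"
      proof (intro L2_add L2_cmult)
        have "L2 (\<lambda>x. pd i \<zeta> x * f x)" by (rule L2_bounded_mult[OF LW_D(1)[OF f] _ C]) simp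
        then show "L2 (\<lambda>x. \<bar>pd i \<zeta> x * f x\<bar>)" by (rule L2_mono) auto
        show "L2 (\<lambda>x. \<bar>pd i \<zeta> x\<bar>)" by (rule L2_mono[OF L2_test_fun[OF t]]) auto
      qed
      show ?thesis
      proof (rule L2_mono[OF L])
        show "(\<lambda>x. m x * pd i \<zeta> x) \<in> borel_measurable borel" unfolding m_def by measurable
        fix x
        have "\<bar>s\<bar> = 1" using s by (metis abs_mult_self_eq abs_one abs_mult_pos abs_square_eq_1 power2_eq_square)
        then have "\<bar>m x\<bar> \<le> \<bar>f x\<bar> + \<bar>k\<bar>" using abs_mult[of s "f x"] by (auto simp: m_def)
        then have "\<bar>m x\<bar> * \<bar>pd i \<zeta> x\<bar> \<le> (\<bar>f x\<bar> + \<bar>k\<bar>) * \<bar>pd i \<zeta> x\<bar>" by (intro mult_right_mono) auto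
        then show "\<bar>m x * pd i \<zeta> x\<bar> \<le> \<bar>\<bar>pd i \<zeta> x * f x\<bar> + \<bar>k\<bar> * \<bar>pd i \<zeta> x\<bar>\<bar>"
          by (simp add: abs_mult algebra_simps)
      qed
    qed
    then have "L2 (\<lambda>x. (m x *\<^sub>R grad \<zeta> x) $ i)" for i by (simp add: grad_def)
    from L2_norm_square(1)[where G="\<lambda>x. m x *\<^sub>R grad \<zeta> x", OF this]
    show ?thesis by (simp add: power_mult_distrib)
  qed
  then show "integrable lborel (\<lambda>x. (max 0 (s * f x - k))^2 * (norm (grad \<zeta> x))^2)" by (simp add: m_def)
  have IG: "integrable lborel (\<lambda>x. (norm (G x))^2)" by (rule L2_norm_square(1)[OF LW_D(2)[OF f]])
  have I2: "integrable lborel (\<lambda>x. A x * (\<zeta> x)^2 * (norm (G x))^2)"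
  proof (rule Bochner_Integration.integrable_bound[OF IG])
    have [measurable]: "(\<lambda>x. (norm (G x))^2) \<in> borel_measurable borel" using borel_measurable_integrable[OF IG] by simp
    have "(\<lambda>x. A x * (\<zeta> x)^2 * (norm (G x))^2) \<in> borel_measurable borel" unfolding A_def by measurable
    then show "(\<lambda>x. A x * (\<zeta> x)^2 * (norm (G x))^2) \<in> borel_measurable lborel" by simp
    have "A x * (\<zeta> x)^2 \<le> 1" "0 \<le> A x * (\<zeta> x)^2" for x using z(2,3)[of x] by (auto simp: A_def power_le_one)
    then have "A x * (\<zeta> x)^2 * (norm (G x))^2 \<le> (norm (G x))^2" for x by (intro mult_left_le_one_le) auto
    then show "AE x in lborel. norm (A x * (\<zeta> x)^2 * (norm (G x))^2) \<le> norm ((norm (G x))^2)"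
      by (simp add: A_def)
  qed
  then show "integrable lborel (\<lambda>x. of_bool (k < s * f x) * (\<zeta> x)^2 * (norm (G x))^2)" by (simp add: A_def)
  define X where "X x = indicator ?B x * (of_bool (0 < f x + p x) - of_bool (0 < f x) :: real)" for x
  have I3: "integrable lborel X"
  proof (rule integrable_bounded_support[where K="?B" and B=1])
    show "X \<in> borel_measurable borel" unfolding X_def[abs_def] by (rule borel_indicator_mult) auto
  qed (auto simp: X_def indicator_def)
  \<comment> \<open>Cost of the cutoff gradient, gain of energy, change of the positivity set. The
    factor 1/2 in the integrand turns 4 Lam and lam into 2 Lam and lam/2.\<close>
  define R where "R x = 2 * Lam * ((m x)^2 * (norm (grad \<zeta> x))^2) - lam / 2 * (A x * (\<zeta> x)^2 * (norm (G x))^2) + X x" for x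
  have IR: "integrable lborel R" unfolding R_def
    by (intro Bochner_Integration.integrable_add Bochner_Integration.integrable_diff integrable_mult_right I1 I2 I3)
  have "0 \<le> (\<integral>x. indicator ?B x * R x \<partial>lborel)"
  proof (rule minimality[OF M B p r'(2) p0 IR])
    have "AE x in lborel. x \<in> \<Omega> \<longrightarrow> (\<forall>\<xi>. lam * (norm \<xi>)^2 \<le> \<xi> \<bullet> (a x *v \<xi>) \<and> \<xi> \<bullet> (a x *v \<xi>) \<le> Lam * (norm \<xi>)^2)"
      using el unfolding elliptic_def AE_completion_iff by (auto elim!: eventually_mono)
    then show "AE x in lborel. x \<in> ?B \<longrightarrow> AC_integrand a x (f x + p x) (G x + P x) \<le> AC_integrand a x (f x) (G x) + R x"
    proof eventually_elim
      case (elim x)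
      show ?case
      proof
        assume x: "x \<in> ?B"
        then have el: "lam * (norm \<xi>)^2 \<le> \<xi> \<bullet> (a x *v \<xi>)" "\<xi> \<bullet> (a x *v \<xi>) \<le> Lam * (norm \<xi>)^2" for \<xi>
          using elim BO by auto
        have psd: "0 \<le> \<xi> \<bullet> (a x *v \<xi>)" for \<xi>
          using el(1)[of \<xi>] lam by (meson mult_nonneg_nonneg less_imp_le zero_le_power2 order_trans)
        define Q where "Q \<xi> = (a x *v \<xi>) \<bullet> \<xi>" for \<xi>
        have Q: "lam * (norm \<xi>)^2 \<le> Q \<xi>" "Q \<xi> \<le> Lam * (norm \<xi>)^2" for \<xi> using el[of \<xi>] by (auto simp: Q_def inner_commute)
        have "Q (G x + P x) \<le> Q (G x) - A x * (\<zeta> x)^2 * Q (G x) + 4 * (Lam * ((m x)^2 * (norm (grad \<zeta> x))^2))"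
        proof (cases "k < s * f x")
          case True
          then have A1: "A x = 1" by (simp add: A_def)
          have "s *\<^sub>R (s *\<^sub>R v) = v" for v :: "real^'n" using s by simp
          then have "G x + P x = (1 - (\<zeta> x)^2) *\<^sub>R G x + \<zeta> x *\<^sub>R ((- 2 * s * m x) *\<^sub>R grad \<zeta> x)"
            unfolding P_def gz2 A1 using s
            by (simp add: algebra_simps power2_eq_square)
          then have "Q (G x + P x) \<le> (1 - (\<zeta> x)^2) * Q (G x) + Q ((- 2 * s * m x) *\<^sub>R grad \<zeta> x)"
            unfolding Q_def by (simp only:) (rule quadratic_convexity[OF psd z(2,3)])
          also have "Q ((- 2 * s * m x) *\<^sub>R grad \<zeta> x) \<le> Lam * (norm ((- 2 * s * m x) *\<^sub>R grad \<zeta> x))^2" by (rule Q)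
          also have "(norm ((- 2 * s * m x) *\<^sub>R grad \<zeta> x))^2 = 4 * ((m x)^2 * (norm (grad \<zeta> x))^2)"
          proof -
            have "(norm ((- 2 * s * m x) *\<^sub>R grad \<zeta> x))^2 = (s * s) * (4 * ((m x)^2 * (norm (grad \<zeta> x))^2))"
              unfolding norm_scaleR power_mult_distrib power2_abs by (simp add: power2_eq_square)
            then show ?thesis using s by simp
          qed
          finally show ?thesis using A1 by (simp add: algebra_simps)
        next
          case False
          then show ?thesis using mA[OF False] by (simp add: P_def)
        qed
        also have "\<dots> \<le> Q (G x) - A x * (\<zeta> x)^2 * (lam * (norm (G x))^2) + 4 * (Lam * ((m x)^2 * (norm (grad \<zeta> x))^2))"
        proof -
          have "A x * (\<zeta> x)^2 * (lam * (norm (G x))^2) \<le> A x * (\<zeta> x)^2 * Q (G x)"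
            by (rule mult_left_mono[OF Q(1)]) (simp add: A_def)
          then show ?thesis by simp
        qed
        finally show "AC_integrand a x (f x + p x) (G x + P x) \<le> AC_integrand a x (f x) (G x) + R x"
          using x unfolding AC_integrand_def R_def X_def Q_def by (simp add: algebra_simps split: if_splits)
      qed
    qed
  qed
  also have "(\<integral>x. indicator ?B x * R x \<partial>lborel) = (\<integral>x. R x \<partial>lborel)"
  proof -
    have e: "indicator ?B x * R x = R x" for x
    proof (cases "x \<in> ?B")
      case False
      then have "x \<notin> tsupport \<zeta>" using z(1) by (auto simp: test_fun_def)
      then have "\<zeta> x = 0" "grad \<zeta> x = 0"
        using zero_outside_tsupport[of x \<zeta>] pd_zero_outside[of x \<zeta>] by (auto simp: grad_def vec_eq_iff)
      then show ?thesis using False by (simp add: R_def X_def)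
    qed simp
    show ?thesis unfolding e ..
  qed
  also have "(\<integral>x. R x \<partial>lborel) = 2 * Lam * (\<integral>x. (m x)^2 * (norm (grad \<zeta> x))^2 \<partial>lborel)
      - lam / 2 * (\<integral>x. A x * (\<zeta> x)^2 * (norm (G x))^2 \<partial>lborel) + (\<integral>x. X x \<partial>lborel)"
    unfolding R_def using I1 I2 I3 by simp
  finally show "lam / 2 * (\<integral>x. of_bool (k < s * f x) * (\<zeta> x)^2 * (norm (G x))^2 \<partial>lborel) \<le>
    2 * Lam * (\<integral>x. (max 0 (s * f x - k))^2 * (norm (grad \<zeta> x))^2 \<partial>lborel) +
    (\<integral>x. indicator (ball c r) x * (of_bool (0 < f x + p x) - of_bool (0 < f x)) \<partial>lborel)"
    unfolding m_def A_def X_def by linarith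
qed

text \<open>De Giorgi's class. The parameter \<epsilon> carries the cost of enlarging the positivity
  set: 0 for the minimizer, 2/lam for its negative, and 0 for the negative as well on balls where
  the minimizer is positive.\<close>

definition DG :: "real \<Rightarrow> real \<Rightarrow> real^'n::finite \<Rightarrow> real \<Rightarrow> (real^'n \<Rightarrow> real) \<Rightarrow> (real^'n \<Rightarrow> real^'n) \<Rightarrow> bool" where
  "DG \<gamma> \<epsilon> c R f G \<longleftrightarrow> LW (ball c R) f G \<and> (\<forall>k \<rho> r. 0 < \<rho> \<and> \<rho> < r \<and> r \<le> R \<longrightarrow>
     (\<integral>x. indicator (ball c \<rho> \<inter> {x. k < f x}) x * (norm (G x))^2 \<partial>lborel) \<le>
       \<gamma> / (r - \<rho>)^2 * (\<integral>x. indicator (ball c r) x * (max 0 (f x - k))^2 \<partial>lborel)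
       + \<epsilon> * measure lborel ({x. k < f x} \<inter> ball c r))"

text \<open>The gradient term 2 Lam of the Caccioppoli inequality, divided by lam/2, with the
  squared cutoff constant.\<close>

definition DGconst :: "real \<Rightarrow> real \<Rightarrow> 'n::finite itself \<Rightarrow> real" where
  "DGconst lam Lam t = 4 * Lam * (cutoff_const t)^2 / lam"

lemma L2_max0: "L2 f \<Longrightarrow> A \<in> sets borel \<Longrightarrow> bounded A \<Longrightarrow> L2 (\<lambda>x. indicator A x * max 0 (f x - k))"
proof -
  assume f: "L2 f" and A: "A \<in> sets borel" "bounded A"
  have [measurable]: "f \<in> borel_measurable borel" by (rule L2_borel[OF f])
  have L: "L2 (\<lambda>x. \<bar>f x\<bar> + \<bar>k\<bar> * indicator A x)"
    by (intro L2_add L2_cmult L2_indicator A L2_mono[OF f]) auto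
  show ?thesis
  proof (rule L2_mono[OF L])
    show "(\<lambda>x. indicator A x * max 0 (f x - k)) \<in> borel_measurable borel"
      by (rule borel_indicator_mult[OF A(1)]) simp
  qed (auto simp: indicator_def)
qed

lemma integrable_max0_sq:
  assumes "L2 f" "A \<in> sets borel" "bounded A"
  shows "integrable lborel (\<lambda>x. indicator A x * (max 0 (f x - k))^2)"
proof -
  have "(\<lambda>x. (indicator A x * max 0 (f x - k))^2) = (\<lambda>x. indicator A x * (max 0 (f x - k))^2)"
    by (auto simp: indicator_def fun_eq_iff)
  with L2_integrable[OF L2_max0[OF assms, of k]] show ?thesis by simp
qed

text \<open>The bound J on the change of the positivity set is a parameter, because one derivation
  serves several cases: J is 0 when u is lowered, the measure of a superlevel set when u is raised,
  and minus the measure of the positivity set when u is killed on the inner ball.\<close>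

lemma cutoff_caccioppoli:
  fixes f :: "real^'n::finite \<Rightarrow> real"
  assumes M: "AC_minimizer lam Lam \<Omega> a u f G" and B: "cball c r \<subseteq> \<Omega>" "0 < \<rho>" "\<rho> < r" and s: "s * s = (1::real)"
    and jump: "\<And>\<zeta> p. (\<And>x. 0 \<le> \<zeta> x) \<Longrightarrow> (\<And>x. \<zeta> x \<le> 1) \<Longrightarrow> (\<And>x. x \<in> ball c \<rho> \<Longrightarrow> \<zeta> x = 1) \<Longrightarrow>
      (\<And>x. p x = - s * ((\<zeta> x)^2 * max 0 (s * f x - k))) \<Longrightarrow> p \<in> borel_measurable borel \<Longrightarrow>
      (\<integral>x. indicator (ball c r) x * (of_bool (0 < f x + p x) - of_bool (0 < f x)) \<partial>lborel) \<le> J"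
  shows "(\<integral>x. indicator (ball c \<rho> \<inter> {x. k < s * f x}) x * (norm (G x))^2 \<partial>lborel) \<le>
       DGconst lam Lam TYPE('n) / (r - \<rho>)^2 * (\<integral>x. indicator (ball c r) x * (max 0 (s * f x - k))^2 \<partial>lborel) + 2 / lam * J"
proof -
  have lam: "0 < lam" "lam \<le> Lam" and f: "LW \<Omega> f G" using M by (auto simp: AC_minimizer_def)
  have r: "0 < r" using B by simp
  obtain \<zeta> where z: "test_fun (ball c r) \<zeta>" "\<And>x. 0 \<le> \<zeta> x" "\<And>x. \<zeta> x \<le> 1"
    "\<And>x. x \<in> ball c \<rho> \<Longrightarrow> \<zeta> x = 1" "\<And>x. norm (grad \<zeta> x) \<le> cutoff_const TYPE('n) / (r - \<rho>)"
    using cutoff_exists[OF B(2,3)] by metis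
  note C = caccioppoli[OF M r B(1) z(1-3) s, of k]
  define K where "K = cutoff_const TYPE('n) / (r - \<rho>)"
  have [measurable]: "f \<in> borel_measurable borel" by (rule L2_borel[OF LW_D(1)[OF f]])
  have IG: "integrable lborel (\<lambda>x. (norm (G x))^2)" by (rule L2_norm_square(1)[OF LW_D(2)[OF f]])
  have sb: "ball c \<rho> \<inter> {x. k < s * f x} \<in> sets borel" by measurable
  have "(\<integral>x. indicator (ball c \<rho> \<inter> {x. k < s * f x}) x * (norm (G x))^2 \<partial>lborel) \<le>
    (\<integral>x. of_bool (k < s * f x) * (\<zeta> x)^2 * (norm (G x))^2 \<partial>lborel)"
  proof (rule integral_mono[OF _ C(3)])
    show "integrable lborel (\<lambda>x. indicator (ball c \<rho> \<inter> {x. k < s * f x}) x * (norm (G x))^2)"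
      using integrable_mult_indicator[OF _ IG, of "ball c \<rho> \<inter> {x. k < s * f x}"] sb by simp
    show "indicator (ball c \<rho> \<inter> {x. k < s * f x}) x * (norm (G x))^2 \<le> of_bool (k < s * f x) * (\<zeta> x)^2 * (norm (G x))^2" for x
      using z(4)[of x] by (auto simp: indicator_def)
  qed
  then have "lam / 2 * (\<integral>x. indicator (ball c \<rho> \<inter> {x. k < s * f x}) x * (norm (G x))^2 \<partial>lborel) \<le>
    lam / 2 * (\<integral>x. of_bool (k < s * f x) * (\<zeta> x)^2 * (norm (G x))^2 \<partial>lborel)"
    using lam by (intro mult_left_mono) auto
  also note C(1)
  also have "2 * Lam * (\<integral>x. (max 0 (s * f x - k))^2 * (norm (grad \<zeta> x))^2 \<partial>lborel)
    \<le> 2 * Lam * (\<integral>x. K^2 * (indicator (ball c r) x * (max 0 (s * f x - k))^2) \<partial>lborel)"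
  proof (rule mult_left_mono[OF integral_mono[OF C(2)]])
    show "integrable lborel (\<lambda>x. K^2 * (indicator (ball c r) x * (max 0 (s * f x - k))^2))"
      by (intro integrable_mult_right integrable_max0_sq L2_cmult LW_D(1)[OF f]) auto
    fix x
    show "(max 0 (s * f x - k))^2 * (norm (grad \<zeta> x))^2 \<le> K^2 * (indicator (ball c r) x * (max 0 (s * f x - k))^2)"
    proof (cases "x \<in> ball c r")
      case True
      have "(norm (grad \<zeta> x))^2 \<le> K^2" using z(5)[of x] by (intro power_mono) (auto simp: K_def)
      then have "(max 0 (s * f x - k))^2 * (norm (grad \<zeta> x))^2 \<le> (max 0 (s * f x - k))^2 * K^2"
        by (intro mult_left_mono) auto
      then show ?thesis using True by (simp add: mult.commute)
    next
      case False
      then have "x \<notin> tsupport \<zeta>" using z(1) by (auto simp: test_fun_def)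
      then have "grad \<zeta> x = 0" using pd_zero_outside[of x \<zeta>] by (auto simp: grad_def vec_eq_iff)
      then show ?thesis by simp
    qed
  qed (use lam in simp)
  also have "(\<integral>x. indicator (ball c r) x * (of_bool (0 < f x + (- s * ((\<zeta> x)^2 * max 0 (s * f x - k)))) - of_bool (0 < f x)) \<partial>lborel) \<le> J"
    by (rule jump[OF z(2,3,4) refl C(4)])
  finally have "lam / 2 * (\<integral>x. indicator (ball c \<rho> \<inter> {x. k < s * f x}) x * (norm (G x))^2 \<partial>lborel) \<le>
    2 * Lam * (K^2 * (\<integral>x. indicator (ball c r) x * (max 0 (s * f x - k))^2 \<partial>lborel)) + J" by simp
  then have "(\<integral>x. indicator (ball c \<rho> \<inter> {x. k < s * f x}) x * (norm (G x))^2 \<partial>lborel) \<le>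
    2 / lam * (2 * Lam * (K^2 * (\<integral>x. indicator (ball c r) x * (max 0 (s * f x - k))^2 \<partial>lborel)) + J)"
    using lam by (simp add: field_simps)
  also have "\<dots> = DGconst lam Lam TYPE('n) / (r - \<rho>)^2 * (\<integral>x. indicator (ball c r) x * (max 0 (s * f x - k))^2 \<partial>lborel) + 2 / lam * J"
    by (simp add: DGconst_def K_def power_divide algebra_simps)
  finally show ?thesis .
qed

lemma finite_measure_ball_Int:
  fixes c :: "real^'n::finite"
  assumes "X \<in> sets borel"
  shows "emeasure lborel (X \<inter> ball c r) < \<infinity>" "integrable lborel (indicator (X \<inter> ball c r) :: _ \<Rightarrow> real)"
proof -
  have "emeasure lborel (X \<inter> ball c r) \<le> emeasure lborel (ball c r)" using assms by (intro emeasure_mono) auto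
  then show "emeasure lborel (X \<inter> ball c r) < \<infinity>" using emeasure_lborel_ball_finite[of c r] by (rule le_less_trans)
  then show "integrable lborel (indicator (X \<inter> ball c r) :: _ \<Rightarrow> real)"
    using assms by (intro integrable_real_indicator) (auto simp: less_top)
qed

lemma jump_integrable:
  fixes f p :: "real^'n::finite \<Rightarrow> real"
  assumes [measurable]: "f \<in> borel_measurable borel" "p \<in> borel_measurable borel"
  shows "integrable lborel (\<lambda>x. indicator (ball c r) x * (of_bool (0 < f x + p x) - of_bool (0 < f x) :: real))"
proof (rule integrable_bounded_support[where K="ball c r" and B=1])
  show "(\<lambda>x. indicator (ball c r) x * (of_bool (0 < f x + p x) - of_bool (0 < f x) :: real)) \<in> borel_measurable borel"
    by (rule borel_indicator_mult) auto
qed (auto simp: indicator_def)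

lemma minimizer_DG_sub:
  fixes f :: "real^'n::finite \<Rightarrow> real"
  assumes M: "AC_minimizer lam Lam \<Omega> a u f G" and B: "cball c R \<subseteq> \<Omega>"
  shows "DG (DGconst lam Lam TYPE('n)) 0 c R f G"
  unfolding DG_def
proof (intro conjI allI impI)
  have f: "LW \<Omega> f G" using M by (auto simp: AC_minimizer_def)
  then show "LW (ball c R) f G" using B ball_subset_cball by (blast intro: LW_mono)
  fix k \<rho> r :: real assume r: "0 < \<rho> \<and> \<rho> < r \<and> r \<le> R"
  then have "cball c r \<subseteq> \<Omega>" using B by (meson order_trans subset_cball)
  note C = cutoff_caccioppoli[OF M this, of \<rho> 1 k 0]
  have J: "(\<integral>x. indicator (ball c r) x * (of_bool (0 < f x + p x) - of_bool (0 < f x)) \<partial>lborel) \<le> (0::real)"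
    if p: "\<And>x. p x \<le> 0" for p :: "real^'n \<Rightarrow> real"
  proof (intro integral_nonpos_AE AE_I2)
    fix x
    from p[of x] show "indicator (ball c r) x * (of_bool (0 < f x + p x) - of_bool (0 < f x) :: real) \<le> 0"
      using add_nonpos_nonpos[of "f x" "p x"] by (force simp: indicator_def)
  qed
  from C[OF _ _ _ J] r have "(\<integral>x. indicator (ball c \<rho> \<inter> {x. k < 1 * f x}) x * (norm (G x))^2 \<partial>lborel) \<le>
       DGconst lam Lam TYPE('n) / (r - \<rho>)^2 * (\<integral>x. indicator (ball c r) x * (max 0 (1 * f x - k))^2 \<partial>lborel)
       + 2 / lam * 0"
    by (auto simp: mult_nonneg_nonneg)
  then show "(\<integral>x. indicator (ball c \<rho> \<inter> {x. k < f x}) x * (norm (G x))^2 \<partial>lborel) \<le>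
       DGconst lam Lam TYPE('n) / (r - \<rho>)^2 * (\<integral>x. indicator (ball c r) x * (max 0 (f x - k))^2 \<partial>lborel)
       + 0 * measure lborel ({x. k < f x} \<inter> ball c r)"
    by simp
qed

lemma minimizer_DG_super:
  fixes f :: "real^'n::finite \<Rightarrow> real"
  assumes M: "AC_minimizer lam Lam \<Omega> a u f G" and B: "cball c R \<subseteq> \<Omega>"
  shows "DG (DGconst lam Lam TYPE('n)) (2 / lam) c R (\<lambda>x. - f x) (\<lambda>x. - G x)"
    and "(AE x in lborel. x \<in> ball c R \<longrightarrow> 0 < f x) \<Longrightarrow> DG (DGconst lam Lam TYPE('n)) 0 c R (\<lambda>x. - f x) (\<lambda>x. - G x)"
proof -
  have f: "LW \<Omega> f G" using M by (auto simp: AC_minimizer_def)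
  have L: "LW (ball c R) (\<lambda>x. - f x) (\<lambda>x. - G x)"
    using LW_minus[OF f] B ball_subset_cball by (blast intro: LW_mono)
  have [measurable]: "f \<in> borel_measurable borel" by (rule L2_borel[OF LW_D(1)[OF f]])
  have key: "(\<integral>x. indicator (ball c \<rho> \<inter> {x. k < - f x}) x * (norm (- G x))^2 \<partial>lborel) \<le>
       DGconst lam Lam TYPE('n) / (r - \<rho>)^2 * (\<integral>x. indicator (ball c r) x * (max 0 (- f x - k))^2 \<partial>lborel) + 2 / lam * J"
    if r: "0 < \<rho>" "\<rho> < r" "r \<le> R"
      and J: "\<And>p. (\<And>x. 0 \<le> p x) \<Longrightarrow> (\<And>x. \<not> k < - f x \<Longrightarrow> p x = 0) \<Longrightarrow> p \<in> borel_measurable borel \<Longrightarrow>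
        (\<integral>x. indicator (ball c r) x * (of_bool (0 < f x + p x) - of_bool (0 < f x)) \<partial>lborel) \<le> J"
    for k \<rho> r J
  proof -
    have "cball c r \<subseteq> \<Omega>" using B r by (meson order_trans subset_cball)
    note C = cutoff_caccioppoli[OF M this r(1,2), of "-1" k J]
    have J': "(\<integral>x. indicator (ball c r) x * (of_bool (0 < f x + p x) - of_bool (0 < f x)) \<partial>lborel) \<le> J"
      if "\<And>x. p x = - (-1) * ((\<zeta> x)^2 * max 0 ((-1) * f x - k))" "p \<in> borel_measurable borel" for \<zeta> p :: "real^'n \<Rightarrow> real"
    proof (rule J)
      show "0 \<le> p x" "\<not> k < - f x \<Longrightarrow> p x = 0" for x by (simp_all add: that(1))
    qed (rule that(2))
    have "(\<integral>x. indicator (ball c \<rho> \<inter> {x. k < (-1) * f x}) x * (norm (G x))^2 \<partial>lborel) \<le>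
       DGconst lam Lam TYPE('n) / (r - \<rho>)^2 * (\<integral>x. indicator (ball c r) x * (max 0 ((-1) * f x - k))^2 \<partial>lborel) + 2 / lam * J"
      by (rule C) (simp, rule J')
    then show ?thesis by simp
  qed
  show "DG (DGconst lam Lam TYPE('n)) (2 / lam) c R (\<lambda>x. - f x) (\<lambda>x. - G x)"
    unfolding DG_def
  proof (intro conjI allI impI L)
    fix k \<rho> r :: real assume r: "0 < \<rho> \<and> \<rho> < r \<and> r \<le> R"
    show "(\<integral>x. indicator (ball c \<rho> \<inter> {x. k < - f x}) x * (norm (- G x))^2 \<partial>lborel) \<le>
       DGconst lam Lam TYPE('n) / (r - \<rho>)^2 * (\<integral>x. indicator (ball c r) x * (max 0 (- f x - k))^2 \<partial>lborel)
       + 2 / lam * measure lborel ({x. k < - f x} \<inter> ball c r)"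
    proof (rule key)
      fix p :: "real^'n \<Rightarrow> real" assume p: "\<And>x. 0 \<le> p x" "\<And>x. \<not> k < - f x \<Longrightarrow> p x = 0" "p \<in> borel_measurable borel"
      \<comment> \<open>New positivity can arise only where \<open>p\<close> is nonzero, that is
        where \<open>- f\<close> exceeds k.\<close>
      have "(\<integral>x. indicator (ball c r) x * (of_bool (0 < f x + p x) - of_bool (0 < f x)) \<partial>lborel) \<le>
        (\<integral>x. (indicator ({x. k < - f x} \<inter> ball c r) x :: real) \<partial>lborel)"
      proof (rule integral_mono[OF jump_integrable finite_measure_ball_Int(2)])
        show "{x. k < - f x} \<in> sets borel" by measurable
        show "indicator (ball c r) x * (of_bool (0 < f x + p x) - of_bool (0 < f x)) \<le> (indicator ({x. k < - f x} \<inter> ball c r) x :: real)" for x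
          using p(2)[of x] by (auto simp: indicator_def)
      qed (use p in auto)
      then show "(\<integral>x. indicator (ball c r) x * (of_bool (0 < f x + p x) - of_bool (0 < f x)) \<partial>lborel) \<le> measure lborel ({x. k < - f x} \<inter> ball c r)"
        by simp
    qed (use r in auto)
  qed
  assume pos: "AE x in lborel. x \<in> ball c R \<longrightarrow> 0 < f x"
  show "DG (DGconst lam Lam TYPE('n)) 0 c R (\<lambda>x. - f x) (\<lambda>x. - G x)"
    unfolding DG_def
  proof (intro conjI allI impI L)
    fix k \<rho> r :: real assume r: "0 < \<rho> \<and> \<rho> < r \<and> r \<le> R"
    have "(\<integral>x. indicator (ball c \<rho> \<inter> {x. k < - f x}) x * (norm (- G x))^2 \<partial>lborel) \<le>
       DGconst lam Lam TYPE('n) / (r - \<rho>)^2 * (\<integral>x. indicator (ball c r) x * (max 0 (- f x - k))^2 \<partial>lborel) + 2 / lam * 0"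
    proof (rule key)
      fix p :: "real^'n \<Rightarrow> real"
      have "AE x in lborel. indicator (ball c r) x * (of_bool (0 < f x + p x) - of_bool (0 < f x) :: real) \<le> 0"
        using pos by eventually_elim (use r in \<open>auto simp: indicator_def\<close>)
      then show "(\<integral>x. indicator (ball c r) x * (of_bool (0 < f x + p x) - of_bool (0 < f x)) \<partial>lborel) \<le> (0::real)"
        by (rule integral_nonpos_AE)
    qed (use r in auto)
    then show "(\<integral>x. indicator (ball c \<rho> \<inter> {x. k < - f x}) x * (norm (- G x))^2 \<partial>lborel) \<le>
       DGconst lam Lam TYPE('n) / (r - \<rho>)^2 * (\<integral>x. indicator (ball c r) x * (max 0 (- f x - k))^2 \<partial>lborel)
       + 0 * measure lborel ({x. k < - f x} \<inter> ball c r)" by simp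
  qed
qed

text \<open>The competitor $(1 - \zeta^2) u$ vanishes on the inner ball, which saves the measure of the positivity set there.\<close>

lemma minimizer_kill:
  fixes f :: "real^'n::finite \<Rightarrow> real"
  assumes M: "AC_minimizer lam Lam \<Omega> a u f G" and B: "cball c r \<subseteq> \<Omega>" "0 < \<rho>" "\<rho> < r"
  shows "2 / lam * measure lborel ({x. 0 < f x} \<inter> ball c \<rho>) + (\<integral>x. indicator (ball c \<rho> \<inter> {x. 0 < f x}) x * (norm (G x))^2 \<partial>lborel)
    \<le> DGconst lam Lam TYPE('n) / (r - \<rho>)^2 * (\<integral>x. indicator (ball c r) x * (max 0 (f x))^2 \<partial>lborel)"
proof -
  have f: "LW \<Omega> f G" using M by (auto simp: AC_minimizer_def)
  have fb [measurable]: "f \<in> borel_measurable borel" by (rule L2_borel[OF LW_D(1)[OF f]])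
  have S: "{x. 0 < f x} \<in> sets borel" by measurable
  have "(\<integral>x. indicator (ball c r) x * (of_bool (0 < f x + p x) - of_bool (0 < f x)) \<partial>lborel) \<le> - measure lborel ({x. 0 < f x} \<inter> ball c \<rho>)"
    if z: "\<And>x. x \<in> ball c \<rho> \<Longrightarrow> \<zeta> x = 1" "\<And>x. p x = - 1 * ((\<zeta> x)^2 * max 0 (1 * f x - 0))" "p \<in> borel_measurable borel"
    for \<zeta> p :: "real^'n \<Rightarrow> real"
  proof -
    have "(\<integral>x. indicator (ball c r) x * (of_bool (0 < f x + p x) - of_bool (0 < f x)) \<partial>lborel) \<le>
      (\<integral>x. (- indicator ({x. 0 < f x} \<inter> ball c \<rho>) x :: real) \<partial>lborel)"
    proof (rule integral_mono[OF jump_integrable[OF fb z(3)]])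
      show "integrable lborel (\<lambda>x. - indicator ({x. 0 < f x} \<inter> ball c \<rho>) x :: real)"
        by (rule Bochner_Integration.integrable_minus[OF finite_measure_ball_Int(2)[OF S]])
      fix x
      have "p x \<le> 0" by (simp add: z(2))
      moreover have "f x + p x = 0" if "x \<in> ball c \<rho>" "0 < f x" using that z(1)[OF that(1)] by (simp add: z(2))
      ultimately show "indicator (ball c r) x * (of_bool (0 < f x + p x) - of_bool (0 < f x)) \<le> - (indicator ({x. 0 < f x} \<inter> ball c \<rho>) x :: real)"
        using B(3) by (auto simp: indicator_def)
    qed
    then show ?thesis by simp
  qed
  note J = this
  have "(\<integral>x. indicator (ball c \<rho> \<inter> {x. 0 < 1 * f x}) x * (norm (G x))^2 \<partial>lborel) \<le>
       DGconst lam Lam TYPE('n) / (r - \<rho>)^2 * (\<integral>x. indicator (ball c r) x * (max 0 (1 * f x - 0))^2 \<partial>lborel)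
       + 2 / lam * (- measure lborel ({x. 0 < f x} \<inter> ball c \<rho>))"
    by (rule cutoff_caccioppoli[OF M B]) (simp, rule J)
  then show ?thesis by simp
qed

section \<open>De Giorgi classes and nondegeneracy\<close>

definition excess :: "(real^'n::finite \<Rightarrow> real) \<Rightarrow> real^'n \<Rightarrow> real \<Rightarrow> real \<Rightarrow> real" where
  "excess f c k r = (\<integral>x. indicator (ball c r) x * (max 0 (f x - k))^2 \<partial>lborel)"

lemma excess_nonneg: "0 \<le> excess f c k r"
  unfolding excess_def by (rule Bochner_Integration.integral_nonneg) simp

lemma excess_integrable: "L2 f \<Longrightarrow> integrable lborel (\<lambda>x. indicator (ball c r) x * (max 0 (f x - k))^2)"
  by (rule integrable_max0_sq) auto

lemma excess_mono:
  assumes f: "L2 f" and "r \<le> r'" "k' \<le> k"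
  shows "excess f c k r \<le> excess f c k' r'"
  unfolding excess_def
proof (rule integral_mono[OF excess_integrable[OF f] excess_integrable[OF f]])
  fix x
  have "(max 0 (f x - k))^2 \<le> (max 0 (f x - k'))^2" using assms(3) by (intro power_mono) auto
  then show "indicator (ball c r) x * (max 0 (f x - k))^2 \<le> indicator (ball c r') x * (max 0 (f x - k'))^2"
    using assms(2) by (auto simp: indicator_def)
qed

text \<open>Chebyshev: on the set in question the excess over k' is more than k - k'.\<close>

lemma superlevel_measure:
  fixes f :: "real^'n::finite \<Rightarrow> real"
  assumes f: "L2 f" and "k' < k"
  shows "(k - k')^2 * measure lborel ({x. k < f x} \<inter> ball c r) \<le> excess f c k' r"
proof -
  have [measurable]: "f \<in> borel_measurable borel" by (rule L2_borel[OF f])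
  have S: "{x. k < f x} \<in> sets borel" by measurable
  have "(k - k')^2 * measure lborel ({x. k < f x} \<inter> ball c r) =
    (\<integral>x. (k - k')^2 * (indicator ({x. k < f x} \<inter> ball c r) x :: real) \<partial>lborel)" by simp
  also have "\<dots> \<le> excess f c k' r" unfolding excess_def
  proof (rule integral_mono[OF integrable_mult_right[OF finite_measure_ball_Int(2)[OF S]] excess_integrable[OF f]])
    fix x
    show "(k - k')^2 * (indicator ({x. k < f x} \<inter> ball c r) x :: real) \<le> indicator (ball c r) x * (max 0 (f x - k'))^2"
    proof (cases "x \<in> {x. k < f x} \<inter> ball c r")
      case True
      then have "(k - k')^2 \<le> (max 0 (f x - k'))^2" using assms(2) by (intro power_mono) auto
      then show ?thesis using True by simp
    qed simp
  qed
  finally show ?thesis .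
qed

lemma excess_zero:
  fixes f :: "real^'n::finite \<Rightarrow> real"
  assumes f: "L2 f" and z: "excess f c k r \<le> 0"
  shows "AE x in lborel. x \<in> ball c r \<longrightarrow> f x \<le> k"
proof -
  have "AE x in lborel. indicator (ball c r) x * (max 0 (f x - k))^2 = 0"
  proof (rule integral_nonneg_eq_0_iff_AE[OF excess_integrable[OF f], THEN iffD1])
    show "(\<integral>x. indicator (ball c r) x * (max 0 (f x - k))^2 \<partial>lborel) = 0"
      using z excess_nonneg[of f c k r] unfolding excess_def by linarith
  qed simp
  then show ?thesis by eventually_elim (auto simp: indicator_def split: if_splits)
qed

text \<open>Faber--Krahn for \<zeta> times the truncated function, whose support has at most the
  measure of the superlevel set. The length d stays free, so that the iteration can prescribe
  it.\<close>

lemma DG_step: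
  fixes f :: "real^'n::finite \<Rightarrow> real"
  assumes f: "LW (ball c R) f G" and r: "0 < \<rho>" "\<rho> < r" "r \<le> R"
    and d: "0 < d" "2 * measure lborel ({x. k < f x} \<inter> ball c r) \<le> d ^ CARD('n)"
  shows "excess f c k \<rho> \<le> 2 * real CARD('n) * d^2 *
     (2 * (\<integral>x. indicator (ball c r \<inter> {x. k < f x}) x * (norm (G x))^2 \<partial>lborel)
     + 2 * ((cutoff_const TYPE('n) / (r - \<rho>))^2 * excess f c k r))"
proof -
  obtain \<zeta> where z: "test_fun (ball c r) \<zeta>" "\<And>x. 0 \<le> \<zeta> x" "\<And>x. \<zeta> x \<le> 1"
    "\<And>x. x \<in> ball c \<rho> \<Longrightarrow> \<zeta> x = 1" "\<And>x. norm (grad \<zeta> x) \<le> cutoff_const TYPE('n) / (r - \<rho>)"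
    using cutoff_exists[OF r(1,2)] by metis
  define K where "K = cutoff_const TYPE('n) / (r - \<rho>)"
  have fr: "LW (ball c r) f G" by (rule LW_mono[OF f]) (use r in auto)
  have Lf: "L2 f" by (rule LW_D(1)[OF f])
  have [measurable]: "f \<in> borel_measurable borel" by (rule L2_borel[OF Lf])
  define w where "w x = \<zeta> x * max 0 (f x - k)" for x
  define W where "W x = (\<zeta> x * of_bool (k < f x)) *\<^sub>R G x + max 0 (f x - k) *\<^sub>R grad \<zeta> x" for x
  have w: "LW UNIV w W" unfolding w_def[abs_def] W_def[abs_def] by (rule LW_truncate_cutoff[OF fr z(1)])
  define A where "A = {x. k < f x} \<inter> ball c r"
  have S: "{x. k < f x} \<in> sets borel" by measurable
  then have Ab: "A \<in> sets borel" by (simp add: A_def)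
  have out: "\<zeta> x = 0" "grad \<zeta> x = 0" if "x \<notin> ball c r" for x
  proof -
    have "x \<notin> tsupport \<zeta>" using z(1) that by (auto simp: test_fun_def)
    then show "\<zeta> x = 0" "grad \<zeta> x = 0"
      using zero_outside_tsupport[of x \<zeta>] pd_zero_outside[of x \<zeta>] by (auto simp: grad_def vec_eq_iff)
  qed
  have w0: "w x = 0" if "x \<notin> A" for x using that out[of x] by (auto simp: w_def A_def)
  have IG: "integrable lborel (\<lambda>x. (norm (G x))^2)" by (rule L2_norm_square(1)[OF LW_D(2)[OF f]])
  have IGA: "integrable lborel (\<lambda>x. indicator (ball c r \<inter> {x. k < f x}) x * (norm (G x))^2)"
    using integrable_mult_indicator[OF _ IG, of "ball c r \<inter> {x. k < f x}"] S by simp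
  have "excess f c k \<rho> \<le> (\<integral>x. (w x)^2 \<partial>lborel)"
    unfolding excess_def
  proof (rule integral_mono[OF excess_integrable[OF Lf] L2_integrable[OF LW_D(1)[OF w]]])
    show "indicator (ball c \<rho>) x * (max 0 (f x - k))^2 \<le> (w x)^2" for x
      using z(4)[of x] by (auto simp: w_def indicator_def)
  qed
  also have "\<dots> \<le> 2 * real CARD('n) * d^2 * (\<integral>x. (norm (W x))^2 \<partial>lborel)"
  proof (rule faber_krahn[OF w _ bounded_ball Ab w0 _ d(1)])
    show "w x = 0" if "x \<notin> ball c r" for x using that w0 by (auto simp: A_def)
    show "emeasure lborel A < \<infinity>" unfolding A_def by (rule finite_measure_ball_Int(1)[OF S])
    show "2 * measure lborel A \<le> d ^ CARD('n)" using d(2) by (simp add: A_def)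
  qed auto
  also have "(\<integral>x. (norm (W x))^2 \<partial>lborel) \<le> (\<integral>x. 2 * (indicator (ball c r \<inter> {x. k < f x}) x * (norm (G x))^2) + 2 * (K^2 * (indicator (ball c r) x * (max 0 (f x - k))^2)) \<partial>lborel)"
  proof (rule integral_mono[OF L2_norm_square(1)[OF LW_D(2)[OF w]]])
    show "integrable lborel (\<lambda>x. 2 * (indicator (ball c r \<inter> {x. k < f x}) x * (norm (G x))^2) + 2 * (K^2 * (indicator (ball c r) x * (max 0 (f x - k))^2)))"
      by (intro Bochner_Integration.integrable_add integrable_mult_right IGA excess_integrable Lf)
    fix x
    show "(norm (W x))^2 \<le> 2 * (indicator (ball c r \<inter> {x. k < f x}) x * (norm (G x))^2) + 2 * (K^2 * (indicator (ball c r) x * (max 0 (f x - k))^2))"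
    proof (cases "x \<in> ball c r \<and> k < f x")
      case True
      have "norm (W x) \<le> \<zeta> x * norm (G x) + (f x - k) * norm (grad \<zeta> x)"
        using True z(2)[of x] norm_triangle_ineq[of "(\<zeta> x * of_bool (k < f x)) *\<^sub>R G x" "max 0 (f x - k) *\<^sub>R grad \<zeta> x"]
        by (simp add: W_def)
      also have "\<dots> \<le> norm (G x) + (f x - k) * K"
        using True z(2,3,5)[of x] by (intro add_mono mult_left_le_one_le mult_left_mono) (auto simp: K_def)
      finally have "(norm (W x))^2 \<le> (norm (G x) + (f x - k) * K)^2" by (intro power_mono) auto
      also have "\<dots> \<le> 2 * (norm (G x))^2 + 2 * ((f x - k) * K)^2"
        using sum_squares_bound[of "norm (G x)" "(f x - k) * K"] by (simp add: power2_sum)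
      finally show ?thesis using True by (simp add: power_mult_distrib mult.commute)
    next
      case False
      then have "W x = 0" using out[of x] by (auto simp: W_def)
      then show ?thesis by simp
    qed
  qed
  also have "\<dots> = 2 * (\<integral>x. indicator (ball c r \<inter> {x. k < f x}) x * (norm (G x))^2 \<partial>lborel) + 2 * (K^2 * excess f c k r)"
    using IGA excess_integrable[OF Lf, of c r k] by (simp add: excess_def)
  finally show ?thesis using d(1) by (simp add: K_def mult_left_mono)
qed

text \<open>Each step from \<open>rad R j\<close> to \<open>rad R (Suc j)\<close> is halved by
  \<open>rad' R j\<close>: the energy estimate uses the outer half and the cutoff of
  \<open>DG_step\<close> the inner one. Both gaps equal R 2^(-j) / 8, and the radii stay above
  R/2.\<close>

definition rad :: "real \<Rightarrow> nat \<Rightarrow> real" where "rad R j = R / 2 * (1 + (1/2)^j)"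

definition rad' :: "real \<Rightarrow> nat \<Rightarrow> real" where "rad' R j = R / 2 * (1 + 3/4 * (1/2)^j)"

lemma rad_props:
  assumes "0 < R"
  shows "rad R 0 = R" "R / 2 < rad R j" "rad R j \<le> R" "0 < rad R j" "0 < rad' R j" "rad' R j \<le> R"
    "rad R j - rad' R j = R * (1/2)^j / 8" "rad' R j - rad R (Suc j) = R * (1/2)^j / 8"
    "rad R (Suc j) < rad' R j" "rad' R j < rad R j"
proof -
  define t where "t = (1/2::real)^j"
  have t: "0 < t" "t \<le> 1" "(1/2::real)^j = t" "(1/2::real)^Suc j = t / 2" by (auto simp: t_def power_le_one)
  show "rad R 0 = R" by (simp add: rad_def)
  show "R / 2 < rad R j" "rad R j \<le> R" "0 < rad R j" "0 < rad' R j"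
    using assms t(1,2) unfolding rad_def rad'_def t(3) by (auto simp: field_simps add_pos_pos)
  have "rad' R j \<le> R / 2 * 2" using assms t(1,2) unfolding rad'_def t(3) by (intro mult_left_mono) auto
  then show "rad' R j \<le> R" by simp
  show 1: "rad R j - rad' R j = R * (1/2)^j / 8" "rad' R j - rad R (Suc j) = R * (1/2)^j / 8"
    unfolding rad_def rad'_def t(3,4) by (auto simp: field_simps)
  have "0 < R * (1/2)^j / 8" using assms t(1) unfolding t(3) by simp
  then show "rad R (Suc j) < rad' R j" "rad' R j < rad R j" using 1 by linarith+
qed

text \<open>De Giorgi's iteration: with $q = 2^{-n}/4$ the excesses decay like $q^j$, so that the superlevel sets have
  measure at most $(\delta R 2^{-j})^n / 2$, and the Faber--Krahn factor $4^{-j}$ cancels the factor $4^j$ of the energy estimate.\<close>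

lemma DG_iteration:
  fixes C :: real
  assumes C: "0 < C"
  shows "\<exists>\<nu>>0. \<forall>(f::real^'n::finite \<Rightarrow> real) G c R h (k::nat \<Rightarrow> real) K.
    LW (ball c R) f G \<longrightarrow> 0 < R \<longrightarrow> 0 < h \<longrightarrow> (\<forall>j. k j \<le> k (Suc j) \<and> k j \<le> K) \<longrightarrow>
    (\<forall>j. h^2 * measure lborel ({x. k (Suc j) < f x} \<inter> ball c (rad' R j)) \<le> C * 4^j * excess f c (k j) (rad R j)) \<longrightarrow>
    (\<forall>j. R^2 * (\<integral>x. indicator (ball c (rad' R j) \<inter> {x. k (Suc j) < f x}) x * (norm (G x))^2 \<partial>lborel) \<le> C * 4^j * excess f c (k j) (rad R j)) \<longrightarrow>
    excess f c (k 0) R \<le> \<nu> * h^2 * R ^ CARD('n) \<longrightarrow>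
    (AE x in lborel. x \<in> ball c (R / 2) \<longrightarrow> f x \<le> K)"
proof -
  define n where "n = CARD('n)"
  define C0 where "C0 = cutoff_const TYPE('n)"
  define q where "q = (1/2::real)^n / 4"
  \<comment> \<open>\<open>d\<close> is the length for which the Faber--Krahn factor times the
    energy and cutoff coefficients equals \<open>q\<close>; 64 is the square of the 8 in the radius
    gap. The next constant \<nu> converts the smallness of the excess into the bound of the
    superlevel measure by half of (R d 2^(-j))^n.\<close>
  define d where "d = sqrt (q / (4 * real n * (C + 64 * C0^2)))"
  define \<nu> where "\<nu> = d^n / (2 * C)"
  have n: "0 < n" by (simp add: n_def)
  have q: "0 < q" "q < 1" using power_le_one[of "1/2::real" n] by (auto simp: q_def simp del: power_one_over)
  have den: "0 < 4 * real n * (C + 64 * C0^2)" using n C by (simp add: add_pos_nonneg)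
  then have d: "0 < d" "d^2 * (4 * real n * (C + 64 * C0^2)) = q" using q n by (auto simp: d_def)
  have \<nu>: "0 < \<nu>" using d C by (simp add: \<nu>_def)
  have main: "AE x in lborel. x \<in> ball c (R / 2) \<longrightarrow> f x \<le> K"
    if f: "LW (ball c R) f G" and R: "0 < R" and h: "0 < h" and k: "\<And>j. k j \<le> k (Suc j)" "\<And>j. k j \<le> K"
      and m: "\<And>j. h^2 * measure lborel ({x. k (Suc j) < f x} \<inter> ball c (rad' R j)) \<le> C * 4^j * excess f c (k j) (rad R j)"
      and g: "\<And>j. R^2 * (\<integral>x. indicator (ball c (rad' R j) \<inter> {x. k (Suc j) < f x}) x * (norm (G x))^2 \<partial>lborel) \<le> C * 4^j * excess f c (k j) (rad R j)"
      and e0: "excess f c (k 0) R \<le> \<nu> * h^2 * R ^ n"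
    for f :: "real^'n \<Rightarrow> real" and G c R h K and k :: "nat \<Rightarrow> real"
  proof -
    note rp = rad_props[OF R]
    have Lf: "L2 f" by (rule LW_D(1)[OF f])
    define A where "A j = excess f c (k j) (rad R j)" for j
    have A0: "0 \<le> A j" for j unfolding A_def by (rule excess_nonneg)
    have step: "A (Suc j) \<le> q * A j" if Aj: "A j \<le> \<nu> * q^j * h^2 * R^n" for j
    proof -
      define T where "T = (2::real)^j"
      have T: "0 < T" "(4::real)^j = T^2" "(1/2::real)^j = 1 / T" by (auto simp: T_def power_mult[symmetric] mult.commute power_one_over power2_eq_square power_mult_distrib[symmetric])
      have qn: "(4 * q) = (1/2)^n" by (simp add: q_def)
      define M where "M = measure lborel ({x. k (Suc j) < f x} \<inter> ball c (rad' R j))"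
      have "h^2 * M \<le> C * 4^j * (\<nu> * q^j * h^2 * R^n)"
        using m[of j] Aj C unfolding A_def[symmetric] M_def[symmetric] by (meson mult_left_mono order_trans mult_nonneg_nonneg less_imp_le zero_le_power zero_le_numeral)
      then have "h^2 * M \<le> h^2 * (C * \<nu> * (4 * q)^j * R^n)" by (simp add: power_mult_distrib mult_ac)
      then have M: "M \<le> C * \<nu> * (4 * q)^j * R^n" using h by simp
      define \<delta> where "\<delta> = R * d * (1/2)^j"
      have \<delta>: "0 < \<delta>" using R d by (simp add: \<delta>_def)
      have "2 * M \<le> \<delta> ^ n"
      proof -
        have "\<delta>^n = R^n * d^n * (4 * q)^j" unfolding \<delta>_def qn by (simp add: power_mult_distrib power_mult[symmetric] mult.commute)
        also have "\<dots> = 2 * (C * \<nu> * (4 * q)^j * R^n)" using C by (simp add: \<nu>_def)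
        finally show ?thesis using M by simp
      qed
      from DG_step[OF f rp(4)[of "Suc j"] rp(9)[of j] rp(6)[of j] \<delta> this[unfolded M_def n_def]]
      have "A (Suc j) \<le> 2 * real n * \<delta>^2 * (2 * (\<integral>x. indicator (ball c (rad' R j) \<inter> {x. k (Suc j) < f x}) x * (norm (G x))^2 \<partial>lborel)
        + 2 * ((C0 / (R * (1/2)^j / 8))^2 * excess f c (k (Suc j)) (rad' R j)))"
        unfolding A_def n_def C0_def rp(8) .
      also have "\<dots> \<le> 2 * real n * \<delta>^2 * (2 * (C * 4^j * A j / R^2) + 2 * ((C0 / (R * (1/2)^j / 8))^2 * A j))"
      proof (intro mult_left_mono add_mono)
        show "(\<integral>x. indicator (ball c (rad' R j) \<inter> {x. k (Suc j) < f x}) x * (norm (G x))^2 \<partial>lborel) \<le> C * 4^j * A j / R^2"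
          using g[of j] R unfolding A_def by (simp add: field_simps)
        show "excess f c (k (Suc j)) (rad' R j) \<le> A j" unfolding A_def
          using rp(10)[of j] k(1)[of j] by (intro excess_mono Lf) auto
      qed (auto simp: n)
      also have "\<dots> = d^2 * (4 * real n * (C + 64 * C0^2)) * A j"
        using R T(1) unfolding \<delta>_def T(2,3) by (simp add: field_simps power2_eq_square)
      finally show ?thesis unfolding d(2) .
    qed
    have dec: "A j \<le> \<nu> * q^j * h^2 * R^n" for j
    proof (induction j)
      case 0
      then show ?case using e0 by (simp add: A_def rp(1))
    next
      case (Suc j)
      have "A (Suc j) \<le> q * A j" by (rule step[OF Suc])
      also have "\<dots> \<le> q * (\<nu> * q^j * h^2 * R^n)" using Suc q by (intro mult_left_mono) auto
      finally show ?case by (simp add: mult_ac)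
    qed
    have "(\<lambda>j. q^j) \<longlonglongrightarrow> 0" by (rule LIMSEQ_power_zero) (use q in simp)
    then have lim: "(\<lambda>j. \<nu> * q^j * h^2 * R^n) \<longlonglongrightarrow> \<nu> * 0 * h^2 * R^n"
      by (intro tendsto_mult tendsto_const)
    have "excess f c K (R / 2) \<le> \<nu> * 0 * h^2 * R^n"
    proof (rule LIMSEQ_le_const[OF lim], intro exI allI impI)
      fix j
      have "excess f c K (R / 2) \<le> A j" unfolding A_def
        using rp(2)[of j] k(2)[of j] by (intro excess_mono Lf) auto
      then show "excess f c K (R / 2) \<le> \<nu> * q^j * h^2 * R^n" using dec[of j] by linarith
    qed
    then show ?thesis by (intro excess_zero Lf) simp
  qed
  show ?thesis using \<nu> main unfolding n_def by (intro exI[of _ \<nu>]) blast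
qed

text \<open>The levels climb from k to k + h in steps h 2^(-j) / 2, so Chebyshev supplies the
  measure hypothesis of the iteration and the De Giorgi inequality the energy hypothesis. The error
  term is harmless once its scaled size is at most h^2.\<close>

lemma DG_sup_bound:
  assumes "0 \<le> \<gamma>"
  shows "\<exists>\<nu>>0. \<forall>(f::real^'n::finite \<Rightarrow> real) G c R h k \<epsilon>. DG \<gamma> \<epsilon> c R f G \<longrightarrow> 0 < R \<longrightarrow> 0 < h \<longrightarrow> 0 \<le> \<epsilon> \<longrightarrow> \<epsilon> * R^2 \<le> h^2 \<longrightarrow>
    excess f c k R \<le> \<nu> * h^2 * R ^ CARD('n) \<longrightarrow> (AE x in lborel. x \<in> ball c (R / 2) \<longrightarrow> f x \<le> k + h)"
proof -
  \<comment> \<open>64 is the squared 8 of the radius gap, and 4 comes from Chebyshev at level gap h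
    2^(-j) / 2.\<close>
  define C where "C = 64 * \<gamma> + 4"
  have C: "0 < C" using assms by (simp add: C_def add_nonneg_pos)
  obtain \<nu> where \<nu>: "0 < \<nu>" and it: "\<And>(f::real^'n \<Rightarrow> real) G c R h (k::nat \<Rightarrow> real) K.
    LW (ball c R) f G \<Longrightarrow> 0 < R \<Longrightarrow> 0 < h \<Longrightarrow> (\<And>j. k j \<le> k (Suc j) \<and> k j \<le> K) \<Longrightarrow>
    (\<And>j. h^2 * measure lborel ({x. k (Suc j) < f x} \<inter> ball c (rad' R j)) \<le> C * 4^j * excess f c (k j) (rad R j)) \<Longrightarrow>
    (\<And>j. R^2 * (\<integral>x. indicator (ball c (rad' R j) \<inter> {x. k (Suc j) < f x}) x * (norm (G x))^2 \<partial>lborel) \<le> C * 4^j * excess f c (k j) (rad R j)) \<Longrightarrow>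
    excess f c (k 0) R \<le> \<nu> * h^2 * R ^ CARD('n) \<Longrightarrow>
    (AE x in lborel. x \<in> ball c (R / 2) \<longrightarrow> f x \<le> K)"
    using DG_iteration[OF C, where 'n='n] by blast
  have "AE x in lborel. x \<in> ball c (R / 2) \<longrightarrow> f x \<le> k0 + h"
    if D: "DG \<gamma> \<epsilon> c R f G" and R: "0 < R" and h: "0 < h" and \<epsilon>: "0 \<le> \<epsilon>" "\<epsilon> * R^2 \<le> h^2"
      and e: "excess f c k0 R \<le> \<nu> * h^2 * R ^ CARD('n)" for f :: "real^'n \<Rightarrow> real" and G c R h k0 \<epsilon>
  proof -
    note rp = rad_props[OF R]
    have f: "LW (ball c R) f G" using D by (simp add: DG_def)
    have Lf: "L2 f" by (rule LW_D(1)[OF f])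
    define k where "k j = k0 + h * (1 - (1/2)^j)" for j
    define T where "T j = (2::real)^j" for j
    have T: "0 < T j" "(4::real)^j = (T j)^2" "(1/2::real)^j = 1 / T j" for j
      by (auto simp: T_def power_mult[symmetric] mult.commute power_one_over power2_eq_square power_mult_distrib[symmetric])
    have kd: "k (Suc j) - k j = h / (2 * T j)" for j unfolding k_def T_def by (simp add: power_one_over field_simps)
    have kd0: "k j < k (Suc j)" for j
    proof -
      have "0 < h / (2 * T j)" using h T(1)[of j] by simp
      then show ?thesis using kd[of j] by linarith
    qed
    have meas: "h^2 * measure lborel ({x. k (Suc j) < f x} \<inter> ball c r) \<le> 4 * 4^j * excess f c (k j) r" for j r
    proof -
      have "(h / (2 * T j))^2 * measure lborel ({x. k (Suc j) < f x} \<inter> ball c r) \<le> excess f c (k j) r"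
        using superlevel_measure[OF Lf kd0[of j], of c r] unfolding kd .
      then show ?thesis using T(1)[of j] by (simp add: T(2) power_divide power_mult_distrib field_simps)
    qed
    show ?thesis
    proof (rule it[OF f R h, of k])
      show "k j \<le> k (Suc j) \<and> k j \<le> k0 + h" for j
        using kd0[of j] h unfolding k_def by (simp add: algebra_simps)
      show "h^2 * measure lborel ({x. k (Suc j) < f x} \<inter> ball c (rad' R j)) \<le> C * 4^j * excess f c (k j) (rad R j)" for j
      proof -
        have "h^2 * measure lborel ({x. k (Suc j) < f x} \<inter> ball c (rad' R j)) \<le> 4 * 4^j * excess f c (k j) (rad' R j)" by (rule meas)
        also have "\<dots> \<le> C * 4^j * excess f c (k j) (rad R j)"
          using assms rp(10)[of j] by (intro mult_mono excess_mono Lf excess_nonneg) (auto simp: C_def)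
        finally show ?thesis .
      qed
      show "R^2 * (\<integral>x. indicator (ball c (rad' R j) \<inter> {x. k (Suc j) < f x}) x * (norm (G x))^2 \<partial>lborel) \<le> C * 4^j * excess f c (k j) (rad R j)" for j
      proof -
        let ?X = "measure lborel ({x. k (Suc j) < f x} \<inter> ball c (rad R j))"
        have "(\<integral>x. indicator (ball c (rad' R j) \<inter> {x. k (Suc j) < f x}) x * (norm (G x))^2 \<partial>lborel) \<le>
          \<gamma> / (rad R j - rad' R j)^2 * excess f c (k (Suc j)) (rad R j) + \<epsilon> * ?X"
          using D rp(5,10,3)[of j] unfolding DG_def excess_def by blast
        then have "R^2 * (\<integral>x. indicator (ball c (rad' R j) \<inter> {x. k (Suc j) < f x}) x * (norm (G x))^2 \<partial>lborel) \<le>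
          R^2 * (\<gamma> / (R * (1/2)^j / 8)^2 * excess f c (k (Suc j)) (rad R j) + \<epsilon> * ?X)"
          unfolding rp(7) by (intro mult_left_mono) auto
        also have "\<dots> = 64 * \<gamma> * 4^j * excess f c (k (Suc j)) (rad R j) + (\<epsilon> * R^2) * ?X"
          using R T(1)[of j] unfolding T(2,3) by (simp add: field_simps power2_eq_square)
        \<comment> \<open>The error term is bounded through h^2 times the superlevel measure, which
          Chebyshev returns to the excess at the lower level.\<close>
        also have "\<dots> \<le> 64 * \<gamma> * 4^j * excess f c (k j) (rad R j) + h^2 * ?X"
          using assms \<epsilon>(2) kd0[of j] by (intro add_mono mult_left_mono mult_right_mono excess_mono Lf) auto
        also have "\<dots> \<le> 64 * \<gamma> * 4^j * excess f c (k j) (rad R j) + 4 * 4^j * excess f c (k j) (rad R j)"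
          using meas[of j "rad R j"] by simp
        also have "\<dots> = C * 4^j * excess f c (k j) (rad R j)" by (simp add: C_def algebra_simps)
        finally show ?thesis .
      qed
      show "excess f c (k 0) R \<le> \<nu> * h^2 * R ^ CARD('n)" using e by (simp add: k_def)
    qed
  qed
  with \<nu> show ?thesis by blast
qed

text \<open>All levels stay at 0, so there is no gap for Chebyshev. Instead
  \<open>minimizer_kill\<close> bounds the measure of the positivity set itself by the excess; this
  is where the measure term of the functional forces u to vanish.\<close>

lemma minimizer_nondegenerate:
  assumes lam: "0 < lam" "lam \<le> Lam"
  shows "\<exists>\<nu>>0. \<forall>\<Omega> a u (f::real^'n::finite \<Rightarrow> real) G c R. AC_minimizer lam Lam \<Omega> a u f G \<longrightarrow> cball c R \<subseteq> \<Omega> \<longrightarrow> 0 < R \<longrightarrow>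
    excess f c 0 R \<le> \<nu> * R^2 * R ^ CARD('n) \<longrightarrow> (AE x in lborel. x \<in> ball c (R / 2) \<longrightarrow> f x \<le> 0)"
proof -
  define \<gamma> where "\<gamma> = DGconst lam Lam TYPE('n)"
  have \<gamma>: "0 < \<gamma>" using lam cutoff_const_pos[where 'n='n] by (simp add: \<gamma>_def DGconst_def)
  define C where "C = 64 * \<gamma> + 32 * \<gamma> * lam"
  have C: "0 < C" "64 * \<gamma> \<le> C" "32 * \<gamma> * lam \<le> C" using \<gamma> lam by (auto simp: C_def add_pos_pos)
  obtain \<nu> where \<nu>: "0 < \<nu>" and it: "\<And>(f::real^'n \<Rightarrow> real) G c R h (k::nat \<Rightarrow> real) K.
    LW (ball c R) f G \<Longrightarrow> 0 < R \<Longrightarrow> 0 < h \<Longrightarrow> (\<And>j. k j \<le> k (Suc j) \<and> k j \<le> K) \<Longrightarrow>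
    (\<And>j. h^2 * measure lborel ({x. k (Suc j) < f x} \<inter> ball c (rad' R j)) \<le> C * 4^j * excess f c (k j) (rad R j)) \<Longrightarrow>
    (\<And>j. R^2 * (\<integral>x. indicator (ball c (rad' R j) \<inter> {x. k (Suc j) < f x}) x * (norm (G x))^2 \<partial>lborel) \<le> C * 4^j * excess f c (k j) (rad R j)) \<Longrightarrow>
    excess f c (k 0) R \<le> \<nu> * h^2 * R ^ CARD('n) \<Longrightarrow>
    (AE x in lborel. x \<in> ball c (R / 2) \<longrightarrow> f x \<le> K)"
    using DG_iteration[OF C(1), where 'n='n] by blast
  have "AE x in lborel. x \<in> ball c (R / 2) \<longrightarrow> f x \<le> 0"
    if M: "AC_minimizer lam Lam \<Omega> a u f G" and B: "cball c R \<subseteq> \<Omega>" and R: "0 < R"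
      and e: "excess f c 0 R \<le> \<nu> * R^2 * R ^ CARD('n)" for \<Omega> a u and f :: "real^'n \<Rightarrow> real" and G c R
  proof -
    note rp = rad_props[OF R]
    have f: "LW (ball c R) f G" using minimizer_DG_sub[OF M B] by (simp add: DG_def)
    have S: "0 \<le> (\<integral>x. indicator (ball c (rad' R j) \<inter> {x. 0 < f x}) x * (norm (G x))^2 \<partial>lborel)" for j
      by (rule Bochner_Integration.integral_nonneg) simp
    have kill: "R^2 * (2 / lam * measure lborel ({x. 0 < f x} \<inter> ball c (rad' R j)) + (\<integral>x. indicator (ball c (rad' R j) \<inter> {x. 0 < f x}) x * (norm (G x))^2 \<partial>lborel))
      \<le> 64 * \<gamma> * 4^j * excess f c 0 (rad R j)" for j
    proof -
      define T where "T = (2::real)^j"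
      have T: "0 < T" "(4::real)^j = T^2" "(1/2::real)^j = 1 / T" by (auto simp: T_def power_mult[symmetric] mult.commute power_one_over power2_eq_square power_mult_distrib[symmetric])
      have "cball c (rad R j) \<subseteq> \<Omega>" using B rp(3)[of j] by (meson order_trans subset_cball)
      from minimizer_kill[OF M this rp(5)[of j] rp(10)[of j]]
      have "R^2 * (2 / lam * measure lborel ({x. 0 < f x} \<inter> ball c (rad' R j)) + (\<integral>x. indicator (ball c (rad' R j) \<inter> {x. 0 < f x}) x * (norm (G x))^2 \<partial>lborel))
        \<le> R^2 * (\<gamma> / (R * (1/2)^j / 8)^2 * excess f c 0 (rad R j))"
        unfolding rp(7) \<gamma>_def excess_def by (intro mult_left_mono) auto
      also have "\<dots> = 64 * \<gamma> * 4^j * excess f c 0 (rad R j)"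
        using R T(1) unfolding T(2,3) by (simp add: field_simps power2_eq_square)
      finally show ?thesis .
    qed
    show ?thesis
    proof (rule it[OF f R R, of "\<lambda>_. 0"])
      fix j
      have "R^2 * (2 / lam * measure lborel ({x. 0 < f x} \<inter> ball c (rad' R j))) \<le> 64 * \<gamma> * 4^j * excess f c 0 (rad R j)"
        using S[of j] by (intro order_trans[OF mult_left_mono kill[of j]]) auto
      then have "R^2 * measure lborel ({x. 0 < f x} \<inter> ball c (rad' R j)) \<le> 32 * \<gamma> * lam * 4^j * excess f c 0 (rad R j)"
        using lam by (simp add: field_simps)
      also have "\<dots> \<le> C * 4^j * excess f c 0 (rad R j)"
        using C(3) by (intro mult_right_mono excess_nonneg) auto
      finally show "R^2 * measure lborel ({x. 0 < f x} \<inter> ball c (rad' R j)) \<le> C * 4^j * excess f c 0 (rad R j)" .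
      have "R^2 * (\<integral>x. indicator (ball c (rad' R j) \<inter> {x. 0 < f x}) x * (norm (G x))^2 \<partial>lborel) \<le> 64 * \<gamma> * 4^j * excess f c 0 (rad R j)"
      proof -
        have "0 \<le> R^2 * (2 / lam * measure lborel ({x. 0 < f x} \<inter> ball c (rad' R j)))" using lam by simp
        then show ?thesis using kill[of j] by (simp add: distrib_left)
      qed
      also have "\<dots> \<le> C * 4^j * excess f c 0 (rad R j)"
        using C(2) by (intro mult_right_mono excess_nonneg) auto
      finally show "R^2 * (\<integral>x. indicator (ball c (rad' R j) \<inter> {x. 0 < f x}) x * (norm (G x))^2 \<partial>lborel) \<le> C * 4^j * excess f c 0 (rad R j)" .
    qed (use e in auto)
  qed
  with \<nu> show ?thesis by blast
qed

section \<open>Decrease of the supremum\<close>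

lemma measure_ball_scale:
  fixes c :: "real^'n::finite"
  assumes "0 \<le> r"
  shows "measure lborel (ball c r) = r ^ CARD('n) * measure lborel (ball (0::real^'n) 1)"
  using content_ball_conv_unit_ball[OF assms, of c] by simp

lemma measure_Int_ball_mono:
  fixes c :: "real^'n::finite"
  assumes "X \<in> sets borel" "Y \<in> sets borel" "X \<inter> ball c r \<subseteq> Y \<inter> ball c r'"
  shows "measure lborel (X \<inter> ball c r) \<le> measure lborel (Y \<inter> ball c r')"
  using assms finite_measure_ball_Int(1)[OF assms(2), of c r']
  by (intro measure_mono_fmeasurable) (auto simp: fmeasurable_def)

lemma excess_le_measure:
  fixes f :: "real^'n::finite \<Rightarrow> real"
  assumes f: "L2 f" and b: "AE x in lborel. x \<in> ball c r \<longrightarrow> f x \<le> k + h" and h: "0 \<le> h"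
  shows "excess f c k r \<le> h^2 * measure lborel ({x. k < f x} \<inter> ball c r)"
proof -
  have [measurable]: "f \<in> borel_measurable borel" by (rule L2_borel[OF f])
  have S: "{x. k < f x} \<in> sets borel" by measurable
  have "excess f c k r \<le> (\<integral>x. h^2 * (indicator ({x. k < f x} \<inter> ball c r) x :: real) \<partial>lborel)"
    unfolding excess_def
  proof (rule integral_mono_AE[OF excess_integrable[OF f] integrable_mult_right[OF finite_measure_ball_Int(2)[OF S]]])
    show "AE x in lborel. indicator (ball c r) x * (max 0 (f x - k))^2 \<le> h^2 * (indicator ({x. k < f x} \<inter> ball c r) x :: real)"
      using b
    proof eventually_elim
      case (elim x)
      show ?case
      proof (cases "x \<in> ball c r \<and> k < f x")
        case True
        then have "(max 0 (f x - k))^2 \<le> h^2" using elim by (intro power_mono) auto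
        then show ?thesis using True by simp
      qed (auto simp: indicator_def)
    qed
  qed
  then show ?thesis by simp
qed

text \<open>De Giorgi's second lemma. Between the levels \<mu> - H/2^i and the next, the
  isoperimetric inequality forces the layer to carry measure if the top superlevel set does. The
  layers are disjoint, so among s of them the top set has measure at most of order R^n / sqrt s, and
  for large s \<open>DG_sup_bound\<close> applies at that level. The number s depends only on
  \<gamma>, \<tau> and the dimension.\<close>

lemma DG_decrease:
  assumes \<gamma>: "0 \<le> \<gamma>" and \<tau>: "0 < \<tau>"
  shows "\<exists>s::nat. \<forall>(f::real^'n::finite \<Rightarrow> real) G c R \<mu> H \<epsilon>. DG \<gamma> \<epsilon> c (2 * R) f G \<longrightarrow> 0 < R \<longrightarrow> 0 < H \<longrightarrow> 0 \<le> \<epsilon> \<longrightarrow>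
    \<epsilon> * R^2 \<le> (H / 2^(s+1))^2 \<longrightarrow> (AE x in lborel. x \<in> ball c (2 * R) \<longrightarrow> f x \<le> \<mu>) \<longrightarrow>
    \<tau> * R ^ CARD('n) \<le> measure lborel ({x. f x \<le> \<mu> - H} \<inter> ball c R) \<longrightarrow>
    (AE x in lborel. x \<in> ball c (R / 2) \<longrightarrow> f x \<le> \<mu> - H / 2^(s+1))"
proof -
  define n where "n = real CARD('n)"
  define \<alpha> where "\<alpha> = measure lborel (ball (0::real^'n) 1)"
  have \<alpha>: "0 < \<alpha>" unfolding \<alpha>_def by (rule content_ball_pos) simp
  have n: "0 < n" by (simp add: n_def)
  obtain \<nu> where \<nu>: "0 < \<nu>" and sup: "\<And>(f::real^'n \<Rightarrow> real) G c R h k \<epsilon>. DG \<gamma> \<epsilon> c R f G \<Longrightarrow> 0 < R \<Longrightarrow> 0 < h \<Longrightarrow> 0 \<le> \<epsilon> \<Longrightarrow> \<epsilon> * R^2 \<le> h^2 \<Longrightarrow>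
    excess f c k R \<le> \<nu> * h^2 * R ^ CARD('n) \<Longrightarrow> (AE x in lborel. x \<in> ball c (R / 2) \<longrightarrow> f x \<le> k + h)"
    using DG_sup_bound[OF \<gamma>, where 'n='n] by blast
  \<comment> \<open>The constant that the summed layer estimates give for s (X s)^2 / R^(2n): the
    cube of \<open>V\<close> contributes \<alpha>^3 8^n and the total measure of the layers one
    further \<alpha>. The choice of \<open>s\<close> below makes X s at most \<nu>/4 R^n.\<close>
  define K1 where "K1 = 16 * n * (\<gamma> + 1) * \<alpha>^4 * 8^CARD('n) / \<tau>^2"
  have K1: "0 < K1" using n \<gamma> \<alpha> \<tau> by (auto simp: K1_def intro!: divide_pos_pos mult_pos_pos add_nonneg_pos)
  obtain s :: nat where s: "16 * K1 / \<nu>^2 < real s" using reals_Archimedean2 by blast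
  have "0 < 16 * K1 / \<nu>^2" using K1 \<nu> by simp
  then have s0: "0 < real s" using s by linarith
  have "AE x in lborel. x \<in> ball c (R / 2) \<longrightarrow> f x \<le> \<mu> - H / 2^(s+1)"
    if D: "DG \<gamma> \<epsilon> c (2 * R) f G" and R: "0 < R" and H: "0 < H" and \<epsilon>: "0 \<le> \<epsilon>" "\<epsilon> * R^2 \<le> (H / 2^(s+1))^2"
      and b: "AE x in lborel. x \<in> ball c (2 * R) \<longrightarrow> f x \<le> \<mu>"
      and t: "\<tau> * R ^ CARD('n) \<le> measure lborel ({x. f x \<le> \<mu> - H} \<inter> ball c R)"
    for f :: "real^'n \<Rightarrow> real" and G c R \<mu> H \<epsilon>
  proof -
    have f: "LW (ball c (2 * R)) f G" using D by (simp add: DG_def)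
    have Lf: "L2 f" by (rule LW_D(1)[OF f])
    have LG: "L2 (\<lambda>x. G x $ j)" for j by (rule LW_D(2)[OF f])
    have [measurable]: "f \<in> borel_measurable borel" by (rule L2_borel[OF Lf])
    have Sm: "{x. k < f x} \<in> sets borel" "{x. f x \<le> k} \<in> sets borel" "{x. k < f x \<and> f x \<le> l} \<in> sets borel" for k l by measurable
    define h where "h i = H / 2^i" for i
    define k where "k i = \<mu> - h i" for i
    have h: "0 < h i" "h (Suc i) = h i / 2" for i using H by (auto simp: h_def)
    have hle: "h j \<le> h i" if "i \<le> j" for i j
      unfolding h_def using H that by (intro divide_left_mono) (auto simp: power_increasing)
    have kl: "k i < k (Suc i)" "k (Suc i) - k i = h i / 2" for i using h[of i] h(1)[of "Suc i"] by (auto simp: k_def h(2))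
    define X where "X i = measure lborel ({x. k i < f x} \<inter> ball c R)" for i
    define V where "V = measure lborel (ball (0::real^'n) (2 * R))"
    have V: "V = \<alpha> * 2^CARD('n) * R ^ CARD('n)"
      unfolding V_def \<alpha>_def using R measure_ball_scale[of "2 * R" "0::real^'n"] by (simp add: power_mult_distrib)
    have V0: "0 < V" using V \<alpha> R by simp
    have IG: "integrable lborel (\<lambda>x. (norm (G x))^2)" by (rule L2_norm_square(1)[OF LG])
    \<comment> \<open>Cauchy--Schwarz bounds the gradient integral over the layer by the root of its
      measure times the energy. The energy is of order (h i)^2, the error term being absorbed since
      its smallness is assumed at the finest level, and this cancels the squared level gap.\<close>
    have est: "(X s)^2 \<le> (16 * n * (\<gamma> + 1) * V^3 / (\<tau> * R ^ CARD('n))^2) * (X i - X (Suc i))" if i: "i < s" for i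
    proof -
      define Di where "Di = {x. k i < f x \<and> f x \<le> k (Suc i)} \<inter> ball c R"
      have Dib: "Di \<in> sets borel" "bounded Di" using Sm(3) by (auto simp: Di_def)
      have mD: "measure lborel Di = X i - X (Suc i)"
      proof -
        have "{x. k i < f x} \<inter> ball c R = Di \<union> ({x. k (Suc i) < f x} \<inter> ball c R)" using kl(1)[of i] by (auto simp: Di_def)
        then have "X i = measure lborel (Di \<union> ({x. k (Suc i) < f x} \<inter> ball c R))" by (simp add: X_def)
        also have "\<dots> = measure lborel Di + X (Suc i)" unfolding X_def
        proof (rule measure_Union)
          show "emeasure lborel Di \<noteq> \<infinity>" unfolding Di_def using finite_measure_ball_Int(1)[OF Sm(3)] by (metis less_irrefl)
          show "emeasure lborel ({x. k (Suc i) < f x} \<inter> ball c R) \<noteq> \<infinity>" using finite_measure_ball_Int(1)[OF Sm(1)] by (metis less_irrefl)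
          show "Di \<in> sets lborel" "{x. k (Suc i) < f x} \<inter> ball c R \<in> sets lborel" using Dib(1) Sm(1) by auto
          show "Di \<inter> ({x. k (Suc i) < f x} \<inter> ball c R) = {}" by (auto simp: Di_def)
        qed
        finally show ?thesis by simp
      qed
      define E where "E = (\<integral>x. indicator (ball c R \<inter> {x. k i < f x}) x * (norm (G x))^2 \<partial>lborel)"
      have ei: "\<epsilon> * R^2 \<le> (h i)^2"
      proof -
        have "(H / 2^(s+1))^2 \<le> (h i)^2" using hle[of i "s+1"] i H by (intro power_mono) (auto simp: h_def)
        then show ?thesis using \<epsilon>(2) by linarith
      qed
      have "E \<le> \<gamma> / (2 * R - R)^2 * excess f c (k i) (2 * R) + \<epsilon> * measure lborel ({x. k i < f x} \<inter> ball c (2 * R))"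
      proof -
        have "0 < R \<and> R < 2 * R \<and> 2 * R \<le> 2 * R" using R by simp
        then show ?thesis using D unfolding DG_def excess_def E_def by blast
      qed
      also have "\<dots> \<le> \<gamma> / R^2 * ((h i)^2 * V) + \<epsilon> * V"
      proof -
        have mV: "measure lborel ({x. k i < f x} \<inter> ball c (2 * R)) \<le> V"
          using measure_Int_ball_mono[OF Sm(1), of UNIV "k i" c "2 * R" "2 * R"] measure_ball_scale[of "2 * R" c] measure_ball_scale[of "2 * R" "0::real^'n"] R
          by (simp add: V_def)
        have "excess f c (k i) (2 * R) \<le> (h i)^2 * measure lborel ({x. k i < f x} \<inter> ball c (2 * R))"
          by (rule excess_le_measure[OF Lf]) (use b h(1)[of i] in \<open>auto simp: k_def\<close>)
        also have "\<dots> \<le> (h i)^2 * V" using mV by (intro mult_left_mono) auto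
        finally have "excess f c (k i) (2 * R) \<le> (h i)^2 * V" .
        then show ?thesis using mV \<gamma> \<epsilon>(1) R by (intro add_mono mult_left_mono) (auto intro: mult_left_mono divide_right_mono)
      qed
      also have "\<dots> = (\<gamma> * (h i)^2 + \<epsilon> * R^2) * V / R^2" using R by (simp add: field_simps)
      also have "\<dots> \<le> (\<gamma> * (h i)^2 + (h i)^2) * V / R^2"
        using ei V0 by (intro divide_right_mono mult_right_mono add_left_mono) auto
      also have "\<dots> = (\<gamma> + 1) * (h i)^2 * V / R^2" by (simp add: algebra_simps)
      finally have E: "E \<le> (\<gamma> + 1) * (h i)^2 * V / R^2" .
      define S where "S = (\<Sum>j\<in>UNIV. \<integral>x. indicator Di x * \<bar>G x $ j\<bar> \<partial>lborel)"
      have S2: "S^2 \<le> n * (measure lborel Di * E)"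
      proof -
        have "S^2 \<le> n * (\<Sum>j\<in>UNIV. (\<integral>x. indicator Di x * \<bar>G x $ j\<bar> \<partial>lborel)^2)"
          unfolding S_def n_def using Cauchy_Schwarz_ineq_sum[of "\<lambda>_. 1" "\<lambda>j. \<integral>x. indicator Di x * \<bar>G x $ j\<bar> \<partial>lborel" "UNIV::'n set"] by simp
        also have "\<dots> \<le> n * (\<Sum>j\<in>UNIV. measure lborel Di * (\<integral>x. indicator Di x * (G x $ j)^2 \<partial>lborel))"
        proof (intro mult_left_mono sum_mono)
          fix j
          have LD: "L2 (\<lambda>x. indicator Di x * G x $ j)"
            by (rule L2_bounded_mult[OF LG, where B=1]) (use Dib in \<open>auto simp: indicator_def\<close>)
          have "(\<integral>x. indicator Di x * \<bar>G x $ j\<bar> \<partial>lborel)^2 = (\<integral>x. \<bar>indicator Di x * (indicator Di x * G x $ j)\<bar> \<partial>lborel)^2"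
            by (intro arg_cong[where f="\<lambda>x. x^2"] Bochner_Integration.integral_cong) (auto simp: indicator_def)
          also have "\<dots> \<le> (\<integral>x. (indicator Di x)^2 \<partial>lborel) * (\<integral>x. (indicator Di x * G x $ j)^2 \<partial>lborel)"
            by (rule L2_cauchy_schwarz[OF L2_indicator[OF Dib] LD])
          also have "(\<integral>x. (indicator Di x :: real)^2 \<partial>lborel) = measure lborel Di"
          proof -
            have "(\<lambda>x. (indicator Di x :: real)^2) = indicator Di" by (auto simp: indicator_def)
            then show ?thesis by simp
          qed
          also have "(\<lambda>x. (indicator Di x * G x $ j)^2) = (\<lambda>x. indicator Di x * (G x $ j)^2)" by (auto simp: indicator_def)
          finally show "(\<integral>x. indicator Di x * \<bar>G x $ j\<bar> \<partial>lborel)^2 \<le> measure lborel Di * (\<integral>x. indicator Di x * (G x $ j)^2 \<partial>lborel)" .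
        qed (simp add: n_def)
        also have "(\<Sum>j\<in>UNIV. measure lborel Di * (\<integral>x. indicator Di x * (G x $ j)^2 \<partial>lborel)) = measure lborel Di * (\<integral>x. indicator Di x * (norm (G x))^2 \<partial>lborel)"
        proof -
          have I: "integrable lborel (\<lambda>x. indicator Di x * (G x $ j)^2)" for j
            using integrable_mult_indicator[OF _ L2_integrable[OF LG[of j]], of Di] Dib by simp
          have "(\<integral>x. indicator Di x * (norm (G x))^2 \<partial>lborel) = (\<integral>x. (\<Sum>j\<in>UNIV. indicator Di x * (G x $ j)^2) \<partial>lborel)"
            unfolding power2_norm_eq_inner inner_vec_def by (simp add: power2_eq_square sum_distrib_left)
          also have "\<dots> = (\<Sum>j\<in>UNIV. \<integral>x. indicator Di x * (G x $ j)^2 \<partial>lborel)"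
            by (rule Bochner_Integration.integral_sum[OF I])
          finally show ?thesis by (simp add: sum_distrib_left)
        qed
        also have "(\<integral>x. indicator Di x * (norm (G x))^2 \<partial>lborel) \<le> E" unfolding E_def
        proof (rule integral_mono)
          show "integrable lborel (\<lambda>x. indicator Di x * (norm (G x))^2)"
            using integrable_mult_indicator[OF _ IG, of Di] Dib by simp
          show "integrable lborel (\<lambda>x. indicator (ball c R \<inter> {x. k i < f x}) x * (norm (G x))^2)"
            using integrable_mult_indicator[OF _ IG, of "ball c R \<inter> {x. k i < f x}"] Sm by simp
        qed (auto simp: Di_def indicator_def)
        finally show ?thesis by (simp add: n_def mult_left_mono)
      qed
      have iso: "h i / 2 * measure lborel ({x. f x \<le> k i} \<inter> ball c R) * X (Suc i) \<le> 2 * R * V * S"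
        using isoperimetric[OF f R _ kl(1)[of i]] R unfolding kl(2) X_def V_def S_def Di_def by simp
      have Xs: "X s \<le> X (Suc i)" unfolding X_def
      proof (rule measure_Int_ball_mono[OF Sm(1) Sm(1)])
        have "k (Suc i) \<le> k s" using hle[of "Suc i" s] i by (simp add: k_def)
        then show "{x. k s < f x} \<inter> ball c R \<subseteq> {x. k (Suc i) < f x} \<inter> ball c R" by auto
      qed
      have mt: "\<tau> * R ^ CARD('n) \<le> measure lborel ({x. f x \<le> k i} \<inter> ball c R)"
      proof -
        have "\<mu> - H \<le> k i" using hle[of 0 i] by (simp add: k_def h_def)
        then have "measure lborel ({x. f x \<le> \<mu> - H} \<inter> ball c R) \<le> measure lborel ({x. f x \<le> k i} \<inter> ball c R)"
          by (intro measure_Int_ball_mono Sm) auto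
        then show ?thesis using t by linarith
      qed
      define Z where "Z = \<tau> * R ^ CARD('n)"
      have Z: "0 < Z" using \<tau> R by (simp add: Z_def)
      have X0: "0 \<le> X s" by (simp add: X_def)
      have "h i / 2 * Z * X s \<le> 2 * R * V * S"
      proof -
        have "h i / 2 * Z * X s \<le> h i / 2 * measure lborel ({x. f x \<le> k i} \<inter> ball c R) * X (Suc i)"
          using h(1)[of i] mt Xs X0 Z unfolding Z_def[symmetric] by (intro mult_mono) auto
        then show ?thesis using iso by linarith
      qed
      then have "(h i / 2 * Z * X s)^2 \<le> (2 * R * V * S)^2" using h(1)[of i] Z X0 by (intro power_mono) auto
      also have "\<dots> \<le> (2 * R * V)^2 * (n * (measure lborel Di * E))"
        unfolding power_mult_distrib[of "2 * R * V" S] using S2 by (intro mult_left_mono) auto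
      also have "\<dots> \<le> (2 * R * V)^2 * (n * (measure lborel Di * ((\<gamma> + 1) * (h i)^2 * V / R^2)))"
        using E n by (intro mult_left_mono) auto
      also have "\<dots> = (h i)^2 * (4 * n * (\<gamma> + 1) * V^3 * measure lborel Di)"
        using R by (simp add: field_simps power2_eq_square power3_eq_cube)
      finally have "(h i)^2 * (Z^2 * (X s)^2 / 4) \<le> (h i)^2 * (4 * n * (\<gamma> + 1) * V^3 * measure lborel Di)"
        by (simp add: power_mult_distrib power_divide mult_ac)
      then have "Z^2 * (X s)^2 / 4 \<le> 4 * n * (\<gamma> + 1) * V^3 * measure lborel Di"
        using h(1)[of i] by (simp add: mult_le_cancel_left)
      then show ?thesis unfolding mD Z_def[symmetric] using Z by (simp add: field_simps)
    qed
    define K0 where "K0 = 16 * n * (\<gamma> + 1) * V^3 / (\<tau> * R ^ CARD('n))^2"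
    have K0: "0 \<le> K0" using n \<gamma> V0 by (simp add: K0_def)
    have "real s * (X s)^2 = (\<Sum>i<s. (X s)^2)" by simp
    also have "\<dots> \<le> (\<Sum>i<s. K0 * (X i - X (Suc i)))" by (intro sum_mono) (use est in \<open>auto simp: K0_def\<close>)
    \<comment> \<open>The layer measures are differences of consecutive superlevel measures, so the
      sum telescopes.\<close>
    also have "\<dots> = K0 * (X 0 - X s)" by (simp add: sum_distrib_left[symmetric] sum_lessThan_telescope')
    also have "\<dots> \<le> K0 * (\<alpha> * R ^ CARD('n))"
    proof (rule mult_left_mono[OF _ K0])
      have "X 0 \<le> measure lborel (ball c R)" unfolding X_def
        using measure_Int_ball_mono[OF Sm(1), of UNIV "k 0" c R R] by simp
      moreover have "0 \<le> X s" by (simp add: X_def)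
      ultimately show "X 0 - X s \<le> \<alpha> * R ^ CARD('n)"
        using measure_ball_scale[of R c] R by (simp add: \<alpha>_def mult.commute)
    qed
    also have "\<dots> = K1 * (R ^ CARD('n))^2"
    proof -
      have e8: "(8::real)^CARD('n) = (2^CARD('n))^3" by (simp add: power_mult[symmetric] mult.commute[of _ 3]) (simp add: power_mult)
      show ?thesis unfolding K0_def K1_def V e8 using R \<tau> by (simp add: field_simps power_mult_distrib power3_eq_cube power4_eq_xxxx power2_eq_square)
    qed
    finally have sX: "real s * (X s)^2 \<le> K1 * (R ^ CARD('n))^2" .
    have Xs: "X s \<le> \<nu> / 4 * R ^ CARD('n)"
    proof (rule power2_le_imp_le)
      have "16 * K1 \<le> real s * \<nu>^2" using s \<nu> by (simp add: field_simps)
      then have "16 * K1 * (R ^ CARD('n))^2 \<le> real s * \<nu>^2 * (R ^ CARD('n))^2" by (intro mult_right_mono) auto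
      then have "real s * (16 * (X s)^2) \<le> real s * (\<nu>^2 * (R ^ CARD('n))^2)" using sX by simp
      then have "16 * (X s)^2 \<le> \<nu>^2 * (R ^ CARD('n))^2" using s0 by (simp add: mult_le_cancel_left)
      then show "(X s)^2 \<le> (\<nu> / 4 * R ^ CARD('n))^2" by (simp add: power_mult_distrib power_divide)
      show "0 \<le> \<nu> / 4 * R ^ CARD('n)" using \<nu> R by simp
    qed
    have DR: "DG \<gamma> \<epsilon> c R f G" unfolding DG_def
    proof (intro conjI allI impI)
      show "LW (ball c R) f G" by (rule LW_mono[OF f]) (use R in auto)
      fix k \<rho> r :: real assume "0 < \<rho> \<and> \<rho> < r \<and> r \<le> R"
      then show "(\<integral>x. indicator (ball c \<rho> \<inter> {x. k < f x}) x * (norm (G x))^2 \<partial>lborel) \<le>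
        \<gamma> / (r - \<rho>)^2 * (\<integral>x. indicator (ball c r) x * (max 0 (f x - k))^2 \<partial>lborel) + \<epsilon> * measure lborel ({x. k < f x} \<inter> ball c r)"
        using D R unfolding DG_def by simp
    qed
    have "AE x in lborel. x \<in> ball c (R / 2) \<longrightarrow> f x \<le> k s + h (s+1)"
    proof (rule sup[OF DR R h(1) \<epsilon>(1)])
      show "\<epsilon> * R^2 \<le> (h (s+1))^2" using \<epsilon>(2) by (simp add: h_def)
      have "excess f c (k s) R \<le> (h s)^2 * X s" unfolding X_def
        by (rule excess_le_measure[OF Lf]) (use b h(1)[of s] R in \<open>auto simp: k_def elim!: eventually_mono\<close>)
      also have "\<dots> \<le> (h s)^2 * (\<nu> / 4 * R ^ CARD('n))" by (rule mult_left_mono[OF Xs]) simp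
      \<comment> \<open>The factor 1/4 compensates for passing from h s to its half, the height by
        which the supremum bound is applied.\<close>
      also have "\<dots> = \<nu> * (h (s+1))^2 * R ^ CARD('n)" by (simp add: h_def power_divide mult_ac)
      finally show "excess f c (k s) R \<le> \<nu> * (h (s+1))^2 * R ^ CARD('n)" .
    qed
    moreover have "k s + h (s+1) = \<mu> - H / 2^(s+1)" by (simp add: k_def h_def)
    ultimately show ?thesis by simp
  qed
  then show ?thesis by blast
qed

section \<open>Linear growth and continuity\<close>

text \<open>Stands for positivity at a point as long as no continuous representative is
  available.\<close>

definition pos_near :: "(real^'n::finite \<Rightarrow> real) \<Rightarrow> real^'n \<Rightarrow> bool" where
  "pos_near f c \<longleftrightarrow> (\<exists>r>0. \<exists>\<delta>>0. AE x in lborel. x \<in> ball c r \<longrightarrow> \<delta> \<le> f x)"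

lemma DGconst_nonneg: "0 < lam \<Longrightarrow> lam \<le> Lam \<Longrightarrow> 0 \<le> DGconst lam Lam t"
  unfolding DGconst_def by simp

lemma minimizer_nonneg:
  "AC_minimizer lam Lam \<Omega> a u f G \<Longrightarrow> AE x in lborel. x \<in> \<Omega> \<longrightarrow> 0 \<le> f x"
  unfolding AC_minimizer_def by (auto elim!: eventually_elim2)

text \<open>If the average of $u^2$ at scale $R/8$ is large compared to $R^2$ and comparable to the one at scale $R$,
  then $u$ is large on a fixed portion of the small ball, hence bounded below near the centre.\<close>

lemma growth_step:
  assumes lam: "0 < lam" "lam \<le> Lam"
  shows "\<exists>C>0. \<forall>\<Omega> a u (f::real^'n::finite \<Rightarrow> real) G c R. AC_minimizer lam Lam \<Omega> a u f G \<longrightarrow> cball c R \<subseteq> \<Omega> \<longrightarrow> 0 < R \<longrightarrow>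
    \<not> pos_near f c \<longrightarrow> excess f c 0 (R / 8) / (R / 8)^(CARD('n) + 2) \<le> max C (excess f c 0 R / R^(CARD('n) + 2) / 2)"
proof -
  define N where "N = CARD('n)"
  define \<alpha> where "\<alpha> = measure lborel (ball (0::real^'n) 1)"
  have \<alpha>: "0 < \<alpha>" unfolding \<alpha>_def by (rule content_ball_pos) simp
  note \<gamma> = DGconst_nonneg[OF lam, of "TYPE('n)"]
  obtain \<nu> where \<nu>: "0 < \<nu>" and sup: "\<And>(f::real^'n \<Rightarrow> real) G c R h k \<epsilon>. DG (DGconst lam Lam TYPE('n)) \<epsilon> c R f G \<Longrightarrow> 0 < R \<Longrightarrow> 0 < h \<Longrightarrow> 0 \<le> \<epsilon> \<Longrightarrow> \<epsilon> * R^2 \<le> h^2 \<Longrightarrow>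
    excess f c k R \<le> \<nu> * h^2 * R ^ CARD('n) \<Longrightarrow> (AE x in lborel. x \<in> ball c (R / 2) \<longrightarrow> f x \<le> k + h)"
    using DG_sup_bound[OF \<gamma>, where 'n='n] by blast
  have \<tau>: "0 < \<nu> / 256" using \<nu> by simp
  obtain s :: nat where dec: "\<And>(f::real^'n \<Rightarrow> real) G c R \<mu> H \<epsilon>. DG (DGconst lam Lam TYPE('n)) \<epsilon> c (2 * R) f G \<Longrightarrow> 0 < R \<Longrightarrow> 0 < H \<Longrightarrow> 0 \<le> \<epsilon> \<Longrightarrow>
    \<epsilon> * R^2 \<le> (H / 2^(s+1))^2 \<Longrightarrow> (AE x in lborel. x \<in> ball c (2 * R) \<longrightarrow> f x \<le> \<mu>) \<Longrightarrow>
    \<nu> / 256 * R ^ CARD('n) \<le> measure lborel ({x. f x \<le> \<mu> - H} \<inter> ball c R) \<Longrightarrow>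
    (AE x in lborel. x \<in> ball c (R / 2) \<longrightarrow> f x \<le> \<mu> - H / 2^(s+1))"
    using DG_decrease[OF \<gamma> \<tau>, where 'n='n] by blast
  \<comment> \<open>If t > C r^2, the level drop H / 2^(s+1) below, whose square is t / (4^(s+1) 2
    \<alpha>), dominates the scaled error 2/lam r^2. This is how the height makes the error term
    negligible.\<close>
  define C where "C = (2 / lam) * 4^(s+1) * (2 * \<alpha>)"
  have C: "0 < C" using lam \<alpha> by (simp add: C_def)
  have "excess f c 0 (R / 8) / (R / 8)^(N + 2) \<le> max C (excess f c 0 R / R^(N + 2) / 2)"
    if M: "AC_minimizer lam Lam \<Omega> a u f G" and B: "cball c R \<subseteq> \<Omega>" and R: "0 < R" and np: "\<not> pos_near f c"
    for \<Omega> a u and f :: "real^'n \<Rightarrow> real" and G c R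
  proof (rule ccontr)
    assume neg: "\<not> ?thesis"
    define r where "r = R / 8"
    have r: "0 < r" "R = 8 * r" using R by (auto simp: r_def)
    define t where "t = excess f c 0 r / r^N"
    have Er: "excess f c 0 r / r^(N+2) = t / r^2" using r by (simp add: t_def power_add power2_eq_square)
    have e: "excess f c 0 r = t * r^N" using r by (simp add: t_def)
    have "max C (excess f c 0 R / R^(N + 2) / 2) < t / r^2"
      using neg unfolding not_le r_def[symmetric] Er .
    then have 1: "C < t / r^2" "excess f c 0 R / R^(N + 2) / 2 < t / r^2"
      unfolding max_less_iff_conj by blast+
    have t: "C * r^2 < t" using 1(1) r by (simp add: field_simps)
    have "0 < C * r^2" using C r by simp
    then have t0: "0 < t" using t by linarith
    \<comment> \<open>\<open>t\<close> is normalised by the n-th power of the radius only, so the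
      failure of halving costs 2 times 8^2 = 128.\<close>
    have eR: "excess f c 0 R \<le> 128 * t * R^N"
    proof -
      have "excess f c 0 R < 2 * (t / r^2) * R^(N+2)" using 1(2) R by (simp add: field_simps)
      also have "2 * (t / r^2) * R^(N+2) = 128 * t * R^N" using r by (simp add: power_add power2_eq_square)
      finally show ?thesis by simp
    qed
    define h where "h = sqrt (128 * t / \<nu>)"
    have h: "0 < h" "\<nu> * h^2 = 128 * t" using t0 \<nu> by (auto simp: h_def)
    have f: "LW \<Omega> f G" using M by (simp add: AC_minimizer_def)
    have Lf: "L2 f" by (rule LW_D(1)[OF f])
    have [measurable]: "f \<in> borel_measurable borel" by (rule L2_borel[OF Lf])
    have fh: "AE x in lborel. x \<in> ball c (R / 2) \<longrightarrow> f x \<le> h"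
      using sup[OF minimizer_DG_sub[OF M B] R h(1), of 0] eR unfolding h(2) N_def by simp
    \<comment> \<open>Points with f below H carry at most half of the L2 mass in
      \<open>ball c r\<close>. The other half must sit where f is at least H, and since f is at most
      h there, with \<nu> h^2 = 128 t, that set has measure at least \<nu> r^n / 256.\<close>
    define H where "H = sqrt (t / (2 * \<alpha>))"
    have H: "0 < H" "H^2 * \<alpha> = t / 2" "H^2 = t / (2 * \<alpha>)" using t0 \<alpha> by (auto simp: H_def)
    define Y where "Y = measure lborel ({x. - f x \<le> 0 - H} \<inter> ball c r)"
    have Sm: "{x. - f x \<le> 0 - H} \<in> sets borel" by measurable
    have "excess f c 0 r \<le> (\<integral>x. H^2 * (indicator (UNIV \<inter> ball c r) x :: real) + h^2 * (indicator ({x. - f x \<le> 0 - H} \<inter> ball c r) x :: real) \<partial>lborel)"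
      unfolding excess_def
    proof (rule integral_mono_AE[OF excess_integrable[OF Lf]])
      show "integrable lborel (\<lambda>x. H^2 * (indicator (UNIV \<inter> ball c r) x :: real) + h^2 * (indicator ({x. - f x \<le> 0 - H} \<inter> ball c r) x :: real))"
        by (intro Bochner_Integration.integrable_add integrable_mult_right finite_measure_ball_Int(2) Sm) simp
      show "AE x in lborel. indicator (ball c r) x * (max 0 (f x - 0))^2 \<le> H^2 * (indicator (UNIV \<inter> ball c r) x :: real) + h^2 * (indicator ({x. - f x \<le> 0 - H} \<inter> ball c r) x :: real)"
        using fh
      proof eventually_elim
        case (elim x)
        show ?case
        proof (cases "x \<in> ball c r")
          case True
          then have "f x \<le> h" using elim r by simp
          show ?thesis
          proof (cases "H \<le> f x")
            case h': True
            have "(max 0 (f x))^2 \<le> h^2" using \<open>f x \<le> h\<close> h(1) by (intro power_mono) auto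
            then show ?thesis using True h' by (simp add: add_increasing)
          next
            case False
            have "(max 0 (f x))^2 \<le> H^2" using False H(1) by (intro power_mono) auto
            then show ?thesis using True by (simp add: add_increasing2)
          qed
        qed simp
      qed
    qed
    also have "\<dots> = H^2 * measure lborel (ball c r) + h^2 * Y"
      using finite_measure_ball_Int(2)[of UNIV c r] finite_measure_ball_Int(2)[OF Sm, of c r] by (simp add: Y_def)
    also have "measure lborel (ball c r) = r^N * \<alpha>" using measure_ball_scale[of r c] r by (simp add: N_def \<alpha>_def)
    finally have "t * r^N \<le> (H^2 * \<alpha>) * r^N + h^2 * Y" using e by (simp add: mult_ac)
    then have "t / 2 * r^N \<le> h^2 * Y" unfolding H(2) by simp
    then have "\<nu> * (t / 2 * r^N) \<le> \<nu> * (h^2 * Y)" using \<nu> by (intro mult_left_mono) auto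
    also have "\<dots> = 128 * t * Y" using h(2) by (simp add: mult.assoc[symmetric])
    finally have "t * (\<nu> / 256 * r^N) \<le> t * Y" by (simp add: mult_ac)
    then have Y: "\<nu> / 256 * r^N \<le> Y" using t0 by simp
    have "2 * r \<le> R" using r by simp
    then have BO: "cball c (2 * r) \<subseteq> \<Omega>" using B by (meson order_trans subset_cball)
    have "AE x in lborel. x \<in> ball c (r / 2) \<longrightarrow> - f x \<le> 0 - H / 2^(s+1)"
    proof (rule dec[OF minimizer_DG_super(1)[OF M BO] r(1) H(1)])
      show "0 \<le> 2 / lam" using lam by simp
      have "C / (4^(s+1) * (2 * \<alpha>)) * r^2 \<le> t / (4^(s+1) * (2 * \<alpha>))"
        using t \<alpha> by (simp add: divide_right_mono)
      moreover have "C / (4^(s+1) * (2 * \<alpha>)) = 2 / lam" using \<alpha> by (simp add: C_def)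
      moreover have "(H / 2^(s+1))^2 = t / (4^(s+1) * (2 * \<alpha>))"
      proof -
        have "((2::real)^(s+1))^2 = 4^(s+1)" by (simp add: power_mult[symmetric] mult.commute[of _ 2]) (simp add: power_mult)
        then show ?thesis unfolding power_divide H(3) by simp
      qed
      ultimately show "2 / lam * r^2 \<le> (H / 2^(s+1))^2" by (simp only:)
      show "AE x in lborel. x \<in> ball c (2 * r) \<longrightarrow> - f x \<le> 0"
        using minimizer_nonneg[OF M] by eventually_elim (use subset_trans[OF ball_subset_cball BO] in auto)
      show "\<nu> / 256 * r ^ CARD('n) \<le> measure lborel ({x. - f x \<le> 0 - H} \<inter> ball c r)"
        using Y by (simp add: Y_def N_def)
    qed
    then have "AE x in lborel. x \<in> ball c (r / 2) \<longrightarrow> H / 2^(s+1) \<le> f x" by (auto elim!: eventually_mono)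
    then have "pos_near f c" unfolding pos_near_def using r H(1)
      by (intro exI[of _ "r / 2"] conjI exI[of _ "H / 2^(s+1)"]) auto
    then show False using np by simp
  qed
  with C show ?thesis unfolding N_def by blast
qed

text \<open>\<open>growth_step\<close> is iterated over the radii R / 8^j: the normalised excess is
  at most C or decays like 2^(-j), so its initial value is eventually forgotten.
  \<open>DG_sup_bound\<close> then turns the L2 bound into a bound of the supremum.\<close>

lemma linear_growth:
  assumes lam: "0 < lam" "lam \<le> Lam"
  shows "\<exists>C>0. \<forall>\<Omega> a u (f::real^'n::finite \<Rightarrow> real) G c. AC_minimizer lam Lam \<Omega> a u f G \<longrightarrow> c \<in> \<Omega> \<longrightarrow> \<not> pos_near f c \<longrightarrow>
    (\<exists>r0>0. \<forall>r. 0 < r \<and> r < r0 \<longrightarrow> cball c (2 * r) \<subseteq> \<Omega> \<and> (AE x in lborel. x \<in> ball c r \<longrightarrow> f x \<le> C * r))"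
proof -
  define N where "N = CARD('n)"
  note \<gamma> = DGconst_nonneg[OF lam, of "TYPE('n)"]
  obtain \<nu> where \<nu>: "0 < \<nu>" and sup: "\<And>(f::real^'n \<Rightarrow> real) G c R h k \<epsilon>. DG (DGconst lam Lam TYPE('n)) \<epsilon> c R f G \<Longrightarrow> 0 < R \<Longrightarrow> 0 < h \<Longrightarrow> 0 \<le> \<epsilon> \<Longrightarrow> \<epsilon> * R^2 \<le> h^2 \<Longrightarrow>
    excess f c k R \<le> \<nu> * h^2 * R ^ CARD('n) \<Longrightarrow> (AE x in lborel. x \<in> ball c (R / 2) \<longrightarrow> f x \<le> k + h)"
    using DG_sup_bound[OF \<gamma>, where 'n='n] by blast
  obtain C where C: "0 < C" and step: "\<And>\<Omega> a u (f::real^'n \<Rightarrow> real) G c R. AC_minimizer lam Lam \<Omega> a u f G \<Longrightarrow> cball c R \<subseteq> \<Omega> \<Longrightarrow> 0 < R \<Longrightarrow>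
    \<not> pos_near f c \<Longrightarrow> excess f c 0 (R / 8) / (R / 8)^(CARD('n) + 2) \<le> max C (excess f c 0 R / R^(CARD('n) + 2) / 2)"
    using growth_step[OF lam, where 'n='n] by blast
  \<comment> \<open>8^(N+2) is lost between an arbitrary radius and the next radius R / 8^j; the
    factor 2 comes from applying the supremum bound in the ball of radius 2 r.\<close>
  define D where "D = 2 * sqrt (8^(N+2) * C / \<nu>)"
  have D: "0 < D" using C \<nu> by (simp add: D_def)
  have "\<exists>r0>0. \<forall>r. 0 < r \<and> r < r0 \<longrightarrow> cball c (2 * r) \<subseteq> \<Omega> \<and> (AE x in lborel. x \<in> ball c r \<longrightarrow> f x \<le> D * r)"
    if M: "AC_minimizer lam Lam \<Omega> a u f G" and c: "c \<in> \<Omega>" and np: "\<not> pos_near f c"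
    for \<Omega> a u and f :: "real^'n \<Rightarrow> real" and G c
  proof -
    have O: "open \<Omega>" and f: "LW \<Omega> f G" using M by (auto simp: AC_minimizer_def)
    have Lf: "L2 f" by (rule LW_D(1)[OF f])
    obtain R where R: "0 < R" "cball c R \<subseteq> \<Omega>" using O c open_contains_cball by blast
    define E where "E r = excess f c 0 r / r^(N+2)" for r
    have sub: "cball c r \<subseteq> \<Omega>" if "r \<le> R" for r using R(2) that by (meson order_trans subset_cball)
    have it: "E (R / 8^j) \<le> max C (E R / 2^j)" for j
    proof (induction j)
      case (Suc j)
      have Rj: "0 < R / 8^j" "R / 8^j \<le> R" using R(1) by (auto simp: divide_le_eq)
      have "E (R / 8^j / 8) \<le> max C (E (R / 8^j) / 2)"
        unfolding E_def N_def by (rule step[OF M sub[OF Rj(2)] Rj(1) np])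
      also have "\<dots> \<le> max C (E R / 2^Suc j)"
        using Suc C by (auto simp: max_def split: if_splits)
      finally show ?case by (simp add: mult.commute)
    qed simp
    \<comment> \<open>The number of scales after which the initial value no longer matters; it
      depends on the solution and on the point, and fixes the threshold radius.\<close>
    obtain J :: nat where J: "E R / C < 2^J" using real_arch_pow[of 2 "E R / C"] by auto
    have big: "excess f c 0 r \<le> 8^(N+2) * C * r^(N+2)" if r: "0 < r" "r \<le> R / 8^J" for r
    proof -
      obtain m where m: "R / r < 8^m" using real_arch_pow[of 8 "R / r"] by auto
      \<comment> \<open>The predecessor j of this least exponent satisfies r \<le> R/8^j \<le> 8 r,
        so r is compared with a radius of the iteration.\<close>
      define l where "l = (LEAST m. R / r < 8^m)"
      have l: "R / r < 8^l" unfolding l_def by (rule LeastI[of _ m]) (rule m)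
      have "8^J \<le> R / r" using r by (simp add: field_simps)
      then have "(8::real)^J < 8^l" using l by linarith
      then have "J < l" by (simp add: power_strict_increasing_iff)
      then obtain j where j: "l = Suc j" "J \<le> j" by (cases l) auto
      have "\<not> R / r < 8^j" using not_less_Least[of j "\<lambda>m. R / r < 8^m"] j(1) unfolding l_def by simp
      then have rj: "r \<le> R / 8^j" using r by (simp add: field_simps)
      have rj': "R / 8^j \<le> 8 * r" using l r unfolding j(1) by (simp add: field_simps)
      have p: "0 < R / 8^j" using R by simp
      have "E R / 2^j \<le> C"
      proof -
        have "E R \<le> C * 2^J" using J C by (simp add: field_simps)
        also have "\<dots> \<le> C * 2^j" using j(2) C by (intro mult_left_mono power_increasing) auto
        finally show ?thesis by (simp add: field_simps)
      qed
      then have "E (R / 8^j) \<le> C" using it[of j] by auto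
      then have "excess f c 0 (R / 8^j) \<le> C * (R / 8^j)^(N+2)"
        unfolding E_def using pos_divide_le_eq[OF zero_less_power[OF p, of "N + 2"]] by blast
      also have "\<dots> \<le> C * (8 * r)^(N+2)" using rj' p C by (intro mult_left_mono power_mono) auto
      also have "\<dots> = 8^(N+2) * C * r^(N+2)" by (simp only: power_mult_distrib mult_ac)
      finally show ?thesis using excess_mono[OF Lf rj order_refl, of c 0] by linarith
    qed
    define r0 where "r0 = R / 8^J / 2"
    have "cball c (2 * r) \<subseteq> \<Omega> \<and> (AE x in lborel. x \<in> ball c r \<longrightarrow> f x \<le> D * r)" if r: "0 < r" "r < r0" for r
    proof
      have "R / 8^J \<le> R" using R(1) by (simp add: divide_le_eq)
      then have rR: "2 * r \<le> R" "2 * r \<le> R / 8^J" using r by (auto simp: r0_def)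
      show B: "cball c (2 * r) \<subseteq> \<Omega>" by (rule sub[OF rR(1)])
      have "AE x in lborel. x \<in> ball c (2 * r / 2) \<longrightarrow> f x \<le> 0 + D * r"
      proof (rule sup[OF minimizer_DG_sub[OF M B]])
        have "D^2 = 4 * (8^(N+2) * C / \<nu>)" using C \<nu> by (simp add: D_def power_mult_distrib)
        then have "\<nu> * (D * r)^2 = 8^(N+2) * C * (2 * r)^2" using \<nu> by (simp add: power_mult_distrib)
        then have "\<nu> * (D * r)^2 * (2 * r)^N = 8^(N+2) * C * (2 * r)^(N+2)" by (simp only: power_add mult_ac)
        then show "excess f c 0 (2 * r) \<le> \<nu> * (D * r)^2 * (2 * r)^CARD('n)"
          using big[of "2 * r"] r(1) rR(2) by (simp add: N_def)
      qed (use r(1) D in auto)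
      then show "AE x in lborel. x \<in> ball c r \<longrightarrow> f x \<le> D * r" by simp
    qed
    moreover have "0 < r0" using R(1) by (simp add: r0_def)
    ultimately show ?thesis by blast
  qed
  with D show ?thesis by blast
qed

text \<open>Either f lies below the middle of its range on half of the ball, or above it.
  \<open>DG_decrease\<close> without error term, for f or for -f, cuts a fixed fraction off the top
  or off the bottom; with H half of the range the fraction is 1/2^(s+2).\<close>

lemma oscillation_decay:
  assumes \<gamma>: "0 \<le> \<gamma>"
  shows "\<exists>\<theta>::real. 0 < \<theta> \<and> \<theta> < 1 \<and> (\<forall>(f::real^'n::finite \<Rightarrow> real) G c R m M. DG \<gamma> 0 c (2 * R) f G \<longrightarrow> DG \<gamma> 0 c (2 * R) (\<lambda>x. - f x) (\<lambda>x. - G x) \<longrightarrow>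
    0 < R \<longrightarrow> m < M \<longrightarrow> (AE x in lborel. x \<in> ball c (2 * R) \<longrightarrow> m \<le> f x \<and> f x \<le> M) \<longrightarrow>
    (\<exists>m' M'. M' - m' = \<theta> * (M - m) \<and> (AE x in lborel. x \<in> ball c (R / 2) \<longrightarrow> m' \<le> f x \<and> f x \<le> M')))"
proof -
  define \<alpha> where "\<alpha> = measure lborel (ball (0::real^'n) 1)"
  have \<alpha>: "0 < \<alpha>" unfolding \<alpha>_def by (rule content_ball_pos) simp
  then have \<tau>: "0 < \<alpha> / 2" by simp
  obtain s :: nat where dec: "\<And>(f::real^'n \<Rightarrow> real) G c R \<mu> H \<epsilon>. DG \<gamma> \<epsilon> c (2 * R) f G \<Longrightarrow> 0 < R \<Longrightarrow> 0 < H \<Longrightarrow> 0 \<le> \<epsilon> \<Longrightarrow>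
    \<epsilon> * R^2 \<le> (H / 2^(s+1))^2 \<Longrightarrow> (AE x in lborel. x \<in> ball c (2 * R) \<longrightarrow> f x \<le> \<mu>) \<Longrightarrow>
    \<alpha> / 2 * R ^ CARD('n) \<le> measure lborel ({x. f x \<le> \<mu> - H} \<inter> ball c R) \<Longrightarrow>
    (AE x in lborel. x \<in> ball c (R / 2) \<longrightarrow> f x \<le> \<mu> - H / 2^(s+1))"
    using DG_decrease[OF \<gamma> \<tau>, where 'n='n] by blast
  define \<theta> :: real where "\<theta> = 1 - 1 / 2^(s+2)"
  have \<theta>: "0 < \<theta>" "\<theta> < 1" using one_le_power[of "2::real" "s+2"] by (auto simp: \<theta>_def less_1_mult one_less_power divide_less_eq simp del: power_Suc)
  have "\<exists>m' M'. M' - m' = \<theta> * (M - m) \<and> (AE x in lborel. x \<in> ball c (R / 2) \<longrightarrow> m' \<le> f x \<and> f x \<le> M')"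
    if D: "DG \<gamma> 0 c (2 * R) f G" "DG \<gamma> 0 c (2 * R) (\<lambda>x. - f x) (\<lambda>x. - G x)" and R: "0 < R" and mM: "m < M"
      and b: "AE x in lborel. x \<in> ball c (2 * R) \<longrightarrow> m \<le> f x \<and> f x \<le> M"
    for f :: "real^'n \<Rightarrow> real" and G c R m M
  proof -
    have [measurable]: "f \<in> borel_measurable borel" using D by (auto simp: DG_def intro: L2_borel[OF LW_D(1)])
    define H where "H = (M - m) / 2"
    have H: "0 < H" using mM by (simp add: H_def)
    have bb: "AE x in lborel. x \<in> ball c (R / 2) \<longrightarrow> m \<le> f x \<and> f x \<le> M"
      using b by eventually_elim (use R in auto)
    have S: "{x. f x \<le> M - H} \<in> sets borel" "{x. - f x \<le> - m - H} \<in> sets borel" by measurable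
    have "measure lborel (ball c R) \<le> measure lborel ({x. f x \<le> M - H} \<inter> ball c R) + measure lborel ({x. - f x \<le> - m - H} \<inter> ball c R)"
    proof -
      have "ball c R = ({x. f x \<le> M - H} \<inter> ball c R) \<union> ({x. - f x \<le> - m - H} \<inter> ball c R)" by (auto simp: H_def field_simps)
      then have "measure lborel (ball c R) = measure lborel (({x. f x \<le> M - H} \<inter> ball c R) \<union> ({x. - f x \<le> - m - H} \<inter> ball c R))" by simp
      also have "\<dots> \<le> measure lborel ({x. f x \<le> M - H} \<inter> ball c R) + measure lborel ({x. - f x \<le> - m - H} \<inter> ball c R)"
        using S finite_measure_ball_Int(1)[OF S(1), of c R] finite_measure_ball_Int(1)[OF S(2), of c R]
        by (intro measure_Un_le) auto
      finally show ?thesis .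
    qed
    then have "\<alpha> / 2 * R ^ CARD('n) \<le> measure lborel ({x. f x \<le> M - H} \<inter> ball c R) \<or>
      \<alpha> / 2 * R ^ CARD('n) \<le> measure lborel ({x. - f x \<le> - m - H} \<inter> ball c R)"
      using measure_ball_scale[of R c] R unfolding \<alpha>_def by (auto simp: field_simps)
    then show ?thesis
    proof
      assume "\<alpha> / 2 * R ^ CARD('n) \<le> measure lborel ({x. f x \<le> M - H} \<inter> ball c R)"
      note t = this
      have "AE x in lborel. x \<in> ball c (2 * R) \<longrightarrow> f x \<le> M" using b by eventually_elim auto
      from dec[OF D(1) R H _ _ this t] have "AE x in lborel. x \<in> ball c (R / 2) \<longrightarrow> f x \<le> M - H / 2^(s+1)" by simp
      with bb have "AE x in lborel. x \<in> ball c (R / 2) \<longrightarrow> m \<le> f x \<and> f x \<le> M - H / 2^(s+1)" by eventually_elim auto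
      moreover have "M - H / 2^(s+1) - m = \<theta> * (M - m)" by (simp add: \<theta>_def H_def algebra_simps)
      ultimately show ?thesis by blast
    next
      assume "\<alpha> / 2 * R ^ CARD('n) \<le> measure lborel ({x. - f x \<le> - m - H} \<inter> ball c R)"
      note t = this
      have "AE x in lborel. x \<in> ball c (2 * R) \<longrightarrow> - f x \<le> - m" using b by eventually_elim auto
      from dec[OF D(2) R H _ _ this t] have "AE x in lborel. x \<in> ball c (R / 2) \<longrightarrow> - f x \<le> - m - H / 2^(s+1)" by simp
      with bb have "AE x in lborel. x \<in> ball c (R / 2) \<longrightarrow> m + H / 2^(s+1) \<le> f x \<and> f x \<le> M" by eventually_elim auto
      moreover have "M - (m + H / 2^(s+1)) = \<theta> * (M - m)" by (simp add: \<theta>_def H_def algebra_simps)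
      ultimately show ?thesis by blast
    qed
  qed
  with \<theta> show ?thesis by blast
qed

lemma DG_mono: "DG \<gamma> \<epsilon> c R f G \<Longrightarrow> r \<le> R \<Longrightarrow> DG \<gamma> \<epsilon> c r f G"
  unfolding DG_def using LW_mono[of "ball c R" f G "ball c r"] by (auto simp: subset_ball)

text \<open>Near a point of positivity both f and -f are in De Giorgi's class without error term.
  Each oscillation step passes from radius 2 \<rho> to \<rho>/2, hence the powers of 4.\<close>

lemma positive_continuity:
  fixes f :: "real^'n::finite \<Rightarrow> real"
  assumes M: "AC_minimizer lam Lam \<Omega> a u f G" and c: "c \<in> \<Omega>" and p: "pos_near f c" and \<eta>: "0 < \<eta>"
  shows "\<exists>\<rho>>0. \<exists>m. AE x in lborel. x \<in> ball c \<rho> \<longrightarrow> \<bar>f x - m\<bar> \<le> \<eta>"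
proof -
  have O: "open \<Omega>" and lam: "0 < lam" "lam \<le> Lam" using M by (auto simp: AC_minimizer_def)
  note \<gamma> = DGconst_nonneg[OF lam, of "TYPE('n)"]
  obtain r1 \<delta> where r1: "0 < r1" "0 < \<delta>" "AE x in lborel. x \<in> ball c r1 \<longrightarrow> \<delta> \<le> f x" using p by (auto simp: pos_near_def)
  obtain r2 where r2: "0 < r2" "cball c r2 \<subseteq> \<Omega>" using O c open_contains_cball by blast
  define R where "R = min r1 r2"
  have R: "0 < R" "cball c R \<subseteq> \<Omega>" using r1 r2 subset_cball[of R r2 c] by (auto simp: R_def)
  have pos: "AE x in lborel. x \<in> ball c R \<longrightarrow> 0 < f x"
    using r1(3) by eventually_elim (use r1(2) in \<open>auto simp: R_def\<close>)
  note D1 = minimizer_DG_sub[OF M R(2)] and D2 = minimizer_DG_super(2)[OF M R(2) pos]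
  obtain \<nu> where \<nu>: "0 < \<nu>" and sup: "\<And>(f::real^'n \<Rightarrow> real) G c R h k \<epsilon>. DG (DGconst lam Lam TYPE('n)) \<epsilon> c R f G \<Longrightarrow> 0 < R \<Longrightarrow> 0 < h \<Longrightarrow> 0 \<le> \<epsilon> \<Longrightarrow> \<epsilon> * R^2 \<le> h^2 \<Longrightarrow>
    excess f c k R \<le> \<nu> * h^2 * R ^ CARD('n) \<Longrightarrow> (AE x in lborel. x \<in> ball c (R / 2) \<longrightarrow> f x \<le> k + h)"
    using DG_sup_bound[OF \<gamma>, where 'n='n] by blast
  obtain \<theta> where \<theta>: "0 < \<theta>" "\<theta> < 1" and osc: "\<And>(f::real^'n \<Rightarrow> real) G c R m M. DG (DGconst lam Lam TYPE('n)) 0 c (2 * R) f G \<Longrightarrow>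
    DG (DGconst lam Lam TYPE('n)) 0 c (2 * R) (\<lambda>x. - f x) (\<lambda>x. - G x) \<Longrightarrow>
    0 < R \<Longrightarrow> m < M \<Longrightarrow> (AE x in lborel. x \<in> ball c (2 * R) \<longrightarrow> m \<le> f x \<and> f x \<le> M) \<Longrightarrow>
    (\<exists>m' M'. M' - m' = \<theta> * (M - m) \<and> (AE x in lborel. x \<in> ball c (R / 2) \<longrightarrow> m' \<le> f x \<and> f x \<le> M'))"
    using oscillation_decay[OF \<gamma>, where 'n='n] by blast
  define h where "h = sqrt (excess f c 0 R / (\<nu> * R ^ CARD('n)) + 1)"
  have h: "0 < h" "h^2 = excess f c 0 R / (\<nu> * R ^ CARD('n)) + 1"
    using excess_nonneg[of f c 0 R] \<nu> R(1) by (auto simp: h_def add_nonneg_pos)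
  have fh: "AE x in lborel. x \<in> ball c (R / 2) \<longrightarrow> f x \<le> h"
  proof -
    have "excess f c 0 R \<le> \<nu> * h^2 * R ^ CARD('n)" unfolding h(2) using \<nu> R(1) by (simp add: field_simps)
    from sup[OF D1 R(1) h(1) _ _ this] h(1) show ?thesis by simp
  qed
  have it: "\<exists>m M. m < M \<and> M - m = \<theta>^j * h \<and> (AE x in lborel. x \<in> ball c (R / 2 / 4^j) \<longrightarrow> m \<le> f x \<and> f x \<le> M)" for j
  proof (induction j)
    case 0
    have "AE x in lborel. x \<in> ball c (R / 2) \<longrightarrow> 0 \<le> f x \<and> f x \<le> h"
      using fh pos by eventually_elim (use R(1) in auto)
    then show ?case using h(1) by (intro exI[of _ 0] exI[of _ h]) simp
  next
    case (Suc j)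
    then obtain m M where mM: "m < M" "M - m = \<theta>^j * h" "AE x in lborel. x \<in> ball c (R / 2 / 4^j) \<longrightarrow> m \<le> f x \<and> f x \<le> M" by blast
    define \<rho> where "\<rho> = R / 4 / 4^j"
    have \<rho>: "0 < \<rho>" "2 * \<rho> = R / 2 / 4^j" "\<rho> / 2 = R / 2 / 4^Suc j" using R(1) by (auto simp: \<rho>_def)
    have "1 \<le> 2 * (4::real)^j" using one_le_power[of "4::real" j] by linarith
    then have "2 * \<rho> \<le> R" unfolding \<rho>(2) using R(1) by (simp add: divide_le_eq mult_le_cancel_left1)
    note le = this
    obtain m' M' where "M' - m' = \<theta> * (M - m)" "AE x in lborel. x \<in> ball c (\<rho> / 2) \<longrightarrow> m' \<le> f x \<and> f x \<le> M'"
      using osc[OF DG_mono[OF D1 le] DG_mono[OF D2 le] \<rho>(1) mM(1)] mM(3) unfolding \<rho>(2) by blast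
    moreover have "0 < \<theta> * (M - m)" using \<theta> mM(1) by simp
    ultimately show ?case unfolding \<rho>(3) using mM(2) by (intro exI[of _ m'] exI[of _ M']) auto
  qed
  have "(\<lambda>j. \<theta>^j * h) \<longlonglongrightarrow> 0" using \<theta> by (intro tendsto_mult_left_zero LIMSEQ_power_zero) simp
  from order_tendstoD(2)[OF this \<eta>] obtain j where j: "\<theta>^j * h < \<eta>" by (auto simp: eventually_sequentially)
  obtain m M where mM: "M - m = \<theta>^j * h" "AE x in lborel. x \<in> ball c (R / 2 / 4^j) \<longrightarrow> m \<le> f x \<and> f x \<le> M" using it by blast
  have "AE x in lborel. x \<in> ball c (R / 2 / 4^j) \<longrightarrow> \<bar>f x - m\<bar> \<le> \<eta>"
    using mM(2) by eventually_elim (use mM(1) j in auto)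
  then show ?thesis using R(1) by (intro exI[of _ "R / 2 / 4^j"]) auto
qed

section \<open>A continuous representative\<close>

lemma AE_ball_obtain:
  fixes c :: "real^'n::finite"
  assumes "AE x in lborel. x \<in> ball c r \<longrightarrow> P x" "0 < r"
  obtains x where "x \<in> ball c r" "P x"
proof -
  have "\<not> (AE x in lborel. x \<notin> ball c r)"
  proof
    assume "AE x in lborel. x \<notin> ball c r"
    then have "measure lborel (ball c r) = 0"
      using AE_iff_null_sets[of "ball c r" lborel] by (auto simp: null_sets_def measure_def)
    with content_ball_pos[OF assms(2), of c] show False by simp
  qed
  moreover have "AE x in lborel. x \<notin> ball c r" if "\<not> (\<exists>x. x \<in> ball c r \<and> P x)"
    using assms(1) by eventually_elim (use that in blast)
  ultimately have "\<exists>x. x \<in> ball c r \<and> P x" by blast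
  then show ?thesis using that by blast
qed

text \<open>The representative is the limit of essential suprema over shrinking balls. An almost
  everywhere bound of f on a ball becomes a bound of w at every point of that ball, which yields
  both continuity and equality with f almost everywhere.\<close>

lemma continuous_representative:
  fixes f :: "real^'n::finite \<Rightarrow> real"
  assumes O: "open \<Omega>" and osc: "\<And>x \<eta>. x \<in> \<Omega> \<Longrightarrow> 0 < \<eta> \<Longrightarrow> \<exists>\<rho>>0. \<exists>m. AE y in lborel. y \<in> ball x \<rho> \<longrightarrow> \<bar>f y - m\<bar> \<le> \<eta>"
  obtains w where "continuous_on \<Omega> w" "AE x in lborel. x \<in> \<Omega> \<longrightarrow> w x = f x"
proof -
  define T where "T x = {t. \<exists>\<rho>>0. AE y in lborel. y \<in> ball x \<rho> \<longrightarrow> f y \<le> t}" for x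
  define w where "w x = Inf (T x)" for x
  have key: "\<bar>w z - m\<bar> \<le> \<eta>" if b: "AE y in lborel. y \<in> ball x \<rho> \<longrightarrow> \<bar>f y - m\<bar> \<le> \<eta>" and z: "z \<in> ball x \<rho>" for x \<rho> m \<eta> z
  proof -
    obtain d where d: "0 < d" "ball z d \<subseteq> ball x \<rho>" using z open_contains_ball[of "ball x \<rho>"] open_ball by metis
    have up: "m + \<eta> \<in> T z" unfolding T_def
    proof (intro CollectI exI[of _ d] conjI d)
      show "AE y in lborel. y \<in> ball z d \<longrightarrow> f y \<le> m + \<eta>" using b by eventually_elim (use d(2) in auto)
    qed
    have low: "m - \<eta> \<le> t" if t: "t \<in> T z" for t
    proof -
      obtain e where e: "0 < e" "AE y in lborel. y \<in> ball z e \<longrightarrow> f y \<le> t" using t by (auto simp: T_def)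
      have "AE y in lborel. y \<in> ball z (min d e) \<longrightarrow> m - \<eta> \<le> t"
        using b e(2) by eventually_elim (use d(2) in auto)
      then show ?thesis by (rule AE_ball_obtain) (use d e in auto)
    qed
    have "w z \<le> m + \<eta>" unfolding w_def by (rule cInf_lower[OF up bdd_belowI[OF low]])
    moreover have "m - \<eta> \<le> w z" unfolding w_def using up low by (intro cInf_greatest) auto
    ultimately show ?thesis by simp
  qed
  have "continuous_on \<Omega> w" unfolding continuous_on_iff
  proof (intro ballI allI impI)
    fix x and e :: real assume x: "x \<in> \<Omega>" and e: "0 < e"
    have "0 < e / 3" using e by simp
    from osc[OF x this] obtain \<rho> m where \<rho>: "0 < \<rho>" "AE y in lborel. y \<in> ball x \<rho> \<longrightarrow> \<bar>f y - m\<bar> \<le> e / 3" by blast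
    have "dist (w z) (w x) < e" if "dist z x < \<rho>" for z
    proof -
      have "z \<in> ball x \<rho>" "x \<in> ball x \<rho>" using that \<rho>(1) by (auto simp: dist_commute)
      note key[OF \<rho>(2) this(1)] key[OF \<rho>(2) this(2)]
      then show ?thesis using e unfolding dist_real_def by linarith
    qed
    then show "\<exists>d>0. \<forall>x'\<in>\<Omega>. dist x' x < d \<longrightarrow> dist (w x') (w x) < e" using \<rho>(1) by blast
  qed
  moreover have "AE x in lborel. x \<in> \<Omega> \<longrightarrow> w x = f x"
  proof -
    have "AE x in lborel. x \<in> \<Omega> \<longrightarrow> \<bar>w x - f x\<bar> \<le> 2 * seps k" for k
    proof (rule AE_local)
      fix x assume x: "x \<in> \<Omega>"
      have "0 < seps k" by simp
      from osc[OF x this] obtain \<rho> m where \<rho>: "0 < \<rho>" "AE y in lborel. y \<in> ball x \<rho> \<longrightarrow> \<bar>f y - m\<bar> \<le> seps k" by blast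
      from \<rho>(2) have "AE y in lborel. y \<in> ball x \<rho> \<longrightarrow> \<bar>w y - f y\<bar> \<le> 2 * seps k"
      proof eventually_elim
        case (elim y)
        show ?case
        proof
          assume "y \<in> ball x \<rho>"
          with key[OF \<rho>(2) this] elim show "\<bar>w y - f y\<bar> \<le> 2 * seps k" by linarith
        qed
      qed
      then show "\<exists>r>0. AE y in lborel. y \<in> ball x r \<longrightarrow> \<bar>w y - f y\<bar> \<le> 2 * seps k" using \<rho>(1) by blast
    qed
    then have "AE x in lborel. \<forall>k. x \<in> \<Omega> \<longrightarrow> \<bar>w x - f x\<bar> \<le> 2 * seps k" unfolding AE_all_countable by blast
    then show ?thesis
    proof eventually_elim
      case (elim x)
      show ?case
      proof
        assume "x \<in> \<Omega>"
        then have le: "\<bar>w x - f x\<bar> \<le> 2 * seps k" for k using elim by blast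
        have "(\<lambda>k. 2 * seps k) \<longlonglongrightarrow> 2 * 0"
          using LIMSEQ_inverse_real_of_nat by (intro tendsto_mult tendsto_const) (simp add: inverse_eq_divide)
        then have "\<bar>w x - f x\<bar> \<le> 2 * 0" by (rule LIMSEQ_le_const) (use le in blast)
        then show "w x = f x" by simp
      qed
    qed
  qed
  ultimately show ?thesis by (rule that)
qed

section \<open>Hausdorff dimension of porous sets\<close>

lemma hausdorff_pre_le:
  assumes "E \<subseteq> (\<Union>k. C k)" "\<And>k. bounded (C k)" "\<And>k. diameter (C k) \<le> \<delta>"
  shows "hausdorff_pre s \<delta> E \<le> (\<Sum>k. ennreal (diameter (C k) powr s))"
  unfolding hausdorff_pre_def by (rule INF_lower) (use assms in auto)

text \<open>The usual distribution of e 2^(-m-1) over the pieces, at fixed \<delta>; used both for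
  the cubes that tile one piece and for the pieces themselves.\<close>

lemma hausdorff_pre_null_UN:
  fixes E :: "nat \<Rightarrow> 'a::metric_space set"
  assumes null: "\<And>m. hausdorff_pre s \<delta> (E m) = 0"
  shows "hausdorff_pre s \<delta> (\<Union>m. E m) = 0"
proof -
  have "hausdorff_pre s \<delta> (\<Union>m. E m) \<le> 0 + ennreal e" if e: "0 < e" for e
  proof -
    have "\<exists>C. E m \<subseteq> (\<Union>k. C k) \<and> (\<forall>k. bounded (C k) \<and> diameter (C k) \<le> \<delta>) \<and>
      (\<Sum>k. ennreal (diameter (C k) powr s)) < ennreal (e * (1/2)^(Suc m))" for m
    proof -
      have "hausdorff_pre s \<delta> (E m) < ennreal (e * (1/2)^(Suc m))" using e by (simp add: null)
      then show ?thesis unfolding hausdorff_pre_def INF_less_iff by auto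
    qed
    then obtain C where C: "\<And>m. E m \<subseteq> (\<Union>k. C m k)" "\<And>m k. bounded (C m k)" "\<And>m k. diameter (C m k) \<le> \<delta>"
      "\<And>m. (\<Sum>k. ennreal (diameter (C m k) powr s)) < ennreal (e * (1/2)^(Suc m))" by metis
    define D where "D = (\<lambda>(m, k). C m k)"
    have "hausdorff_pre s \<delta> (\<Union>m. E m) \<le> (\<Sum>i. ennreal (diameter (D (prod_decode i)) powr s))"
    proof (rule hausdorff_pre_le)
      show "(\<Union>m. E m) \<subseteq> (\<Union>i. D (prod_decode i))"
      proof
        fix x assume "x \<in> (\<Union>m. E m)"
        then obtain m k where "x \<in> C m k" using C(1) by blast
        then have "x \<in> D (prod_decode (prod_encode (m, k)))" by (simp add: D_def)
        then show "x \<in> (\<Union>i. D (prod_decode i))" by blast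
      qed
    qed (auto simp: D_def C split: prod.split)
    also have "\<dots> = (\<Sum>m. \<Sum>k. ennreal (diameter (C m k) powr s))"
      by (subst suminf_ennreal_2dimen[of "\<lambda>m. \<Sum>k. ennreal (diameter (C m k) powr s)"
            "\<lambda>p. ennreal (diameter (D p) powr s)"]) (auto simp: D_def)
    also have "\<dots> \<le> (\<Sum>m. ennreal (e * (1/2)^(Suc m)))"
      by (intro suminf_le less_imp_le C(4)) auto
    also have "\<dots> = ennreal e"
    proof -
      have "(\<lambda>m. e * (1/2)^(Suc m)) sums (e * 1)" by (intro sums_mult power_half_series)
      then show ?thesis using e by (subst suminf_ennreal2) (auto simp: sums_iff)
    qed
    finally show ?thesis by simp
  qed
  then have "hausdorff_pre s \<delta> (\<Union>m. E m) \<le> 0" by (rule ennreal_le_epsilon)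
  then show ?thesis by simp
qed

lemma hausdorff_pre_finite:
  assumes "finite F" "E \<subseteq> (\<Union>S\<in>F. D S)" "\<And>S. S \<in> F \<Longrightarrow> bounded (D S)" "\<And>S. S \<in> F \<Longrightarrow> diameter (D S) \<le> d"
    "d \<le> \<delta>" "0 \<le> d" "0 \<le> s"
  shows "hausdorff_pre s \<delta> E \<le> ennreal (card F * d powr s)"
proof -
  obtain xs where xs: "set xs = F" "distinct xs" using finite_distinct_list[OF assms(1)] by blast
  \<comment> \<open>Padding by empty sets is free: they have diameter 0, and \<open>0 powr s\<close>
    is 0 for every s, also for s = 0.\<close>
  define C where "C k = (if k < length xs then D (xs ! k) else {})" for k
  have inF: "xs ! k \<in> F" if "k < length xs" for k using that xs nth_mem by blast
  have dC: "diameter (C k) \<le> d" for k using assms(4)[OF inF] assms(6) by (auto simp: C_def)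
  have "hausdorff_pre s \<delta> E \<le> (\<Sum>k. ennreal (diameter (C k) powr s))"
  proof (rule hausdorff_pre_le)
    show "E \<subseteq> (\<Union>k. C k)"
    proof
      fix x assume "x \<in> E"
      then obtain S where S: "S \<in> F" "x \<in> D S" using assms(2) by blast
      then obtain k where "k < length xs" "xs ! k = S" using xs by (metis in_set_conv_nth)
      then have "x \<in> C k" using S by (simp add: C_def)
      then show "x \<in> (\<Union>k. C k)" by blast
    qed
    show "bounded (C k)" for k using assms(3)[OF inF] by (auto simp: C_def)
    show "diameter (C k) \<le> \<delta>" for k using dC assms(5) order_trans by blast
  qed
  also have "\<dots> = (\<Sum>k<length xs. ennreal (diameter (C k) powr s))"
    by (rule suminf_finite) (auto simp: C_def)
  also have "\<dots> \<le> (\<Sum>k<length xs. ennreal (d powr s))"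
  proof (intro sum_mono ennreal_leI powr_mono2 assms(7) dC)
    fix k assume "k \<in> {..<length xs}"
    then show "0 \<le> diameter (C k)" using assms(3)[OF inF] by (auto simp: C_def intro: diameter_ge_0)
  qed
  also have "\<dots> = ennreal (card F * d powr s)"
    using distinct_card[OF xs(2)] xs(1) by (simp add: ennreal_mult ennreal_of_nat_eq_real_of_nat)
  finally show ?thesis .
qed

text \<open>Half-open, so that the floor function names the subcube to which a point
  belongs.\<close>

definition hcube :: "real^'n::finite \<Rightarrow> real \<Rightarrow> (real^'n) set" where
  "hcube a l = {x. \<forall>i. a $ i \<le> x $ i \<and> x $ i < a $ i + l}"

lemma dist_hcube: "x \<in> hcube a l \<Longrightarrow> y \<in> hcube a l \<Longrightarrow> dist x y \<le> real CARD('n) * l" for x :: "real^'n::finite"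
proof -
  assume xy: "x \<in> hcube a l" "y \<in> hcube a l"
  have "norm (x - y) \<le> (\<Sum>i\<in>UNIV. \<bar>(x - y) $ i\<bar>)" by (rule norm_le_l1_cart)
  also have "\<dots> \<le> (\<Sum>i\<in>(UNIV::'n set). l)"
  proof (rule sum_mono)
    fix i
    have "a $ i \<le> x $ i \<and> x $ i < a $ i + l" "a $ i \<le> y $ i \<and> y $ i < a $ i + l" using xy by (auto simp: hcube_def)
    then show "\<bar>(x - y) $ i\<bar> \<le> l" by (simp add: abs_le_iff)
  qed
  finally show ?thesis by (simp add: dist_norm)
qed

lemma bounded_hcube: "bounded (hcube a l)" for a :: "real^'n::finite"
proof (cases "hcube a l = {}")
  case False
  then obtain x where "x \<in> hcube a l" by blast
  then have "hcube a l \<subseteq> cball x (real CARD('n) * l)" using dist_hcube by force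
  then show ?thesis using bounded_subset bounded_cball by blast
qed simp

lemma diameter_hcube: "0 \<le> l \<Longrightarrow> diameter (hcube a l) \<le> real CARD('n) * l" for a :: "real^'n::finite"
  by (rule diameter_le) (auto simp: dist_hcube[unfolded dist_norm])

lemma hcube_subdivide:
  fixes a :: "real^'n::finite"
  assumes l: "0 < l" and N: "0 < N" and x: "x \<in> hcube a l"
  shows "\<exists>v\<in>PiE UNIV (\<lambda>_. {..<N}). x \<in> hcube (a + (\<chi> i. real (v i) * (l / N))) (l / N)"
proof -
  define t where "t i = (x $ i - a $ i) * N / l" for i
  define v where "v i = nat \<lfloor>t i\<rfloor>" for i
  have t: "0 \<le> t i" "t i < N" "x $ i = a $ i + t i * (l / N)" for i
  proof -
    have "a $ i \<le> x $ i" "x $ i < a $ i + l" using x by (auto simp: hcube_def)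
    then show "0 \<le> t i" "t i < N" "x $ i = a $ i + t i * (l / N)" using l N by (auto simp: t_def divide_simps)
  qed
  have v: "real (v i) \<le> t i" "t i < real (v i) + 1" "v i < N" for i
  proof -
    show "real (v i) \<le> t i" "t i < real (v i) + 1" using t(1)[of i] by (auto simp: v_def of_nat_nat)
    then show "v i < N" using t(2)[of i] by linarith
  qed
  show ?thesis
  proof (rule bexI[of _ v])
    have "a $ i + real (v i) * (l / N) \<le> x $ i \<and> x $ i < a $ i + real (v i) * (l / N) + l / N" for i
    proof -
      have q: "0 < l / N" using l N by simp
      have "real (v i) * (l / N) \<le> t i * (l / N)" by (rule mult_right_mono) (use v q in auto)
      moreover have "t i * (l / N) < (real (v i) + 1) * (l / N)" by (rule mult_strict_right_mono) (use v q in auto)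
      ultimately show ?thesis using t(3)[of i] by (simp only: distrib_right mult_1) simp
    qed
    then show "x \<in> hcube (a + (\<chi> i. real (v i) * (l / N))) (l / N)" by (simp add: hcube_def)
    show "v \<in> PiE UNIV (\<lambda>_. {..<N})" using v(3) by auto
  qed
qed

lemma porous_hcube_cover:
  fixes E :: "(real^'n::finite) set"
  assumes k: "0 < \<kappa>" "\<kappa> \<le> 1" and N: "4 * CARD('n) < \<kappa> * real N"
    and por: "\<And>z r. z \<in> E \<Longrightarrow> 0 < r \<Longrightarrow> r < r0 \<Longrightarrow> \<exists>y. ball y (\<kappa> * r) \<subseteq> ball z r - E"
    and l: "0 < l" "l < r0"
  shows "\<exists>F. finite F \<and> card F \<le> N ^ CARD('n) - 1 \<and> E \<inter> hcube a l \<subseteq> (\<Union>b\<in>F. hcube b (l / real N))"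
proof -
  have N0: "0 < N" using N by (cases N) auto
  define m :: "real^'n" where "m = a + (\<chi> i. l / 2)"
  have sub: "ball m (l / 2) \<subseteq> hcube a l"
  proof
    fix x assume "x \<in> ball m (l / 2)"
    then have "\<bar>(m - x) $ i\<bar> < l / 2" for i using component_le_norm_cart[of "m - x" i] by (simp add: dist_norm)
    then have "\<bar>a $ i + l / 2 - x $ i\<bar> < l / 2" for i by (simp add: m_def)
    then show "x \<in> hcube a l" unfolding hcube_def by (simp add: abs_less_iff) (smt (verit) field_sum_of_halves)
  qed
  \<comment> \<open>Either the central ball of radius l/4 misses \<open>E\<close>, or porosity at
    one of its points with radius l/4 gives a hole whose centre is within l/2 of the middle, thus
    still in the cube.\<close>
  have "\<exists>y\<in>hcube a l. ball y (\<kappa> * (l / 4)) \<inter> E = {}"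
  proof (cases "ball m (l / 4) \<inter> E = {}")
    case True
    have "\<kappa> * (l / 4) \<le> l / 4" using k l by (simp add: mult_left_le_one_le)
    then have "ball m (\<kappa> * (l / 4)) \<subseteq> ball m (l / 4)" by (rule subset_ball)
    moreover have "m \<in> hcube a l" using sub l by auto
    ultimately show ?thesis using True by blast
  next
    case False
    then obtain z where z: "z \<in> E" "dist m z < l / 4" by auto
    obtain y where y: "ball y (\<kappa> * (l / 4)) \<subseteq> ball z (l / 4) - E" using por[OF z(1), of "l / 4"] l by auto
    have "y \<in> ball y (\<kappa> * (l / 4))" using k l by simp
    then have "y \<in> ball z (l / 4)" using y by blast
    then have "dist z y < l / 4" by simp
    then have "y \<in> ball m (l / 2)" using z(2) dist_triangle[of m y z] by (simp add: dist_commute)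
    then show ?thesis using sub y by blast
  qed
  then obtain y where y: "y \<in> hcube a l" "ball y (\<kappa> * (l / 4)) \<inter> E = {}" by blast
  define c where "c v = a + (\<chi> i. real (v i) * (l / N))" for v :: "'n \<Rightarrow> nat"
  define P where "P = PiE (UNIV::'n set) (\<lambda>_. {..<N})"
  have P: "finite P" "card P = N ^ CARD('n)" unfolding P_def by (auto simp: card_PiE intro!: finite_PiE)
  obtain v0 where v0: "v0 \<in> P" "y \<in> hcube (c v0) (l / N)"
    using hcube_subdivide[OF l(1) N0 y(1)] unfolding P_def c_def by blast
  have "hcube (c v0) (l / N) \<subseteq> ball y (\<kappa> * (l / 4))"
  proof
    fix x assume "x \<in> hcube (c v0) (l / N)"
    from dist_hcube[OF v0(2) this] have "dist y x \<le> CARD('n) * (l / N)" .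
    also have "\<dots> < \<kappa> * (l / 4)"
    proof -
      have "4 * CARD('n) * l < \<kappa> * real N * l" using N l(1) by (rule mult_strict_right_mono)
      then show ?thesis using N0 by (simp add: divide_simps mult_ac)
    qed
    finally show "x \<in> ball y (\<kappa> * (l / 4))" by simp
  qed
  then have hole: "hcube (c v0) (l / N) \<inter> E = {}" using y(2) by blast
  show ?thesis
  proof (intro exI[of _ "c ` (P - {v0})"] conjI)
    show "finite (c ` (P - {v0}))" using P by simp
    have "card (c ` (P - {v0})) \<le> card (P - {v0})" by (rule card_image_le) (use P in simp)
    also have "\<dots> = N ^ CARD('n) - 1" using P v0 by simp
    finally show "card (c ` (P - {v0})) \<le> N ^ CARD('n) - 1" .
    show "E \<inter> hcube a l \<subseteq> (\<Union>b\<in>c ` (P - {v0}). hcube b (l / real N))"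
    proof
      fix x assume x: "x \<in> E \<inter> hcube a l"
      then obtain v where v: "v \<in> P" "x \<in> hcube (c v) (l / N)"
        using hcube_subdivide[OF l(1) N0, of x a] unfolding P_def c_def by blast
      then have "v \<noteq> v0" using hole x by blast
      then show "x \<in> (\<Union>b\<in>c ` (P - {v0}). hcube b (l / real N))" using v by blast
    qed
  qed
qed

lemma porous_hcube_cover_iter:
  fixes E :: "(real^'n::finite) set"
  assumes k: "0 < \<kappa>" "\<kappa> \<le> 1" and N: "4 * CARD('n) < \<kappa> * real N"
    and por: "\<And>z r. z \<in> E \<Longrightarrow> 0 < r \<Longrightarrow> r < r0 \<Longrightarrow> \<exists>y. ball y (\<kappa> * r) \<subseteq> ball z r - E"
    and l: "0 < l" "l < r0"
  shows "\<exists>F. finite F \<and> card F \<le> (N ^ CARD('n) - 1) ^ j \<and> E \<inter> hcube a l \<subseteq> (\<Union>b\<in>F. hcube b (l / real N ^ j))"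
proof (induction j)
  case 0
  have "finite {a} \<and> card {a} \<le> (N ^ CARD('n) - 1) ^ 0 \<and> E \<inter> hcube a l \<subseteq> (\<Union>b\<in>{a}. hcube b (l / real N ^ 0))" by simp
  then show ?case by (rule exI)
next
  case (Suc j)
  obtain F where F: "finite F" "card F \<le> (N ^ CARD('n) - 1) ^ j" "E \<inter> hcube a l \<subseteq> (\<Union>b\<in>F. hcube b (l / real N ^ j))"
    using Suc.IH by metis
  have N0: "0 < N" using N by (cases N) auto
  then have "1 \<le> real N" by simp
  then have "1 \<le> real N ^ j" by (rule one_le_power)
  then have "l / real N ^ j \<le> l / 1" using l N0 by (intro divide_left_mono) auto
  then have lj2: "l / real N ^ j < r0" using l by linarith
  have lj1: "0 < l / real N ^ j" using l N0 by simp
  have "\<exists>H. finite H \<and> card H \<le> N ^ CARD('n) - 1 \<and> E \<inter> hcube b (l / real N ^ j) \<subseteq> (\<Union>b\<in>H. hcube b (l / real N ^ j / N))" for b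
    by (rule porous_hcube_cover[OF k N _ lj1 lj2]) (rule por)
  then obtain H where H: "\<And>b. finite (H b)" "\<And>b. card (H b) \<le> N ^ CARD('n) - 1"
    "\<And>b. E \<inter> hcube b (l / real N ^ j) \<subseteq> (\<Union>b\<in>H b. hcube b (l / real N ^ j / N))" by metis
  show ?case
  proof (intro exI[of _ "\<Union>b\<in>F. H b"] conjI)
    show "finite (\<Union>b\<in>F. H b)" using F H by blast
    have "card (\<Union>b\<in>F. H b) \<le> (\<Sum>b\<in>F. card (H b))" by (rule card_UN_le[OF F(1)])
    also have "\<dots> \<le> card F * (N ^ CARD('n) - 1)" using sum_bounded_above[of F "\<lambda>b. card (H b)" "N ^ CARD('n) - 1"] H(2) by simp
    also have "\<dots> \<le> (N ^ CARD('n) - 1) ^ Suc j" using F(2) by simp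
    finally show "card (\<Union>b\<in>F. H b) \<le> (N ^ CARD('n) - 1) ^ Suc j" .
    show "E \<inter> hcube a l \<subseteq> (\<Union>b\<in>(\<Union>b\<in>F. H b). hcube b (l / real N ^ Suc j))"
    proof
      fix x assume x: "x \<in> E \<inter> hcube a l"
      then obtain b where b: "b \<in> F" "x \<in> hcube b (l / real N ^ j)" using F(3) by blast
      then obtain b' where "b' \<in> H b" "x \<in> hcube b' (l / real N ^ j / real N)" using H(3)[of b] x by blast
      then show "x \<in> (\<Union>b\<in>(\<Union>b\<in>F. H b). hcube b (l / real N ^ Suc j))" using b by (auto simp: mult.commute)
    qed
  qed
qed

text \<open>Level j of the subdivision costs a constant times the j-th power of (N^n - 1) / N^s, a
  number below 1 by the choice of s.\<close>

lemma porous_hcube_null: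
  fixes E :: "(real^'n::finite) set"
  assumes k: "0 < \<kappa>" "\<kappa> \<le> 1" and N: "4 * CARD('n) < \<kappa> * real N"
    and por: "\<And>z r. z \<in> E \<Longrightarrow> 0 < r \<Longrightarrow> r < r0 \<Longrightarrow> \<exists>y. ball y (\<kappa> * r) \<subseteq> ball z r - E"
    and l: "0 < l" "l < r0" and s: "0 \<le> s" "real (N ^ CARD('n) - 1) < real N powr s" and d: "0 < \<delta>"
  shows "hausdorff_pre s \<delta> (E \<inter> hcube a l) = 0"
proof -
  define p where "p = real (N ^ CARD('n) - 1)"
  define q where "q = p / real N powr s"
  define n where "n = real CARD('n)"
  have n: "1 \<le> n" unfolding n_def by (simp add: Suc_le_eq)
  have "4 \<le> 4 * n" using n by simp
  also have "\<dots> < \<kappa> * real N" using N by (simp add: n_def)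
  also have "\<dots> \<le> real N" using k by (simp add: mult_left_le_one_le)
  finally have N4: "4 < real N" .
  have q: "0 \<le> q" "q < 1" using s(2) N4 by (auto simp: q_def p_def)
  have lim: "(\<lambda>j. n * l / real N ^ j) \<longlonglongrightarrow> 0"
  proof -
    have "(\<lambda>j. n * l * (1 / real N) ^ j) \<longlonglongrightarrow> n * l * 0" by (intro tendsto_mult tendsto_const LIMSEQ_power_zero) (use N4 in simp)
    then show ?thesis by (simp add: power_divide)
  qed
  have bd: "eventually (\<lambda>j. hausdorff_pre s \<delta> (E \<inter> hcube a l) \<le> ennreal ((n * l) powr s * q ^ j)) sequentially"
    using order_tendstoD(2)[OF lim d]
  proof eventually_elim
    case (elim j)
    obtain F where F: "finite F" "card F \<le> (N ^ CARD('n) - 1) ^ j" "E \<inter> hcube a l \<subseteq> (\<Union>b\<in>F. hcube b (l / real N ^ j))"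
      using porous_hcube_cover_iter[OF k N por l] by blast
    have "hausdorff_pre s \<delta> (E \<inter> hcube a l) \<le> ennreal (card F * (n * l / real N ^ j) powr s)"
    proof (rule hausdorff_pre_finite[OF F(1) F(3)])
      show "diameter (hcube b (l / real N ^ j)) \<le> n * l / real N ^ j" for b :: "real^'n"
        using diameter_hcube[of "l / N ^ j" b] l by (simp add: n_def)
    qed (use elim bounded_hcube s l n in auto)
    also have "\<dots> \<le> ennreal (p ^ j * (n * l / real N ^ j) powr s)"
    proof (intro ennreal_leI mult_right_mono)
      have "real (card F) \<le> real ((N ^ CARD('n) - 1) ^ j)" using F(2) of_nat_le_iff by blast
      then show "real (card F) \<le> p ^ j" by (simp add: p_def)
    qed simp
    also have "p ^ j * (n * l / real N ^ j) powr s = (n * l) powr s * q ^ j"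
    proof -
      have "(real N ^ j) powr s = (real N powr s) ^ j" using N4 by (simp add: powr_power powr_realpow[symmetric] powr_powr mult.commute)
      then show ?thesis using n l N4 by (simp add: powr_divide q_def power_divide)
    qed
    finally show ?case .
  qed
  have "(\<lambda>j. (n * l) powr s * q ^ j) \<longlonglongrightarrow> (n * l) powr s * 0" by (intro tendsto_mult tendsto_const LIMSEQ_power_zero) (use q in simp)
  then have "(\<lambda>j. ennreal ((n * l) powr s * q ^ j)) \<longlonglongrightarrow> 0" using tendsto_ennrealI by fastforce
  from tendsto_lowerbound[OF this bd] show ?thesis by simp
qed

lemma hcubes_cover:
  assumes "0 < l"
  shows "(\<Union>j. hcube (l *\<^sub>R (\<chi> i. of_int ((from_nat j :: 'n \<Rightarrow> int) i))) l) = (UNIV :: (real^'n::finite) set)"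
proof -
  have "x \<in> (\<Union>j. hcube (l *\<^sub>R (\<chi> i. of_int ((from_nat j :: 'n \<Rightarrow> int) i))) l)" for x :: "real^'n"
  proof -
    define v where "v i = \<lfloor>x $ i / l\<rfloor>" for i
    have "l * of_int (v i) \<le> x $ i \<and> x $ i < l * of_int (v i) + l" for i
    proof -
      have "of_int (v i) \<le> x $ i / l" "x $ i / l < of_int (v i) + 1" unfolding v_def by linarith+
      then show ?thesis using assms by (simp add: field_simps)
    qed
    then have "x \<in> hcube (l *\<^sub>R (\<chi> i. of_int ((from_nat (to_nat v) :: 'n \<Rightarrow> int) i))) l" by (simp add: hcube_def)
    then show ?thesis by blast
  qed
  then show ?thesis by blast
qed

text \<open>N^n - 1 < N^n is strict, so by continuity it survives lowering the exponent by some
  \<sigma>, which depends only on \<kappa> and n. The pieces may have different threshold radii,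
  because null contents add up over countable unions.\<close>

lemma porous_hausdorff_dim:
  assumes k: "0 < \<kappa>" "\<kappa> \<le> 1"
  shows "\<exists>\<sigma>>0. \<sigma> \<le> 1 \<and> (\<forall>A :: nat \<Rightarrow> (real^'n::finite) set.
    (\<forall>m. \<exists>r0>0. \<forall>z\<in>A m. \<forall>r. 0 < r \<and> r < r0 \<longrightarrow> (\<exists>y. ball y (\<kappa> * r) \<subseteq> ball z r - A m)) \<longrightarrow>
    hausdorff_dim (\<Union>m. A m) \<le> real CARD('n) - \<sigma>)"
proof -
  obtain N :: nat where "4 * real CARD('n) / \<kappa> < real N" using reals_Archimedean2 by blast
  then have N: "4 * CARD('n) < \<kappa> * real N" using k by (simp add: field_simps)
  then have N0: "0 < N" by (cases N) auto
  have "((\<lambda>\<sigma>. real N powr (real CARD('n) - \<sigma>)) \<longlongrightarrow> real N powr (real CARD('n) - 0)) (at_right 0)"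
    by (intro tendsto_intros) (use N0 in auto)
  moreover have "real (N ^ CARD('n) - 1) < real N powr (real CARD('n) - 0)"
    using N0 by (simp add: powr_realpow of_nat_diff)
  ultimately have "eventually (\<lambda>\<sigma>. real (N ^ CARD('n) - 1) < real N powr (real CARD('n) - \<sigma>)) (at_right 0)"
    by (rule order_tendstoD(1))
  then obtain b :: real where b: "0 < b" "\<And>\<sigma>. 0 < \<sigma> \<Longrightarrow> \<sigma> < b \<Longrightarrow> real (N ^ CARD('n) - 1) < real N powr (real CARD('n) - \<sigma>)"
    unfolding eventually_at_right_field by blast
  define \<sigma> where "\<sigma> = min 1 (b / 2)"
  define s where "s = real CARD('n) - \<sigma>"
  have \<sigma>: "0 < \<sigma>" "\<sigma> \<le> 1" "\<sigma> < b" using b(1) by (auto simp: \<sigma>_def)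
  have "1 \<le> real CARD('n)" by (simp add: Suc_le_eq)
  then have s: "0 \<le> s" using \<sigma> unfolding s_def by linarith
  have Ns: "real (N ^ CARD('n) - 1) < real N powr s" unfolding s_def by (rule b(2)[OF \<sigma>(1,3)])
  show ?thesis
  proof (intro exI[of _ \<sigma>] conjI allI impI \<sigma>)
    fix A :: "nat \<Rightarrow> (real^'n) set"
    assume A: "\<forall>m. \<exists>r0>0. \<forall>z\<in>A m. \<forall>r. 0 < r \<and> r < r0 \<longrightarrow> (\<exists>y. ball y (\<kappa> * r) \<subseteq> ball z r - A m)"
    have "hausdorff_pre s \<delta> (A m) = 0" if "0 < \<delta>" for m \<delta>
    proof -
      obtain r0 where r0: "0 < r0" and por: "\<And>z r. z \<in> A m \<Longrightarrow> 0 < r \<Longrightarrow> r < r0 \<Longrightarrow> \<exists>y. ball y (\<kappa> * r) \<subseteq> ball z r - A m"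
        using A by metis
      define l where "l = r0 / 2"
      have l: "0 < l" "l < r0" using r0 by (auto simp: l_def)
      define a where "a j = l *\<^sub>R (\<chi> i. of_int ((from_nat j :: 'n \<Rightarrow> int) i) :: real^'n)" for j
      have "hausdorff_pre s \<delta> (A m \<inter> hcube (a j) l) = 0" for j
        by (rule porous_hcube_null[OF k N por l s Ns that])
      then have "hausdorff_pre s \<delta> (\<Union>j. A m \<inter> hcube (a j) l) = 0" by (rule hausdorff_pre_null_UN)
      moreover have "(\<Union>j. A m \<inter> hcube (a j) l) = A m" using hcubes_cover[OF l(1), where 'n='n] unfolding a_def by blast
      ultimately show ?thesis by simp
    qed
    then have "hausdorff_pre s \<delta> (\<Union>m. A m) = 0" if "0 < \<delta>" for \<delta> using that by (intro hausdorff_pre_null_UN) blast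
    then have "hausdorff_measure s (\<Union>m. A m) = 0" unfolding hausdorff_measure_def by (intro antisym SUP_least) auto
    then have "Inf {s. 0 \<le> s \<and> hausdorff_measure s (\<Union>m. A m) = 0} \<le> s"
      by (intro cInf_lower) (use s in \<open>auto intro!: bdd_belowI[of _ 0]\<close>)
    then show "hausdorff_dim (\<Union>m. A m) \<le> real CARD('n) - \<sigma>" by (simp add: hausdorff_dim_def s_def)
  qed
qed

text \<open>A point y near z with w y > r/(4 C) cannot have a point of linear growth within \<kappa>
  r, for growth there would force w y \<le> C \<kappa> r. Growth at radius \<kappa> r is known only
  for points with a uniform threshold, so each hole avoids one piece \<open>A m\<close> and not all
  of \<open>F\<close>.\<close>

lemma linear_growth_hausdorff_dim:
  assumes C: "0 < C"
  shows "\<exists>\<sigma>>0. \<sigma> \<le> 1 \<and> (\<forall>\<Omega> (w :: real^'n::finite \<Rightarrow> real) F. continuous_on \<Omega> w \<longrightarrow>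
    (\<forall>z\<in>F. \<exists>r0>0. \<forall>r. 0 < r \<and> r < r0 \<longrightarrow> cball z r \<subseteq> \<Omega> \<and> r / C \<le> Sup (w ` ball z r) \<and> Sup (w ` ball z r) \<le> C * r) \<longrightarrow>
    hausdorff_dim F \<le> real CARD('n) - \<sigma>)"
proof -
  \<comment> \<open>1/2 keeps the hole inside the ball of radius r, and 1/(4 C^2) makes C \<kappa> r
    at most r/(4 C).\<close>
  define \<kappa> where "\<kappa> = min (1/2) (1 / (4 * C^2))"
  have k: "0 < \<kappa>" "\<kappa> \<le> 1" "\<kappa> \<le> 1/2" "\<kappa> \<le> 1 / (4 * C^2)" using C by (auto simp: \<kappa>_def)
  obtain \<sigma> where \<sigma>: "0 < \<sigma>" "\<sigma> \<le> 1" and dim: "\<And>A :: nat \<Rightarrow> (real^'n::finite) set.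
    (\<And>m. \<exists>r0>0. \<forall>z\<in>A m. \<forall>r. 0 < r \<and> r < r0 \<longrightarrow> (\<exists>y. ball y (\<kappa> * r) \<subseteq> ball z r - A m)) \<Longrightarrow>
    hausdorff_dim (\<Union>m. A m) \<le> real CARD('n) - \<sigma>"
    using porous_hausdorff_dim[OF k(1,2), where 'n='n] by blast
  show ?thesis
  proof (intro exI[of _ \<sigma>] conjI allI impI \<sigma>)
    fix \<Omega> F and w :: "real^'n \<Rightarrow> real"
    assume cont: "continuous_on \<Omega> w"
      and F: "\<forall>z\<in>F. \<exists>r0>0. \<forall>r. 0 < r \<and> r < r0 \<longrightarrow> cball z r \<subseteq> \<Omega> \<and> r / C \<le> Sup (w ` ball z r) \<and> Sup (w ` ball z r) \<le> C * r"
    \<comment> \<open>Points at which the growth bounds hold for all radii below 1/(m+1); every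
      point of \<open>F\<close> belongs to some piece.\<close>
    define A where "A m = {z\<in>F. \<forall>r. 0 < r \<and> r < inverse (real (Suc m)) \<longrightarrow>
      cball z r \<subseteq> \<Omega> \<and> r / C \<le> Sup (w ` ball z r) \<and> Sup (w ` ball z r) \<le> C * r}" for m
    have FA: "F = (\<Union>m. A m)"
    proof
      show "F \<subseteq> (\<Union>m. A m)"
      proof
        fix z assume z: "z \<in> F"
        then obtain r0 where r0: "0 < r0" "\<And>r. 0 < r \<Longrightarrow> r < r0 \<Longrightarrow>
          cball z r \<subseteq> \<Omega> \<and> r / C \<le> Sup (w ` ball z r) \<and> Sup (w ` ball z r) \<le> C * r" using F by blast
        obtain m where m: "inverse (real (Suc m)) < r0" using reals_Archimedean[OF r0(1)] by blast
        have "z \<in> A m" unfolding A_def using z by (intro CollectI conjI allI impI r0(2)) (use m in linarith)+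
        then show "z \<in> (\<Union>m. A m)" by blast
      qed
    qed (auto simp: A_def)
    have AD: "cball z r \<subseteq> \<Omega>" "r / C \<le> Sup (w ` ball z r)" "Sup (w ` ball z r) \<le> C * r"
      if "z \<in> A m" "0 < r" "r < inverse (real (Suc m))" for z r m
      using that unfolding A_def by blast+
    have por: "\<exists>y. ball y (\<kappa> * r) \<subseteq> ball z r - A m" if z: "z \<in> A m" and r: "0 < r" "r < inverse (real (Suc m))" for z r m
    proof -
      have "r / 2 / C \<le> Sup (w ` ball z (r / 2))" by (rule AD(2)[OF z]) (use r in linarith)+
      \<comment> \<open>Staying strictly below the supremum provides an actual point of the ball of
        radius r/2.\<close>
      moreover have "r / (4 * C) < r / 2 / C" using C r by (simp add: field_simps)
      ultimately have "r / (4 * C) < Sup (w ` ball z (r / 2))" by linarith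
      then obtain y where y: "y \<in> ball z (r / 2)" "r / (4 * C) < w y"
        by (rule less_cSupE) (use r in auto)
      have kr: "0 < \<kappa> * r" "\<kappa> * r \<le> r / 2" using mult_right_mono[OF k(3), of r] k(1) r by auto
      have "ball y (\<kappa> * r) \<subseteq> ball z r"
      proof
        fix x assume "x \<in> ball y (\<kappa> * r)"
        then show "x \<in> ball z r" using y(1) kr(2) dist_triangle[of z x y] by auto
      qed
      moreover have "z' \<notin> A m" if z': "z' \<in> ball y (\<kappa> * r)" for z'
      proof
        assume a: "z' \<in> A m"
        have b: "\<kappa> * r < inverse (real (Suc m))" using kr r by linarith
        have "bdd_above (w ` cball z' (\<kappa> * r))"
          by (intro bounded_imp_bdd_above compact_imp_bounded compact_continuous_image compact_cball continuous_on_subset[OF cont] AD(1)[OF a kr(1) b])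
        then have bdd: "bdd_above (w ` ball z' (\<kappa> * r))" by (rule bdd_above_mono) auto
        have "w y \<le> Sup (w ` ball z' (\<kappa> * r))" by (rule cSup_upper[OF _ bdd]) (use z' in \<open>auto simp: dist_commute\<close>)
        also have "\<dots> \<le> C * (\<kappa> * r)" by (rule AD(3)[OF a kr(1) b])
        also have "\<dots> \<le> C * (1 / (4 * C^2) * r)" by (intro mult_left_mono mult_right_mono k) (use C r in auto)
        also have "\<dots> = r / (4 * C)" using C by (simp add: power2_eq_square)
        finally show False using y(2) by simp
      qed
      ultimately show ?thesis by blast
    qed
    have "hausdorff_dim (\<Union>m. A m) \<le> real CARD('n) - \<sigma>"
    proof (rule dim)
      show "\<exists>r0>0. \<forall>z\<in>A m. \<forall>r. 0 < r \<and> r < r0 \<longrightarrow> (\<exists>y. ball y (\<kappa> * r) \<subseteq> ball z r - A m)" for m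
        by (intro exI[of _ "inverse (real (Suc m))"] conjI ballI allI impI) (use por in \<open>auto simp del: of_nat_Suc\<close>)
    qed
    then show "hausdorff_dim F \<le> real CARD('n) - \<sigma>" using FA by simp
  qed
qed

section \<open>The free boundary\<close>

lemma AE_le_continuous:
  fixes w :: "real^'n::finite \<Rightarrow> real"
  assumes "open U" "continuous_on U w" "AE x in lborel. x \<in> U \<longrightarrow> w x \<le> t" "x \<in> U"
  shows "w x \<le> t"
proof (rule ccontr)
  assume "\<not> w x \<le> t"
  moreover have "open {x \<in> U. t < w x}"
    using continuous_openin_preimage_gen[OF assms(2), of "{t<..}"] openin_open_eq[OF assms(1)] by (simp add: vimage_def Int_def)
  ultimately obtain r where r: "0 < r" "ball x r \<subseteq> {x \<in> U. t < w x}"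
    using assms(4) open_contains_ball by (metis (no_types, lifting) mem_Collect_eq not_le)
  have "AE y in lborel. y \<in> ball x r \<longrightarrow> w y \<le> t"
    using assms(3) by eventually_elim (use r in auto)
  then obtain y where "y \<in> ball x r" "w y \<le> t" using r(1) by (rule AE_ball_obtain)
  then show False using r(2) by auto
qed

text \<open>Two reasons for small oscillation: at points of positivity the De Giorgi decay, at all
  others linear growth, which squeezes f between 0 and C r.\<close>

lemma minimizer_continuous_representative:
  fixes f :: "real^'n::finite \<Rightarrow> real"
  assumes M: "AC_minimizer lam Lam \<Omega> a u f G"
  obtains w where "continuous_on \<Omega> w" "AE x in lborel. x \<in> \<Omega> \<longrightarrow> w x = f x" "\<And>x. x \<in> \<Omega> \<Longrightarrow> 0 \<le> w x"
proof -
  have O: "open \<Omega>" and lam: "0 < lam" "lam \<le> Lam" using M by (auto simp: AC_minimizer_def)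
  obtain C where C: "0 < C" and growth: "\<And>\<Omega> a u (f::real^'n \<Rightarrow> real) G c. AC_minimizer lam Lam \<Omega> a u f G \<Longrightarrow> c \<in> \<Omega> \<Longrightarrow> \<not> pos_near f c \<Longrightarrow>
    \<exists>r0>0. \<forall>r. 0 < r \<and> r < r0 \<longrightarrow> cball c (2 * r) \<subseteq> \<Omega> \<and> (AE x in lborel. x \<in> ball c r \<longrightarrow> f x \<le> C * r)"
    using linear_growth[OF lam, where 'n='n] by blast
  have "\<exists>\<rho>>0. \<exists>m. AE y in lborel. y \<in> ball x \<rho> \<longrightarrow> \<bar>f y - m\<bar> \<le> \<eta>" if x: "x \<in> \<Omega>" and \<eta>: "0 < \<eta>" for x \<eta>
  proof (cases "pos_near f x")
    case True
    then show ?thesis by (rule positive_continuity[OF M x _ \<eta>])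
  next
    case False
    obtain r0 where r0: "0 < r0" "\<And>r. 0 < r \<Longrightarrow> r < r0 \<Longrightarrow> cball x (2 * r) \<subseteq> \<Omega> \<and> (AE y in lborel. y \<in> ball x r \<longrightarrow> f y \<le> C * r)"
      using growth[OF M x False] by blast
    define r where "r = min (r0 / 2) (\<eta> / C)"
    have r: "0 < r" "r < r0" "C * r \<le> \<eta>" using r0(1) \<eta> C by (auto simp: r_def min_def field_simps)
    have sub: "ball x r \<subseteq> \<Omega>" using r0(2)[OF r(1,2)] r(1) by (force simp: subset_iff)
    have up: "AE y in lborel. y \<in> ball x r \<longrightarrow> f y \<le> C * r" using r0(2)[OF r(1,2)] by blast
    have "AE y in lborel. y \<in> ball x r \<longrightarrow> \<bar>f y - 0\<bar> \<le> \<eta>"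
      using up minimizer_nonneg[OF M]
    proof eventually_elim
      case (elim y)
      show ?case
      proof
        assume y: "y \<in> ball x r"
        then have "0 \<le> f y" "f y \<le> C * r" using elim sub by blast+
        then show "\<bar>f y - 0\<bar> \<le> \<eta>" using r(3) by linarith
      qed
    qed
    then show ?thesis using r(1) by blast
  qed
  from continuous_representative[OF O this] obtain w where w: "continuous_on \<Omega> w" "AE x in lborel. x \<in> \<Omega> \<longrightarrow> w x = f x" by blast
  have "AE x in lborel. x \<in> \<Omega> \<longrightarrow> - w x \<le> 0" using w(2) minimizer_nonneg[OF M] by eventually_elim auto
  then have "- w x \<le> 0" if "x \<in> \<Omega>" for x
    using AE_le_continuous[OF O continuous_on_minus[OF w(1)] _ that] by blast
  then show thesis using that[OF w] by simp
qed

text \<open>Everything follows from reading nondegeneracy backwards: at a free boundary point the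
  excess is at least \<nu> r^(n+2). Bounding it by the squared supremum times the volume of the ball
  gives the lower growth bound, and bounding it by (C1 r)^2 times the measure of the positivity set
  gives the density.\<close>

lemma free_boundary_estimates:
  assumes lam: "0 < lam" "lam \<le> Lam"
  shows "\<exists>C>0. \<exists>\<theta>>0. \<forall>\<Omega> a u (f::real^'n::finite \<Rightarrow> real) G w z. AC_minimizer lam Lam \<Omega> a u f G \<longrightarrow> continuous_on \<Omega> w \<longrightarrow>
    (AE x in lborel. x \<in> \<Omega> \<longrightarrow> w x = f x) \<longrightarrow> (\<forall>x\<in>\<Omega>. 0 \<le> w x) \<longrightarrow> z \<in> frontier {x \<in> \<Omega>. 0 < w x} \<inter> \<Omega> \<longrightarrow>
    (\<exists>r0>0. \<forall>r. 0 < r \<and> r < r0 \<longrightarrow> cball z r \<subseteq> \<Omega> \<and> r / C \<le> Sup (w ` ball z r) \<and> Sup (w ` ball z r) \<le> C * r \<and>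
      ennreal (\<theta> * r ^ CARD('n)) \<le> emeasure lebesgue {x \<in> ball z r. 0 < w x})"
proof -
  define n where "n = CARD('n)"
  define \<alpha> where "\<alpha> = measure lborel (ball (0::real^'n) 1)"
  have \<alpha>: "0 < \<alpha>" unfolding \<alpha>_def by (rule content_ball_pos) simp
  obtain C1 where C1: "0 < C1" and growth: "\<And>\<Omega> a u (f::real^'n \<Rightarrow> real) G c. AC_minimizer lam Lam \<Omega> a u f G \<Longrightarrow> c \<in> \<Omega> \<Longrightarrow> \<not> pos_near f c \<Longrightarrow>
    \<exists>r0>0. \<forall>r. 0 < r \<and> r < r0 \<longrightarrow> cball c (2 * r) \<subseteq> \<Omega> \<and> (AE x in lborel. x \<in> ball c r \<longrightarrow> f x \<le> C1 * r)"
    using linear_growth[OF lam, where 'n='n] by blast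
  obtain \<nu> where \<nu>: "0 < \<nu>" and nondeg: "\<And>\<Omega> a u (f::real^'n \<Rightarrow> real) G c R. AC_minimizer lam Lam \<Omega> a u f G \<Longrightarrow> cball c R \<subseteq> \<Omega> \<Longrightarrow> 0 < R \<Longrightarrow>
    excess f c 0 R \<le> \<nu> * R^2 * R ^ CARD('n) \<Longrightarrow> (AE x in lborel. x \<in> ball c (R / 2) \<longrightarrow> f x \<le> 0)"
    using minimizer_nondegenerate[OF lam, where 'n='n] by blast
  \<comment> \<open>C1 serves the upper bound; the root is what r^2 \<nu> \<le> S^2 \<alpha> demands
    for the lower one.\<close>
  define C where "C = max C1 (sqrt (\<alpha> / \<nu>))"
  define \<theta> where "\<theta> = \<nu> / C1^2"
  have C: "0 < C" "C1 \<le> C" "sqrt (\<alpha> / \<nu>) \<le> C" using C1 by (auto simp: C_def)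
  have \<theta>: "0 < \<theta>" using C1 \<nu> by (simp add: \<theta>_def)
  have C\<alpha>: "\<alpha> \<le> \<nu> * C^2"
  proof -
    have "\<alpha> / \<nu> \<le> C^2" by (rule real_sqrt_le_iff[THEN iffD1]) (use C in simp)
    then show ?thesis using \<nu> by (simp add: field_simps)
  qed
  show ?thesis
  proof (rule exI[of _ C], rule conjI[OF C(1)], rule exI[of _ \<theta>], rule conjI[OF \<theta>], intro allI impI)
    fix \<Omega> a u G z and f w :: "real^'n \<Rightarrow> real"
    assume M: "AC_minimizer lam Lam \<Omega> a u f G" and cont: "continuous_on \<Omega> w"
      and ae: "AE x in lborel. x \<in> \<Omega> \<longrightarrow> w x = f x" and nn: "\<forall>x\<in>\<Omega>. 0 \<le> w x"
      and z: "z \<in> frontier {x \<in> \<Omega>. 0 < w x} \<inter> \<Omega>"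
    define U where "U = {x \<in> \<Omega>. 0 < w x}"
    have O: "open \<Omega>" and f: "L2 f" using M LW_D(1) by (auto simp: AC_minimizer_def)
    have U: "open U" unfolding U_def
      using continuous_openin_preimage_gen[OF cont, of "{0<..}"] openin_open_eq[OF O] by (simp add: vimage_def Int_def)
    have zU: "z \<in> \<Omega>" "z \<notin> U" "z \<in> closure U" using z U unfolding U_def[symmetric] by (auto simp: frontier_def interior_open)
    then have wz: "w z = 0" using nn by (force simp: U_def)
    \<comment> \<open>A positive lower bound near z would pass to w z by continuity, while w z = 0
      because z lies in \<Omega> but not in the open set \<open>U\<close>.\<close>
    have np: "\<not> pos_near f z"
    proof
      assume "pos_near f z"
      then obtain r \<delta> where r: "0 < r" "0 < \<delta>" "AE x in lborel. x \<in> ball z r \<longrightarrow> \<delta> \<le> f x" unfolding pos_near_def by blast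
      obtain s where s: "0 < s" "ball z s \<subseteq> \<Omega>" using O zU(1) open_contains_ball by blast
      define t where "t = min r s"
      have t: "0 < t" "ball z t \<subseteq> \<Omega>" "t \<le> r" using r s by (auto simp: t_def)
      have "AE x in lborel. x \<in> ball z t \<longrightarrow> - w x \<le> - \<delta>" using r(3) ae
      proof eventually_elim
        case (elim x)
        then show ?case using t(2,3) by auto
      qed
      then have "- w z \<le> - \<delta>"
        using AE_le_continuous[OF open_ball continuous_on_minus[OF continuous_on_subset[OF cont t(2)]]] t(1) centre_in_ball by blast
      then show False using wz r(2) by simp
    qed
    obtain r0 where r0: "0 < r0" and gr: "\<And>r. 0 < r \<Longrightarrow> r < r0 \<Longrightarrow> cball z (2 * r) \<subseteq> \<Omega> \<and> (AE x in lborel. x \<in> ball z r \<longrightarrow> f x \<le> C1 * r)"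
      using growth[OF M zU(1) np] by blast
    show "\<exists>r0>0. \<forall>r. 0 < r \<and> r < r0 \<longrightarrow> cball z r \<subseteq> \<Omega> \<and> r / C \<le> Sup (w ` ball z r) \<and> Sup (w ` ball z r) \<le> C * r \<and>
      ennreal (\<theta> * r ^ CARD('n)) \<le> emeasure lebesgue {x \<in> ball z r. 0 < w x}"
    proof (intro exI[of _ r0] conjI allI impI r0)
      fix r :: real assume "0 < r \<and> r < r0"
      then have r: "0 < r" "r < r0" by auto
      have "cball z r \<subseteq> cball z (2 * r)" using r by (intro subset_cball) simp
      then show sub: "cball z r \<subseteq> \<Omega>" using gr[OF r] by blast
      then have bsub: "ball z r \<subseteq> \<Omega>" using ball_subset_cball by blast
      have up: "AE x in lborel. x \<in> ball z r \<longrightarrow> f x \<le> C1 * r" using gr[OF r] by blast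
      define S where "S = Sup (w ` ball z r)"
      have wle: "w x \<le> C1 * r" if "x \<in> ball z r" for x
      proof (rule AE_le_continuous[OF open_ball continuous_on_subset[OF cont bsub] _ that])
        show "AE x in lborel. x \<in> ball z r \<longrightarrow> w x \<le> C1 * r" using up ae by eventually_elim (use bsub in auto)
      qed
      have "S \<le> C1 * r" unfolding S_def by (rule cSUP_least) (use r wle in auto)
      also have "\<dots> \<le> C * r" using C r by (intro mult_right_mono) auto
      finally show "Sup (w ` ball z r) \<le> C * r" by (simp add: S_def)
      have wS: "w x \<le> S" if "x \<in> ball z r" for x
        unfolding S_def by (rule cSUP_upper[OF that]) (use wle in \<open>auto intro!: bdd_aboveI2[of _ _ "C1 * r"]\<close>)
      have S0: "0 \<le> S" using wS[of z] wz r by simp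
      define X where "X = {x. 0 < f x} \<inter> ball z r"
      have Xb: "X \<in> sets borel" using L2_borel[OF f] unfolding X_def by measurable
      \<comment> \<open>Otherwise w would vanish on the half ball, although z is a limit of points
        where w is positive.\<close>
      have big: "\<nu> * r^2 * r ^ n < excess f z 0 r"
      proof (rule ccontr)
        assume "\<not> ?thesis"
        then have f0: "AE x in lborel. x \<in> ball z (r / 2) \<longrightarrow> f x \<le> 0" using nondeg[OF M sub r(1)] by (simp add: n_def)
        have hsub: "ball z (r / 2) \<subseteq> \<Omega>" using bsub r subset_ball[of "r / 2" r z] by auto
        have h: "AE x in lborel. x \<in> ball z (r / 2) \<longrightarrow> w x \<le> 0"
          using ae f0 by eventually_elim (use hsub in auto)
        obtain y where y: "y \<in> U" "dist y z < r / 2" using zU(3) r closure_approachable half_gt_zero by metis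
        have "w y \<le> 0"
          by (rule AE_le_continuous[OF open_ball continuous_on_subset[OF cont hsub] h]) (use y in \<open>auto simp: dist_commute\<close>)
        then show False using y(1) by (simp add: U_def)
      qed
      have "AE x in lborel. x \<in> ball z r \<longrightarrow> f x \<le> 0 + S" using ae by eventually_elim (use bsub wS in force)
      from excess_le_measure[OF f this S0] have "excess f z 0 r \<le> S^2 * measure lborel X" by (simp add: X_def)
      also have "\<dots> \<le> S^2 * (r ^ n * \<alpha>)"
      proof (rule mult_left_mono)
        have "measure lborel X \<le> measure lborel (ball z r)"
          by (rule measure_mono_fmeasurable)
            (use Xb emeasure_lborel_ball_finite[of z r] in \<open>auto simp: X_def infinity_ennreal_def intro!: fmeasurableI\<close>)
        then show "measure lborel X \<le> r ^ n * \<alpha>" using measure_ball_scale[of r z] r by (simp add: \<alpha>_def n_def)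
      qed simp
      finally have "r ^ n * (\<nu> * r^2) \<le> r ^ n * (S^2 * \<alpha>)" using big by (simp add: mult_ac)
      then have "\<nu> * r^2 \<le> S^2 * \<alpha>" using r by simp
      also have "\<dots> \<le> S^2 * (\<nu> * C^2)" by (intro mult_left_mono C\<alpha>) simp
      finally have "\<nu> * r^2 \<le> \<nu> * (C * S)^2" by (simp add: power_mult_distrib mult_ac)
      then have "r^2 \<le> (C * S)^2" using \<nu> by simp
      then have "r \<le> C * S" by (rule power2_le_imp_le) (use C S0 in simp)
      then show "r / C \<le> Sup (w ` ball z r)" using C unfolding S_def[symmetric] by (simp add: field_simps)
      have "AE x in lborel. x \<in> ball z r \<longrightarrow> f x \<le> 0 + C1 * r" using up by simp
      from excess_le_measure[OF f this] have "excess f z 0 r \<le> (C1 * r)^2 * measure lborel X" using C1 r by (simp add: X_def)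
      then have "r^2 * (\<nu> * r ^ n) \<le> r^2 * (C1^2 * measure lborel X)" using big by (simp add: power_mult_distrib mult_ac)
      then have "\<nu> * r ^ n \<le> C1^2 * measure lborel X" using r by simp
      then have "\<theta> * r ^ n \<le> measure lborel X" using C1 by (simp add: \<theta>_def field_simps)
      then have "ennreal (\<theta> * r ^ n) \<le> ennreal (measure lborel X)" by (rule ennreal_leI)
      also have "\<dots> = emeasure lborel X"
      proof -
        have "emeasure lborel X < \<infinity>" unfolding X_def by (rule finite_measure_ball_Int) (use L2_borel[OF f] in measurable)
        then show ?thesis by (simp add: emeasure_eq_ennreal_measure)
      qed
      also have "\<dots> = emeasure lborel (U \<inter> ball z r)"
      proof (rule emeasure_eq_AE)
        show "AE x in lborel. x \<in> X \<longleftrightarrow> x \<in> U \<inter> ball z r" using ae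
        proof eventually_elim
          case (elim x)
          then show ?case using bsub by (auto simp: X_def U_def)
        qed
      qed (use Xb U in auto)
      also have "\<dots> = emeasure lebesgue (U \<inter> ball z r)" using U by simp
      also have "U \<inter> ball z r = {x \<in> ball z r. 0 < w x}" using bsub by (auto simp: U_def)
      finally show "ennreal (\<theta> * r ^ CARD('n)) \<le> emeasure lebesgue {x \<in> ball z r. 0 < w x}" by (simp add: n_def)
    qed
  qed
qed

theorem theorem1:
  fixes lam Lam M :: real
  assumes "0 < lam" and "lam \<le> Lam"
  shows "\<exists>C \<theta> \<sigma>. C > 0 \<and> \<theta> > 0 \<and> 0 < \<sigma> \<and> \<sigma> \<le> 1 \<and>
    (\<forall>(\<Omega>::(real^'n::finite) set) a u.
       lipschitz_domain \<Omega> \<and> elliptic \<Omega> a lam Lam \<and>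
       local_min \<Omega> (AC_integrand a) u \<and>
       (AE x in lebesgue. x \<in> \<Omega> \<longrightarrow> 0 \<le> u x) \<and>
       sqrt (LINT x:\<Omega>|lebesgue. (u x)^2) = M
     \<longrightarrow>
       (\<exists>w. continuous_on \<Omega> w \<and> (AE x in lebesgue. x \<in> \<Omega> \<longrightarrow> w x = u x) \<and>
          (\<forall>Z0 \<in> frontier {x \<in> \<Omega>. 0 < w x} \<inter> \<Omega>. \<exists>r0>0. \<forall>r. 0 < r \<and> r < r0 \<longrightarrow>
              cball Z0 r \<subseteq> \<Omega> \<and>
              r / C \<le> Sup (w ` ball Z0 r) \<and> Sup (w ` ball Z0 r) \<le> C * r \<and>
              ennreal (\<theta> * r ^ CARD('n)) \<le> emeasure lebesgue {x \<in> ball Z0 r. 0 < w x}) \<and>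
          hausdorff_dim (frontier {x \<in> \<Omega>. 0 < w x} \<inter> \<Omega>) \<le> real CARD('n) - \<sigma>))"
proof -
  obtain C \<theta> where C: "0 < C" "0 < \<theta>" and est: "\<And>\<Omega> a u (f::real^'n \<Rightarrow> real) G w z. AC_minimizer lam Lam \<Omega> a u f G \<Longrightarrow> continuous_on \<Omega> w \<Longrightarrow>
    (AE x in lborel. x \<in> \<Omega> \<longrightarrow> w x = f x) \<Longrightarrow> (\<forall>x\<in>\<Omega>. 0 \<le> w x) \<Longrightarrow> z \<in> frontier {x \<in> \<Omega>. 0 < w x} \<inter> \<Omega> \<Longrightarrow>
    (\<exists>r0>0. \<forall>r. 0 < r \<and> r < r0 \<longrightarrow> cball z r \<subseteq> \<Omega> \<and> r / C \<le> Sup (w ` ball z r) \<and> Sup (w ` ball z r) \<le> C * r \<and>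
      ennreal (\<theta> * r ^ CARD('n)) \<le> emeasure lebesgue {x \<in> ball z r. 0 < w x})"
    using free_boundary_estimates[OF assms, where 'n='n] by blast
  \<comment> \<open>\<sigma> is derived from \<open>C\<close> alone, and all three constants are
    fixed before the domain, the coefficients and the minimizer are introduced.\<close>
  obtain \<sigma> where \<sigma>: "0 < \<sigma>" "\<sigma> \<le> 1" and dim: "\<And>\<Omega> (w :: real^'n \<Rightarrow> real) F. continuous_on \<Omega> w \<Longrightarrow>
    (\<forall>z\<in>F. \<exists>r0>0. \<forall>r. 0 < r \<and> r < r0 \<longrightarrow> cball z r \<subseteq> \<Omega> \<and> r / C \<le> Sup (w ` ball z r) \<and> Sup (w ` ball z r) \<le> C * r) \<Longrightarrow>
    hausdorff_dim F \<le> real CARD('n) - \<sigma>"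
    using linear_growth_hausdorff_dim[OF C(1), where 'n='n] by blast
  show ?thesis
  proof (rule exI[of _ C], rule exI[of _ \<theta>], rule exI[of _ \<sigma>], intro conjI C \<sigma> allI impI)
    fix \<Omega> :: "(real^'n) set" and a u
    assume H: "lipschitz_domain \<Omega> \<and> elliptic \<Omega> a lam Lam \<and> local_min \<Omega> (AC_integrand a) u \<and>
      (AE x in lebesgue. x \<in> \<Omega> \<longrightarrow> 0 \<le> u x) \<and> sqrt (LINT x:\<Omega>|lebesgue. (u x)^2) = M"
    then have O: "open \<Omega>" and "H1 \<Omega> u" by (auto simp: lipschitz_domain_def local_min_def)
    then obtain f G where f: "LW \<Omega> f G" "AE x in lborel. x \<in> \<Omega> \<longrightarrow> f x = u x \<and> G x = wgrad \<Omega> u x"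
      using weak_grad_LW[OF H1_wgrad] by blast
    have M: "AC_minimizer lam Lam \<Omega> a u f G"
      unfolding AC_minimizer_def using H O f assms by (simp add: AE_completion_iff)
    obtain w where w: "continuous_on \<Omega> w" "AE x in lborel. x \<in> \<Omega> \<longrightarrow> w x = f x" "\<And>x. x \<in> \<Omega> \<Longrightarrow> 0 \<le> w x"
      using minimizer_continuous_representative[OF M] by blast
    have "AE x in lborel. x \<in> \<Omega> \<longrightarrow> w x = u x" using w(2) f(2) by eventually_elim auto
    then have wu: "AE x in lebesgue. x \<in> \<Omega> \<longrightarrow> w x = u x" by (rule AE_completion)
    have nn: "\<forall>x\<in>\<Omega>. 0 \<le> w x" using w(3) by blast
    note e = est[OF M w(1,2) nn]
    have "hausdorff_dim (frontier {x \<in> \<Omega>. 0 < w x} \<inter> \<Omega>) \<le> real CARD('n) - \<sigma>"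
    proof (rule dim[OF w(1)], rule ballI)
      fix z assume "z \<in> frontier {x \<in> \<Omega>. 0 < w x} \<inter> \<Omega>"
      from e[OF this] show "\<exists>r0>0. \<forall>r. 0 < r \<and> r < r0 \<longrightarrow> cball z r \<subseteq> \<Omega> \<and> r / C \<le> Sup (w ` ball z r) \<and> Sup (w ` ball z r) \<le> C * r"
        by metis
    qed
    then show "\<exists>w. continuous_on \<Omega> w \<and> (AE x in lebesgue. x \<in> \<Omega> \<longrightarrow> w x = u x) \<and>
          (\<forall>Z0 \<in> frontier {x \<in> \<Omega>. 0 < w x} \<inter> \<Omega>. \<exists>r0>0. \<forall>r. 0 < r \<and> r < r0 \<longrightarrow>
              cball Z0 r \<subseteq> \<Omega> \<and>
              r / C \<le> Sup (w ` ball Z0 r) \<and> Sup (w ` ball Z0 r) \<le> C * r \<and>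
              ennreal (\<theta> * r ^ CARD('n)) \<le> emeasure lebesgue {x \<in> ball Z0 r. 0 < w x}) \<and>
          hausdorff_dim (frontier {x \<in> \<Omega>. 0 < w x} \<inter> \<Omega>) \<le> real CARD('n) - \<sigma>"
      by (intro exI[of _ w] conjI w(1) wu ballI e)
  qed
qed

end
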